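(* Let $\mathfrak g$ be a finite-dimensional semisimple Lie algebra, $\mathrm{Cur}\,\mathfrak g$ the associated current conformal algebra, and $\mathbb C$ the trivial module (on which $\partial$ and $\mathrm{Cur}\,\mathfrak g$ act by zero). 1. The embedding $C^\bullet(\mathfrak g,\mathbb C)\subset\widetilde C^\bullet(\mathrm{Cur}\,\mathfrak g,\mathbb C)$ of the Chevalley--Eilenberg complex of $\mathfrak g$, as the subcomplex of cochains of $\lambda$-degree zero, is a quasi-isomorphism, i.e. it induces an isomorphism on cohomology. Therefore, $$\widetilde{\mathrm H}^\bullet(\mathrm{Cur}\,\mathfrak g,\mathbb C)\simeq\mathrm H^\bullet(\mathfrak g,\mathbb C)\simeq\Bigl(\bigwedge\nolimits^\bullet\mathfrak g^*\Bigr)^{\mathfrak g}.$$ 2. For $q\ge0$, $$\mathrm H^q(\mathrm{Cur}\,\mathfrak g,\mathbb C)\simeq\mathrm H^q(\mathfrak g,\mathbb C)\oplus\mathrm H^{q+1}(\mathfrak g,\mathbb C).$$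
   Context: Everything is over $\mathbb C$. A (Lie) conformal algebra is a $\mathbb C[\partial]$-module $A$ with a linear map $A\otimes A\to A[\lambda]$, $a\otimes b\mapsto[a_\lambda b]$, such that: $[(\partial a)_\lambda b]=-\lambda[a_\lambda b]$ and $[a_\lambda\,\partial b]=(\partial+\lambda)[a_\lambda b]$; $[a_\lambda b]=-[b_{-\lambda-\partial}a]$; $[a_\lambda[b_\mu c]]=[[a_\lambda b]_{\lambda+\mu}c]+[b_\mu[a_\lambda c]]$. The current conformal algebra is $\mathrm{Cur}\,\mathfrak g=\mathbb C[\partial]\otimes\mathfrak g$ with $\lambda$-bracket determined by $[a_\lambda b]=[a,b]$ for $a,b\in\mathfrak g$. A conformal $A$-module is a $\mathbb C[\partial]$-module $M$ with a linear map $A\otimes M\to M[\lambda]$, $a\otimes v\mapsto a_\lambda v$, such that $a_\lambda(b_\mu v)-b_\mu(a_\lambda v)=[a_\lambda b]_{\lambda+\mu}v$, $(\partial a)_\lambda v=-\lambda a_\lambda v$, $a_\lambda(\partial v)=(\partial+\lambda)a_\lambda v$. Basic complex: $\widetilde C^n(A,M)$ ($n\ge0$) is the space of linear maps $\gamma\colon A^{\otimes n}\to M[\lambda_1,\dots,\lambda_n]$, $a_1\otimes\dots\otimes a_n\mapsto\gamma_{\lambda_1,\dots,\lambda_n}(a_1,\dots,a_n)$, such that $\gamma_{\lambda_1,\dots,\lambda_n}(a_1,\dots,\partial a_i,\dots,a_n)=-\lambda_i\gamma_{\lambda_1,\dots,\lambda_n}(a_1,\dots,a_n)$ for all $i$,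 and $\gamma$ is skew-symmetric under simultaneous permutations of the $a_i$ and the $\lambda_i$ ($\widetilde C^0=M$). The differential is $$(d\gamma)_{\lambda_1,\dots,\lambda_{n+1}}(a_1,\dots,a_{n+1})=\sum_{i}(-1)^{i+1}{a_i}_{\lambda_i}\gamma_{\lambda_1,\dots,\widehat{\lambda_i},\dots,\lambda_{n+1}}(a_1,\dots,\widehat{a_i},\dots,a_{n+1})$$ $$+\sum_{i<j}(-1)^{i+j}\gamma_{\lambda_i+\lambda_j,\lambda_1,\dots,\widehat{\lambda_i},\dots,\widehat{\lambda_j},\dots,\lambda_{n+1}}([{a_i}_{\lambda_i}a_j],a_1,\dots,\widehat{a_i},\dots,\widehat{a_j},\dots,a_{n+1}),$$ with $\gamma$ extended linearly over polynomials in the $\lambda_i$. $\mathbb C[\partial]$ acts on $\widetilde C^n(A,M)$ by $(\partial\gamma)_{\lambda_1,\dots,\lambda_n}=(\partial_M+\sum_i\lambda_i)\gamma_{\lambda_1,\dots,\lambda_n}$, where $\partial_M$ is the action of $\partial$ on $M$; this commutes with $d$. $\widetilde{\mathrm H}^\bullet(A,M)$ (basic cohomology) is the cohomology of $\widetilde C^\bullet(A,M)$; $\mathrm H^\bullet(A,M)$ (reduced cohomology) is the cohomology of $C^\bullet(A,M)=\widetilde C^\bullet(A,M)/\partial\widetilde C^\bullet(A,M)$. A cochain $\gamma\in\widetilde C^n(\mathrm{Cur}\,\mathfrak g,\mathbb C)$ is determined by its restriction to $\mathfrak g^{\otimes n}$, where $\mathfrak g=1\otimes\mathfrak g\subset\mathrm{Cur}\,\mathfrak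 g$; its $\lambda$-degree is the total degree in $\lambda_1,\dots,\lambda_n$ of this restriction. The differential preserves $\lambda$-degree, and the subcomplex of $\lambda$-degree zero is identified with the Chevalley--Eilenberg complex $C^\bullet(\mathfrak g,\mathbb C)$. *)

theory Defs
  imports Complex_Main "HOL-Computational_Algebra.Polynomial" "HOL-Combinatorics.Permutations"
begin

section \<open>Complex vector spaces with explicit carrier, cochain complexes, cohomology\<close>

text \<open>
  Cochain spaces are subspaces of function types indexed by the degree, and reduced cochains and
  cohomology classes are cosets, so these spaces are given by an explicit carrier and operations.
\<close>

record 'v cspace =
  Carr :: "'v set"
  Zero :: 'v
  Add :: "'v \<Rightarrow> 'v \<Rightarrow> 'v"
  Scale :: "complex \<Rightarrow> 'v \<Rightarrow> 'v"

definition linear_map :: "'v cspace \<Rightarrow> 'w cspace \<Rightarrow> ('v \<Rightarrow> 'w) \<Rightarrow> bool" where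
  "linear_map V W f \<longleftrightarrow>
     (\<forall>x\<in>Carr V. f x \<in> Carr W) \<and>
     (\<forall>x\<in>Carr V. \<forall>y\<in>Carr V. f (Add V x y) = Add W (f x) (f y)) \<and>
     (\<forall>c. \<forall>x\<in>Carr V. f (Scale V c x) = Scale W c (f x))"

definition linear_iso :: "'v cspace \<Rightarrow> 'w cspace \<Rightarrow> ('v \<Rightarrow> 'w) \<Rightarrow> bool" where
  "linear_iso V W f \<longleftrightarrow> linear_map V W f \<and> bij_betw f (Carr V) (Carr W)"

definition isomorphic :: "'v cspace \<Rightarrow> 'w cspace \<Rightarrow> bool"  (infix "\<simeq>" 50) where
  "V \<simeq> W \<longleftrightarrow> (\<exists>f. linear_iso V W f)"

definition direct_sum :: "'v cspace \<Rightarrow> 'w cspace \<Rightarrow> ('v \<times> 'w) cspace" where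
  "direct_sum V W = \<lparr>Carr = Carr V \<times> Carr W, Zero = (Zero V, Zero W),
     Add = (\<lambda>(x, y) (x', y'). (Add V x x', Add W y y')),
     Scale = (\<lambda>c (x, y). (Scale V c x, Scale W c y))\<rparr>"

definition coset :: "'v cspace \<Rightarrow> 'v set \<Rightarrow> 'v \<Rightarrow> 'v set" where
  "coset V B x = Add V x ` B"

text \<open>
  The quotient of \<open>V\<close> by a subspace \<open>B\<close>. The unions in \<open>Add\<close> and \<open>Scale\<close> are over cosets that
  do not depend on the representatives; in particular \<open>0 \<cdot> (x + B) = B\<close>.
\<close>

definition quotient_space :: "'v cspace \<Rightarrow> 'v set \<Rightarrow> 'v set cspace" where
  "quotient_space V B = \<lparr>Carr = coset V B ` Carr V, Zero = B,
     Add = (\<lambda>X Y. \<Union>x\<in>X. \<Union>y\<in>Y. coset V B (Add V x y)),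
     Scale = (\<lambda>c X. \<Union>x\<in>X. coset V B (Scale V c x))\<rparr>"

text \<open>The map of quotients induced by \<open>f\<close>, again written as a union of equal cosets.\<close>

definition induced_map :: "'w cspace \<Rightarrow> 'w set \<Rightarrow> ('v \<Rightarrow> 'w) \<Rightarrow> 'v set \<Rightarrow> 'w set" where
  "induced_map W B f X = (\<Union>x\<in>X. coset W B (f x))"

definition cocycles :: "(nat \<Rightarrow> 'v cspace) \<Rightarrow> (nat \<Rightarrow> 'v \<Rightarrow> 'v) \<Rightarrow> nat \<Rightarrow> 'v set" where
  "cocycles C d n = {x \<in> Carr (C n). d n x = Zero (C (Suc n))}"

definition coboundaries :: "(nat \<Rightarrow> 'v cspace) \<Rightarrow> (nat \<Rightarrow> 'v \<Rightarrow> 'v) \<Rightarrow> nat \<Rightarrow> 'v set" where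
  "coboundaries C d n = (case n of 0 \<Rightarrow> {Zero (C 0)} | Suc m \<Rightarrow> d m ` Carr (C m))"

definition cohomology :: "(nat \<Rightarrow> 'v cspace) \<Rightarrow> (nat \<Rightarrow> 'v \<Rightarrow> 'v) \<Rightarrow> nat \<Rightarrow> 'v set cspace" where
  "cohomology C d n = quotient_space ((C n)\<lparr>Carr := cocycles C d n\<rparr>) (coboundaries C d n)"

definition cochain_map ::
  "(nat \<Rightarrow> 'v cspace) \<Rightarrow> (nat \<Rightarrow> 'v \<Rightarrow> 'v) \<Rightarrow> (nat \<Rightarrow> 'w cspace) \<Rightarrow> (nat \<Rightarrow> 'w \<Rightarrow> 'w) \<Rightarrow>
   (nat \<Rightarrow> 'v \<Rightarrow> 'w) \<Rightarrow> bool" where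
  "cochain_map C d C' d' f \<longleftrightarrow>
     (\<forall>n. linear_map (C n) (C' n) (f n)) \<and>
     (\<forall>n. \<forall>x\<in>Carr (C n). f (Suc n) (d n x) = d' n (f n x))"

definition quasi_isomorphism ::
  "(nat \<Rightarrow> 'v cspace) \<Rightarrow> (nat \<Rightarrow> 'v \<Rightarrow> 'v) \<Rightarrow> (nat \<Rightarrow> 'w cspace) \<Rightarrow> (nat \<Rightarrow> 'w \<Rightarrow> 'w) \<Rightarrow>
   (nat \<Rightarrow> 'v \<Rightarrow> 'w) \<Rightarrow> bool" where
  "quasi_isomorphism C d C' d' f \<longleftrightarrow> cochain_map C d C' d' f \<and>
     (\<forall>n. linear_iso (cohomology C d n) (cohomology C' d' n)
            (induced_map (C' n) (coboundaries C' d' n) (f n)))"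


section \<open>Conformal algebras and conformal modules\<close>

text \<open>
  Since the ground field is infinite, \<open>M[\<lambda>\<^sub>1,\<dots>,\<lambda>\<^sub>n]\<close> is the space of polynomial functions from
  n-tuples of complex numbers to \<open>M\<close>, and we use the latter: \<open>lbr a l b\<close> and \<open>act a l v\<close> are the
  values at \<open>\<lambda> = l\<close> of \<open>[a\<^sub>\<lambda> b]\<close> and \<open>a\<^sub>\<lambda> v\<close>. Linear extension over polynomials in \<open>\<lambda>\<close> and
  substitution of scalars become evaluation.
\<close>

definition poly_fun :: "(complex \<Rightarrow> 'm::ab_group_add \<Rightarrow> 'm) \<Rightarrow> (complex \<Rightarrow> 'm) \<Rightarrow> bool" where
  "poly_fun s f \<longleftrightarrow> (\<exists>N c. \<forall>l. f l = (\<Sum>k\<le>N. s (l ^ k) (c k)))"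

definition multi_poly_fun ::
  "(complex \<Rightarrow> 'm::ab_group_add \<Rightarrow> 'm) \<Rightarrow> nat \<Rightarrow> (complex list \<Rightarrow> 'm) \<Rightarrow> bool" where
  "multi_poly_fun s n f \<longleftrightarrow>
     (\<exists>(E :: (nat \<Rightarrow> nat) set) c. finite E \<and>
        (\<forall>ls. length ls = n \<longrightarrow> f ls = (\<Sum>e\<in>E. s (\<Prod>i<n. ls ! i ^ e i) (c e))))"

text \<open>
  In skew-symmetry, \<open>[b\<^bsub>-\<lambda>-\<partial>\<^esub> a]\<close> stands for \<open>\<Sum>\<^sub>k (-\<lambda>-\<partial>)\<^sup>k c\<^sub>k\<close>, where
  \<open>[b\<^sub>\<mu> a] = \<Sum>\<^sub>k \<mu>\<^sup>k c\<^sub>k\<close>.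
\<close>

locale conformal_algebra = A: vector_space sA
  for sA :: "complex \<Rightarrow> 'a::ab_group_add \<Rightarrow> 'a" +
  fixes pA :: "'a \<Rightarrow> 'a" and lbr :: "'a \<Rightarrow> complex \<Rightarrow> 'a \<Rightarrow> 'a"
  assumes pA_linear: "Vector_Spaces.linear sA sA pA"
    and lbr_poly: "poly_fun sA (\<lambda>l. lbr a l b)"
    and lbr_linear_left: "Vector_Spaces.linear sA sA (\<lambda>a. lbr a l b)"
    and lbr_linear_right: "Vector_Spaces.linear sA sA (\<lambda>b. lbr a l b)"
    and lbr_pA_left: "lbr (pA a) l b = sA (- l) (lbr a l b)"
    and lbr_pA_right: "lbr a l (pA b) = pA (lbr a l b) + sA l (lbr a l b)"
    and lbr_skew: "(\<And>m. lbr b m a = (\<Sum>k\<le>N. sA (m ^ k) (c k))) \<Longrightarrow>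
          lbr a l b = - (\<Sum>k\<le>N. ((\<lambda>x. sA (- l) x - pA x) ^^ k) (c k))"
    and lbr_jacobi: "lbr a l (lbr b m c') = lbr (lbr a l b) (l + m) c' + lbr b m (lbr a l c')"

locale conformal_module = conformal_algebra sA pA lbr + M: vector_space sM
  for sA :: "complex \<Rightarrow> 'a::ab_group_add \<Rightarrow> 'a" and pA lbr
    and sM :: "complex \<Rightarrow> 'm::ab_group_add \<Rightarrow> 'm" +
  fixes pM :: "'m \<Rightarrow> 'm" and act :: "'a \<Rightarrow> complex \<Rightarrow> 'm \<Rightarrow> 'm"
  assumes pM_linear: "Vector_Spaces.linear sM sM pM"
    and act_poly: "poly_fun sM (\<lambda>l. act a l v)"
    and act_linear_left: "Vector_Spaces.linear sA sM (\<lambda>a. act a l v)"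
    and act_linear_right: "Vector_Spaces.linear sM sM (\<lambda>v. act a l v)"
    and act_bracket: "act a l (act b m v) - act b m (act a l v) = act (lbr a l b) (l + m) v"
    and act_pA: "act (pA a) l v = sM (- l) (act a l v)"
    and act_pM: "act a l (pM v) = pM (act a l v) + sM l (act a l v)"
begin

text \<open>
  \<open>\<gamma> [l\<^sub>1,\<dots>,l\<^sub>n] [a\<^sub>1,\<dots>,a\<^sub>n]\<close> is the value of \<open>\<gamma>\<close> at \<open>a\<^sub>1 \<otimes> \<dots> \<otimes> a\<^sub>n\<close> for \<open>\<lambda>\<^sub>i = l\<^sub>i\<close>. Cochains are
  zero on lists of the wrong length, so that equality of cochains is equality of functions.
  Indices start from 0, which changes neither \<open>(-1)\<^bsup>i+j\<^esup>\<close> nor, after \<open>(-1)\<^bsup>i+1\<^esup>\<close> becomes \<open>(-1)\<^sup>i\<close>, the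
  first sum in the differential.
\<close>

definition basic_cochains :: "nat \<Rightarrow> (complex list \<Rightarrow> 'a list \<Rightarrow> 'm) set" where
  "basic_cochains n = {\<gamma>.
     (\<forall>ls as. \<not> (length ls = n \<and> length as = n) \<longrightarrow> \<gamma> ls as = 0) \<and>
     (\<forall>as. length as = n \<longrightarrow> multi_poly_fun sM n (\<lambda>ls. \<gamma> ls as)) \<and>
     (\<forall>ls as i. length ls = n \<and> length as = n \<and> i < n \<longrightarrow>
        Vector_Spaces.linear sA sM (\<lambda>a. \<gamma> ls (as[i := a]))) \<and>
     (\<forall>ls as i. length ls = n \<and> length as = n \<and> i < n \<longrightarrow>
        \<gamma> ls (as[i := pA (as ! i)]) = sM (- (ls ! i)) (\<gamma> ls as)) \<and>
     (\<forall>ls as \<sigma>. length ls = n \<and> length as = n \<and> \<sigma> permutes {..<n} \<longrightarrow>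
        \<gamma> (permute_list \<sigma> ls) (permute_list \<sigma> as) = sM (of_int (sign \<sigma>)) (\<gamma> ls as))}"

definition basic_complex :: "nat \<Rightarrow> (complex list \<Rightarrow> 'a list \<Rightarrow> 'm) cspace" where
  "basic_complex n = \<lparr>Carr = basic_cochains n, Zero = (\<lambda>ls as. 0),
     Add = (\<lambda>\<gamma> \<gamma>' ls as. \<gamma> ls as + \<gamma>' ls as), Scale = (\<lambda>c \<gamma> ls as. sM c (\<gamma> ls as))\<rparr>"

definition basic_d ::
  "nat \<Rightarrow> (complex list \<Rightarrow> 'a list \<Rightarrow> 'm) \<Rightarrow> complex list \<Rightarrow> 'a list \<Rightarrow> 'm" where
  "basic_d n \<gamma> ls as = (if length ls = Suc n \<and> length as = Suc n then
      (\<Sum>i<Suc n. sM ((-1) ^ i) (act (as ! i) (ls ! i) (\<gamma> (nths ls (- {i})) (nths as (- {i}))))) +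
      (\<Sum>j<Suc n. \<Sum>i<j. sM ((-1) ^ (i + j))
         (\<gamma> ((ls ! i + ls ! j) # nths ls (- {i, j}))
            (lbr (as ! i) (ls ! i) (as ! j) # nths as (- {i, j}))))
    else 0)"

definition basic_partial ::
  "(complex list \<Rightarrow> 'a list \<Rightarrow> 'm) \<Rightarrow> complex list \<Rightarrow> 'a list \<Rightarrow> 'm" where
  "basic_partial \<gamma> ls as = pM (\<gamma> ls as) + sM (sum_list ls) (\<gamma> ls as)"

definition basic_cohomology :: "nat \<Rightarrow> (complex list \<Rightarrow> 'a list \<Rightarrow> 'm) set cspace" where
  "basic_cohomology = cohomology basic_complex basic_d"

definition reduced_complex :: "nat \<Rightarrow> (complex list \<Rightarrow> 'a list \<Rightarrow> 'm) set cspace" where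
  "reduced_complex n = quotient_space (basic_complex n) (basic_partial ` basic_cochains n)"

definition reduced_d ::
  "nat \<Rightarrow> (complex list \<Rightarrow> 'a list \<Rightarrow> 'm) set \<Rightarrow> (complex list \<Rightarrow> 'a list \<Rightarrow> 'm) set" where
  "reduced_d n =
     induced_map (basic_complex (Suc n)) (basic_partial ` basic_cochains (Suc n)) (basic_d n)"

definition reduced_cohomology :: "nat \<Rightarrow> (complex list \<Rightarrow> 'a list \<Rightarrow> 'm) set set cspace" where
  "reduced_cohomology = cohomology reduced_complex reduced_d"

end


section \<open>Lie algebras and the Chevalley--Eilenberg complex\<close>

locale lie_algebra = vector_space scale
  for scale :: "complex \<Rightarrow> 'g::ab_group_add \<Rightarrow> 'g" +
  fixes br :: "'g \<Rightarrow> 'g \<Rightarrow> 'g"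
  assumes br_linear_left: "Vector_Spaces.linear scale scale (\<lambda>x. br x y)"
    and br_linear_right: "Vector_Spaces.linear scale scale (\<lambda>y. br x y)"
    and br_self: "br x x = 0"
    and br_jacobi: "br x (br y z) = br (br x y) z + br y (br x z)"
begin

definition lie_ideal :: "'g set \<Rightarrow> bool" where
  "lie_ideal I \<longleftrightarrow> subspace I \<and> (\<forall>x. \<forall>y\<in>I. br x y \<in> I)"

definition derived :: "'g set \<Rightarrow> 'g set" where
  "derived I = span {br x y | x y. x \<in> I \<and> y \<in> I}"

definition solvable :: "'g set \<Rightarrow> bool" where
  "solvable I \<longleftrightarrow> (\<exists>k. (derived ^^ k) I = {0})"

text \<open>
  \<open>C\<^sup>n(\<gg>, \<complex>)\<close> is the space of alternating n-linear forms on \<open>\<gg>\<close>, and for finite-dimensional \<open>\<gg>\<close>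
  this is the n-th exterior power of the dual of \<open>\<gg>\<close>.
\<close>

definition ce_cochains :: "nat \<Rightarrow> ('g list \<Rightarrow> complex) set" where
  "ce_cochains n = {\<omega>.
     (\<forall>as. length as \<noteq> n \<longrightarrow> \<omega> as = 0) \<and>
     (\<forall>as i. length as = n \<and> i < n \<longrightarrow> Vector_Spaces.linear scale (*) (\<lambda>a. \<omega> (as[i := a]))) \<and>
     (\<forall>as \<sigma>. length as = n \<and> \<sigma> permutes {..<n} \<longrightarrow>
        \<omega> (permute_list \<sigma> as) = of_int (sign \<sigma>) * \<omega> as)}"

definition ce_complex :: "nat \<Rightarrow> ('g list \<Rightarrow> complex) cspace" where
  "ce_complex n = \<lparr>Carr = ce_cochains n, Zero = (\<lambda>as. 0),
     Add = (\<lambda>\<omega> \<omega>' as. \<omega> as + \<omega>' as), Scale = (\<lambda>c \<omega> as. c * \<omega> as)\<rparr>"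

definition ce_d :: "nat \<Rightarrow> ('g list \<Rightarrow> complex) \<Rightarrow> 'g list \<Rightarrow> complex" where
  "ce_d n \<omega> as = (if length as = Suc n then
      (\<Sum>j<Suc n. \<Sum>i<j. (-1) ^ (i + j) * \<omega> (br (as ! i) (as ! j) # nths as (- {i, j})))
    else 0)"

definition ce_cohomology :: "nat \<Rightarrow> ('g list \<Rightarrow> complex) set cspace" where
  "ce_cohomology = cohomology ce_complex ce_d"

text \<open>Invariants of the exterior powers of the dual, under the coadjoint action.\<close>

definition invariant_forms :: "nat \<Rightarrow> ('g list \<Rightarrow> complex) cspace" where
  "invariant_forms n = (ce_complex n)\<lparr>Carr := {\<omega> \<in> ce_cochains n.
     \<forall>x as. length as = n \<longrightarrow> (\<Sum>i<n. - \<omega> (as[i := br x (as ! i)])) = 0}\<rparr>"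

end

locale semisimple_lie_algebra = lie_algebra +
  assumes finite_dim: "\<exists>B. finite B \<and> span B = UNIV"
    and semisimple: "lie_ideal I \<Longrightarrow> solvable I \<Longrightarrow> I = {0}"


section \<open>The current conformal algebra\<close>

text \<open>
  \<open>Cur \<gg> = \<complex>[\<partial>] \<otimes> \<gg>\<close> is the type of polynomials in \<open>\<partial>\<close> with coefficients in \<open>\<gg>\<close>; then \<open>\<partial>\<close> is
  \<open>pCons 0\<close>, and \<open>a \<in> \<gg>\<close> is the constant polynomial \<open>[:a:]\<close>. The bracket is the sesquilinear extension
  \<open>[\<partial>\<^sup>m a \<^sub>\<lambda> \<partial>\<^sup>n b] = (-\<lambda>)\<^sup>m (\<partial> + \<lambda>)\<^sup>n [a, b]\<close>.
\<close>

context lie_algebra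
begin

definition cur_scale :: "complex \<Rightarrow> 'g poly \<Rightarrow> 'g poly" where
  "cur_scale c = map_poly (scale c)"

definition cur_lbr :: "'g poly \<Rightarrow> complex \<Rightarrow> 'g poly \<Rightarrow> 'g poly" where
  "cur_lbr p l q = (\<Sum>m\<le>degree p. \<Sum>n\<le>degree q.
     cur_scale ((- l) ^ m) (((\<lambda>r. pCons 0 r + cur_scale l r) ^^ n) [:br (coeff p m) (coeff q n):]))"

definition eval_at :: "complex \<Rightarrow> 'g poly \<Rightarrow> 'g" where
  "eval_at x p = (\<Sum>k\<le>degree p. scale (x ^ k) (coeff p k))"

lemma eval_at_altdef:
  assumes "degree p \<le> N"
  shows "eval_at x p = (\<Sum>k\<le>N. scale (x ^ k) (coeff p k))"
  unfolding eval_at_def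
  by (rule sum.mono_neutral_left) (use assms in \<open>auto simp: coeff_eq_0\<close>)

lemma eval_at_add: "eval_at x (p + q) = eval_at x p + eval_at x q"
proof -
  define N where "N = max (degree p) (degree q)"
  have "degree p \<le> N" "degree q \<le> N" "degree (p + q) \<le> N"
    by (auto simp: N_def intro: degree_add_le)
  then show ?thesis
    by (simp add: eval_at_altdef[of _ N] scale_right_distrib sum.distrib)
qed

lemma coeff_cur_scale [simp]: "coeff (cur_scale c p) k = scale c (coeff p k)"
  by (simp add: cur_scale_def coeff_map_poly)

lemma eval_at_cur_scale: "eval_at x (cur_scale c p) = scale c (eval_at x p)"
proof -
  have "degree (cur_scale c p) \<le> degree p"
    by (rule degree_le) (simp add: coeff_eq_0)
  then show ?thesis
    by (simp add: eval_at_altdef[of _ "degree p"] scale_sum_right mult.commute)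
qed

lemma eval_at_0 [simp]: "eval_at x 0 = 0"
  by (simp add: eval_at_def)

lemma eval_at_const [simp]: "eval_at x [:a:] = a"
  by (simp add: eval_at_def)

lemma eval_at_pCons0: "eval_at x (pCons 0 p) = scale x (eval_at x p)"
proof -
  have "degree (pCons 0 p) \<le> Suc (degree p)"
    by (rule degree_pCons_le)
  then have "eval_at x (pCons 0 p) = (\<Sum>k\<le>Suc (degree p). scale (x ^ k) (coeff (pCons 0 p) k))"
    by (rule eval_at_altdef)
  also have "\<dots> = scale x (eval_at x p)"
    by (simp add: sum.atMost_Suc_shift eval_at_def scale_sum_right del: sum.atMost_Suc)
  finally show ?thesis .
qed

lemma eval_at_minus: "eval_at x (- p) = - eval_at x p"
  using eval_at_add[of x p "- p"] by (simp add: eq_neg_iff_add_eq_0 add.commute)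

lemma eval_at_sum: "eval_at x (\<Sum>i\<in>I. f i) = (\<Sum>i\<in>I. eval_at x (f i))"
  by (induction I rule: infinite_finite_induct) (auto simp: eval_at_add)

lemma eval_at_shift_power:
  "eval_at x (((\<lambda>r. pCons 0 r + cur_scale l r) ^^ n) r) = scale ((x + l) ^ n) (eval_at x r)"
  by (induction n)
    (auto simp: eval_at_add eval_at_cur_scale eval_at_pCons0 scale_left_distrib[symmetric]
      distrib_right[symmetric])

text \<open>Elements of \<open>Cur \<gg>\<close> are determined by their values for \<open>\<partial> = x\<close>, \<open>x\<close> a complex number.\<close>

lemma eval_at_eq_iff: "(\<forall>x. eval_at x p = eval_at x q) \<longleftrightarrow> p = q"
proof
  assume *: "\<forall>x. eval_at x p = eval_at x q"
  define r where "r = p - q"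
  have r0: "eval_at x r = 0" for x
    using * eval_at_add[of x p "- q"] by (simp add: r_def eval_at_minus)
  have "coeff r k = 0" for k
  proof (rule ccontr)
    assume nz: "coeff r k \<noteq> 0"
    interpret VP: vector_space_pair scale "(*) :: complex \<Rightarrow> complex \<Rightarrow> complex"
      by unfold_locales (auto simp: algebra_simps)
    have "independent {coeff r k}"
      using nz by simp
    from VP.linear_independent_extend[OF this, of "\<lambda>_. 1"]
    obtain f where f: "Vector_Spaces.linear scale (*) f" "f (coeff r k) = 1"
      by auto
    interpret f: Vector_Spaces.linear scale "(*)" f by (rule f)
    have "poly (map_poly f r) x = 0" for x
    proof -
      have "degree (map_poly f r) \<le> degree r"
        by (rule degree_le) (simp add: coeff_map_poly coeff_eq_0 f.zero)
      then have "poly (map_poly f r) x = (\<Sum>k\<le>degree r. coeff (map_poly f r) k * x ^ k)"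
        unfolding poly_altdef
        by (intro sum.mono_neutral_left) (auto simp: coeff_eq_0)
      also have "\<dots> = f (eval_at x r)"
        by (simp add: eval_at_def f.sum f.scale coeff_map_poly f.zero mult.commute)
      finally show ?thesis by (simp add: r0 f.zero)
    qed
    then have "map_poly f r = 0"
      by (simp add: poly_all_0_iff_0[symmetric])
    then have "f (coeff r k) = 0"
      by (metis coeff_0 coeff_map_poly f.zero)
    with f(2) show False by simp
  qed
  then have "r = 0" by (simp add: poly_eq_iff)
  then show "p = q" by (simp add: r_def)
qed auto

lemma cur_eqI: "(\<And>x. eval_at x p = eval_at x q) \<Longrightarrow> p = q"
  using eval_at_eq_iff by blast

lemma eval_at_cur_lbr: "eval_at x (cur_lbr p l q) = br (eval_at (- l) p) (eval_at (x + l) q)"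
proof -
  interpret L: Vector_Spaces.linear scale scale "\<lambda>x. br x y" for y by (rule br_linear_left)
  interpret R: Vector_Spaces.linear scale scale "\<lambda>y. br x y" for x by (rule br_linear_right)
  show ?thesis
    by (simp add: cur_lbr_def eval_at_sum eval_at_cur_scale eval_at_shift_power)
      (simp add: eval_at_def L.sum R.sum L.scale R.scale scale_sum_right mult.commute
        sum.swap[of _ "{..degree q}"])
qed

lemma vector_space_cur: "vector_space cur_scale"
  by unfold_locales
    (auto simp: poly_eq_iff scale_right_distrib scale_left_distrib)

lemma poly_fun_cur_lbr: "poly_fun cur_scale (\<lambda>l. cur_lbr p l q)"
proof -
  interpret C: vector_space cur_scale by (rule vector_space_cur)
  have add: "poly_fun cur_scale (\<lambda>l. f l + g l)"
    if "poly_fun cur_scale f" "poly_fun cur_scale g" for f g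
  proof -
    obtain N c N' c' where *: "\<And>l. f l = (\<Sum>k\<le>N. cur_scale (l ^ k) (c k))"
      "\<And>l. g l = (\<Sum>k\<le>N'. cur_scale (l ^ k) (c' k))"
      using \<open>poly_fun cur_scale f\<close> \<open>poly_fun cur_scale g\<close> unfolding poly_fun_def by blast
    define M where "M = max N N'"
    have "f l = (\<Sum>k\<le>M. cur_scale (l ^ k) (if k \<le> N then c k else 0))" for l
      unfolding * by (rule sum.mono_neutral_cong_left) (auto simp: M_def)
    moreover have "g l = (\<Sum>k\<le>M. cur_scale (l ^ k) (if k \<le> N' then c' k else 0))" for l
      unfolding * by (rule sum.mono_neutral_cong_left) (auto simp: M_def)
    ultimately have "f l + g l =
        (\<Sum>k\<le>M. cur_scale (l ^ k) ((if k \<le> N then c k else 0) + (if k \<le> N' then c' k else 0)))" for l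
      by (simp only: C.scale_right_distrib sum.distrib)
    then show ?thesis
      unfolding poly_fun_def by (intro exI allI)
  qed
  have const: "poly_fun cur_scale (\<lambda>l. a)" for a
    unfolding poly_fun_def by (intro exI[of _ 0] exI[of _ "\<lambda>_. a"]) auto
  have sum: "poly_fun cur_scale (\<lambda>l. \<Sum>i\<in>I. f i l)"
    if "\<And>i. poly_fun cur_scale (f i)" for f and I :: "nat set"
    by (induction I rule: infinite_finite_induct) (auto intro: add const that)
  have mult: "poly_fun cur_scale (\<lambda>l. cur_scale l (f l))" if "poly_fun cur_scale f" for f
  proof -
    obtain N c where *: "\<And>l. f l = (\<Sum>k\<le>N. cur_scale (l ^ k) (c k))"
      using \<open>poly_fun cur_scale f\<close> unfolding poly_fun_def by blast
    have "cur_scale l (f l) =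
        (\<Sum>k\<le>Suc N. cur_scale (l ^ k) (case k of 0 \<Rightarrow> 0 | Suc k \<Rightarrow> c k))" for l
      by (simp add: * sum.atMost_Suc_shift C.scale_sum_right del: sum.atMost_Suc)
    then show ?thesis
      unfolding poly_fun_def by (intro exI allI)
  qed
  have lin: "poly_fun cur_scale (\<lambda>l. h (f l))"
    if "poly_fun cur_scale f" "Vector_Spaces.linear cur_scale cur_scale h" for f h
  proof -
    interpret h: Vector_Spaces.linear cur_scale cur_scale h by (rule that)
    obtain N c where *: "\<And>l. f l = (\<Sum>k\<le>N. cur_scale (l ^ k) (c k))"
      using \<open>poly_fun cur_scale f\<close> unfolding poly_fun_def by blast
    have "h (f l) = (\<Sum>k\<le>N. cur_scale (l ^ k) (h (c k)))" for l
      by (simp add: * h.sum h.scale)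
    then show ?thesis
      unfolding poly_fun_def by (intro exI allI)
  qed
  have neg: "poly_fun cur_scale (\<lambda>l. cur_scale (- l) (f l))" if "poly_fun cur_scale f" for f
    using lin[OF mult[OF that] C.linear_scale_self[of "-1"]] by simp
  have pC: "Vector_Spaces.linear cur_scale cur_scale (pCons 0)"
    by unfold_locales (auto simp: poly_eq_iff coeff_pCons split: nat.splits)
  have shift: "poly_fun cur_scale (\<lambda>l. ((\<lambda>r. pCons 0 r + cur_scale l r) ^^ n) a)" for n a
    by (induction n) (auto intro: const add mult lin[OF _ pC])
  have neg_power: "poly_fun cur_scale (\<lambda>l. cur_scale ((- l) ^ n) (f l))"
    if "poly_fun cur_scale f" for f n
  proof (induction n)
    case 0
    then show ?case using that by simp
  next
    case (Suc n)
    then show ?case using neg[OF Suc] by simp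
  qed
  show ?thesis
    unfolding cur_lbr_def by (intro sum neg_power shift)
qed

lemma conformal_algebra_cur: "conformal_algebra cur_scale (pCons 0) cur_lbr"
proof -
  interpret C: vector_space cur_scale by (rule vector_space_cur)
  interpret L: Vector_Spaces.linear scale scale "\<lambda>x. br x y" for y by (rule br_linear_left)
  interpret R: Vector_Spaces.linear scale scale "\<lambda>y. br x y" for x by (rule br_linear_right)
  note ev = eval_at_add eval_at_cur_scale eval_at_pCons0 eval_at_cur_lbr eval_at_minus eval_at_sum
  have br_skew: "br x y = - br y x" for x y
  proof -
    have "br x y + br y x = 0"
      using br_self[of "x + y"] by (simp add: L.add R.add br_self[of x] br_self[of y] add.commute)
    then show ?thesis by (simp add: eq_neg_iff_add_eq_0)
  qed
  show ?thesis
  proof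
    fix a b c' :: "'g poly" and l m :: complex
    show "pCons 0 (a + b) = pCons 0 a + pCons 0 b"
      by (simp add: poly_eq_iff coeff_pCons split: nat.splits)
    show "pCons 0 (cur_scale l a) = cur_scale l (pCons 0 a)"
      by (simp add: poly_eq_iff coeff_pCons split: nat.splits)
    show "poly_fun cur_scale (\<lambda>l. cur_lbr a l b)"
      by (rule poly_fun_cur_lbr)
    show "cur_lbr (pCons 0 a) l b = cur_scale (- l) (cur_lbr a l b)"
      by (rule cur_eqI) (simp add: ev L.scale L.neg)
    show "cur_lbr a l (pCons 0 b) = pCons 0 (cur_lbr a l b) + cur_scale l (cur_lbr a l b)"
      by (rule cur_eqI) (simp add: ev R.add R.scale scale_left_distrib)
    show "cur_lbr a l (cur_lbr b m c') =
        cur_lbr (cur_lbr a l b) (l + m) c' + cur_lbr b m (cur_lbr a l c')"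
    proof (rule cur_eqI)
      fix x
      have "x + (l + m) = x + m + l" "- (l + m) + l = - m" "x + l + m = x + m + l"
        by simp_all
      then show "eval_at x (cur_lbr a l (cur_lbr b m c')) =
          eval_at x (cur_lbr (cur_lbr a l b) (l + m) c' + cur_lbr b m (cur_lbr a l c'))"
        by (simp only: ev) (rule br_jacobi)
    qed
  next
    fix a b :: "'g poly" and l :: complex and N :: nat and c :: "nat \<Rightarrow> 'g poly"
    assume *: "\<And>m. cur_lbr b m a = (\<Sum>k\<le>N. cur_scale (m ^ k) (c k))"
    have pow: "eval_at x (((\<lambda>x. cur_scale (- l) x - pCons 0 x) ^^ k) r) =
        scale ((- l - x) ^ k) (eval_at x r)" for x k r
    proof (induction k)
      case 0
      then show ?case by simp
    next
      case (Suc k)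
      have sub: "eval_at x (p - q) = eval_at x p - eval_at x q" for p q
        using eval_at_add[of x p "- q"] by (simp add: eval_at_minus)
      have "eval_at x (((\<lambda>x. cur_scale (- l) x - pCons 0 x) ^^ Suc k) r) =
          scale (- l) (scale ((- l - x) ^ k) (eval_at x r)) -
          scale x (scale ((- l - x) ^ k) (eval_at x r))"
        by (simp only: funpow.simps o_apply sub eval_at_cur_scale eval_at_pCons0 Suc)
      also have "\<dots> = scale (- l - x) (scale ((- l - x) ^ k) (eval_at x r))"
        by (simp only: scale_left_diff_distrib)
      also have "\<dots> = scale ((- l - x) ^ Suc k) (eval_at x r)"
        by (simp only: scale_scale power_Suc)
      finally show ?case .
    qed
    show "cur_lbr a l b = - (\<Sum>k\<le>N. ((\<lambda>x. cur_scale (- l) x - pCons 0 x) ^^ k) (c k))"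
    proof (rule cur_eqI)
      fix x
      have "eval_at x (- (\<Sum>k\<le>N. ((\<lambda>x. cur_scale (- l) x - pCons 0 x) ^^ k) (c k))) =
          - eval_at x (cur_lbr b (- l - x) a)"
        by (simp only: * eval_at_minus eval_at_sum eval_at_cur_scale pow)
      also have "\<dots> = eval_at x (cur_lbr a l b)"
        by (subst (1 2) eval_at_cur_lbr, subst br_skew) (simp add: add.commute)
      finally show "eval_at x (cur_lbr a l b) =
        eval_at x (- (\<Sum>k\<le>N. ((\<lambda>x. cur_scale (- l) x - pCons 0 x) ^^ k) (c k)))" by simp
    qed
  qed (rule cur_eqI; simp add: ev L.add L.scale R.add R.scale)+
qed

text \<open>The current conformal algebra with its trivial module \<open>\<complex>\<close>.\<close>

sublocale cur: conformal_module cur_scale "pCons 0" cur_lbr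
    "(*) :: complex \<Rightarrow> complex \<Rightarrow> complex" "\<lambda>_. 0" "\<lambda>_ _ _. 0"
proof -
  interpret conformal_algebra cur_scale "pCons 0" cur_lbr by (rule conformal_algebra_cur)
  show "conformal_module cur_scale (pCons 0) cur_lbr
      ((*) :: complex \<Rightarrow> complex \<Rightarrow> complex) (\<lambda>_. 0) (\<lambda>_ _ _. 0)"
    by unfold_locales (auto simp: algebra_simps poly_fun_def intro!: exI[of _ "\<lambda>_. 0"])
qed

lemma cur_lbr_const: "cur_lbr [:a:] l [:b:] = [:br a b:]"
  by (rule cur_eqI) (simp add: eval_at_cur_lbr)

text \<open>Cochains whose restriction to \<open>\<gg>\<close> does not depend on the \<open>\<lambda>\<^sub>i\<close>, i.e. of \<open>\<lambda>\<close>-degree zero.\<close>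

definition degree_zero_cochains :: "nat \<Rightarrow> (complex list \<Rightarrow> 'g poly list \<Rightarrow> complex) set" where
  "degree_zero_cochains n = {\<gamma> \<in> cur.basic_cochains n.
     \<forall>as ls ls'. length as = n \<and> length ls = n \<and> length ls' = n \<longrightarrow>
       \<gamma> ls (map (\<lambda>a. [:a:]) as) = \<gamma> ls' (map (\<lambda>a. [:a:]) as)}"

text \<open>
  The cochain of \<open>Cur \<gg>\<close> whose restriction to \<open>\<gg>\<close> is the constant \<open>\<omega>\<close>. As it sends \<open>\<partial>\<close> in the i-th
  argument to \<open>-\<lambda>\<^sub>i\<close>, its value at \<open>p\<^sub>1 \<otimes> \<dots> \<otimes> p\<^sub>n\<close> is \<open>\<omega>(p\<^sub>1(-\<lambda>\<^sub>1), \<dots>, p\<^sub>n(-\<lambda>\<^sub>n))\<close>.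
\<close>

definition ce_embedding ::
  "nat \<Rightarrow> ('g list \<Rightarrow> complex) \<Rightarrow> complex list \<Rightarrow> 'g poly list \<Rightarrow> complex" where
  "ce_embedding n \<omega> ls ps = (if length ls = n \<and> length ps = n
     then \<omega> (map2 (\<lambda>l p. eval_at (- l) p) ls ps) else 0)"

lemma ce_embedding_const:
  assumes "length ls = n" "length as = n"
  shows "ce_embedding n \<omega> ls (map (\<lambda>a. [:a:]) as) = \<omega> as"
proof -
  have "map2 (\<lambda>l p. eval_at (- l) p) ls (map (\<lambda>a. [:a:]) as) = as"
    using assms by (intro nth_equalityI) auto
  then show ?thesis using assms by (simp add: ce_embedding_def)
qed

definition cur_basic_complex :: "nat \<Rightarrow> (complex list \<Rightarrow> 'g poly list \<Rightarrow> complex) cspace" where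
  "cur_basic_complex = cur.basic_complex"

definition cur_basic_d ::
  "nat \<Rightarrow> (complex list \<Rightarrow> 'g poly list \<Rightarrow> complex) \<Rightarrow> complex list \<Rightarrow> 'g poly list \<Rightarrow> complex" where
  "cur_basic_d = cur.basic_d"

definition cur_basic_cohomology ::
  "nat \<Rightarrow> (complex list \<Rightarrow> 'g poly list \<Rightarrow> complex) set cspace" where
  "cur_basic_cohomology = cur.basic_cohomology"

definition cur_reduced_cohomology ::
  "nat \<Rightarrow> (complex list \<Rightarrow> 'g poly list \<Rightarrow> complex) set set cspace" where
  "cur_reduced_cohomology = cur.reduced_cohomology"

end

end

theory Submission
  imports Defs "HOL-Computational_Algebra.Fundamental_Theorem_Algebra" "HOL-Library.Function_Algebras"
begin

text \<open>
  A basic cochain of \<open>Cur \<gg>\<close> is an alternating form on \<open>\<gg>\<close> with polynomial coefficients; its Taylor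
  coefficients in the \<open>\<lambda>\<^sub>i\<close> form a cochain of bounded degree on \<open>\<gg>[t]\<close>, with \<open>\<lambda>\<^sup>k\<close> dual to \<open>t\<^sup>k\<close>, and \<open>d\<close>
  becomes the Chevalley--Eilenberg differential of \<open>\<gg>[t]\<close>. For dual bases \<open>b\<close>, \<open>b'\<close> with respect to the
  Killing form let \<open>h\<close> be the sum over \<open>p \<ge> 1\<close> and \<open>b\<close> of the contraction with \<open>t\<^sup>p b\<close> followed by the
  truncated action of \<open>t\<^bsup>-p\<^esup> b'\<close>. This action is not by derivations of \<open>\<gg>[t]\<close>, but invariance of the
  Casimir tensor cancels all defects except one proportional to the \<open>\<lambda>\<close>-degree, so that \<open>d h + h d\<close> is
  minus the \<open>\<lambda>\<close>-degree, and only degree zero contributes to cohomology. There, \<open>\<gg>\<close> acts trivially on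
  cohomology by Cartan's formula, and since invariants in representations of semisimple algebras have
  invariant complements, the cohomology is that of the invariant cochains, on which \<open>d = 0\<close>.

  Multiplication by \<open>\<partial> = \<Sum>\<lambda>\<^sub>i\<close> is zero on \<open>0\<close>-cochains and injective on the others, and it is zero on
  cohomology as it raises the \<open>\<lambda>\<close>-degree. Hence a reduced cocycle is given by an invariant form of
  degree \<open>q\<close> together with a primitive of \<open>\<partial>\<eta>\<close> for an invariant form \<open>\<eta>\<close> of degree \<open>q + 1\<close>.
\<close>

section \<open>Linear algebra on finite-dimensional subspaces\<close>

text \<open>For the Killing form the Casimir element acts on \<gg> as the identity. In
  \<open>d h + h d\<close> a slot \<open>t^m a\<close> meets the Casimir element once for each p
  with 1 \<le> p \<le> m and thus contributes -m: this is how the \<lambda>-degree arises. Terms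
  that touch two slots cancel after a shift of p by the degree of a slot, since they then run over
  exactly those p at which the truncated action fails to be a derivation. The sum over p is finite
  because a cochain on a finite-dimensional \<gg> has bounded degree. The normalisation presupposes
  that the Killing form is nondegenerate, which has to be derived from the absence of nonzero
  solvable ideals: by Cartan's criterion in a version for perfect subalgebras, with a test operator
  built from conjugate eigenvalues, and by Engel's theorem relative to a kernel. Forms are functions
  on lists, so that contraction is prefixing an entry, Cartan's formula defines the differential by
  recursion, and identities become inductions on the list. Representations live on
  finite-dimensional subspaces of such function spaces, and quotients of them are avoided.\<close>

locale complex_vs = vector_space scale
  for scale :: "complex \<Rightarrow> 'b::ab_group_add \<Rightarrow> 'b"
begin

definition fin_dim :: "'b set \<Rightarrow> bool" where
  "fin_dim V \<longleftrightarrow> (\<exists>F. finite F \<and> V \<subseteq> span F)"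

definition basis_of :: "'b set \<Rightarrow> 'b set \<Rightarrow> bool" where
  "basis_of B V \<longleftrightarrow> finite B \<and> independent B \<and> span B = V"

text \<open>Linearity is demanded on the whole space, so that shifts, powers and compositions are
  again linear maps there; finiteness is only ever asked of the stable subspace
  \<open>V\<close>.\<close>

definition endo :: "'b set \<Rightarrow> ('b \<Rightarrow> 'b) \<Rightarrow> bool" where
  "endo V T \<longleftrightarrow> Vector_Spaces.linear scale scale T \<and> T ` V \<subseteq> V"

definition trace :: "'b set \<Rightarrow> ('b \<Rightarrow> 'b) \<Rightarrow> complex" where
  "trace B T = (\<Sum>b\<in>B. representation B (T b) b)"

definition gen_eigenspace :: "('b \<Rightarrow> 'b) \<Rightarrow> complex \<Rightarrow> 'b set" where
  "gen_eigenspace T l = {v. \<exists>k. ((\<lambda>v. T v - scale l v) ^^ k) v = 0}"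

section \<open>Bases and dimension of finite-dimensional subspaces\<close>

lemma fin_dim_subset: "fin_dim V \<Longrightarrow> U \<subseteq> V \<Longrightarrow> fin_dim U"
  unfolding fin_dim_def by blast

lemma basis_of_extend:
  assumes "subspace V" "fin_dim V" "independent A" "A \<subseteq> V"
  obtains B where "basis_of B V" "A \<subseteq> B"
proof -
  obtain B where B: "A \<subseteq> B" "B \<subseteq> V" "independent B" "V \<subseteq> span B"
    using maximal_independent_subset_extend[OF assms(4,3)] by blast
  obtain F where F: "finite F" "V \<subseteq> span F"
    using assms(2) unfolding fin_dim_def by blast
  have "finite B"
    using independent_span_bound[OF F(1) B(3) order.trans[OF B(2) F(2)]] by blast
  moreover have "span B = V"
    using B assms(1) span_subspace by blast
  ultimately show ?thesis
    using that[of B] B by (simp add: basis_of_def)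
qed

lemma basis_of_exists:
  assumes "subspace V" "fin_dim V"
  obtains B where "basis_of B V"
  using basis_of_extend[OF assms, of "{}"] independent_empty subspace_0 by blast

lemma basis_of_card: "basis_of B V \<Longrightarrow> card B = dim V"
  using dim_span_eq_card_independent[of B] by (simp add: basis_of_def)

lemma fin_dim_basis: "basis_of B V \<Longrightarrow> fin_dim V"
  unfolding basis_of_def fin_dim_def by blast

lemma dim_le_fin_dim:
  assumes "subspace U" "subspace V" "fin_dim V" "U \<subseteq> V"
  shows "dim U \<le> dim V"
proof -
  obtain A where A: "basis_of A U"
    using basis_of_exists[OF assms(1) fin_dim_subset[OF assms(3,4)]] .
  then have "independent A" "A \<subseteq> V"
    using assms(4) span_superset[of A] by (auto simp: basis_of_def)
  then obtain B where B: "basis_of B V" "A \<subseteq> B"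
    using basis_of_extend[OF assms(2,3)] by metis
  then have "card A \<le> card B"
    by (auto simp: basis_of_def intro: card_mono)
  then show ?thesis
    using basis_of_card[OF A] basis_of_card[OF B(1)] by simp
qed

lemma dim_less_fin_dim:
  assumes "subspace U" "subspace V" "fin_dim V" "U \<subset> V"
  shows "dim U < dim V"
proof -
  obtain A where A: "basis_of A U"
    using basis_of_exists[OF assms(1) fin_dim_subset[OF assms(3)]] assms(4) by blast
  then have "independent A" "A \<subseteq> V"
    using assms(4) span_superset[of A] by (auto simp: basis_of_def)
  then obtain B where B: "basis_of B V" "A \<subseteq> B"
    using basis_of_extend[OF assms(2,3)] by metis
  have "A \<noteq> B"
    using A B assms(4) by (auto simp: basis_of_def)
  then have "card A < card B"
    using B by (auto simp: basis_of_def intro: psubset_card_mono)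
  then show ?thesis
    using basis_of_card[OF A] basis_of_card[OF B(1)] by simp
qed

lemma repr_eq:
  assumes "basis_of B V" "v \<in> V"
  shows "v = (\<Sum>b\<in>B. scale (representation B v b) b)"
  using assms sum_representation_eq[of B v B] by (auto simp: basis_of_def)

lemma repr_add:
  assumes "basis_of B V" "v \<in> V" "w \<in> V"
  shows "representation B (v + w) b = representation B v b + representation B w b"
  using assms representation_add[of B v w] by (auto simp: basis_of_def add.commute)

lemma repr_scale:
  assumes "basis_of B V" "v \<in> V"
  shows "representation B (scale c v) b = c * representation B v b"
  using assms representation_scale[of B v c] by (auto simp: basis_of_def)

lemma repr_sum:
  assumes "basis_of B V" "\<And>i. i \<in> I \<Longrightarrow> f i \<in> V"
  shows "representation B (\<Sum>i\<in>I. f i) b = (\<Sum>i\<in>I. representation B (f i) b)"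
  using assms representation_sum[of B I f] by (auto simp: basis_of_def)

lemma repr_sum_scale:
  assumes "basis_of B V" "b \<in> B"
  shows "representation B (\<Sum>c\<in>B. scale (r c) c) b = r b"
proof -
  have V: "c \<in> V" if "c \<in> B" for c
    using assms(1) that span_base by (auto simp: basis_of_def)
  then have sV: "scale x c \<in> V" if "c \<in> B" for c x
    using assms(1) that subspace_span subspace_scale by (metis basis_of_def)
  have "representation B (\<Sum>c\<in>B. scale (r c) c) b =
      (\<Sum>c\<in>B. r c * representation B c b)"
    using assms(1) by (simp add: repr_sum[OF assms(1) sV] repr_scale[OF assms(1) V])
  also have "\<dots> = (\<Sum>c\<in>B. if c = b then r b else 0)"
    using assms(1) by (intro sum.cong) (auto simp: basis_of_def representation_basis)
  also have "\<dots> = r b"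
    using assms by (simp add: basis_of_def)
  finally show ?thesis .
qed

lemma repr_basis:
  assumes "basis_of B V" "c \<in> B"
  shows "representation B c b = (if b = c then 1 else 0)"
  using assms by (auto simp: basis_of_def representation_basis)

lemma basis_ofD:
  assumes "basis_of B V"
  shows "finite B" "independent B" "subspace V" "\<And>b. b \<in> B \<Longrightarrow> b \<in> V" "B \<subseteq> V"
  using assms span_superset subspace_span by (auto simp: basis_of_def)

section \<open>Endomorphisms of a subspace and their traces\<close>

lemma endoD:
  assumes "endo V T"
  shows "T (x + y) = T x + T y" "T (scale c x) = scale c (T x)" "T (\<Sum>i\<in>I. f i) = (\<Sum>i\<in>I. T (f i))"
    "T 0 = 0" "T (x - y) = T x - T y" "T (- x) = - T x" "x \<in> V \<Longrightarrow> T x \<in> V"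
proof -
  interpret T: Vector_Spaces.linear scale scale T
    using assms by (simp add: endo_def)
  show "T (x + y) = T x + T y" "T (scale c x) = scale c (T x)" "T (\<Sum>i\<in>I. f i) = (\<Sum>i\<in>I. T (f i))"
    "T 0 = 0" "T (x - y) = T x - T y" "T (- x) = - T x" "x \<in> V \<Longrightarrow> T x \<in> V"
    using assms by (auto simp: endo_def T.add T.scale T.sum T.diff T.neg T.zero)
qed

lemma endo_comp: "endo V S \<Longrightarrow> endo V T \<Longrightarrow> endo V (\<lambda>v. S (T v))"
  using Vector_Spaces.linear_compose[of scale scale T scale S] by (auto simp: endo_def o_def)

lemma endo_expand:
  assumes "endo V T" "basis_of B V" "v \<in> V"
  shows "T v = (\<Sum>b\<in>B. scale (representation B v b) (T b))"
proof -
  have "T v = T (\<Sum>b\<in>B. scale (representation B v b) b)"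
    using repr_eq[OF assms(2,3)] by simp
  then show ?thesis
    by (simp add: endoD[OF assms(1)])
qed

lemma trace_comp_expand:
  assumes "endo V S" "endo V T" "basis_of B V"
  shows "trace B (\<lambda>v. S (T v)) = (\<Sum>b\<in>B. \<Sum>c\<in>B. representation B (T b) c * representation B (S c) b)"
  unfolding trace_def
proof (rule sum.cong)
  fix b assume b: "b \<in> B"
  note D = basis_ofD[OF assms(3)] endoD[OF assms(1)] endoD[OF assms(2)]
  have "S (T b) = (\<Sum>c\<in>B. scale (representation B (T b) c) (S c))"
    by (intro endo_expand[OF assms(1,3)] D b)
  then show "representation B (S (T b)) b = (\<Sum>c\<in>B. representation B (T b) c * representation B (S c) b)"
    using D b by (simp add: repr_sum[OF assms(3)] repr_scale[OF assms(3)] subspace_scale)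
qed simp

lemma trace_comp_commute:
  assumes "endo V S" "endo V T" "basis_of B V"
  shows "trace B (\<lambda>v. S (T v)) = trace B (\<lambda>v. T (S v))"
  unfolding trace_comp_expand[OF assms] trace_comp_expand[OF assms(2,1,3)]
  by (subst sum.swap) (simp add: mult.commute)

lemma trace_basis_independent:
  assumes T: "endo V T" and B: "basis_of B V" and C: "basis_of C V"
  shows "trace B T = trace C T"
proof -
  note D = basis_ofD[OF B] basis_ofD[OF C] endoD[OF T]
  have "trace B T = (\<Sum>b\<in>B. \<Sum>c\<in>C. representation C b c * representation B (T c) b)"
    unfolding trace_def
  proof (rule sum.cong)
    fix b assume b: "b \<in> B"
    have "T b = (\<Sum>c\<in>C. scale (representation C b c) (T c))"
      by (intro endo_expand[OF T C] D b)
    then show "representation B (T b) b = (\<Sum>c\<in>C. representation C b c * representation B (T c) b)"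
      using D b by (simp add: repr_sum[OF B] repr_scale[OF B] subspace_scale)
  qed simp
  also have "\<dots> = (\<Sum>c\<in>C. \<Sum>b\<in>B. representation B (T c) b * representation C b c)"
    by (subst sum.swap) (simp add: mult.commute)
  also have "\<dots> = trace C T"
    unfolding trace_def
  proof (rule sum.cong)
    fix c assume c: "c \<in> C"
    have "representation C (T c) c = representation C (\<Sum>b\<in>B. scale (representation B (T c) b) b) c"
      using repr_eq[OF B, of "T c"] D c by simp
    then show "(\<Sum>b\<in>B. representation B (T c) b * representation C b c) = representation C (T c) c"
      using D c by (simp add: repr_sum[OF C] repr_scale[OF C] subspace_scale)
  qed simp
  finally show ?thesis .
qed

lemma trace_add:
  assumes "basis_of B V" "\<And>v. v \<in> V \<Longrightarrow> S v \<in> V" "\<And>v. v \<in> V \<Longrightarrow> T v \<in> V"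
  shows "trace B (\<lambda>v. S v + T v) = trace B S + trace B T"
  using assms basis_ofD(4)[OF assms(1)]
  by (simp add: trace_def repr_add[OF assms(1)] sum.distrib)

lemma trace_scale:
  assumes "basis_of B V" "\<And>v. v \<in> V \<Longrightarrow> T v \<in> V"
  shows "trace B (\<lambda>v. scale c (T v)) = c * trace B T"
  using assms basis_ofD(4)[OF assms(1)]
  by (simp add: trace_def repr_scale[OF assms(1)] sum_distrib_left)

lemma trace_sum:
  assumes "basis_of B V" "\<And>v i. v \<in> V \<Longrightarrow> i \<in> I \<Longrightarrow> T i v \<in> V"
  shows "trace B (\<lambda>v. \<Sum>i\<in>I. T i v) = (\<Sum>i\<in>I. trace B (T i))"
  unfolding trace_def
  using assms basis_ofD(4)[OF assms(1)]
  by (subst sum.swap) (simp add: repr_sum[OF assms(1)])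

lemma trace_cong:
  assumes "basis_of B V" "\<And>v. v \<in> V \<Longrightarrow> S v = T v"
  shows "trace B S = trace B T"
  using assms basis_ofD(4)[OF assms(1)] by (simp add: trace_def)

text \<open>A basis of \<open>W\<close> extends to one of \<open>V\<close>. All values of
  \<open>T\<close> lie in \<open>W\<close>, so the added basis vectors contribute no diagonal
  coefficient.\<close>

lemma trace_range:
  assumes T: "endo V T" and B: "basis_of B V" and C: "basis_of C W" and W: "W \<subseteq> V" "T ` V \<subseteq> W"
  shows "trace B T = trace C T"
proof -
  have "independent C" "C \<subseteq> V"
    using C W by (auto simp: basis_of_def dest: span_base)
  then obtain A where A: "basis_of A V" "C \<subseteq> A"
    using basis_of_extend[OF basis_ofD(3)[OF B] fin_dim_basis[OF B]] by metis
  have sC: "v \<in> span C" if "v \<in> T ` V" for v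
    using C W(2) that by (auto simp: basis_of_def)
  have TC: "T b \<in> span C" if "b \<in> A" for b
    using A that by (intro sC) (auto dest: basis_ofD(4))
  have ext: "representation A v = representation C v" if "v \<in> span C" for v
    using A that by (intro representation_extend) (auto simp: basis_of_def)
  have "trace B T = trace A T"
    by (rule trace_basis_independent[OF T B A(1)])
  also have "\<dots> = (\<Sum>b\<in>A. representation C (T b) b)"
    unfolding trace_def by (intro sum.cong) (auto simp: ext TC)
  also have "\<dots> = (\<Sum>b\<in>C. representation C (T b) b)"
    using A by (intro sum.mono_neutral_right) (auto simp: basis_of_def dest: representation_ne_zero)
  finally show ?thesis by (simp add: trace_def)
qed

section \<open>Nilpotent operators\<close>

lemma endo_funpow: "endo V T \<Longrightarrow> endo V (T ^^ k)"
proof (induction k)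
  case 0
  then show ?case using linear_ident by (simp add: endo_def id_def)
next
  case (Suc k)
  then show ?case using endo_comp[of V T "T ^^ k"] by (simp add: o_def)
qed

lemma funpow_zero_mono:
  fixes T :: "'b \<Rightarrow> 'b"
  assumes "T 0 = 0" "(T ^^ k) v = 0" "k \<le> n"
  shows "(T ^^ n) v = 0"
proof -
  have "(T ^^ m) 0 = 0" for m
    by (induction m) (simp_all add: assms(1))
  moreover have "(T ^^ n) v = (T ^^ (n - k)) ((T ^^ k) v)"
    using assms(3) funpow_add[of "n - k" k T] by simp
  ultimately show ?thesis using assms(2) by simp
qed

lemma nilpotent_uniform:
  assumes T: "endo V T" and V: "subspace V" "fin_dim V" and nil: "\<And>v. v \<in> V \<Longrightarrow> \<exists>k. (T ^^ k) v = 0"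
  obtains k where "\<And>v. v \<in> V \<Longrightarrow> (T ^^ k) v = 0"
proof -
  obtain B where B: "basis_of B V" using basis_of_exists[OF V] .
  define k where "k b = (SOME k. (T ^^ k) b = 0)" for b
  have k: "(T ^^ k b) b = 0" if "b \<in> B" for b
    unfolding k_def by (rule someI_ex) (rule nil[OF basis_ofD(4)[OF B that]])
  \<comment> \<open>The sum of the exponents serves as a common exponent for all basis vectors, also
    when the basis is empty.\<close>
  have "(T ^^ (\<Sum>b\<in>B. k b)) v = 0" if "v \<in> V" for v
  proof -
    have "(T ^^ (\<Sum>b\<in>B. k b)) b = 0" if "b \<in> B" for b
      using basis_ofD(1)[OF B] that
      by (intro funpow_zero_mono[OF endoD(4)[OF T] k[OF that]] member_le_sum) simp_all
    then show ?thesis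
      by (simp add: endo_expand[OF endo_funpow[OF T] B that])
  qed
  then show ?thesis by (rule that)
qed

lemma subspace_endo_image:
  assumes "endo V T" "subspace V"
  shows "subspace (T ` V)"
proof -
  interpret T: Vector_Spaces.linear scale scale T
    using assms by (simp add: endo_def)
  show ?thesis using assms(2) by (rule T.subspace_image)
qed

lemma nilpotent_image_proper:
  assumes T: "endo V T" and V: "subspace V" "fin_dim V" "V \<noteq> {0}"
    and nil: "\<And>v. v \<in> V \<Longrightarrow> \<exists>k. (T ^^ k) v = 0"
  shows "T ` V \<subset> V"
proof -
  obtain k where k: "\<And>v. v \<in> V \<Longrightarrow> (T ^^ k) v = 0"
    using nilpotent_uniform[OF T V(1,2) nil] by blast
  have "T ` V \<noteq> V"
  proof
    assume eq: "T ` V = V"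
    have "(T ^^ n) ` V = V" for n
      by (induction n) (simp_all only: funpow.simps image_id image_comp[symmetric] eq id_apply image_ident)
    then have "V \<subseteq> {0}" using k by (metis image_subset_iff singletonI subset_refl)
    then show False using V subspace_0 by blast
  qed
  then show ?thesis using T by (auto simp: endo_def)
qed

text \<open>Induction on the dimension: the image of \<open>V\<close> is a proper invariant
  subspace, and by \<open>trace_range\<close> it carries the whole trace.\<close>

lemma trace_nilpotent:
  assumes "endo V T" "basis_of B V" "\<And>v. v \<in> V \<Longrightarrow> \<exists>k. (T ^^ k) v = 0"
  shows "trace B T = 0"
  using assms
proof (induction "dim V" arbitrary: V B rule: less_induct)
  case less
  note V = basis_ofD(3)[OF less.prems(2)] fin_dim_basis[OF less.prems(2)]
  show ?case
  proof (cases "V = {0}")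
    case True
    then have "B = {}"
      using less.prems(2) basis_ofD(5)[OF less.prems(2)] dependent_zero by (auto simp: basis_of_def)
    then show ?thesis by (simp add: trace_def)
  next
    case False
    have W: "T ` V \<subset> V"
      by (rule nilpotent_image_proper[OF less.prems(1) V False less.prems(3)])
    have sW: "subspace (T ` V)"
      by (rule subspace_endo_image[OF less.prems(1) V(1)])
    obtain C where C: "basis_of C (T ` V)"
      using basis_of_exists[OF sW] fin_dim_subset[OF V(2)] W by blast
    have "trace B T = trace C T"
      using trace_range[OF less.prems(1,2) C] W by blast
    also have "\<dots> = 0"
    proof (rule less.hyps[OF dim_less_fin_dim[OF sW V W] _ C])
      show "endo (T ` V) T"
        using less.prems(1) unfolding endo_def by blast
      show "\<exists>k. (T ^^ k) v = 0" if "v \<in> T ` V" for v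
        using less.prems(3) W that by blast
    qed
    finally show ?thesis .
  qed
qed

subsection \<open>Generalized eigenspaces\<close>

abbreviation shift :: "('b \<Rightarrow> 'b) \<Rightarrow> complex \<Rightarrow> 'b \<Rightarrow> 'b" where
  "shift T l \<equiv> \<lambda>v. T v - scale l v"

lemma endo_shift:
  assumes "endo V T" "subspace V"
  shows "endo V (shift T l)"
  unfolding endo_def
proof
  show "Vector_Spaces.linear scale scale (shift T l)"
    using assms(1) unfolding endo_def
    by (intro vector_space_pair.linear_compose_sub[OF vector_space_pair.intro[OF vector_space_axioms vector_space_axioms]])
      (auto intro: linear_scale_self)
  show "shift T l ` V \<subseteq> V"
    using assms by (auto simp: endo_def intro!: subspace_diff subspace_scale)
qed

lemma linear_endo_UNIV: "Vector_Spaces.linear scale scale T \<Longrightarrow> endo UNIV T"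
  by (simp add: endo_def)

lemma endo_UNIV: "endo V T \<Longrightarrow> endo UNIV T"
  by (simp add: endo_def)

lemma subspace_gen_eigenspace:
  assumes "endo UNIV T"
  shows "subspace (gen_eigenspace T l)"
proof -
  note N = endo_shift[OF assms subspace_UNIV, of l]
  note P = endoD[OF endo_funpow[OF N]]
  show ?thesis
  proof (rule subspaceI)
    show "0 \<in> gen_eigenspace T l"
      by (auto simp: gen_eigenspace_def intro: exI[of _ 0])
  next
    fix x y assume "x \<in> gen_eigenspace T l" "y \<in> gen_eigenspace T l"
    then obtain k m where "(shift T l ^^ k) x = 0" "(shift T l ^^ m) y = 0"
      by (auto simp: gen_eigenspace_def)
    then have "(shift T l ^^ (k + m)) x = 0" "(shift T l ^^ (k + m)) y = 0"
      using funpow_zero_mono[where T = "shift T l", OF endoD(4)[OF N]] by (meson le_add1 le_add2)+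
    then show "x + y \<in> gen_eigenspace T l"
      by (auto simp: gen_eigenspace_def P intro!: exI[of _ "k + m"])
  next
    fix c x assume "x \<in> gen_eigenspace T l"
    then show "scale c x \<in> gen_eigenspace T l"
      by (auto simp: gen_eigenspace_def P)
  qed
qed

lemma gen_eigenspace_shiftD:
  assumes "shift T l v \<in> gen_eigenspace T l"
  shows "v \<in> gen_eigenspace T l"
proof -
  obtain k where "(shift T l ^^ k) (shift T l v) = 0"
    using assms by (auto simp: gen_eigenspace_def)
  then have "(shift T l ^^ Suc k) v = 0"
    by (simp only: funpow_Suc_right o_apply)
  then show ?thesis unfolding gen_eigenspace_def by blast
qed

lemma gen_eigenspace_shift:
  assumes "endo UNIV T" "v \<in> gen_eigenspace T l"
  shows "shift T l v \<in> gen_eigenspace T l"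
proof -
  obtain k where "(shift T l ^^ k) v = 0"
    using assms by (auto simp: gen_eigenspace_def)
  then have "(shift T l ^^ Suc k) v = 0"
    using funpow_zero_mono[where T = "shift T l", OF endoD(4)[OF endo_shift[OF assms(1) subspace_UNIV]]]
    by (meson le_SucI order_refl)
  then have "(shift T l ^^ k) (shift T l v) = 0"
    by (simp only: funpow_Suc_right o_apply)
  then show ?thesis by (auto simp: gen_eigenspace_def)
qed

lemma gen_eigenspace_stable:
  assumes "endo UNIV T" "v \<in> gen_eigenspace T l"
  shows "T v \<in> gen_eigenspace T l"
proof -
  have "T v = shift T l v + scale l v" by simp
  also have "\<dots> \<in> gen_eigenspace T l"
    using subspace_gen_eigenspace[OF assms(1)] gen_eigenspace_shift[OF assms] assms(2)
    by (intro subspace_add subspace_scale)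
  finally show ?thesis .
qed

lemma gen_eigenspace_commuting:
  assumes T: "endo V T" "subspace V" and S: "endo V S" "\<And>v. v \<in> V \<Longrightarrow> S (T v) = T (S v)"
    and v: "v \<in> V" "v \<in> gen_eigenspace T l"
  shows "S v \<in> gen_eigenspace T l"
proof -
  have "(shift T l ^^ k) v \<in> V \<and> (shift T l ^^ k) (S v) = S ((shift T l ^^ k) v)" for k
    by (induction k) (use v(1) endoD(7)[OF endo_shift[OF T]] in \<open>auto simp: endoD[OF S(1)] S(2)\<close>)
  then show ?thesis
    using v(2) endoD(4)[OF S(1)] unfolding gen_eigenspace_def mem_Collect_eq by metis
qed

text \<open>Inside a finite-dimensional invariant subspace these vectors form the sum of the
  generalized eigenspaces with eigenvalue in \<open>P\<close>, described without choosing a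
  decomposition. With \<open>P = - {0}\<close> this is the Fitting component on which
  \<open>T\<close> is invertible.\<close>

definition killed :: "('b \<Rightarrow> 'b) \<Rightarrow> complex set \<Rightarrow> 'b \<Rightarrow> bool" where
  "killed T P v \<longleftrightarrow> (\<exists>ms. set ms \<subseteq> P \<and> foldr (shift T) ms v = 0)"

lemma foldr_shift_endo:
  assumes "endo UNIV T"
  shows "endo UNIV (foldr (shift T) ms)"
proof (induction ms)
  case Nil
  then show ?case using linear_ident by (simp add: endo_def id_def)
next
  case (Cons m ms)
  then show ?case
    using endo_comp[OF endo_shift[OF assms subspace_UNIV] Cons] by (simp add: o_def)
qed

lemma shift_commute:
  assumes "endo UNIV T"
  shows "shift T l (shift T m v) = shift T m (shift T l v)"
  by (simp add: endoD[OF assms] scale_right_diff_distrib mult.commute)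

lemma foldr_shift_commute:
  assumes "endo UNIV T"
  shows "foldr (shift T) ms (shift T l v) = shift T l (foldr (shift T) ms v)"
  by (induction ms) (simp_all add: shift_commute[OF assms, where l = l])

lemma foldr_shift_commute':
  assumes "endo UNIV T"
  shows "foldr (shift T) ms (foldr (shift T) ns v) = foldr (shift T) ns (foldr (shift T) ms v)"
  by (induction ns) (simp_all add: foldr_shift_commute[OF assms])

lemma subspace_killed:
  assumes "endo UNIV T"
  shows "subspace {v. killed T P v}"
proof (rule subspaceI)
  show "0 \<in> {v. killed T P v}"
    by (auto simp: killed_def intro: exI[of _ "[]"])
next
  fix x y assume "x \<in> {v. killed T P v}" "y \<in> {v. killed T P v}"
  then obtain ms ns where *: "set ms \<subseteq> P" "foldr (shift T) ms x = 0" "set ns \<subseteq> P" "foldr (shift T) ns y = 0"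
    by (auto simp: killed_def)
  have "foldr (shift T) (ms @ ns) x = 0" "foldr (shift T) (ms @ ns) y = 0"
    using * foldr_shift_commute'[OF assms, of ms ns x] endoD(4)[OF foldr_shift_endo[OF assms]] by simp_all
  then have "foldr (shift T) (ms @ ns) (x + y) = 0"
    by (simp only: endoD(1)[OF foldr_shift_endo[OF assms]] add_0)
  then show "x + y \<in> {v. killed T P v}"
    using * unfolding killed_def by (intro CollectI exI[of _ "ms @ ns"]) auto
next
  fix c x assume "x \<in> {v. killed T P v}"
  then show "scale c x \<in> {v. killed T P v}"
    using endoD(2)[OF foldr_shift_endo[OF assms]] by (auto simp: killed_def)
qed

lemma killed_commuting:
  assumes T: "endo V T" "subspace V" and S: "endo V S" "\<And>v. v \<in> V \<Longrightarrow> S (T v) = T (S v)"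
    and v: "v \<in> V" "killed T P v"
  shows "killed T P (S v)"
proof -
  have "foldr (shift T) ms v \<in> V \<and> foldr (shift T) ms (S v) = S (foldr (shift T) ms v)" for ms
    by (induction ms) (use v(1) endoD(7)[OF endo_shift[OF T]] in \<open>auto simp: endoD[OF S(1)] S(2)\<close>)
  then show ?thesis
    using v(2) endoD(4)[OF S(1)] unfolding killed_def by metis
qed

lemma gen_eigenspace_killed:
  assumes "v \<in> gen_eigenspace T l" "l \<in> P"
  shows "killed T P v"
proof -
  obtain k where k: "(shift T l ^^ k) v = 0"
    using assms by (auto simp: gen_eigenspace_def)
  have "foldr (shift T) (replicate k l) v = (shift T l ^^ k) v"
    by (induction k) auto
  then show ?thesis
    using k assms(2) by (auto simp: killed_def intro!: exI[of _ "replicate k l"])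
qed

text \<open>Peeling off one factor \<open>T - m\<close> leaves, by induction, a genuine eigenvector
  \<open>T v = m v\<close>; then \<open>(T - l)^k v = (m - l)^k v\<close> vanishes only for
  \<open>v = 0\<close>, as \<open>m\<close> differs from \<open>l\<close>.\<close>

lemma gen_eigenspace_killed_eq_0:
  assumes T: "endo UNIV T" and v: "v \<in> gen_eigenspace T l" "killed T P v" and "l \<notin> P"
  shows "v = 0"
proof -
  have "\<forall>v. v \<in> gen_eigenspace T l \<longrightarrow> set ms \<subseteq> P \<longrightarrow> foldr (shift T) ms v = 0 \<longrightarrow> v = 0" for ms
  proof (induction ms)
    case Nil
    then show ?case by simp
  next
    case (Cons m ms)
    show ?case
    proof (intro allI impI)
      fix v assume v: "v \<in> gen_eigenspace T l" "set (m # ms) \<subseteq> P" "foldr (shift T) (m # ms) v = 0"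
      then have "foldr (shift T) ms (shift T m v) = 0"
        by (simp add: foldr_shift_commute[OF T])
      moreover have "shift T m v \<in> gen_eigenspace T l"
        using subspace_gen_eigenspace[OF T] v(1) gen_eigenspace_stable[OF T v(1)]
        by (intro subspace_diff subspace_scale)
      ultimately have "T v = scale m v"
        using Cons v(2) by auto
      then have "(shift T l ^^ k) v = scale ((m - l) ^ k) v" for k
        by (induction k) (simp_all add: endoD[OF T] scale_left_diff_distrib algebra_simps)
      then obtain k where "scale ((m - l) ^ k) v = 0"
        using v(1) by (auto simp: gen_eigenspace_def)
      then show "v = 0"
        using v(2) \<open>l \<notin> P\<close> by auto
    qed
  qed
  then show ?thesis
    using v by (auto simp: killed_def)
qed

text \<open>On this space \<open>T - l\<close> is the nonzero scalar \<open>m - l\<close> plus the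
  locally nilpotent \<open>T - m\<close>; the preimage is built by induction on the exponent that
  kills \<open>v\<close>.\<close>

lemma shift_surj_gen_eigenspace:
  assumes T: "endo V T" "subspace V" and "l \<noteq> m" "v \<in> V" "v \<in> gen_eigenspace T m"
  shows "\<exists>u\<in>V \<inter> gen_eigenspace T m. shift T l u = v"
proof -
  note T' = endo_UNIV[OF T(1)]
  have "\<forall>v\<in>V. (shift T m ^^ k) v = 0 \<longrightarrow> (\<exists>u\<in>V \<inter> gen_eigenspace T m. shift T l u = v)" for k
  proof (induction k)
    case 0
    show ?case
      using T subspace_gen_eigenspace[OF T'] by (auto intro!: bexI[of _ 0] simp: endoD[OF T'] subspace_0)
  next
    case (Suc k)
    show ?case
    proof (intro ballI impI)
      fix v assume v: "v \<in> V" "(shift T m ^^ Suc k) v = 0"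
      then have "(shift T m ^^ k) (shift T m v) = 0"
        by (simp only: funpow_Suc_right o_apply)
      moreover have "shift T m v \<in> V"
        using endoD(7)[OF endo_shift[OF T]] v(1) .
      ultimately obtain u where u: "u \<in> V \<inter> gen_eigenspace T m" "shift T l u = shift T m v"
        using Suc by blast
      have "v \<in> gen_eigenspace T m"
        using v(2) unfolding gen_eigenspace_def by blast
      moreover have "shift T l (scale (inverse (m - l)) (v - u)) = v"
      proof -
        have "shift T l (v - u) = shift T l v - shift T l u"
          by (simp add: endoD[OF T'] scale_right_diff_distrib)
        also have "\<dots> = scale (m - l) v"
          using u(2) by (simp add: scale_left_diff_distrib)
        finally have e: "shift T l (v - u) = scale (m - l) v" .
        have "shift T l (scale (inverse (m - l)) (v - u)) = scale (inverse (m - l)) (shift T l (v - u))"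
          by (simp add: endoD[OF T'] scale_right_diff_distrib mult.commute)
        also have "\<dots> = v" unfolding e using \<open>l \<noteq> m\<close> by simp
        finally show ?thesis .
      qed
      ultimately show "\<exists>u\<in>V \<inter> gen_eigenspace T m. shift T l u = v"
        using u(1) v(1) T(2) subspace_gen_eigenspace[OF T']
        by (intro bexI[of _ "scale (inverse (m - l)) (v - u)"]) (auto intro!: subspace_scale subspace_diff)
    qed
  qed
  then show ?thesis
    using assms(4,5) by (auto simp: gen_eigenspace_def)
qed

section \<open>Polynomials in an operator and the decomposition into generalized eigenspaces\<close>

definition poly_op :: "('b \<Rightarrow> 'b) \<Rightarrow> complex poly \<Rightarrow> 'b \<Rightarrow> 'b" where
  "poly_op T p v = (\<Sum>i\<le>degree p. scale (coeff p i) ((T ^^ i) v))"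

lemma poly_op_altdef:
  assumes "degree p \<le> n"
  shows "poly_op T p v = (\<Sum>i\<le>n. scale (coeff p i) ((T ^^ i) v))"
  unfolding poly_op_def
  by (rule sum.mono_neutral_left) (use assms in \<open>auto simp: coeff_eq_0\<close>)

lemma poly_op_linear_factor:
  assumes "endo UNIV T"
  shows "poly_op T ([:- a, 1:] * q) v = poly_op T q (shift T a v)"
proof -
  have 1: "[:- a, 1:] * q = pCons 0 q + smult (- a) q" by simp
  have d: "degree ([:- a, 1:] * q) \<le> Suc (degree q)"
    unfolding 1 by (intro degree_add_le) (auto intro: degree_pCons_le le_SucI[OF degree_smult_le])
  have "poly_op T ([:- a, 1:] * q) v =
      (\<Sum>i\<le>Suc (degree q). scale (coeff (pCons 0 q) i) ((T ^^ i) v)) -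
      (\<Sum>i\<le>Suc (degree q). scale (a * coeff q i) ((T ^^ i) v))"
    unfolding poly_op_altdef[OF d] by (simp add: 1 scale_left_diff_distrib sum_subtractf)
  also have "(\<Sum>i\<le>Suc (degree q). scale (coeff (pCons 0 q) i) ((T ^^ i) v)) = poly_op T q (T v)"
    by (simp add: sum.atMost_Suc_shift poly_op_def funpow_Suc_right del: sum.atMost_Suc funpow.simps)
  also have "(\<Sum>i\<le>Suc (degree q). scale (a * coeff q i) ((T ^^ i) v)) = poly_op T q (scale a v)"
    using endoD(2)[OF endo_funpow[OF assms]]
    by (simp add: poly_op_def coeff_eq_0 mult.commute)
  also have "poly_op T q (T v) - poly_op T q (scale a v) = poly_op T q (shift T a v)"
    using endoD(5)[OF endo_funpow[OF assms]]
    by (simp add: poly_op_def sum_subtractf scale_right_diff_distrib)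
  finally show ?thesis .
qed

text \<open>The iterates of \<open>v\<close> either repeat or form an infinite subset of a
  finite-dimensional space; both cases give a polynomial relation, which takes the place of a
  minimal polynomial.\<close>

lemma dependent_powers:
  assumes V: "fin_dim V" and T: "\<And>i. (T ^^ i) v \<in> V"
  obtains p where "p \<noteq> 0" "poly_op T p v = 0"
proof (cases "inj (\<lambda>i. (T ^^ i) v)")
  case False
  then obtain i j where ij: "i < j" "(T ^^ i) v = (T ^^ j) v"
    unfolding inj_def by (metis nat_neq_iff)
  define p where "p = monom 1 j - monom (1::complex) i"
  have "coeff p j = 1" using ij by (simp add: p_def)
  then have "p \<noteq> 0" by auto
  moreover have "degree p \<le> j"
    unfolding p_def using ij by (intro degree_diff_le) (auto simp: degree_monom_le order.trans[OF degree_monom_le])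
  then have "poly_op T p v = (\<Sum>k\<le>j. (if k = j then (T ^^ j) v else 0) - (if k = i then (T ^^ i) v else 0))"
    unfolding poly_op_altdef[OF \<open>degree p \<le> j\<close>]
    by (intro sum.cong) (auto simp: p_def)
  then have "poly_op T p v = 0"
    using ij by (simp add: sum_subtractf)
  ultimately show ?thesis by (rule that)
next
  case True
  obtain F where F: "finite F" "V \<subseteq> span F"
    using V unfolding fin_dim_def by blast
  define A where "A = (\<lambda>i. (T ^^ i) v) ` UNIV"
  have "infinite A"
    unfolding A_def using True finite_imageD by blast
  moreover have "A \<subseteq> span F" using T F(2) by (auto simp: A_def)
  ultimately have "dependent A"
    using independent_span_bound[OF F(1)] by blast
  then obtain S u where S: "finite S" "S \<subseteq> A" "\<exists>w\<in>S. u w \<noteq> 0" "(\<Sum>w\<in>S. scale (u w) w) = 0"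
    unfolding dependent_explicit by blast
  define I where "I = {i. (T ^^ i) v \<in> S}"
  have SI: "S = (\<lambda>i. (T ^^ i) v) ` I"
    using S(2) by (auto simp: I_def A_def)
  have inj: "inj_on (\<lambda>i. (T ^^ i) v) I"
    using True by (rule inj_on_subset) simp
  have finI: "finite I"
    using S(1) inj unfolding SI by (rule finite_imageD)
  define n where "n = Max I"
  define p where "p = (\<Sum>i\<in>I. monom (u ((T ^^ i) v)) i)"
  have cp: "coeff p i = (if i \<in> I then u ((T ^^ i) v) else 0)" for i
    using finI by (simp add: p_def coeff_sum)
  have "p \<noteq> 0"
  proof
    assume "p = 0"
    then have "u ((T ^^ i) v) = 0" if "i \<in> I" for i
      using cp[of i] that by simp
    then show False using S(3) SI by auto
  qed
  moreover have d: "degree p \<le> n"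
  proof (rule degree_le, intro allI impI)
    fix i assume "n < i"
    then have "i \<notin> I" using Max_ge[OF finI, of i] by (auto simp: n_def)
    then show "coeff p i = 0" by (simp add: cp)
  qed
  have "poly_op T p v = (\<Sum>i\<in>I. scale (u ((T ^^ i) v)) ((T ^^ i) v))"
    unfolding poly_op_altdef[OF d]
    by (rule sum.mono_neutral_cong_right) (use finI in \<open>auto simp: cp n_def\<close>)
  then have "poly_op T p v = 0"
    using S(4) unfolding SI by (simp add: sum.reindex[OF inj])
  ultimately show ?thesis by (rule that)
qed

lemma span_gen_eigenspaces:
  assumes T: "endo V T" and V: "subspace V" "fin_dim V" and v: "v \<in> V"
  shows "v \<in> span (\<Union>l. V \<inter> gen_eigenspace T l)"
proof -
  note T' = endo_UNIV[OF T]
  let ?G = "span (\<Union>l. V \<inter> gen_eigenspace T l)"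
  \<comment> \<open>If \<open>(T - a) v\<close> is a sum of generalized eigenvectors, so is
    \<open>v\<close>: the components for eigenvalues other than \<open>a\<close> are images under
    \<open>T - a\<close> and can be subtracted, which leaves a generalized eigenvector for
    \<open>a\<close>.\<close>
  have step: "v \<in> ?G" if v: "v \<in> V" "shift T a v \<in> ?G" for a v
  proof -
    have "\<exists>u\<in>?G. u \<in> V \<and> w - shift T a u \<in> V \<inter> gen_eigenspace T a" if "w \<in> ?G" for w
      using that
    proof (induction rule: span_induct_alt)
      case base
      then show ?case
        using V(1) subspace_gen_eigenspace[OF T']
        by (intro bexI[of _ 0]) (auto simp: endoD[OF T'] subspace_0 span_zero)
    next
      case (step c x y)
      then obtain u where u: "u \<in> ?G" "u \<in> V" "y - shift T a u \<in> V \<inter> gen_eigenspace T a"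
        by blast
      from step obtain m where m: "x \<in> V" "x \<in> gen_eigenspace T m" by blast
      show ?case
      proof (cases "a = m")
        case True
        have "scale c x + y - shift T a u = scale c x + (y - shift T a u)" by simp
        also have "\<dots> \<in> V \<inter> gen_eigenspace T a"
          using m True u(3) V(1) subspace_gen_eigenspace[OF T']
          by (auto intro!: subspace_add subspace_scale)
        finally show ?thesis using u by blast
      next
        case False
        then obtain z where z: "z \<in> V \<inter> gen_eigenspace T m" "shift T a z = x"
          using shift_surj_gen_eigenspace[OF T V(1) _ m] by blast
        have "shift T a (scale c z + u) = scale c (shift T a z) + shift T a u"
          by (simp add: endoD[OF T'] algebra_simps scale_right_distrib scale_right_diff_distrib)
        then have "scale c x + y - shift T a (scale c z + u) = y - shift T a u"
          using z(2) by simp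
        moreover have "scale c z + u \<in> ?G"
          using z(1) u(1) by (intro span_add span_scale) (auto intro: span_base)
        moreover have "scale c z + u \<in> V"
          using z(1) u(2) V(1) by (auto intro!: subspace_add subspace_scale)
        ultimately show ?thesis using u(3) by metis
      qed
    qed
    then obtain u where u: "u \<in> ?G" "u \<in> V" "shift T a v - shift T a u \<in> V \<inter> gen_eigenspace T a"
      using v(2) by blast
    have "shift T a (v - u) = shift T a v - shift T a u"
      by (simp add: endoD[OF T'] scale_right_diff_distrib)
    then have "v - u \<in> gen_eigenspace T a"
      using u(3) gen_eigenspace_shiftD by (metis IntD2)
    then have "v - u \<in> ?G"
      using v(1) u(2) V(1) by (intro span_base) (auto intro: subspace_diff)
    then show ?thesis using u(1) span_add by (metis diff_add_cancel)
  qed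
  \<comment> \<open>By the fundamental theorem of algebra \<open>p\<close> loses one linear factor
    at a time, and \<open>step\<close> undoes each factor.\<close>
  have main: "\<forall>v\<in>V. poly_op T p v = 0 \<longrightarrow> v \<in> ?G" if "p \<noteq> 0" for p
    using that
  proof (induction "degree p" arbitrary: p)
    case 0
    then obtain c where "p = [:c:]" "c \<noteq> 0"
      by (metis degree_0_id of_nat_0 pCons_0_0 degree_eq_zeroE)
    then have "poly_op T p v = scale c v" for v
      by (simp add: poly_op_def)
    then show ?case
      using \<open>c \<noteq> 0\<close> span_zero by simp
  next
    case (Suc n)
    then have "\<not> constant (poly p)"
      by (simp add: constant_degree)
    then obtain a where "poly p a = 0"
      using fundamental_theorem_of_algebra by blast
    then obtain q where q: "p = [:- a, 1:] * q"
      by (auto simp: poly_eq_0_iff_dvd elim: dvdE)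
    then have "q \<noteq> 0" using Suc by auto
    have "degree p = Suc (degree q)"
      unfolding q using \<open>q \<noteq> 0\<close> by (subst degree_mult_eq) auto
    then have "degree q = n"
      using Suc.hyps(2) by simp
    then have IH: "\<forall>v\<in>V. poly_op T q v = 0 \<longrightarrow> v \<in> ?G"
      using Suc.hyps(1) \<open>q \<noteq> 0\<close> by blast
    show ?case
    proof (intro ballI impI)
      fix v assume v: "v \<in> V" "poly_op T p v = 0"
      have "shift T a v \<in> V"
        using endoD(7)[OF endo_shift[OF T V(1)]] v(1) .
      moreover have "poly_op T q (shift T a v) = 0"
        using v(2) q poly_op_linear_factor[OF T'] by simp
      ultimately have "shift T a v \<in> ?G" using IH by blast
      then show "v \<in> ?G" using step v(1) by blast
    qed
  qed
  have "(T ^^ i) v \<in> V" for i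
    using endoD(7)[OF endo_funpow[OF T] v] .
  then obtain p where "p \<noteq> 0" "poly_op T p v = 0"
    using dependent_powers[OF V(2)] by blast
  then show ?thesis using main[of p] v by simp
qed

lemma gen_eigenbasis:
  assumes T: "endo V T" and V: "subspace V" "fin_dim V"
  obtains B e where "basis_of B V" "\<And>b. b \<in> B \<Longrightarrow> b \<in> gen_eigenspace T (e b)"
proof -
  let ?G = "\<Union>l. V \<inter> gen_eigenspace T l"
  obtain A where A: "A \<subseteq> ?G" "independent A" "?G \<subseteq> span A"
    using maximal_independent_subset by blast
  have "A \<subseteq> V" using A(1) by blast
  then obtain B where B: "basis_of B V" "A \<subseteq> B"
    using basis_of_extend[OF V A(2)] by blast
  have "V \<subseteq> span A"
    using span_gen_eigenspaces[OF T V] span_minimal[OF A(3) subspace_span] by blast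
  then have "span A = V"
    using \<open>A \<subseteq> V\<close> V(1) span_subspace by blast
  then have "basis_of A V"
    using A(2) B finite_subset by (auto simp: basis_of_def)
  moreover have "\<forall>b\<in>A. \<exists>l. b \<in> gen_eigenspace T l"
    using A(1) by blast
  then obtain e where "\<forall>b\<in>A. b \<in> gen_eigenspace T (e b)"
    by (metis bchoice)
  ultimately show ?thesis using that by blast
qed

text \<open>The part \<open>w\<close> of \<open>v\<close> along basis vectors with eigenvalue other
  than \<open>l\<close> is a generalized eigenvector for \<open>l\<close> and at the same time
  killed by shifts different from \<open>l\<close>, so it vanishes.\<close>

lemma repr_gen_eigenvector:
  assumes T: "endo V T" and B: "basis_of B V" "\<And>b. b \<in> B \<Longrightarrow> b \<in> gen_eigenspace T (e b)"
    and v: "v \<in> V" "v \<in> gen_eigenspace T l" and b: "b \<in> B" "e b \<noteq> l"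
  shows "representation B v b = 0"
proof -
  note T' = endo_UNIV[OF T]
  let ?r = "representation B v"
  define r where "r b = (if e b = l then 0 else ?r b)" for b
  define w where "w = (\<Sum>b\<in>B. scale (r b) b)"
  have "v - w = (\<Sum>b\<in>B. scale (?r b) b) - w"
    using repr_eq[OF B(1) v(1)] by simp
  also have "\<dots> = (\<Sum>b\<in>B. scale (if e b = l then ?r b else 0) b)"
    unfolding w_def sum_subtractf[symmetric] by (intro sum.cong) (auto simp: r_def)
  also have "\<dots> \<in> gen_eigenspace T l"
    using subspace_gen_eigenspace[OF T'] B(2)
    by (intro subspace_sum) (auto intro!: subspace_scale simp: subspace_0)
  finally have "v - (v - w) \<in> gen_eigenspace T l"
    using subspace_diff[OF subspace_gen_eigenspace[OF T'] v(2)] by blast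
  then have w1: "w \<in> gen_eigenspace T l" by simp
  have "scale (r b) b \<in> {v. killed T (- {l}) v}" if "b \<in> B" for b
  proof (cases "e b = l")
    case True
    then show ?thesis
      using subspace_0[OF subspace_killed[OF T']] by (simp add: r_def)
  next
    case False
    then have "b \<in> {v. killed T (- {l}) v}"
      using gen_eigenspace_killed[OF B(2)[OF that], of "- {l}"] by simp
    then show ?thesis by (rule subspace_scale[OF subspace_killed[OF T']])
  qed
  then have "w \<in> {v. killed T (- {l}) v}"
    unfolding w_def by (intro subspace_sum[OF subspace_killed[OF T']])
  then have "w = 0"
    using gen_eigenspace_killed_eq_0[OF T' w1] by simp
  then have "r b = representation B 0 b"
    using repr_sum_scale[OF B(1) b(1), of r] by (simp add: w_def)
  then show ?thesis
    using b(2) by (simp add: r_def representation_zero)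
qed

text \<open>For \<open>f\<close> the identity this would be the semisimple part of \<open>T\<close>.
  The uses below take the conjugate and the squared modulus of the eigenvalue.\<close>

lemma diagonal_operator:
  assumes T: "endo V T" and B: "basis_of B V" "\<And>b. b \<in> B \<Longrightarrow> b \<in> gen_eigenspace T (e b)"
  obtains D where "endo V D" "\<forall>l. \<forall>v\<in>V \<inter> gen_eigenspace T l. D v = scale (f l) v"
    "trace B D = (\<Sum>b\<in>B. f (e b))"
proof -
  interpret VP: vector_space_pair scale scale
    by (intro vector_space_pair.intro vector_space_axioms)
  note Bp = basis_ofD[OF B(1)]
  obtain D where D: "Vector_Spaces.linear scale scale D" "\<And>b. b \<in> B \<Longrightarrow> D b = scale (f (e b)) b"
    using VP.linear_independent_extend[OF Bp(2), of "\<lambda>b. scale (f (e b)) b"] by blast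
  have D': "D v = (\<Sum>b\<in>B. scale (representation B v b) (scale (f (e b)) b))" if "v \<in> V" for v
  proof -
    have "D v = D (\<Sum>b\<in>B. scale (representation B v b) b)"
      using repr_eq[OF B(1) that] by simp
    also have "\<dots> = (\<Sum>b\<in>B. scale (representation B v b) (scale (f (e b)) b))"
      unfolding endoD(2,3)[OF linear_endo_UNIV[OF D(1)]] by (intro sum.cong) (simp_all add: D(2))
    finally show ?thesis .
  qed
  have "D v \<in> V" if "v \<in> V" for v
    using D'[OF that] Bp by (auto intro!: subspace_sum subspace_scale)
  then have endo: "endo V D" using D(1) by (auto simp: endo_def)
  moreover have "D v = scale (f l) v" if v: "v \<in> V" "v \<in> gen_eigenspace T l" for v l
  proof -
    have "D v = (\<Sum>b\<in>B. scale (f l) (scale (representation B v b) b))"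
      unfolding D'[OF v(1)]
      by (intro sum.cong) (use repr_gen_eigenvector[OF T B v] in \<open>auto simp: mult.commute\<close>)
    also have "\<dots> = scale (f l) (\<Sum>b\<in>B. scale (representation B v b) b)"
      by (simp add: scale_sum_right)
    finally show ?thesis
      using repr_eq[OF B(1) v(1)] by simp
  qed
  moreover have "trace B D = (\<Sum>b\<in>B. f (e b))"
    unfolding trace_def
    by (intro sum.cong) (auto simp: D repr_scale[OF B(1)] Bp repr_basis[OF B(1)])
  ultimately show ?thesis using that[of D] by simp
qed

text \<open>If \<open>S\<close> multiplies by conjugate eigenvalues, the trace of \<open>S T\<close>
  is the sum of the squared moduli of the eigenvalues of \<open>T\<close>, so it vanishes only if
  all of them are zero. Conjugation replaces the usual argument with rational-linear functions of
  the eigenvalues.\<close>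

lemma nilpotent_if_trace_cnj:
  assumes T: "endo V T" and V: "subspace V" "fin_dim V"
    and tr: "\<And>B S. basis_of B V \<Longrightarrow> endo V S \<Longrightarrow>
      (\<And>l v. v \<in> V \<Longrightarrow> v \<in> gen_eigenspace T l \<Longrightarrow> S v = scale (cnj l) v) \<Longrightarrow> trace B (\<lambda>v. S (T v)) = 0"
  shows "V \<subseteq> gen_eigenspace T 0"
proof -
  note T' = endo_UNIV[OF T]
  obtain B e where B: "basis_of B V" "\<And>b. b \<in> B \<Longrightarrow> b \<in> gen_eigenspace T (e b)"
    using gen_eigenbasis[OF T V] by blast
  note Bp = basis_ofD[OF B(1)]
  obtain S where S: "endo V S" "\<forall>l. \<forall>v\<in>V \<inter> gen_eigenspace T l. S v = scale (cnj l) v"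
    by (rule diagonal_operator[OF T B, where f = cnj])
  obtain D where D: "endo V D" "\<forall>l. \<forall>v\<in>V \<inter> gen_eigenspace T l. D v = scale (cnj l * l) v"
      "trace B D = (\<Sum>b\<in>B. cnj (e b) * e b)"
    by (rule diagonal_operator[OF T B, where f = "\<lambda>l. cnj l * l"])
  \<comment> \<open>\<open>S T\<close> and the diagonal operator \<open>D\<close> with the squared
    moduli differ by a nilpotent operator, hence have the same trace.\<close>
  define N where "N v = S (T v) - D v" for v
  have N: "endo V N"
    unfolding endo_def
  proof
    have "Vector_Spaces.linear scale scale (\<lambda>v. S (T v) - D v)"
      using endo_comp[OF S(1) T] D(1) unfolding endo_def
      by (intro vector_space_pair.linear_compose_sub[OF vector_space_pair.intro[OF vector_space_axioms vector_space_axioms]]) auto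
    then show "Vector_Spaces.linear scale scale N" by (simp add: N_def[abs_def])
    show "N ` V \<subseteq> V"
      using endoD(7)[OF S(1)] endoD(7)[OF T] endoD(7)[OF D(1)] V(1)
      by (auto simp: N_def intro!: subspace_diff)
  qed
  have Nl: "(N ^^ k) v = scale (cnj l ^ k) ((shift T l ^^ k) v)" if v: "v \<in> V" "v \<in> gen_eigenspace T l" for l v k
  proof -
    have in1: "(shift T l ^^ k) v \<in> V \<and> (shift T l ^^ k) v \<in> gen_eigenspace T l" for k
      by (induction k) (use v endoD(7)[OF endo_shift[OF T V(1)]] gen_eigenspace_shift[OF T'] in auto)
    have N1: "N w = scale (cnj l) (shift T l w)" if w: "w \<in> V" "w \<in> gen_eigenspace T l" for w
    proof -
      have "S (T w) = scale (cnj l) (T w)"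
        using S(2) endoD(7)[OF T w(1)] gen_eigenspace_stable[OF T' w(2)] by blast
      then show ?thesis
        using D(2) w by (simp add: N_def scale_right_diff_distrib)
    qed
    show ?thesis
    proof (induction k)
      case 0
      then show ?case by simp
    next
      case (Suc k)
      have "(N ^^ Suc k) v = scale (cnj l ^ k) (N ((shift T l ^^ k) v))"
        using Suc endoD(2)[OF N] by simp
      also have "\<dots> = scale (cnj l ^ Suc k) ((shift T l ^^ Suc k) v)"
        using N1 in1[of k] by (simp add: mult.commute)
      finally show ?case .
    qed
  qed
  have "(\<Union>l. V \<inter> gen_eigenspace T l) \<subseteq> gen_eigenspace N 0"
  proof
    fix v assume "v \<in> (\<Union>l. V \<inter> gen_eigenspace T l)"
    then obtain l k where "v \<in> V" "v \<in> gen_eigenspace T l" "(shift T l ^^ k) v = 0"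
      by (auto simp: gen_eigenspace_def)
    then have "(N ^^ k) v = 0" using Nl[of v l k] by simp
    then show "v \<in> gen_eigenspace N 0" by (auto simp: gen_eigenspace_def)
  qed
  then have "V \<subseteq> gen_eigenspace N 0"
    using span_minimal[OF _ subspace_gen_eigenspace[OF endo_UNIV[OF N]]] span_gen_eigenspaces[OF T V] by blast
  then have "trace B N = 0"
    by (intro trace_nilpotent[OF N B(1)]) (auto simp: gen_eigenspace_def)
  moreover have "trace B (\<lambda>v. N v + D v) = trace B N + trace B D"
    by (rule trace_add[OF B(1)]) (use endoD(7)[OF N] endoD(7)[OF D(1)] in auto)
  moreover have "(\<lambda>v. N v + D v) = (\<lambda>v. S (T v))"
    by (simp add: N_def)
  ultimately have "(\<Sum>b\<in>B. cnj (e b) * e b) = 0"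
    using tr[OF B(1) S(1)] S(2) D(3) by simp
  moreover have "cnj (e b) * e b = complex_of_real ((cmod (e b))\<^sup>2)" for b
    by (metis complex_norm_square mult.commute)
  ultimately have "complex_of_real (\<Sum>b\<in>B. (cmod (e b))\<^sup>2) = 0"
    by simp
  then have "(\<Sum>b\<in>B. (cmod (e b))\<^sup>2) = 0"
    by (simp only: of_real_eq_0_iff)
  then have "e b = 0" if "b \<in> B" for b
    using that Bp(1) by (simp add: sum_nonneg_eq_0_iff)
  then have "B \<subseteq> gen_eigenspace T 0" using B(2) by force
  then show ?thesis
    using span_minimal[OF _ subspace_gen_eigenspace[OF T'], of B 0] B(1) by (simp add: basis_of_def)
qed

subsection \<open>Bilinear forms\<close>

text \<open>Each functional cuts the dimension by at most one.\<close>

lemma exists_orthogonal: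
  assumes "finite F" "subspace Q" "fin_dim Q" "card F < dim Q"
    and "\<And>f. f \<in> F \<Longrightarrow> Vector_Spaces.linear scale (*) (\<beta> f)"
  obtains y where "y \<in> Q" "y \<noteq> 0" "\<And>f. f \<in> F \<Longrightarrow> \<beta> f y = 0"
proof -
  have "\<exists>y\<in>Q. y \<noteq> 0 \<and> (\<forall>f\<in>F. \<beta> f y = 0)"
    using assms
  proof (induction F arbitrary: Q rule: finite_induct)
    case empty
    then have "Q \<noteq> {0}"
      using dim_span[of "{}"] dim_le_card[of Q "{}"] by (auto simp: span_empty)
    then show ?case using empty subspace_0 by blast
  next
    case (insert f F)
    interpret b: Vector_Spaces.linear scale "(*)" "\<beta> f" using insert.prems(4) by simp
    let ?Q = "{y \<in> Q. \<beta> f y = 0}"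
    have sQ: "subspace ?Q"
      using insert.prems(1) by (auto simp: subspace_def b.add b.scale b.zero)
    have fQ: "fin_dim ?Q" by (rule fin_dim_subset[OF insert.prems(2)]) auto
    have "dim Q \<le> Suc (dim ?Q)"
    proof (cases "\<forall>y\<in>Q. \<beta> f y = 0")
      case True
      then have "?Q = Q" by blast
      then show ?thesis by simp
    next
      case False
      then obtain u where u: "u \<in> Q" "\<beta> f u \<noteq> 0" by blast
      obtain C where C: "basis_of C ?Q" using basis_of_exists[OF sQ fQ] .
      have "Q \<subseteq> span (insert u C)"
      proof
        fix y assume y: "y \<in> Q"
        define c where "c = \<beta> f y / \<beta> f u"
        have "y - scale c u \<in> ?Q"
          using y u insert.prems(1) by (auto simp: b.diff b.scale c_def intro!: subspace_diff subspace_scale)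
        then have "y - scale c u \<in> span C" using C by (auto simp: basis_of_def)
        then show "y \<in> span (insert u C)" using in_span_insert span_breakdown_eq by blast
      qed
      then have "dim Q \<le> card (insert u C)"
        by (rule dim_le_card) (use basis_ofD[OF C] in simp)
      then show ?thesis
        using basis_ofD(1)[OF C] basis_of_card[OF C] by (simp add: card_insert_if split: if_splits)
    qed
    then have "card F < dim ?Q" using insert by simp
    then obtain y where "y \<in> ?Q" "y \<noteq> 0" "\<forall>f\<in>F. \<beta> f y = 0"
      using insert.IH[OF sQ fQ] insert.prems(4) by blast
    then show ?case by auto
  qed
  then show ?thesis using that by blast
qed

text \<open>For each \<open>b\<close> some nonzero vector is orthogonal to the other basis vectors,
  which are too few to force zero. Nondegeneracy makes its pairing with \<open>b\<close> nonzero, so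
  it can be normalized.\<close>

lemma dual_basis:
  assumes Q: "basis_of B Q" and lin: "\<And>x. Vector_Spaces.linear scale (*) (\<beta> x)"
    and nondeg: "\<And>y. y \<in> Q \<Longrightarrow> (\<And>b. b \<in> B \<Longrightarrow> \<beta> b y = 0) \<Longrightarrow> y = 0"
  obtains d where "\<And>b. b \<in> B \<Longrightarrow> d b \<in> Q"
    "\<And>b c. b \<in> B \<Longrightarrow> c \<in> B \<Longrightarrow> \<beta> c (d b) = (if b = c then 1 else 0)"
proof -
  note Bp = basis_ofD[OF Q]
  have "\<exists>y\<in>Q. \<forall>c\<in>B. \<beta> c y = (if b = c then 1 else 0)" if b: "b \<in> B" for b
  proof -
    have "card (B - {b}) < dim Q"
      using b Bp(1) basis_of_card[OF Q] by (metis card_Diff1_less)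
    then obtain y where y: "y \<in> Q" "y \<noteq> 0" "\<And>c. c \<in> B - {b} \<Longrightarrow> \<beta> c y = 0"
      using exists_orthogonal[of "B - {b}" Q \<beta>] Bp fin_dim_basis[OF Q] lin by blast
    have "\<beta> b y \<noteq> 0" using nondeg[OF y(1)] y by blast
    interpret b: Vector_Spaces.linear scale "(*)" "\<beta> x" for x by (rule lin)
    show ?thesis
      using y \<open>\<beta> b y \<noteq> 0\<close> Bp(3)
      by (intro bexI[of _ "scale (1 / \<beta> b y) y"]) (auto simp: b.scale intro: subspace_scale)
  qed
  then obtain d where "\<forall>b\<in>B. d b \<in> Q \<and> (\<forall>c\<in>B. \<beta> c (d b) = (if b = c then 1 else 0))"
    using bchoice[of B "\<lambda>b y. y \<in> Q \<and> (\<forall>c\<in>B. \<beta> c y = (if b = c then 1 else 0))"] by blast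
  then show ?thesis using that by blast
qed

end

section \<open>Semisimple Lie algebras\<close>

sublocale lie_algebra \<subseteq> complex_vs scale ..

text \<open>Only linearity in the vector is assumed. The Lie derivative on all functions of lists is
  an operator of this kind, but the representation laws hold for it only on multilinear forms;
  \<open>rep_on\<close> records a subspace on which they hold.\<close>

locale lie_action = lie_algebra scale br + V: complex_vs sV
  for scale :: "complex \<Rightarrow> 'g::ab_group_add \<Rightarrow> 'g" and br
    and sV :: "complex \<Rightarrow> 'v::ab_group_add \<Rightarrow> 'v" +
  fixes act :: "'g \<Rightarrow> 'v \<Rightarrow> 'v"
  assumes act_linear: "Vector_Spaces.linear sV sV (act x)"
begin

definition rep_on :: "'g set \<Rightarrow> 'v set \<Rightarrow> bool" where
  "rep_on K W \<longleftrightarrow> V.subspace W \<and> V.fin_dim W \<and>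
     (\<forall>x\<in>K. \<forall>w\<in>W. act x w \<in> W) \<and>
     (\<forall>x y. \<forall>w\<in>W. act (x + y) w = act x w + act y w) \<and>
     (\<forall>c x. \<forall>w\<in>W. act (scale c x) w = sV c (act x w)) \<and>
     (\<forall>x y. \<forall>w\<in>W. act (br x y) w = act x (act y w) - act y (act x w))"

lemma rep_onD:
  assumes "rep_on K W"
  shows "V.subspace W" "V.fin_dim W" "x \<in> K \<Longrightarrow> w \<in> W \<Longrightarrow> act x w \<in> W"
    "w \<in> W \<Longrightarrow> act (x + y) w = act x w + act y w"
    "w \<in> W \<Longrightarrow> act (scale c x) w = sV c (act x w)"
    "w \<in> W \<Longrightarrow> act (br x y) w = act x (act y w) - act y (act x w)"
    "w \<in> W \<Longrightarrow> act 0 w = 0" "w \<in> W \<Longrightarrow> act (x - y) w = act x w - act y w"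
    "w \<in> W \<Longrightarrow> act (\<Sum>i\<in>I. f i) w = (\<Sum>i\<in>I. act (f i) w)"
proof -
  show *: "V.subspace W" "V.fin_dim W" "x \<in> K \<Longrightarrow> w \<in> W \<Longrightarrow> act x w \<in> W"
    "\<And>x y w. w \<in> W \<Longrightarrow> act (x + y) w = act x w + act y w"
    "\<And>c x w. w \<in> W \<Longrightarrow> act (scale c x) w = sV c (act x w)"
    "w \<in> W \<Longrightarrow> act (br x y) w = act x (act y w) - act y (act x w)"
    using assms unfolding rep_on_def by blast+
  show 0: "act 0 w = 0" if "w \<in> W" for w
    using *(5)[OF that, of 0 0] by simp
  show "act (x - y) w = act x w - act y w" if "w \<in> W"
    using *(4)[OF that, of "x - y" y] by (simp add: algebra_simps)
  show "act (\<Sum>i\<in>I. f i) w = (\<Sum>i\<in>I. act (f i) w)" if "w \<in> W"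
    by (induction I rule: infinite_finite_induct) (simp_all add: 0[OF that] *(4)[OF that])
qed

lemma rep_on_subset: "rep_on K W \<Longrightarrow> L \<subseteq> K \<Longrightarrow> rep_on L W"
  unfolding rep_on_def by blast

lemma rep_on_submodule:
  assumes "rep_on K W" "V.subspace U" "U \<subseteq> W" "\<And>x w. x \<in> K \<Longrightarrow> w \<in> U \<Longrightarrow> act x w \<in> U"
  shows "rep_on K U"
  using assms V.fin_dim_subset[of W U] unfolding rep_on_def by blast

lemma endo_act: "rep_on K W \<Longrightarrow> x \<in> K \<Longrightarrow> V.endo W (act x)"
  using act_linear by (auto simp: V.endo_def rep_onD)

lemma act_endo_UNIV: "V.endo UNIV (act x)"
  using act_linear by (simp add: V.endo_def)

lemmas act_simps = V.endoD(1-6)[OF act_endo_UNIV]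

end

context lie_algebra
begin

sublocale ad: lie_action scale br scale br
  by (intro lie_action.intro lie_action_axioms.intro lie_algebra_axioms complex_vs.intro
    vector_space_axioms br_linear_right)

lemmas br_right = ad.act_simps

lemma br_left:
  "br (x + y) z = br x z + br y z" "br (scale c x) z = scale c (br x z)" "br 0 z = 0"
  "br (x - y) z = br x z - br y z" "br (- x) z = - br x z" "br (\<Sum>i\<in>I. f i) z = (\<Sum>i\<in>I. br (f i) z)"
proof -
  interpret L: Vector_Spaces.linear scale scale "\<lambda>x. br x z" by (rule br_linear_left)
  show "br (x + y) z = br x z + br y z" "br (scale c x) z = scale c (br x z)" "br 0 z = 0"
    "br (x - y) z = br x z - br y z" "br (- x) z = - br x z" "br (\<Sum>i\<in>I. f i) z = (\<Sum>i\<in>I. br (f i) z)"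
    by (simp_all add: L.add L.scale L.zero L.diff L.neg L.sum)
qed

lemma br_swap: "br x y = - br y x"
proof -
  have "br x y + br y x = 0"
    using br_self[of "x + y"] by (simp add: br_left br_right br_self[of x] br_self[of y] add.commute)
  then show ?thesis by (simp add: eq_neg_iff_add_eq_0)
qed

lemma br_br: "br (br x y) z = br x (br y z) - br y (br x z)"
  using br_jacobi[of x y z] by (simp add: algebra_simps)

lemma ad_rep_on:
  assumes "subspace W" "fin_dim W" "\<And>x w. x \<in> K \<Longrightarrow> w \<in> W \<Longrightarrow> br x w \<in> W"
  shows "ad.rep_on K W"
  using assms by (auto simp: ad.rep_on_def br_left br_br)

lemma subspace_derived: "subspace (derived A)"
  unfolding derived_def by (rule subspace_span)

lemma lie_ideal_derived:
  assumes "lie_ideal I"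
  shows "lie_ideal (derived I)"
  unfolding lie_ideal_def
proof (intro conjI allI ballI subspace_derived)
  fix x y assume "y \<in> derived I"
  then show "br x y \<in> derived I"
    unfolding derived_def
  proof (induction rule: span_induct_alt)
    case base
    then show ?case by (simp add: br_right span_zero)
  next
    case (step c z y)
    then obtain u v where uv: "z = br u v" "u \<in> I" "v \<in> I" by blast
    have "br x z = br (br x u) v + br u (br x v)"
      unfolding uv(1) by (rule br_jacobi)
    moreover have "br x u \<in> I" "br x v \<in> I"
      using assms uv by (auto simp: lie_ideal_def)
    ultimately have "br x z \<in> span {br x y |x y. x \<in> I \<and> y \<in> I}"
      using uv by (simp only:) (intro span_add span_base; blast)
    then show ?case
      using step.IH by (auto simp: br_right intro!: span_add span_scale)
  qed
qed

lemma derived_subset_ideal: "lie_ideal I \<Longrightarrow> derived I \<subseteq> I"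
  unfolding derived_def lie_ideal_def by (intro span_minimal) auto

subsection \<open>Engel's theorem\<close>

text \<open>
  The subspace \<open>Z\<close> plays the role of the kernel of a representation, so that nilpotency of the
  adjoint action is only needed modulo \<open>Z\<close>.
\<close>

definition engel_alg :: "'g set \<Rightarrow> 'g set \<Rightarrow> bool" where
  "engel_alg Z K \<longleftrightarrow> subspace Z \<and> subspace K \<and> fin_dim K \<and> Z \<subseteq> K \<and>
     (\<forall>x\<in>K. \<forall>y\<in>K. br x y \<in> K) \<and> (\<forall>x\<in>K. \<forall>z\<in>Z. br x z \<in> Z) \<and>
     (\<forall>x\<in>K. \<forall>y\<in>K. \<exists>k. (br x ^^ k) y \<in> Z)"

text \<open>An ideal of codimension one that contains \<open>Z\<close>, together with a
  complementary vector: the input of Engel's induction.\<close>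

definition codim1 :: "'g set \<Rightarrow> 'g set \<Rightarrow> bool" where
  "codim1 Z K \<longleftrightarrow> (\<exists>M x. Z \<subseteq> M \<and> M \<subset> K \<and> subspace M \<and> (\<forall>y\<in>M. \<forall>z\<in>M. br y z \<in> M) \<and>
     x \<in> K \<and> (\<forall>m\<in>M. br m x \<in> M) \<and> (\<forall>k\<in>K. \<exists>m\<in>M. \<exists>c. k = m + scale c x))"

lemma engel_alg_subalgebra:
  assumes "engel_alg Z K" "Z \<subseteq> M" "M \<subseteq> K" "subspace M" "\<And>y z. y \<in> M \<Longrightarrow> z \<in> M \<Longrightarrow> br y z \<in> M"
  shows "engel_alg Z M"
  using assms fin_dim_subset[of K M] unfolding engel_alg_def by blast

end

context lie_action
begin

text \<open>Everything is modulo \<open>U\<close>, in place of a representation on the quotient of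
  \<open>W\<close> by \<open>U\<close>. All vectors obtained from \<open>w\<close> by powers of
  \<open>x\<close> are still sent into \<open>U\<close> by \<open>M\<close>, because
  \<open>[m, x]\<close> lies in \<open>M\<close>; the last of them outside \<open>U\<close> is sent
  into \<open>U\<close> by \<open>x\<close> as well.\<close>

lemma engel_step:
  assumes W: "rep_on K W" and U: "V.subspace U" "\<And>k u. k \<in> K \<Longrightarrow> u \<in> U \<Longrightarrow> act k u \<in> U"
    and M: "x \<in> K" "M \<subseteq> K" "\<And>m. m \<in> M \<Longrightarrow> br m x \<in> M" "\<And>k. k \<in> K \<Longrightarrow> \<exists>m\<in>M. \<exists>c. k = m + scale c x"
    and w: "w \<in> W" "w \<notin> U" "\<And>m. m \<in> M \<Longrightarrow> act m w \<in> U" "(act x ^^ n) w \<in> U"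
  shows "\<exists>w\<in>W. w \<notin> U \<and> (\<forall>k\<in>K. act k w \<in> U)"
proof -
  note Wp = rep_onD[OF W]
  define j where "j = (LEAST j. (act x ^^ j) w \<in> U)"
  have j: "(act x ^^ j) w \<in> U" unfolding j_def by (rule LeastI[of _ n]) (rule w(4))
  then have "j \<noteq> 0" using w(2) by (intro notI) simp
  then obtain i where i: "j = Suc i" by (cases j) auto
  have "(act x ^^ i) w \<notin> U"
    using not_less_Least[of i "\<lambda>j. (act x ^^ j) w \<in> U"] i unfolding j_def by auto
  moreover have "(act x ^^ l) w \<in> W \<and> (\<forall>m\<in>M. act m ((act x ^^ l) w) \<in> U)" for l
  proof (induction l)
    case 0
    then show ?case using w by simp
  next
    case (Suc l)
    let ?v = "(act x ^^ l) w"
    have "act m (act x ?v) \<in> U" if m: "m \<in> M" for m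
    proof -
      have "act m (act x ?v) = act x (act m ?v) + act (br m x) ?v"
        using Suc by (simp add: Wp(6))
      then show ?thesis
        using Suc m M U by (auto intro!: V.subspace_add)
    qed
    then show ?case using Suc Wp(3) M(1) by simp
  qed
  moreover have "act k ((act x ^^ i) w) \<in> U" if k: "k \<in> K" for k
  proof -
    let ?v = "(act x ^^ i) w"
    obtain m c where mc: "m \<in> M" "k = m + scale c x" using M(4)[OF k] by blast
    have v: "?v \<in> W" "act m ?v \<in> U" using calculation(2)[of i] mc by auto
    have "act x ?v \<in> U" using j i by simp
    then show ?thesis
      using v mc U(1) by (auto simp: Wp(4,5) intro!: V.subspace_add V.subspace_scale)
  qed
  ultimately show ?thesis by blast
qed

text \<open>The ideals of codimension one enter as a hypothesis up to dimension \<open>n\<close>,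
  since their existence is itself proved by applying this lemma to smaller algebras in their adjoint
  action.\<close>

lemma engel_rep:
  assumes codim1: "\<And>K'. engel_alg Z K' \<Longrightarrow> dim K' \<le> n \<Longrightarrow> K' \<noteq> Z \<Longrightarrow> codim1 Z K'"
    and "engel_alg Z K" "dim K \<le> n" "rep_on K W"
    and U: "V.subspace U" "U \<subset> W" "\<And>z w. z \<in> Z \<Longrightarrow> w \<in> W \<Longrightarrow> act z w \<in> U"
    and "\<And>k u. k \<in> K \<Longrightarrow> u \<in> U \<Longrightarrow> act k u \<in> U"
    and "\<And>x w. x \<in> K \<Longrightarrow> w \<in> W \<Longrightarrow> \<exists>k. (act x ^^ k) w \<in> U"
  shows "\<exists>w\<in>W. w \<notin> U \<and> (\<forall>x\<in>K. act x w \<in> U)"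
  using assms(2-4,8,9)
proof (induction "dim K" arbitrary: K rule: less_induct)
  case less
  note K = less.prems(1)[unfolded engel_alg_def]
  show ?case
  proof (cases "K = Z")
    case True
    then show ?thesis using U by blast
  next
    case False
    obtain M x where M: "Z \<subseteq> M" "M \<subset> K" "subspace M" "\<forall>y\<in>M. \<forall>z\<in>M. br y z \<in> M"
      "x \<in> K" "\<forall>m\<in>M. br m x \<in> M" "\<forall>k\<in>K. \<exists>m\<in>M. \<exists>c. k = m + scale c x"
      using codim1[OF less.prems(1,2) False] unfolding codim1_def by blast
    have eM: "engel_alg Z M"
      using engel_alg_subalgebra[OF less.prems(1) M(1)] M by blast
    have dM: "dim M < dim K"
      using dim_less_fin_dim[OF M(3) _ _ M(2)] K by blast
    have rM: "rep_on M W"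
      using rep_on_subset[OF less.prems(3)] M(2) by blast
    have "\<exists>w\<in>W. w \<notin> U \<and> (\<forall>x\<in>M. act x w \<in> U)"
    proof (rule less.hyps[OF dM eM _ rM])
      show "dim M \<le> n" using dM less.prems(2) by simp
    qed (use less.prems(4,5) M(2) in blast)+
    then obtain w where w: "w \<in> W" "w \<notin> U" "\<forall>x\<in>M. act x w \<in> U" by blast
    obtain k where "(act x ^^ k) w \<in> U" using less.prems(5) M(5) w(1) by blast
    moreover have "M \<subseteq> K" using M(2) by blast
    ultimately show ?thesis
      by (intro engel_step[OF less.prems(3) U(1) less.prems(4) M(5) \<open>M \<subseteq> K\<close> bspec[OF M(6)] bspec[OF M(7)] w(1,2) bspec[OF w(3)]])
  qed
qed

end

context lie_algebra
begin

text \<open>A maximal proper subalgebra \<open>M\<close> above \<open>Z\<close> acts on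
  \<open>K\<close> modulo \<open>M\<close>. Engel's theorem for this action yields \<open>x\<close>
  outside \<open>M\<close> with \<open>[M, x]\<close> in \<open>M\<close>; then \<open>M\<close> and
  \<open>x\<close> span a larger subalgebra, which by maximality is \<open>K\<close>.\<close>

lemma engel_codim1:
  assumes "engel_alg Z K" "K \<noteq> Z"
  shows "codim1 Z K"
  using assms
proof (induction "dim K" arbitrary: K rule: less_induct)
  case less
  note K = less.prems(1)[unfolded engel_alg_def]
  define Q where "Q M \<longleftrightarrow> Z \<subseteq> M \<and> M \<subset> K \<and> subspace M \<and> (\<forall>y\<in>M. \<forall>z\<in>M. br y z \<in> M)" for M
  have "Q Z" using K less.prems(2) by (auto simp: Q_def)
  moreover have "\<forall>M. Q M \<longrightarrow> dim M \<le> dim K"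
    using K dim_le_fin_dim[of _ K] by (auto simp: Q_def)
  ultimately have "\<exists>M. Q M \<and> (\<forall>M'. Q M' \<longrightarrow> dim M' \<le> dim M)"
    by (intro Lattices_Big.ex_has_greatest_nat[of Q Z dim "Suc (dim K)"]) (auto simp: less_Suc_eq_le)
  then obtain M where M: "Q M" "\<And>M'. Q M' \<Longrightarrow> dim M' \<le> dim M"
    by blast
  note QM = M(1)[unfolded Q_def]
  have eM: "engel_alg Z M"
    using engel_alg_subalgebra[OF less.prems(1)] QM by blast
  have dM: "dim M < dim K"
    using dim_less_fin_dim[of M K] K QM by blast
  have rM: "ad.rep_on M K"
    using K QM by (intro ad_rep_on) blast+
  have "\<exists>w\<in>K. w \<notin> M \<and> (\<forall>x\<in>M. br x w \<in> M)"
  proof (rule ad.engel_rep[OF _ eM order_refl rM])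
    fix K' assume "engel_alg Z K'" "dim K' \<le> dim M" "K' \<noteq> Z"
    then show "codim1 Z K'" using dM by (intro less.hyps) simp_all
  next
    show "\<exists>k. (br x ^^ k) w \<in> M" if "x \<in> M" "w \<in> K" for x w
    proof -
      have "x \<in> K" using that QM by blast
      then have "\<exists>k. (br x ^^ k) w \<in> Z" using that(2) K by simp
      then show ?thesis using QM by blast
    qed
  next
    show "br z w \<in> M" if "z \<in> Z" "w \<in> K" for z w
    proof -
      have "br w z \<in> Z" using that K by blast
      then have "br z w \<in> Z" using br_swap[of z w] K subspace_neg by metis
      then show ?thesis using QM by blast
    qed
  next
    show "subspace M" "M \<subset> K" using QM by blast+
    show "br k u \<in> M" if "k \<in> M" "u \<in> M" for k u using that QM by blast
  qed
  then obtain x where x: "x \<in> K" "x \<notin> M" "\<And>m. m \<in> M \<Longrightarrow> br m x \<in> M" by blast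
  define M' where "M' = span (insert x M)"
  have M'_iff: "y \<in> M' \<longleftrightarrow> (\<exists>m\<in>M. \<exists>c. y = m + scale c x)" for y
  proof -
    have "span M = M" using QM by (simp add: span_eq_iff)
    then have "y \<in> M' \<longleftrightarrow> (\<exists>c. y - scale c x \<in> M)"
      unfolding M'_def span_insert \<open>span M = M\<close> by simp
    also have "\<dots> \<longleftrightarrow> (\<exists>m\<in>M. \<exists>c. y = m + scale c x)"
    proof
      assume "\<exists>c. y - scale c x \<in> M"
      then obtain c where "y - scale c x \<in> M" by blast
      then show "\<exists>m\<in>M. \<exists>c. y = m + scale c x"
        by (intro bexI[of _ "y - scale c x"] exI[of _ c]) simp_all
    next
      assume "\<exists>m\<in>M. \<exists>c. y = m + scale c x"
      then obtain m c where mc: "m \<in> M" "y = m + scale c x" by blast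
      then have "y - scale c x \<in> M" by simp
      then show "\<exists>c. y - scale c x \<in> M" by blast
    qed
    finally show ?thesis .
  qed
  have sM': "subspace M'" unfolding M'_def by (rule subspace_span)
  have MM': "M \<subset> M'"
    using x(2) span_superset[of "insert x M"] unfolding M'_def by blast
  have M'K: "M' \<subseteq> K"
    unfolding M'_def using x(1) QM K by (intro span_minimal) auto
  have clM': "br y z \<in> M'" if yz: "y \<in> M'" "z \<in> M'" for y z
  proof -
    obtain m c where m: "m \<in> M" "y = m + scale c x" using yz(1) unfolding M'_iff by blast
    obtain n e where n: "n \<in> M" "z = n + scale e x" using yz(2) unfolding M'_iff by blast
    note e = m n
    have "br y z = br m n + scale e (br m x) - scale c (br n x)"
      using br_swap[of x n] by (simp add: e br_left br_right br_self algebra_simps)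
    also have "\<dots> \<in> M"
    proof -
      have "subspace M" "br m n \<in> M" using QM e by blast+
      then show ?thesis by (intro subspace_add subspace_diff subspace_scale x(3) e)
    qed
    finally show ?thesis using MM' by blast
  qed
  have "M' = K"
  proof (rule ccontr)
    assume "M' \<noteq> K"
    then have "Q M'" using M'K sM' clM' MM' QM unfolding Q_def by blast
    then have "dim M' \<le> dim M" by (rule M(2))
    moreover have "dim M < dim M'"
      using dim_less_fin_dim[OF _ sM' _ MM'] QM fin_dim_subset[of K M'] M'K K by blast
    ultimately show False by simp
  qed
  then have "\<forall>k\<in>K. \<exists>m\<in>M. \<exists>c. k = m + scale c x"
    using M'_iff by simp
  then show ?case
    using x QM unfolding codim1_def by blast
qed

end

context lie_action
begin

lemmas engel = engel_rep[OF engel_codim1 _ order_refl]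

text \<open>Roots add to weights: \<open>(x - l - m) y w = ([x, y] - m y) w + y (x - l) w\<close>,
  and induction runs over the sum of the two nilpotency exponents.\<close>

lemma act_gen_eigenspace:
  assumes W: "rep_on K W" and K: "subspace K" "x \<in> K" "\<And>y. y \<in> K \<Longrightarrow> br x y \<in> K"
    and y: "y \<in> K" "y \<in> gen_eigenspace (br x) m" and w: "w \<in> W" "w \<in> V.gen_eigenspace (act x) l"
  shows "act y w \<in> V.gen_eigenspace (act x) (l + m)"
proof -
  note Wp = rep_onD[OF W]
  let ?G = "V.gen_eigenspace (act x) (l + m)"
  note sG = V.subspace_gen_eigenspace[OF act_endo_UNIV]
  have "\<forall>y\<in>K. \<forall>w\<in>W. (shift (br x) m ^^ i) y = 0 \<longrightarrow> (V.shift (act x) l ^^ j) w = 0 \<longrightarrow> i + j \<le> n \<longrightarrow> act y w \<in> ?G" for i j n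
  proof (induction n arbitrary: i j)
    case 0
    then show ?case using V.subspace_0[OF sG] by (auto simp: Wp(7))
  next
    case (Suc n)
    show ?case
    proof (intro ballI impI)
      fix y w assume y: "y \<in> K" and w: "w \<in> W"
        and yi: "(shift (br x) m ^^ i) y = 0" and wj: "(V.shift (act x) l ^^ j) w = 0" and ij: "i + j \<le> Suc n"
      show "act y w \<in> ?G"
      proof (cases "i = 0 \<or> j = 0")
        case True
        then show ?thesis using yi wj w V.subspace_0[OF sG] by (auto simp: Wp(7) act_simps)
      next
        case False
        then obtain i' j' where ij': "i = Suc i'" "j = Suc j'" by (metis not0_implies_Suc)
        have y': "shift (br x) m y \<in> K"
          using y K by (auto intro!: subspace_diff subspace_scale)
        have w': "V.shift (act x) l w \<in> W"
          using w Wp(1,3) K(2) by (auto intro!: V.subspace_diff V.subspace_scale)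
        have "(shift (br x) m ^^ i') (shift (br x) m y) = 0"
          using yi ij'(1) by (simp only: funpow_Suc_right o_apply)
        then have 1: "act (shift (br x) m y) w \<in> ?G"
          using Suc.IH[of i' j] y' w wj ij ij' by auto
        have "(V.shift (act x) l ^^ j') (V.shift (act x) l w) = 0"
          using wj ij'(2) by (simp only: funpow_Suc_right o_apply)
        then have 2: "act y (V.shift (act x) l w) \<in> ?G"
          using Suc.IH[of i j'] y w' yi ij ij' by auto
        have "V.shift (act x) (l + m) (act y w) = act (shift (br x) m y) w + act y (V.shift (act x) l w)"
          using w by (simp add: Wp act_simps V.scale_left_distrib)
        then have "V.shift (act x) (l + m) (act y w) \<in> ?G"
          using V.subspace_add[OF sG 1 2] by simp
        then show ?thesis by (rule V.gen_eigenspace_shiftD)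
      qed
    qed
  qed
  moreover obtain i j where "(shift (br x) m ^^ i) y = 0" "(V.shift (act x) l ^^ j) w = 0"
    using y(2) w(2) by (auto simp: gen_eigenspace_def V.gen_eigenspace_def)
  ultimately show ?thesis using y(1) w(1) by blast
qed

text \<open>Once \<open>ad x\<close> is known to be nilpotent modulo the kernel \<open>Z\<close>,
  Engel's theorem applies relative to the invariants \<open>U\<close>. A vector outside
  \<open>U\<close> that \<open>S\<close> sends into \<open>U\<close> is killed by all brackets,
  hence by \<open>S = [S, S]\<close>, so it would lie in \<open>U\<close> after all.\<close>

lemma perfect_nilpotent_trivial:
  assumes W: "rep_on S W" and S: "subspace S" "fin_dim S" "derived S = S"
    and nil: "\<And>x. x \<in> S \<Longrightarrow> W \<subseteq> V.gen_eigenspace (act x) 0"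
    and "x \<in> S" "w \<in> W"
  shows "act x w = 0"
proof -
  note Wp = rep_onD[OF W]
  define Z where "Z = {x \<in> S. \<forall>w\<in>W. act x w = 0}"
  have Scl: "br x y \<in> S" if "x \<in> S" "y \<in> S" for x y
  proof -
    have "br x y \<in> derived S"
      unfolding derived_def using that by (intro span_base) blast
    then show ?thesis using S(3) by simp
  qed
  have sZ: "subspace Z"
    using S(1) by (auto simp: Z_def subspace_def Wp)
  have SZ: "br x z \<in> Z" if "x \<in> S" "z \<in> Z" for x z
    using that Scl by (auto simp: Z_def Wp act_simps)
  have ZW: "z \<in> Z \<Longrightarrow> w \<in> W \<Longrightarrow> act z w = 0" for z w by (simp add: Z_def)
  have adnil: "\<exists>k. (br x ^^ k) y \<in> Z" if x: "x \<in> S" and y: "y \<in> S" for x y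
  proof -
    let ?N = "{y. \<exists>k. (br x ^^ k) y \<in> Z}"
    note P = endoD[OF endo_funpow[OF ad.act_endo_UNIV]]
    have up: "(br x ^^ (k + n)) y \<in> Z" if "(br x ^^ n) y \<in> Z" for y n k
      using that by (induction k) (auto simp: SZ[OF x])
    have "subspace ?N"
    proof (rule subspaceI)
      show "0 \<in> ?N" using subspace_0[OF sZ] by (auto intro: exI[of _ 0])
      show "y + y' \<in> ?N" if "y \<in> ?N" "y' \<in> ?N" for y y'
      proof -
        from that obtain k n where "(br x ^^ k) y \<in> Z" "(br x ^^ n) y' \<in> Z" by blast
        then have "(br x ^^ (n + k)) y \<in> Z" "(br x ^^ (n + k)) y' \<in> Z"
          using up[of k y n] up[of n y' k] by (simp_all add: add.commute)
        then have "(br x ^^ (n + k)) (y + y') \<in> Z"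
          by (simp add: P subspace_add[OF sZ])
        then show ?thesis by blast
      qed
      show "scale c y \<in> ?N" if "y \<in> ?N" for c y
        using that subspace_scale[OF sZ] by (auto simp: P)
    qed
    moreover have "S \<inter> gen_eigenspace (br x) m \<subseteq> ?N" for m
    proof
      fix y assume y: "y \<in> S \<inter> gen_eigenspace (br x) m"
      show "y \<in> ?N"
      proof (cases "m = 0")
        case True
        then obtain k where "(br x ^^ k) y = 0"
          using y by (auto simp: gen_eigenspace_def)
        then have "(br x ^^ k) y \<in> Z" using subspace_0[OF sZ] by simp
        then show ?thesis by blast
      next
        case False
        \<comment> \<open>A root vector for \<open>m \<noteq> 0\<close> moves weight 0 to weight
          \<open>m\<close>, but \<open>x\<close> has only the weight 0 on \<open>W\<close>.\<close>
        have "act y w = 0" if w: "w \<in> W" for w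
        proof -
          have "act y w \<in> V.gen_eigenspace (act x) (0 + m)"
            using act_gen_eigenspace[OF W S(1) x Scl[OF x], of y m w 0] y w nil[OF x] by blast
          moreover have "V.killed (act x) {0} (act y w)"
            using Wp(3)[of y w] y w nil[OF x] V.gen_eigenspace_killed by blast
          ultimately show ?thesis
            using V.gen_eigenspace_killed_eq_0[OF act_endo_UNIV] False by force
        qed
        then have "y \<in> Z" using y by (auto simp: Z_def)
        then show ?thesis by (auto intro: exI[of _ 0])
      qed
    qed
    moreover have "endo S (br x)"
      using Scl[OF x] br_linear_right by (auto simp: endo_def)
    ultimately have "S \<subseteq> ?N"
      using span_gen_eigenspaces[of S "br x"] S span_minimal[of "\<Union>l. S \<inter> gen_eigenspace (br x) l" ?N] by blast
    then show ?thesis using y by blast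
  qed
  have eS: "engel_alg Z S"
    unfolding engel_alg_def using S sZ Scl SZ adnil by (auto simp: Z_def)
  define U where "U = {w \<in> W. \<forall>x\<in>S. act x w = 0}"
  have sU: "V.subspace U"
    using Wp(1) by (auto simp: U_def V.subspace_def act_simps)
  have SU: "act k u \<in> U" if "k \<in> S" "u \<in> U" for k u
    using that V.subspace_0[OF sU] by (auto simp: U_def)
  have "U = W"
  proof (rule ccontr)
    assume "U \<noteq> W"
    then have "U \<subset> W" by (auto simp: U_def)
    moreover have "\<exists>k. (act x ^^ k) w \<in> U" if "x \<in> S" "w \<in> W" for x w
    proof -
      have "\<exists>k. (act x ^^ k) w = 0"
        using nil[OF that(1)] that(2) by (auto simp: V.gen_eigenspace_def)
      then show ?thesis using V.subspace_0[OF sU] by metis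
    qed
    moreover have "act z w \<in> U" if "z \<in> Z" "w \<in> W" for z w
      using that ZW V.subspace_0[OF sU] by simp
    ultimately obtain w where w: "w \<in> W" "w \<notin> U" "\<forall>x\<in>S. act x w \<in> U"
      using engel[OF _ _ eS W sU] SU by blast
    have "act y w = 0" if "y \<in> S" for y
    proof -
      have "y \<in> span {br x y |x y. x \<in> S \<and> y \<in> S}"
        using that S(3) by (simp add: derived_def)
      then show ?thesis
      proof (induction rule: span_induct_alt)
        case base
        then show ?case using w by (simp add: Wp)
      next
        case (step c z y)
        then obtain u v where uv: "z = br u v" "u \<in> S" "v \<in> S" by blast
        have "act u (act v w) = 0" "act v (act u w) = 0"
          using w(3) uv by (auto simp: U_def)
        then show ?case
          using w(1) step.IH by (simp add: uv(1) Wp)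
      qed
    qed
    then show False using w by (auto simp: U_def)
  qed
  then show ?thesis using assms(6,7) by (auto simp: U_def)
qed

end

subsection \<open>Cartan's criterion\<close>

context lie_action
begin

definition trace_form :: "'v set \<Rightarrow> 'g \<Rightarrow> 'g \<Rightarrow> complex" where
  "trace_form B x y = V.trace B (\<lambda>w. act x (act y w))"

context
  fixes W B assumes W: "rep_on UNIV W" and B: "V.basis_of B W"
begin

private lemma Wp:
    "V.subspace W" "V.fin_dim W" "w \<in> W \<Longrightarrow> act x w \<in> W"
    "w \<in> W \<Longrightarrow> act (x + y) w = act x w + act y w"
    "w \<in> W \<Longrightarrow> act (scale c x) w = sV c (act x w)"
    "w \<in> W \<Longrightarrow> act (br x y) w = act x (act y w) - act y (act x w)"
  using rep_onD[OF W] by auto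

private lemma trace_triple:
  "V.trace B (\<lambda>w. act x (act y (act z w))) = V.trace B (\<lambda>w. act z (act x (act y w)))"
  using V.trace_comp_commute[OF V.endo_comp[OF endo_act[OF W] endo_act[OF W]] endo_act[OF W] B, of x y z] by simp

private lemma trace_diff:
  assumes "V.endo W S" "V.endo W T"
  shows "V.trace B (\<lambda>w. S w - T w) = V.trace B S - V.trace B T"
proof -
  have "V.trace B (\<lambda>w. (S w - T w) + T w) = V.trace B (\<lambda>w. S w - T w) + V.trace B T"
    using V.endoD(7)[OF assms(1)] V.endoD(7)[OF assms(2)] Wp(1)
    by (intro V.trace_add[OF B]) (auto intro: V.subspace_diff)
  then show ?thesis by simp
qed

lemma trace_form_linear_left: "Vector_Spaces.linear scale (*) (\<lambda>x. trace_form B x y)"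
proof -
  have "trace_form B (x + x') y = trace_form B x y + trace_form B x' y" for x x'
  proof -
    have "trace_form B (x + x') y = V.trace B (\<lambda>w. act x (act y w) + act x' (act y w))"
      unfolding trace_form_def by (rule V.trace_cong[OF B]) (simp add: Wp)
    also have "\<dots> = trace_form B x y + trace_form B x' y"
      unfolding trace_form_def by (rule V.trace_add[OF B]) (simp_all add: Wp(3))
    finally show ?thesis .
  qed
  moreover have "trace_form B (scale c x) y = c * trace_form B x y" for c x
  proof -
    have "trace_form B (scale c x) y = V.trace B (\<lambda>w. sV c (act x (act y w)))"
      unfolding trace_form_def by (rule V.trace_cong[OF B]) (simp add: Wp)
    also have "\<dots> = c * trace_form B x y"
      unfolding trace_form_def by (rule V.trace_scale[OF B]) (simp add: Wp(3))
    finally show ?thesis .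
  qed
  ultimately show ?thesis
    by unfold_locales (auto simp: algebra_simps)
qed

lemma trace_form_commute: "trace_form B x y = trace_form B y x"
  unfolding trace_form_def by (rule V.trace_comp_commute[OF endo_act[OF W] endo_act[OF W] B]) auto

lemma trace_form_linear_right: "Vector_Spaces.linear scale (*) (trace_form B x)"
  using trace_form_linear_left[of x] by (simp add: trace_form_commute[of _ x])

lemma trace_form_invariant: "trace_form B (br x y) z = trace_form B x (br y z)"
proof -
  note e = endo_act[OF W UNIV_I]
  note e3 = V.endo_comp[OF e V.endo_comp[OF e e]]
  have "trace_form B (br x y) z = V.trace B (\<lambda>w. act x (act y (act z w)) - act y (act x (act z w)))"
    unfolding trace_form_def by (rule V.trace_cong[OF B]) (simp add: Wp)
  also have "\<dots> = V.trace B (\<lambda>w. act x (act y (act z w))) - V.trace B (\<lambda>w. act y (act x (act z w)))"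
    by (rule trace_diff[OF e3 e3])
  also have "V.trace B (\<lambda>w. act y (act x (act z w))) = V.trace B (\<lambda>w. act x (act z (act y w)))"
    by (rule trace_triple[symmetric])
  also have "V.trace B (\<lambda>w. act x (act y (act z w))) - V.trace B (\<lambda>w. act x (act z (act y w))) =
      V.trace B (\<lambda>w. act x (act y (act z w)) - act x (act z (act y w)))"
    by (rule trace_diff[OF e3 e3, symmetric])
  also have "\<dots> = trace_form B x (br y z)"
    unfolding trace_form_def by (rule V.trace_cong[OF B]) (simp add: Wp act_simps)
  finally show ?thesis .
qed

text \<open>
  If \<open>S\<close> acts by the conjugate eigenvalues of \<open>x\<close>, then commutation with \<open>S\<close> preserves the image of \<open>P\<close>,
  because on the root components of \<open>y \<in> P\<close> it is multiplication by the conjugate root.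
\<close>

lemma cartan_nilpotent:
  assumes P: "subspace P" "fin_dim P" "derived P = P"
    and tr: "\<And>x y. x \<in> P \<Longrightarrow> y \<in> P \<Longrightarrow> trace_form B x y = 0" and x: "x \<in> P"
  shows "W \<subseteq> V.gen_eigenspace (act x) 0"
proof (rule V.nilpotent_if_trace_cnj[OF endo_act[OF W UNIV_I] Wp(1,2)])
  fix C S assume C: "V.basis_of C W" and S: "V.endo W S"
    and Seig: "\<And>l v. v \<in> W \<Longrightarrow> v \<in> V.gen_eigenspace (act x) l \<Longrightarrow> S v = sV (cnj l) v"
  note Sp = V.endoD[OF S]
  note e = endo_act[OF W UNIV_I]
  have Pcl: "br y z \<in> P" if "y \<in> P" "z \<in> P" for y z
  proof -
    have "br y z \<in> derived P"
      unfolding derived_def using that by (intro span_base) blast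
    then show ?thesis using P(3) by simp
  qed
  have comm: "\<exists>y'\<in>P. \<forall>w\<in>W. S (act y w) - act y (S w) = act y' w" if "y \<in> P" for y
  proof -
    have "endo P (br x)"
      using Pcl[OF x] br_linear_right by (auto simp: endo_def)
    then have "y \<in> span (\<Union>m. P \<inter> gen_eigenspace (br x) m)"
      using span_gen_eigenspaces P that by blast
    then show ?thesis
    proof (induction rule: span_induct_alt)
      case base
      then show ?case
        using subspace_0[OF P(1)] by (intro bexI[of _ 0]) (auto simp: rep_onD[OF W] Sp)
    next
      case (step c z y)
      then obtain m where z: "z \<in> P" "z \<in> gen_eigenspace (br x) m" by blast
      obtain y' where y': "y' \<in> P" "\<forall>w\<in>W. S (act y w) - act y (S w) = act y' w"
        using step.IH by blast
      \<comment> \<open>On the weight space of \<open>l\<close> the element \<open>z\<close> raises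
        the weight by \<open>m\<close>, so the commutator with \<open>S\<close> multiplies by
        \<open>cnj (l + m) - cnj l = cnj m\<close>. Weight spaces span \<open>W\<close>.\<close>
      have *: "S (act z w) - act z (S w) = act (scale (cnj m) z) w" if w: "w \<in> W" for w
      proof -
        let ?N = "{w \<in> W. S (act z w) - act z (S w) = act (scale (cnj m) z) w}"
        have "V.subspace ?N"
        proof (rule V.subspaceI)
          show "0 \<in> ?N" using V.subspace_0[OF Wp(1)] by (simp add: Sp act_simps)
        next
          fix u v assume "u \<in> ?N" "v \<in> ?N"
          then have uv: "u \<in> W" "v \<in> W" "S (act z u) = act (scale (cnj m) z) u + act z (S u)"
              "S (act z v) = act (scale (cnj m) z) v + act z (S v)"
            by (auto simp: diff_eq_eq)
          have "S (act z (u + v)) - act z (S (u + v)) = act (scale (cnj m) z) (u + v)"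
            by (simp add: Sp(1) act_simps(1) uv(3,4) algebra_simps)
          then show "u + v \<in> ?N" using V.subspace_add[OF Wp(1) uv(1,2)] by simp
        next
          fix c u assume "u \<in> ?N"
          then have u: "u \<in> W" "S (act z u) = act (scale (cnj m) z) u + act z (S u)"
            by (auto simp: diff_eq_eq)
          have "S (act z (sV c u)) - act z (S (sV c u)) = act (scale (cnj m) z) (sV c u)"
            by (simp add: Sp(2) act_simps(2) u(2) V.scale_right_distrib)
          then show "sV c u \<in> ?N" using V.subspace_scale[OF Wp(1) u(1)] by simp
        qed
        moreover have "W \<inter> V.gen_eigenspace (act x) l \<subseteq> ?N" for l
        proof
          fix w assume w: "w \<in> W \<inter> V.gen_eigenspace (act x) l"
          have "act z w \<in> V.gen_eigenspace (act x) (l + m)"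
            using act_gen_eigenspace[OF rep_on_subset[OF W] P(1) x Pcl[OF x] z, of w l] w by blast
          then have "S (act z w) = sV (cnj (l + m)) (act z w)"
            using Seig Wp(3) w by blast
          moreover have "S w = sV (cnj l) w" using Seig w by blast
          then have "act z (S w) = sV (cnj l) (act z w)"
            by (simp add: act_simps)
          ultimately show "w \<in> ?N"
            using w by (simp add: Wp V.scale_left_distrib)
        qed
        then have "(\<Union>l. W \<inter> V.gen_eigenspace (act x) l) \<subseteq> ?N" by (rule UN_least)
        moreover note V.span_gen_eigenspaces[OF e[of x] Wp(1,2) w]
        ultimately have "w \<in> ?N"
          using V.span_minimal[of "\<Union>l. W \<inter> V.gen_eigenspace (act x) l" ?N] by blast
        then show ?thesis by simp
      qed
      have "S (act (scale c z + y) w) - act (scale c z + y) (S w) = act (scale (c * cnj m) z + y') w"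
        if w: "w \<in> W" for w
      proof -
        have "S (act (scale c z + y) w) - act (scale c z + y) (S w) =
            sV c (S (act z w) - act z (S w)) + (S (act y w) - act y (S w))"
          using w Sp(7) by (simp add: Wp(4,5) Sp(1,2) V.scale_right_diff_distrib)
        also have "\<dots> = act (scale (c * cnj m) z + y') w"
          using w y'(2) by (simp add: * Wp(4,5))
        finally show ?thesis .
      qed
      moreover have "scale (c * cnj m) z + y' \<in> P"
        using z y' P(1) by (intro subspace_add subspace_scale)
      ultimately show ?case by blast
    qed
  qed
  \<comment> \<open>By cyclicity the trace of \<open>S [y, z]\<close> equals that of
    \<open>[S, y] z\<close>; the commutator acts as an element of \<open>P\<close>, where the form
    vanishes. Brackets span \<open>P\<close>, so \<open>x\<close> itself is covered.\<close>
  have main: "V.trace B (\<lambda>w. S (act u w)) = 0" if "u \<in> P" for u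
  proof -
    have "u \<in> span {br x y |x y. x \<in> P \<and> y \<in> P}"
      using that P(3) by (simp add: derived_def)
    then show ?thesis
    proof (induction rule: span_induct_alt)
      case base
      have "V.trace B (\<lambda>w. S (act 0 w)) = V.trace B (\<lambda>w. 0)"
        by (rule V.trace_cong[OF B]) (simp add: rep_onD[OF W] Sp)
      also have "\<dots> = 0"
        by (simp add: V.trace_def V.representation_zero)
      finally show ?case .
    next
      case (step c u v)
      then obtain y z where yz: "u = br y z" "y \<in> P" "z \<in> P" by blast
      obtain y' where y': "y' \<in> P" "\<forall>w\<in>W. S (act y w) - act y (S w) = act y' w"
        using comm yz(2) by blast
      have "V.trace B (\<lambda>w. S (act u w)) = V.trace B (\<lambda>w. S (act y (act z w)) - S (act z (act y w)))"
        by (rule V.trace_cong[OF B]) (simp add: yz(1) Wp(6) Sp(5))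
      also have "\<dots> = V.trace B (\<lambda>w. S (act y (act z w))) - V.trace B (\<lambda>w. S (act z (act y w)))"
        by (intro trace_diff V.endo_comp[OF S V.endo_comp[OF e e]])
      also have "V.trace B (\<lambda>w. S (act z (act y w))) = V.trace B (\<lambda>w. act y (S (act z w)))"
        using V.trace_comp_commute[OF V.endo_comp[OF S e[of z]] e[of y] B] by simp
      also have "V.trace B (\<lambda>w. S (act y (act z w))) - V.trace B (\<lambda>w. act y (S (act z w))) =
          V.trace B (\<lambda>w. S (act y (act z w)) - act y (S (act z w)))"
        by (intro trace_diff[symmetric] V.endo_comp[OF S V.endo_comp[OF e e]] V.endo_comp[OF e V.endo_comp[OF S e]])
      also have "\<dots> = trace_form B y' z"
        unfolding trace_form_def by (rule V.trace_cong[OF B]) (use y'(2) Wp(3) in blast)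
      also have "\<dots> = 0" using tr y'(1) yz(3) by blast
      finally have u: "V.trace B (\<lambda>w. S (act u w)) = 0" .
      have "V.trace B (\<lambda>w. S (act (scale c u + v) w)) =
          V.trace B (\<lambda>w. sV c (S (act u w)) + S (act v w))"
        by (rule V.trace_cong[OF B]) (simp add: Wp(4,5) Sp(1,2))
      also have "\<dots> = V.trace B (\<lambda>w. sV c (S (act u w))) + V.trace B (\<lambda>w. S (act v w))"
        using Sp(7) Wp(1,3) by (intro V.trace_add[OF B]) (auto intro: V.subspace_scale)
      also have "\<dots> = 0"
        using V.trace_scale[OF B, of "\<lambda>w. S (act u w)" c] Sp(7) Wp(3) u step.IH by simp
      finally show ?case .
    qed
  qed
  have "V.trace C (\<lambda>w. S (act x w)) = V.trace B (\<lambda>w. S (act x w))"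
    by (rule V.trace_basis_independent[OF V.endo_comp[OF S e] C B])
  then show "V.trace C (\<lambda>w. S (act x w)) = 0" using main[OF x] by simp
qed

end

end

subsection \<open>The Killing form\<close>

text \<open>
  Dual bases with respect to an invariant form: the Casimir tensor is invariant, and the form is
  normalized so that the Casimir element acts as the identity in the adjoint representation.
\<close>

definition (in lie_algebra) casimir_pair :: "'g set \<Rightarrow> ('g \<Rightarrow> 'g) \<Rightarrow> bool" where
  "casimir_pair B d \<longleftrightarrow> finite B \<and>
     (\<forall>\<Psi> a. (\<forall>u. Vector_Spaces.linear scale (*) (\<lambda>v. \<Psi> v u)) \<longrightarrow>
        (\<forall>u. Vector_Spaces.linear scale (*) (\<Psi> u)) \<longrightarrow>
        (\<Sum>b\<in>B. (\<Psi> b (br (d b) a) :: complex)) = - (\<Sum>b\<in>B. \<Psi> (br b a) (d b))) \<and>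
     (\<forall>a. (\<Sum>b\<in>B. br b (br (d b) a)) = a)"

context semisimple_lie_algebra
begin

lemma fin_dim_any: "fin_dim K"
  using finite_dim by (auto simp: fin_dim_def)

text \<open>A term of least dimension in the derived series is perfect, and it is nonzero because a
  nonzero ideal is not solvable.\<close>

lemma perfect_core:
  assumes "lie_ideal I" "I \<noteq> {0}"
  obtains P where "lie_ideal P" "P \<subseteq> I" "derived P = P" "P \<noteq> {0}"
proof -
  have id: "lie_ideal ((derived ^^ k) I)" for k
    by (induction k) (auto simp: assms(1) lie_ideal_derived)
  obtain k where k: "\<And>m. dim ((derived ^^ k) I) \<le> dim ((derived ^^ m) I)"
    using ex_has_least_nat[of "\<lambda>_. True" 0 "\<lambda>m. dim ((derived ^^ m) I)"] by auto
  let ?P = "(derived ^^ k) I"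
  have "derived ?P = ?P"
  proof (rule ccontr)
    assume "derived ?P \<noteq> ?P"
    then have "derived ?P \<subset> ?P" using derived_subset_ideal[OF id] by blast
    then have "dim (derived ?P) < dim ?P"
      using id[of k] by (intro dim_less_fin_dim subspace_derived fin_dim_any) (auto simp: lie_ideal_def)
    then show False using k[of "Suc k"] by simp
  qed
  moreover have "?P \<noteq> {0}"
    using semisimple[OF assms(1)] assms(2) unfolding solvable_def by blast
  moreover have "(derived ^^ m) I \<subseteq> I" for m
    by (induction m) (use derived_subset_ideal[OF id] in auto)
  ultimately show ?thesis using that id by blast
qed

lemma ad_rep_UNIV: "ad.rep_on UNIV UNIV"
  by (rule ad_rep_on) (auto simp: fin_dim_any)


text \<open>The radical of the form is an ideal. A perfect core \<open>P\<close> of it would act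
  nilpotently on \<gg> by Cartan's criterion, hence trivially, so that \<open>P = [P, P]\<close>
  would be zero.\<close>

lemma killing_nondegenerate:
  assumes B: "basis_of B UNIV" and x: "\<And>y. ad.trace_form B x y = 0"
  shows "x = 0"
proof -
  note K = ad_rep_UNIV B
  interpret L: Vector_Spaces.linear scale "(*)" "\<lambda>x. ad.trace_form B x y" for y
    by (rule ad.trace_form_linear_left[OF K])
  let ?S = "{x. \<forall>y. ad.trace_form B x y = 0}"
  have "lie_ideal ?S"
    unfolding lie_ideal_def
  proof (intro conjI allI ballI)
    show "subspace ?S" by (auto simp: subspace_def L.add L.scale L.zero)
    fix x y assume "y \<in> ?S"
    then have "ad.trace_form B (br y x) z = 0" for z
      using ad.trace_form_invariant[OF K, of y x z] by simp
    then show "br x y \<in> ?S" by (simp add: br_swap[of x y] L.neg)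
  qed
  have "?S = {0}"
  proof (rule ccontr)
    assume "?S \<noteq> {0}"
    then obtain P where P: "lie_ideal P" "P \<subseteq> ?S" "derived P = P" "P \<noteq> {0}"
      using perfect_core[OF \<open>lie_ideal ?S\<close>] by blast
    have sP: "subspace P" using P(1) by (simp add: lie_ideal_def)
    have nil: "UNIV \<subseteq> gen_eigenspace (br x) 0" if "x \<in> P" for x
      using P(2) by (intro ad.cartan_nilpotent[OF K sP fin_dim_any P(3) _ that]) blast
    have zero: "br x y = 0" if "x \<in> P" for x y
      using ad.perfect_nilpotent_trivial[OF ad.rep_on_subset[OF K(1)] sP fin_dim_any P(3) nil that] by simp
    have "derived P \<subseteq> {0}"
      unfolding derived_def by (rule span_minimal) (auto simp: zero)
    then have "P \<subseteq> {0}" using P(3) by simp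
    then show False using P(4) subspace_0[OF sP] by blast
  qed
  then show ?thesis using x by blast
qed

lemma abelian_ideal_trivial:
  assumes "lie_ideal I" "\<And>x y. x \<in> I \<Longrightarrow> y \<in> I \<Longrightarrow> br x y = 0"
  shows "I = {0}"
proof (rule semisimple[OF assms(1)])
  have "{br x y |x y. x \<in> I \<and> y \<in> I} \<subseteq> {0}" using assms(2) by auto
  then have "derived I \<subseteq> {0}"
    unfolding derived_def by (rule span_minimal) simp
  moreover have "0 \<in> derived I" by (rule subspace_0[OF subspace_derived])
  ultimately have "(derived ^^ 1) I = {0}" by auto
  then show "solvable I" unfolding solvable_def by blast
qed

text \<open>The intersection of \<open>I\<close> with its orthogonal space is an abelian ideal,
  hence zero. Therefore a vector of \<open>I\<close> orthogonal to \<open>[I, I]\<close> is central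
  in \<open>I\<close>, and the centre of \<open>I\<close> is again an abelian ideal. This makes the
  criterion for perfect algebras applicable to the radical of any trace form.\<close>

lemma ideal_perfect:
  assumes I: "lie_ideal I"
  shows "derived I = I"
proof (rule ccontr)
  assume "derived I \<noteq> I"
  then have sub: "derived I \<subset> I" using derived_subset_ideal[OF I] by blast
  have sI: "subspace I" and Icl: "\<And>x y. y \<in> I \<Longrightarrow> br x y \<in> I" using I by (auto simp: lie_ideal_def)
  have Icl': "br y x \<in> I" if "y \<in> I" for x y
    using subspace_neg[OF sI Icl[OF that]] br_swap[of y x] by simp
  obtain B where B: "basis_of B UNIV"
    using basis_of_exists[OF subspace_UNIV fin_dim_any] .
  note K = ad_rep_UNIV B
  let ?k = "ad.trace_form B"
  interpret L: Vector_Spaces.linear scale "(*)" "\<lambda>x. ?k x y" for y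
    by (rule ad.trace_form_linear_left[OF K])
  interpret R: Vector_Spaces.linear scale "(*)" "?k x" for x
    by (rule ad.trace_form_linear_right[OF K])
  note inv = ad.trace_form_invariant[OF K]
  let ?A = "{x \<in> I. \<forall>y\<in>I. ?k y x = 0}"
  have "?A = {0}"
  proof (rule abelian_ideal_trivial)
    show "lie_ideal ?A"
      unfolding lie_ideal_def
    proof (intro conjI allI ballI)
      show "subspace ?A" using sI by (auto simp: subspace_def R.add R.scale R.zero)
      fix x y assume y: "y \<in> ?A"
      then have "?k (br z x) y = 0" if "z \<in> I" for z using Icl'[OF that] by blast
      then show "br x y \<in> ?A" using Icl y by (simp add: inv)
    qed
    show "br x y = 0" if xy: "x \<in> ?A" "y \<in> ?A" for x y
    proof (rule killing_nondegenerate[OF B])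
      fix z
      have "?k x (br y z) = ?k (br y z) x" by (rule ad.trace_form_commute[OF K])
      also have "\<dots> = 0" using xy Icl'[of y z] by blast
      finally show "?k (br x y) z = 0" by (simp add: inv)
    qed
  qed
  obtain F where F: "basis_of F (derived I)"
    using basis_of_exists[OF subspace_derived fin_dim_any] .
  have "card F < dim I"
    using dim_less_fin_dim[OF subspace_derived sI fin_dim_any sub] basis_of_card[OF F] by simp
  then obtain x where x: "x \<in> I" "x \<noteq> 0" "\<And>f. f \<in> F \<Longrightarrow> ?k f x = 0"
    using exists_orthogonal[of F I ?k] basis_ofD(1)[OF F] sI fin_dim_any R.linear_axioms by blast
  have "subspace {d. ?k d x = 0}" by (auto simp: subspace_def L.add L.scale L.zero)
  moreover have "F \<subseteq> {d. ?k d x = 0}" using x(3) by blast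
  ultimately have "span F \<subseteq> {d. ?k d x = 0}" by (intro span_minimal)
  then have orth: "?k d x = 0" if "d \<in> derived I" for d
    using F that by (auto simp: basis_of_def)
  have "br t x = 0" if t: "t \<in> I" for t
  proof -
    have "?k s (br t x) = 0" if s: "s \<in> I" for s
    proof -
      have "br s t \<in> derived I"
        unfolding derived_def using s t by (intro span_base) blast
      then show ?thesis using orth inv by metis
    qed
    then have "br t x \<in> ?A" using Icl[OF x(1)] by simp
    then show ?thesis using \<open>?A = {0}\<close> by blast
  qed
  then have xC: "x \<in> {x \<in> I. \<forall>t\<in>I. br t x = 0}" using x(1) by blast
  have "{x \<in> I. \<forall>t\<in>I. br t x = 0} = {0}" (is "?C = _")
  proof (rule abelian_ideal_trivial)
    show "lie_ideal ?C"
      unfolding lie_ideal_def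
    proof (intro conjI allI ballI)
      show "subspace ?C" using sI by (auto simp: subspace_def br_right)
      fix y x assume x: "x \<in> ?C"
      have "br t (br y x) = 0" if "t \<in> I" for t
        using x that Icl'[OF that, of y] br_jacobi[of t y x] by (simp add: br_right)
      then show "br y x \<in> ?C" using x Icl by simp
    qed
  qed blast
  then show False using xC x(2) by blast
qed

lemma killing_casimir:
  obtains B d where "casimir_pair B d"
proof -
  obtain B where B: "basis_of B UNIV"
    using basis_of_exists[OF subspace_UNIV fin_dim_any] .
  note K = ad_rep_UNIV B
  let ?k = "ad.trace_form B"
  interpret L: Vector_Spaces.linear scale "(*)" "\<lambda>x. ?k x y" for y
    by (rule ad.trace_form_linear_left[OF K])
  interpret R: Vector_Spaces.linear scale "(*)" "?k x" for x
    by (rule ad.trace_form_linear_right[OF K])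
  note inv = ad.trace_form_invariant[OF K] and comm = ad.trace_form_commute[OF K]
  have nd: "y = 0" if "\<And>b. b \<in> B \<Longrightarrow> ?k b y = 0" for y
  proof (rule killing_nondegenerate[OF B])
    fix z
    have "subspace {z. ?k z y = 0}" by (auto simp: subspace_def L.add L.scale L.zero)
    then have "span B \<subseteq> {z. ?k z y = 0}" using that by (intro span_minimal) auto
    then show "?k y z = 0" using B comm[of y z] by (auto simp: basis_of_def)
  qed
  obtain d where d: "\<And>b c. b \<in> B \<Longrightarrow> c \<in> B \<Longrightarrow> ?k c (d b) = (if b = c then 1 else 0)"
  proof (rule dual_basis[OF B, of ?k])
    show "Vector_Spaces.linear scale (*) (?k x)" for x by (rule R.linear_axioms)
    show "y = 0" if "\<And>b. b \<in> B \<Longrightarrow> ?k b y = 0" for y using that by (rule nd)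
  qed (rule that)
  have fin: "finite B" using B by (simp add: basis_of_def)
  have exp1: "v = (\<Sum>c\<in>B. scale (?k v (d c)) c)" for v
  proof -
    have "?k v (d c) = representation B v c" if c: "c \<in> B" for c
    proof -
      have "?k v (d c) = ?k (\<Sum>b\<in>B. scale (representation B v b) b) (d c)"
        using repr_eq[OF B, of v] by simp
      also have "\<dots> = (\<Sum>b\<in>B. if b = c then representation B v b else 0)"
        unfolding L.sum L.scale by (intro sum.cong) (auto simp: d c)
      finally show ?thesis using c fin by simp
    qed
    then show ?thesis using repr_eq[OF B, of v] by simp
  qed
  have exp2: "v = (\<Sum>c\<in>B. scale (?k c v) (d c))" for v
  proof -
    have "v - (\<Sum>c\<in>B. scale (?k c v) (d c)) = 0"
    proof (rule nd)
      fix b assume b: "b \<in> B"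
      have "?k b (\<Sum>c\<in>B. scale (?k c v) (d c)) = (\<Sum>c\<in>B. if c = b then ?k c v else 0)"
        unfolding R.sum R.scale by (intro sum.cong) (auto simp: d b)
      then show "?k b (v - (\<Sum>c\<in>B. scale (?k c v) (d c))) = 0"
        using b fin by (simp add: R.diff)
    qed
    then show ?thesis by simp
  qed
  \<comment> \<open>Expansion in the dual bases compares the coefficients of
    \<open>b \<otimes> d c\<close>, which agree up to sign by invariance of the form.\<close>
  have inv_tensor: "(\<Sum>b\<in>B. \<Psi> b (br (d b) a)) = - (\<Sum>b\<in>B. \<Psi> (br b a) (d b))"
    if "\<And>u. Vector_Spaces.linear scale (*) (\<lambda>v. \<Psi> v u)" "\<And>u. Vector_Spaces.linear scale (*) (\<Psi> u)" for \<Psi> :: "'a \<Rightarrow> 'a \<Rightarrow> complex" and a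
  proof -
    interpret PL: Vector_Spaces.linear scale "(*)" "\<lambda>v. \<Psi> v u" for u by (rule that(1))
    interpret PR: Vector_Spaces.linear scale "(*)" "\<Psi> u" for u by (rule that(2))
    have "\<Psi> b (br (d b) a) = (\<Sum>c\<in>B. ?k c (br (d b) a) * \<Psi> b (d c))" for b
      by (subst exp2[of "br (d b) a"]) (simp add: PR.sum PR.scale)
    moreover have "\<Psi> (br c a) (d c) = (\<Sum>b\<in>B. ?k (br c a) (d b) * \<Psi> b (d c))" for c
      by (subst exp1[of "br c a"]) (simp add: PL.sum PL.scale)
    moreover have "?k c (br (d b) a) = - ?k (br c a) (d b)" for b c
      by (subst br_swap) (simp add: R.neg inv)
    ultimately show ?thesis
      by (simp add: sum_negf) (rule sum.swap)
  qed
  have casimir: "(\<Sum>b\<in>B. br b (br (d b) a)) = a" for a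
  proof -
    have "?k y (\<Sum>b\<in>B. br b (br (d b) a)) = ?k y a" for y
    proof -
      have "?k y (\<Sum>b\<in>B. br b (br (d b) a)) = (\<Sum>b\<in>B. ?k (br y b) (br (d b) a))"
        by (simp add: R.sum inv)
      also have "\<dots> = - (\<Sum>b\<in>B. ?k (br y (br b a)) (d b))"
      proof (rule inv_tensor)
        interpret RL: Vector_Spaces.linear scale scale "br y" by (rule br_linear_right)
        show "Vector_Spaces.linear scale (*) (\<lambda>v. ?k (br y v) u)" for u
          using Vector_Spaces.linear_compose[OF br_linear_right[of y] L.linear_axioms[of u]] by (simp add: o_def)
        show "Vector_Spaces.linear scale (*) (?k (br y u))" for u by (rule R.linear_axioms)
      qed
      also have "\<dots> = (\<Sum>b\<in>B. ?k (br y (br a b)) (d b))"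
        by (simp add: br_swap[of _ a] br_right L.neg sum_negf)
      \<comment> \<open>Pairing with \<open>d b\<close> reads off the coordinate at
        \<open>b\<close>, so the sum is the trace of \<open>ad y ad a\<close>. Here the choice of
        the Killing form gives the Casimir element the eigenvalue one.\<close>
      also have "\<dots> = ?k y a"
      proof -
        have "representation B (br y (br a b)) b = ?k (br y (br a b)) (d b)" if "b \<in> B" for b
          using repr_sum_scale[OF B that, of "\<lambda>c. ?k (br y (br a b)) (d c)"] exp1[of "br y (br a b)"] by simp
        then show ?thesis
          by (simp add: ad.trace_form_def trace_def)
      qed
      finally show ?thesis .
    qed
    then have "(\<Sum>b\<in>B. br b (br (d b) a)) - a = 0"
      by (intro nd) (simp add: R.diff)
    then show ?thesis by simp
  qed
  show ?thesis
  proof (rule that[of B d], unfold casimir_pair_def, intro conjI allI impI)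
    show "finite B" by (rule fin)
    show "(\<Sum>b\<in>B. br b (br (d b) a)) = a" for a by (rule casimir)
    fix \<Psi> :: "'a \<Rightarrow> 'a \<Rightarrow> complex" and a
    assume "\<forall>u. Vector_Spaces.linear scale (*) (\<lambda>v. \<Psi> v u)" "\<forall>u. Vector_Spaces.linear scale (*) (\<Psi> u)"
    then have "\<And>u. Vector_Spaces.linear scale (*) (\<lambda>v. \<Psi> v u)" "\<And>u. Vector_Spaces.linear scale (*) (\<Psi> u)"
      by blast+
    then show "(\<Sum>b\<in>B. \<Psi> b (br (d b) a)) = - (\<Sum>b\<in>B. \<Psi> (br b a) (d b))"
      by (rule inv_tensor)
  qed
qed

end

subsection \<open>Invariants and coinvariants of a representation\<close>

locale semisimple_action = semisimple_lie_algebra scale br + lie_action scale br sV act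
  for scale :: "complex \<Rightarrow> 'g::ab_group_add \<Rightarrow> 'g" and br
    and sV :: "complex \<Rightarrow> 'v::ab_group_add \<Rightarrow> 'v" and act
begin

definition invariants :: "'v set \<Rightarrow> 'v set" where
  "invariants W = {w \<in> W. \<forall>x. act x w = 0}"

text \<open>The quotient of \<open>W\<close> by this subspace is the space of coinvariants.\<close>

definition moved :: "'v set \<Rightarrow> 'v set" where
  "moved W = V.span {act x w |x w. w \<in> W}"

lemma moved_mono: "U \<subseteq> W \<Longrightarrow> moved U \<subseteq> moved W"
  unfolding moved_def by (rule V.span_mono) blast

lemma moved_subset: "rep_on UNIV W \<Longrightarrow> moved W \<subseteq> W"
  unfolding moved_def by (rule V.span_minimal) (auto simp: rep_onD)

lemma act_in_moved: "w \<in> W \<Longrightarrow> act x w \<in> moved W"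
  unfolding moved_def by (rule V.span_base) blast

lemma subspace_moved: "V.subspace (moved W)"
  unfolding moved_def by (rule V.subspace_span)

text \<open>The radical is an ideal and therefore perfect, so Cartan's criterion and the triviality
  of nilpotent actions of perfect algebras both apply to it.\<close>

lemma trace_form_radical_trivial:
  assumes W: "rep_on UNIV W" and B: "V.basis_of B W" and x: "\<And>y. trace_form B x y = 0" and w: "w \<in> W"
  shows "act x w = 0"
proof -
  interpret L: Vector_Spaces.linear scale "(*)" "\<lambda>x. trace_form B x y" for y
    by (rule trace_form_linear_left[OF W B])
  let ?S = "{x. \<forall>y. trace_form B x y = 0}"
  have S: "lie_ideal ?S"
    unfolding lie_ideal_def
  proof (intro conjI allI ballI)
    show "subspace ?S" by (auto simp: subspace_def L.add L.scale L.zero)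
    fix x y assume "y \<in> ?S"
    then have "trace_form B (br y x) z = 0" for z
      using trace_form_invariant[OF W B, of y x z] by simp
    then show "br x y \<in> ?S" by (simp add: br_swap[of x y] L.neg)
  qed
  then have sS: "subspace ?S" by (simp add: lie_ideal_def)
  note pS = ideal_perfect[OF S]
  have "W \<subseteq> V.gen_eigenspace (act x) 0" if "x \<in> ?S" for x
    by (rule cartan_nilpotent[OF W B sS fin_dim_any pS _ that]) simp
  then show ?thesis
    using perfect_nilpotent_trivial[OF rep_on_subset[OF W] sS fin_dim_any pS _ _ w, of x] x by blast
qed

text \<open>
  Unless \<open>W\<close> is trivial, a Casimir element of the trace form on a complement of its radical
  acts on \<open>W\<close> with nonzero trace, hence not nilpotently.
\<close>

lemma exists_casimir:
  assumes W: "rep_on UNIV W" and nontriv: "\<exists>x. \<exists>w\<in>W. act x w \<noteq> 0"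
  obtains C where "V.endo W C" "\<And>x w. w \<in> W \<Longrightarrow> act x (C w) = C (act x w)"
    "\<And>w. w \<in> W \<Longrightarrow> C w \<in> moved W" "\<And>w. w \<in> invariants W \<Longrightarrow> C w = 0"
    "\<not> W \<subseteq> V.gen_eigenspace C 0"
proof -
  note Wp = rep_onD[OF W]
  obtain BW where BW: "V.basis_of BW W" using V.basis_of_exists[OF Wp(1,2)] .
  let ?k = "trace_form BW"
  interpret L: Vector_Spaces.linear scale "(*)" "\<lambda>x. ?k x y" for y
    by (rule trace_form_linear_left[OF W BW])
  interpret R: Vector_Spaces.linear scale "(*)" "?k x" for x
    by (rule trace_form_linear_right[OF W BW])
  note inv = trace_form_invariant[OF W BW] and comm = trace_form_commute[OF W BW]
  define S where "S = {x. \<forall>y. ?k x y = 0}"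
  have sS: "subspace S" by (auto simp: S_def subspace_def L.add L.scale L.zero)
  have Strivial: "act x w = 0" if "x \<in> S" "w \<in> W" for x w
    using trace_form_radical_trivial[OF W BW _ that(2), of x] that(1) by (simp add: S_def)
  obtain BS where BS: "basis_of BS S" using basis_of_exists[OF sS fin_dim_any] .
  obtain BG where BG: "basis_of BG UNIV" "BS \<subseteq> BG"
    using basis_of_extend[OF subspace_UNIV fin_dim_any] basis_ofD[OF BS] by blast
  \<comment> \<open>\<open>D\<close> spans a linear complement of the radical \<open>S\<close>. As
    \<open>S\<close> acts by zero, expansions in \<open>D\<close> and in its dual family are correct
    after acting on \<open>W\<close>, which is what \<open>exp1\<close> and \<open>exp2\<close>
    express.\<close>
  define D where "D = BG - BS"
  have finD: "finite D" using basis_ofD(1)[OF BG(1)] by (simp add: D_def)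
  have decomp: "v - (\<Sum>b\<in>D. scale (representation BG v b) b) \<in> S" for v
  proof -
    have "v = (\<Sum>b\<in>BG. scale (representation BG v b) b)" using repr_eq[OF BG(1)] by simp
    also have "\<dots> = (\<Sum>b\<in>D. scale (representation BG v b) b) + (\<Sum>b\<in>BS. scale (representation BG v b) b)"
      unfolding D_def by (rule sum.subset_diff[OF BG(2) basis_ofD(1)[OF BG(1)]])
    finally have "v - (\<Sum>b\<in>D. scale (representation BG v b) b) = (\<Sum>b\<in>BS. scale (representation BG v b) b)"
      by (simp add: algebra_simps)
    also have "\<dots> \<in> S" using basis_ofD(4)[OF BS] sS by (intro subspace_sum subspace_scale)
    finally show ?thesis .
  qed
  have indD: "independent D"
    using basis_ofD(2)[OF BG(1)] independent_mono by (metis D_def Diff_subset)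
  have QD: "basis_of D (span D)" using finD indD by (simp add: basis_of_def)
  have "D \<noteq> {}"
  proof
    assume "D = {}"
    then have "v \<in> S" for v using decomp[of v] by simp
    then show False using nontriv Strivial by blast
  qed
  have SQ: "y = 0" if "y \<in> S" "y \<in> span D" for y
  proof -
    have "y \<in> span (BG - BS) \<inter> span BS"
      using that BS by (simp add: D_def basis_of_def)
    moreover have "representation BG y b = 0" for b
    proof (cases "b \<in> BS")
      case True
      have "representation BG y b = representation D y b"
        using basis_ofD(2)[OF BG(1)] that(2) by (subst representation_extend[of BG y D]) (auto simp: D_def)
      also have "\<dots> = 0"
        using True representation_ne_zero[of D y b] by (auto simp: D_def)
      finally show ?thesis .
    next
      case False
      have "representation BG y b = representation BS y b"
        using basis_ofD(2)[OF BG(1)] that(1) BG(2) BS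
        by (subst representation_extend[of BG y BS]) (auto simp: basis_of_def)
      also have "\<dots> = 0"
        using False representation_ne_zero[of BS y b] by auto
      finally show ?thesis .
    qed
    then show ?thesis using repr_eq[OF BG(1), of y] by simp
  qed
  have nd: "y \<in> S" if "\<And>b. b \<in> D \<Longrightarrow> ?k b y = 0" for y
  proof -
    have "?k y z = 0" for z
    proof -
      have "?k (\<Sum>b\<in>D. scale (representation BG z b) b) y = 0"
        using that by (simp add: L.sum L.scale)
      moreover have "?k (z - (\<Sum>b\<in>D. scale (representation BG z b) b)) y = 0"
        using decomp[of z] by (simp add: S_def)
      ultimately show ?thesis by (simp add: L.diff comm[of y z])
    qed
    then show ?thesis by (simp add: S_def)
  qed
  obtain d where d: "\<And>b c. b \<in> D \<Longrightarrow> c \<in> D \<Longrightarrow> ?k c (d b) = (if b = c then 1 else 0)"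
  proof (rule dual_basis[OF QD, of ?k])
    show "Vector_Spaces.linear scale (*) (?k x)" for x by (rule R.linear_axioms)
    show "y = 0" if "y \<in> span D" "\<And>b. b \<in> D \<Longrightarrow> ?k b y = 0" for y
      using SQ[OF nd that(1)] that(2) .
  qed (rule that)
  have exp1: "act v w = (\<Sum>c\<in>D. sV (?k v (d c)) (act c w))" if w: "w \<in> W" for v w
  proof -
    let ?r = "representation BG v"
    have "?k v (d c) = ?r c" if c: "c \<in> D" for c
    proof -
      have "?k (v - (\<Sum>b\<in>D. scale (?r b) b)) (d c) = 0"
        using decomp[of v] by (simp add: S_def)
      moreover have "?k (\<Sum>b\<in>D. scale (?r b) b) (d c) = (\<Sum>b\<in>D. if b = c then ?r b else 0)"
        unfolding L.sum L.scale by (intro sum.cong) (auto simp: d c)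
      ultimately show ?thesis using c finD by (simp add: L.diff)
    qed
    moreover have "act (v - (\<Sum>b\<in>D. scale (?r b) b)) w = 0"
      using Strivial[OF decomp w] .
    ultimately show ?thesis using w by (simp add: Wp)
  qed
  have exp2: "act v w = (\<Sum>c\<in>D. sV (?k c v) (act (d c) w))" if w: "w \<in> W" for v w
  proof -
    have "v - (\<Sum>c\<in>D. scale (?k c v) (d c)) \<in> S"
    proof (rule nd)
      fix b assume b: "b \<in> D"
      have "?k b (\<Sum>c\<in>D. scale (?k c v) (d c)) = (\<Sum>c\<in>D. if c = b then ?k c v else 0)"
        unfolding R.sum R.scale by (intro sum.cong) (auto simp: d b)
      then show "?k b (v - (\<Sum>c\<in>D. scale (?k c v) (d c))) = 0"
        using b finD by (simp add: R.diff)
    qed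
    then have "act (v - (\<Sum>c\<in>D. scale (?k c v) (d c))) w = 0" using Strivial w by blast
    then show ?thesis using w by (simp add: Wp)
  qed
  define C where "C w = (\<Sum>b\<in>D. act b (act (d b) w))" for w
  have endo: "V.endo W C"
    unfolding V.endo_def
  proof
    show "Vector_Spaces.linear sV sV C"
      by unfold_locales
        (simp_all add: C_def act_simps sum.distrib V.scale_sum_right algebra_simps)
    show "C ` W \<subseteq> W"
      using Wp(1,3) by (auto simp: C_def intro!: V.subspace_sum)
  qed
  moreover have "act x (C w) = C (act x w)" if w: "w \<in> W" for x w
  proof -
    have "act x (C w) - C (act x w) =
        (\<Sum>b\<in>D. act (br x b) (act (d b) w) + act b (act (br x (d b)) w))"
      unfolding C_def act_simps sum_subtractf[symmetric]
      using w by (intro sum.cong) (simp_all add: Wp act_simps)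
    also have "\<dots> = (\<Sum>b\<in>D. act (br x b) (act (d b) w)) + (\<Sum>b\<in>D. act b (act (br x (d b)) w))"
      by (rule sum.distrib)
    also have "(\<Sum>b\<in>D. act (br x b) (act (d b) w)) = (\<Sum>b\<in>D. \<Sum>c\<in>D. sV (?k (br x b) (d c)) (act c (act (d b) w)))"
      using w by (intro sum.cong exp1) (simp_all add: Wp)
    also have "(\<Sum>b\<in>D. act b (act (br x (d b)) w)) = (\<Sum>b\<in>D. \<Sum>c\<in>D. sV (?k c (br x (d b))) (act b (act (d c) w)))"
    proof (intro sum.cong refl)
      fix b
      have "act b (act (br x (d b)) w) = act b (\<Sum>c\<in>D. sV (?k c (br x (d b))) (act (d c) w))"
        using exp2[OF w, of "br x (d b)"] by simp
      then show "act b (act (br x (d b)) w) = (\<Sum>c\<in>D. sV (?k c (br x (d b))) (act b (act (d c) w)))"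
        by (simp add: act_simps)
    qed
    also have "\<dots> = (\<Sum>b\<in>D. \<Sum>c\<in>D. - sV (?k (br x b) (d c)) (act c (act (d b) w)))"
    proof (subst sum.swap, intro sum.cong refl)
      fix b c
      have "?k b (br x (d c)) = - ?k (br x b) (d c)"
        by (simp add: inv[symmetric] br_swap[of x b] L.neg)
      then show "sV (?k b (br x (d c))) (act c (act (d b) w)) = - sV (?k (br x b) (d c)) (act c (act (d b) w))"
        by simp
    qed
    finally show ?thesis by (simp add: sum_negf)
  qed
  moreover have "C w \<in> moved W" if "w \<in> W" for w
    unfolding C_def using that Wp(3) subspace_moved act_in_moved by (intro V.subspace_sum) auto
  moreover have "C w = 0" if "w \<in> invariants W" for w
    using that by (simp add: C_def invariants_def act_simps)
  moreover have "\<not> W \<subseteq> V.gen_eigenspace C 0"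
  proof
    assume nil: "W \<subseteq> V.gen_eigenspace C 0"
    have "V.trace BW C = 0"
      by (rule V.trace_nilpotent[OF endo BW]) (use nil in \<open>auto simp: V.gen_eigenspace_def\<close>)
    moreover have "V.trace BW C = (\<Sum>b\<in>D. ?k b (d b))"
      unfolding C_def[abs_def] trace_form_def by (rule V.trace_sum[OF BW]) (simp add: Wp)
    moreover have "\<dots> = of_nat (card D)" by (simp add: d)
    ultimately show False using \<open>D \<noteq> {}\<close> finD by simp
  qed
  ultimately show ?thesis by (rule that)
qed

text \<open>Fitting decomposition for a Casimir element \<open>C\<close>: the invariants lie in the
  part \<open>W0\<close> where \<open>C\<close> is nilpotent, and the part \<open>W1\<close> where
  it is invertible lies in \<open>moved W\<close> because the values of \<open>C\<close> do. Since
  \<open>C\<close> is not nilpotent on \<open>W\<close>, the part \<open>W0\<close> is smaller and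
  induction applies to it.\<close>

theorem invariants_complement:
  assumes "rep_on UNIV W"
  shows "invariants W \<inter> moved W \<subseteq> {0}" "\<And>w. w \<in> W \<Longrightarrow> \<exists>a\<in>invariants W. w - a \<in> moved W"
proof -
  have "invariants W \<inter> moved W \<subseteq> {0} \<and> (\<forall>w\<in>W. \<exists>a\<in>invariants W. w - a \<in> moved W)"
    using assms
  proof (induction "V.dim W" arbitrary: W rule: less_induct)
    case less
    note W = less.prems and Wp = rep_onD[OF less.prems]
    show ?case
    proof (cases "\<exists>x. \<exists>w\<in>W. act x w \<noteq> 0")
      case False
      then have "invariants W = W" by (auto simp: invariants_def)
      moreover have "moved W = {0}"
      proof -
        have "{act x w |x w. w \<in> W} \<subseteq> {0}" using False by auto
        then have "moved W \<subseteq> {0}" unfolding moved_def by (rule V.span_minimal) simp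
        then show ?thesis using V.subspace_0[OF subspace_moved] by blast
      qed
      ultimately show ?thesis by auto
    next
      case True
      obtain C where C: "V.endo W C" "\<And>x w. w \<in> W \<Longrightarrow> act x (C w) = C (act x w)"
        "\<And>w. w \<in> W \<Longrightarrow> C w \<in> moved W" "\<And>w. w \<in> invariants W \<Longrightarrow> C w = 0"
        "\<not> W \<subseteq> V.gen_eigenspace C 0"
        using exists_casimir[OF W True] by blast
      note CU = V.endo_UNIV[OF C(1)] and Cs = V.endoD[OF C(1)]
      define W0 where "W0 = W \<inter> V.gen_eigenspace C 0"
      define W1 where "W1 = {w \<in> W. V.killed C (- {0}) w}"
      have s0: "V.subspace W0"
        unfolding W0_def by (intro V.subspace_inter Wp(1) V.subspace_gen_eigenspace[OF CU])
      have "W1 = W \<inter> {w. V.killed C (- {0}) w}" by (auto simp: W1_def)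
      then have s1: "V.subspace W1"
        using V.subspace_inter Wp(1) V.subspace_killed[OF CU] by metis
      have a0: "act x w \<in> W0" if "w \<in> W0" for x w
      proof -
        have "act x w \<in> V.gen_eigenspace C 0"
          by (rule V.gen_eigenspace_commuting[OF C(1) Wp(1) endo_act[OF W UNIV_I, of x]])
            (use that C(2) in \<open>auto simp: W0_def\<close>)
        then show ?thesis using that Wp(3) by (simp add: W0_def)
      qed
      have a1: "act x w \<in> W1" if "w \<in> W1" for x w
      proof -
        have "V.killed C (- {0}) (act x w)"
          by (rule V.killed_commuting[OF C(1) Wp(1) endo_act[OF W UNIV_I, of x]])
            (use that C(2) in \<open>auto simp: W1_def\<close>)
        then show ?thesis using that Wp(3) by (simp add: W1_def)
      qed
      have disj: "w = 0" if "w \<in> W0" "w \<in> W1" for w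
        using that V.gen_eigenspace_killed_eq_0[OF CU, of w 0 "- {0}"] by (auto simp: W0_def W1_def)
      have decomp: "\<exists>w0\<in>W0. \<exists>w1\<in>W1. w = w0 + w1" if w: "w \<in> W" for w
      proof -
        let ?X = "{a + b |a b. a \<in> W0 \<and> b \<in> W1}"
        have "(\<Union>l. W \<inter> V.gen_eigenspace C l) \<subseteq> ?X"
        proof
          fix v assume "v \<in> (\<Union>l. W \<inter> V.gen_eigenspace C l)"
          then obtain l where v: "v \<in> W" "v \<in> V.gen_eigenspace C l" by blast
          show "v \<in> ?X"
          proof (cases "l = 0")
            case True
            then have "v \<in> W0" "0 \<in> W1" "v = v + 0" using v V.subspace_0[OF s1] by (auto simp: W0_def)
            then show ?thesis by blast
          next
            case False
            then have "v \<in> W1" "0 \<in> W0" "v = 0 + v"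
              using v V.gen_eigenspace_killed[of v C l] V.subspace_0[OF s0] by (auto simp: W1_def)
            then show ?thesis by blast
          qed
        qed
        then have "V.span (\<Union>l. W \<inter> V.gen_eigenspace C l) \<subseteq> ?X"
          by (rule V.span_minimal) (rule V.subspace_sums[OF s0 s1])
        then show ?thesis
          using V.span_gen_eigenspaces[OF C(1) Wp(1,2) w] by blast
      qed
      have W1moved: "w \<in> moved W" if "w \<in> W1" for w
      proof -
        \<comment> \<open>Modulo \<open>moved W\<close> the operator \<open>C\<close> is zero, so a
          product of shifts \<open>C - m\<close> acts as the product of the numbers
          \<open>- m\<close>, none of which is zero.\<close>
        have "\<exists>c. c \<noteq> 0 \<and> foldr (V.shift C) ms w \<in> W \<and> foldr (V.shift C) ms w - sV c w \<in> moved W"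
          if "set ms \<subseteq> - {0}" for ms
          using that
        proof (induction ms)
          case Nil
          then show ?case
            using \<open>w \<in> W1\<close> V.subspace_0[OF subspace_moved] by (intro exI[of _ 1]) (auto simp: W1_def)
        next
          case (Cons m ms)
          let ?u = "foldr (V.shift C) ms w"
          obtain c where c: "c \<noteq> 0" "?u \<in> W" "?u - sV c w \<in> moved W"
            using Cons by auto
          have "V.shift C m ?u - sV (- m * c) w = C ?u - sV m (?u - sV c w)"
            by (simp add: V.scale_right_diff_distrib)
          also have "\<dots> \<in> moved W"
            by (intro V.subspace_diff V.subspace_scale subspace_moved C(3) c)
          finally show ?case
            using Cons.prems c V.endoD(7)[OF V.endo_shift[OF C(1) Wp(1)]]
            by (intro exI[of _ "- m * c"]) auto
        qed
        moreover obtain ms where "set ms \<subseteq> - {0}" "foldr (V.shift C) ms w = 0"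
          using \<open>w \<in> W1\<close> by (auto simp: W1_def V.killed_def)
        ultimately obtain c where "c \<noteq> 0" "0 - sV c w \<in> moved W" by metis
        then have "sV (- inverse c) (0 - sV c w) \<in> moved W"
          using V.subspace_scale[OF subspace_moved] by blast
        then show ?thesis using \<open>c \<noteq> 0\<close> by simp
      qed
      have "W0 \<subset> W" using C(5) by (auto simp: W0_def)
      then have dim: "V.dim W0 < V.dim W" by (rule V.dim_less_fin_dim[OF s0 Wp(1,2)])
      have r0: "rep_on UNIV W0"
        using \<open>W0 \<subset> W\<close> a0 by (intro rep_on_submodule[OF W s0]) auto
      have IH: "invariants W0 \<inter> moved W0 \<subseteq> {0}" "\<And>w. w \<in> W0 \<Longrightarrow> \<exists>a\<in>invariants W0. w - a \<in> moved W0"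
        using less.hyps[OF dim r0] by auto
      show ?thesis
      proof (intro conjI ballI subsetI)
        fix w assume w: "w \<in> W"
        obtain w0 w1 where w01: "w0 \<in> W0" "w1 \<in> W1" "w = w0 + w1" using decomp[OF w] by blast
        obtain a where a: "a \<in> invariants W0" "w0 - a \<in> moved W0" using IH(2)[OF w01(1)] by blast
        have "w - a = (w0 - a) + w1" by (simp add: w01(3))
        also have "\<dots> \<in> moved W"
          using a(2) moved_mono[of W0 W] \<open>W0 \<subset> W\<close> W1moved[OF w01(2)]
          by (intro V.subspace_add[OF subspace_moved]) auto
        finally show "\<exists>a\<in>invariants W. w - a \<in> moved W"
          using a(1) \<open>W0 \<subset> W\<close> by (intro bexI[of _ a]) (auto simp: invariants_def)
      next
        fix v assume v: "v \<in> invariants W \<inter> moved W"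
        have vW: "v \<in> W" using v by (simp add: invariants_def)
        have "((\<lambda>w. C w - sV 0 w) ^^ 1) v = 0" using C(4) v by simp
        then have v0: "v \<in> W0" using vW unfolding W0_def V.gen_eigenspace_def by blast
        \<comment> \<open>Splitting vectors along \<open>W0\<close> and \<open>W1\<close> splits
          \<open>moved W\<close> as well. An invariant \<open>v\<close> lies in \<open>W0\<close>,
          so its component in \<open>W1\<close> has to vanish and the induction hypothesis for
          \<open>W0\<close> applies.\<close>
        have "\<exists>c0\<in>moved W0. \<exists>c1\<in>W1. u = c0 + c1" if "u \<in> moved W" for u
          using that unfolding moved_def[of W]
        proof (induction rule: V.span_induct_alt)
          case base
          then show ?case
            using V.subspace_0[OF subspace_moved] V.subspace_0[OF s1] by force
        next
          case (step c z y)
          then obtain x w where xw: "z = act x w" "w \<in> W" by blast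
          obtain w0 w1 where w01: "w0 \<in> W0" "w1 \<in> W1" "w = w0 + w1" using decomp[OF xw(2)] by blast
          obtain c0 c1 where c01: "c0 \<in> moved W0" "c1 \<in> W1" "y = c0 + c1" using step.IH by blast
          have "sV c z + y = (sV c (act x w0) + c0) + (sV c (act x w1) + c1)"
            by (simp add: xw w01(3) c01(3) act_simps V.scale_right_distrib algebra_simps)
          moreover have "sV c (act x w0) + c0 \<in> moved W0"
            using w01 c01 act_in_moved by (intro V.subspace_add V.subspace_scale subspace_moved) auto
          moreover have "sV c (act x w1) + c1 \<in> W1"
            using w01 c01 a1 s1 by (intro V.subspace_add V.subspace_scale) auto
          ultimately show ?case by blast
        qed
        then obtain c0 c1 where c01: "c0 \<in> moved W0" "c1 \<in> W1" "v = c0 + c1" using v by blast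
        have "c0 \<in> W0" using c01(1) moved_subset[OF r0] by blast
        then have "c1 \<in> W0" using V.subspace_diff[OF s0 v0 \<open>c0 \<in> W0\<close>] c01(3) by simp
        then have "c1 = 0" using c01(2) by (rule disj)
        then have "v \<in> moved W0" using c01(1,3) by simp
        moreover have "v \<in> invariants W0" using v v0 by (simp add: invariants_def)
        ultimately show "v \<in> {0}" using IH(1) by blast
      qed
    qed
  qed
  then show "invariants W \<inter> moved W \<subseteq> {0}" "\<And>w. w \<in> W \<Longrightarrow> \<exists>a\<in>invariants W. w - a \<in> moved W"
    by blast+
qed

end

section \<open>Alternating forms on lists\<close>

text \<open>Adjacent transpositions fit induction on lists; \<open>alt_if_permute\<close> and
  \<open>alt_permute\<close> translate to the sign condition in the cochain spaces.\<close>

definition alt :: "('x list \<Rightarrow> complex) \<Rightarrow> bool" where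
  "alt F \<longleftrightarrow> (\<forall>us x y vs. F (us @ x # y # vs) = - F (us @ y # x # vs))"

fun der :: "('x \<Rightarrow> 'x) \<Rightarrow> ('x list \<Rightarrow> complex) \<Rightarrow> 'x list \<Rightarrow> complex" where
  "der T F [] = 0"
| "der T F (y # ys) = F (T y # ys) + der T (\<lambda>zs. F (y # zs)) ys"

text \<open>
  The Chevalley--Eilenberg differential for the operation \<open>b\<close>, in the recursive form
  \<open>\<iota>\<^sub>x d = \<theta>\<^sub>x - d \<iota>\<^sub>x\<close> with \<open>\<theta>\<^sub>x = - der (b x)\<close> (Cartan's formula).
\<close>

fun rd :: "('x \<Rightarrow> 'x \<Rightarrow> 'x) \<Rightarrow> ('x list \<Rightarrow> complex) \<Rightarrow> 'x list \<Rightarrow> complex" where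
  "rd b F [] = 0"
| "rd b F (x # xs) = - der (b x) F xs - rd b (\<lambda>ys. F (x # ys)) xs"

text \<open>Skew-symmetry and, below, the Jacobi identity are stated inside a slot of
  \<open>F\<close>: entries may be pairs of a degree and a vector, where sums and negatives are
  meant only between vectors of equal degree.\<close>

definition skew_on :: "('x \<Rightarrow> 'x \<Rightarrow> 'x) \<Rightarrow> ('x list \<Rightarrow> complex) \<Rightarrow> bool" where
  "skew_on b F \<longleftrightarrow> (\<forall>us x y vs. F (us @ b x y # vs) = - F (us @ b y x # vs))"

definition jacobi_on :: "('x \<Rightarrow> 'x \<Rightarrow> 'x) \<Rightarrow> ('x list \<Rightarrow> complex) \<Rightarrow> bool" where
  "jacobi_on b F \<longleftrightarrow> (\<forall>us x y z vs.
     F (us @ b x (b y z) # vs) = F (us @ b (b x y) z # vs) + F (us @ b y (b x z) # vs))"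

lemma altD: "alt F \<Longrightarrow> F (us @ x # y # vs) = - F (us @ y # x # vs)"
  unfolding alt_def by blast

lemma altD0: "alt F \<Longrightarrow> F (x # y # vs) = - F (y # x # vs)"
  using altD[of F "[]" x y vs] by (simp only: append_Nil)

lemma alt_Cons:
  assumes "alt F"
  shows "alt (\<lambda>ys. F (x # ys))"
  unfolding alt_def
proof (intro allI)
  fix us y z vs
  show "F (x # us @ y # z # vs) = - F (x # us @ z # y # vs)"
    using altD[OF assms, of "x # us" y z vs] by (simp only: append_Cons)
qed

lemma skew_on_Cons:
  assumes "skew_on b F"
  shows "skew_on b (\<lambda>ys. F (x # ys))"
  unfolding skew_on_def
proof (intro allI)
  fix us y z vs
  show "F (x # us @ b y z # vs) = - F (x # us @ b z y # vs)"
    using assms[unfolded skew_on_def, rule_format, of "x # us" y z vs] by (simp only: append_Cons)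
qed

lemma skew_onD:
  assumes "skew_on b F"
  shows "F (b x y # vs) = - F (b y x # vs)"
  using assms[unfolded skew_on_def, rule_format, of "[]" x y vs] by (simp only: append_Nil)

lemma jacobi_on_Cons:
  assumes "jacobi_on b F"
  shows "jacobi_on b (\<lambda>ys. F (x # ys))"
  unfolding jacobi_on_def
proof (intro allI)
  fix us y z w vs
  show "F (x # us @ b y (b z w) # vs) = F (x # us @ b (b y z) w # vs) + F (x # us @ b z (b y w) # vs)"
    using assms[unfolded jacobi_on_def, rule_format, of "x # us" y z w vs] by (simp only: append_Cons)
qed

lemma jacobi_onD:
  assumes "jacobi_on b F"
  shows "F (b x (b y z) # vs) = F (b (b x y) z # vs) + F (b y (b x z) # vs)"
  using assms[unfolded jacobi_on_def, rule_format, of "[]" x y z vs] by (simp only: append_Nil)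

lemma der_zero [simp]: "der T (\<lambda>_. 0) xs = 0"
  by (induction xs) auto

lemma der_add: "der T (\<lambda>ys. F ys + G ys) xs = der T F xs + der T G xs"
  by (induction xs arbitrary: F G) auto

lemma der_scale: "der T (\<lambda>ys. c * F ys) xs = c * der T F xs"
  by (induction xs arbitrary: F) (auto simp: distrib_left)

lemma der_minus: "der T (\<lambda>ys. - F ys) xs = - der T F xs"
  using der_scale[of T "- 1" F xs] by simp

lemma der_diff: "der T (\<lambda>ys. F ys - G ys) xs = der T F xs - der T G xs"
  using der_add[of T F "\<lambda>ys. - G ys" xs] by (simp add: der_minus)

lemma der_sum: "der T (\<lambda>ys. \<Sum>i\<in>I. F i ys) xs = (\<Sum>i\<in>I. der T (F i) xs)"
  by (induction I rule: infinite_finite_induct) (auto simp: der_add)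

lemma rd_zero [simp]: "rd b (\<lambda>_. 0) xs = 0"
  by (induction xs) auto

lemma rd_add: "rd b (\<lambda>ys. F ys + G ys) xs = rd b F xs + rd b G xs"
  by (induction xs arbitrary: F G) (auto simp: der_add)

lemma rd_scale: "rd b (\<lambda>ys. c * F ys) xs = c * rd b F xs"
  by (induction xs arbitrary: F) (auto simp: der_scale right_diff_distrib)

lemma rd_minus: "rd b (\<lambda>ys. - F ys) xs = - rd b F xs"
  using rd_scale[of b "- 1" F xs] by simp

lemma rd_diff: "rd b (\<lambda>ys. F ys - G ys) xs = rd b F xs - rd b G xs"
  using rd_add[of b F "\<lambda>ys. - G ys" xs] by (simp add: rd_minus)

lemma rd_sum: "rd b (\<lambda>ys. \<Sum>i\<in>I. F i ys) xs = (\<Sum>i\<in>I. rd b (F i) xs)"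
  by (induction I rule: infinite_finite_induct) (auto simp: rd_add)

lemma der_append:
  "der T F (us @ vs) = der T (\<lambda>ws. F (ws @ vs)) us + der T (\<lambda>ws. F (us @ ws)) vs"
  by (induction us arbitrary: F) auto

lemma alt_der:
  assumes "alt F"
  shows "alt (der T F)"
  unfolding alt_def
proof (intro allI)
  fix us x y vs
  have 1: "F (zs @ x # y # vs) = - F (zs @ y # x # vs)" for zs by (rule altD[OF assms])
  show "der T F (us @ x # y # vs) = - der T F (us @ y # x # vs)"
    using altD[OF assms, of us "T x" y vs] altD[OF assms, of us x "T y" vs] altD[OF assms, of us x y]
    by (simp add: der_append 1 der_minus append_assoc[symmetric] del: append_assoc)
qed

lemma alt_rd:
  assumes "alt F" "skew_on b F"
  shows "alt (rd b F)"
  unfolding alt_def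
proof (intro allI)
  fix us x y vs
  show "rd b F (us @ x # y # vs) = - rd b F (us @ y # x # vs)"
    using assms
  proof (induction us arbitrary: F)
    case Nil
    have "rd b (\<lambda>ys. F (y # x # ys)) vs = - rd b (\<lambda>ys. F (x # y # ys)) vs"
      unfolding rd_minus[symmetric] using altD0[OF Nil.prems(1), of y x] by simp
    then show ?case
      using skew_onD[OF Nil.prems(2), of x y vs] by simp
  next
    case (Cons u us)
    show ?case
      using Cons.IH[OF alt_Cons skew_on_Cons, OF Cons.prems] altD[OF alt_der[OF Cons.prems(1), of "b u"], of us x y vs]
      by simp
  qed
qed

section \<open>Commutation relations between slotwise operators and the differential\<close>

lemma der_commutator:
  "der T (der U F) xs - der U (der T F) xs = der (\<lambda>x. U (T x)) F xs - der (\<lambda>x. T (U x)) F xs"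
  by (induction xs arbitrary: F) (auto simp: der_add algebra_simps)

lemma der_combine:
  assumes "\<And>us x vs. F (us @ T x # vs) = F (us @ T1 x # vs) + F (us @ T2 x # vs) - F (us @ T3 x # vs)"
  shows "der T F xs = der T1 F xs + der T2 F xs - der T3 F xs"
  using assms
proof (induction xs arbitrary: F)
  case Nil
  then show ?case by simp
next
  case (Cons x xs)
  have "der T (\<lambda>zs. F (x # zs)) xs = der T1 (\<lambda>zs. F (x # zs)) xs + der T2 (\<lambda>zs. F (x # zs)) xs - der T3 (\<lambda>zs. F (x # zs)) xs"
    by (rule Cons.IH) (metis Cons.prems append_Cons)
  then show ?case
    using Cons.prems[of "[]" x xs] by simp
qed

text \<open>\<open>B\<close> measures how far \<open>T\<close> is from being a derivation of
  \<open>b\<close>; the failure of \<open>der T\<close> to commute with the differential is then the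
  same recursion for the operation \<open>B\<close>. For the truncated action of negative powers of
  \<open>t\<close> this is the source of the defect terms.\<close>

lemma der_rd_commutator:
  assumes "\<And>us y z vs. F (us @ B y z # vs) = F (us @ b (T y) z # vs) + F (us @ b y (T z) # vs) - F (us @ T (b y z) # vs)"
  shows "der T (rd b F) xs - rd b (der T F) xs = rd B F xs"
  using assms
proof (induction xs arbitrary: F)
  case Nil
  then show ?case by simp
next
  case (Cons y ys)
  let ?F = "\<lambda>zs. F (y # zs)"
  have IH: "der T (rd b ?F) ys - rd b (der T ?F) ys = rd B ?F ys"
    by (rule Cons.IH) (metis Cons.prems append_Cons)
  have B: "der (B y) F ys = der (b (T y)) F ys + der (\<lambda>z. b y (T z)) F ys - der (\<lambda>z. T (b y z)) F ys"
    by (rule der_combine) (rule Cons.prems)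
  have "der T (\<lambda>zs. rd b F (y # zs)) ys = - der T (der (b y) F) ys - der T (rd b ?F) ys"
    by (simp add: der_diff der_minus)
  moreover have "rd b (\<lambda>zs. der T F (y # zs)) ys = rd b (\<lambda>zs. F (T y # zs)) ys + rd b (der T ?F) ys"
    by (simp add: rd_add)
  ultimately have "der T (rd b F) (y # ys) - rd b (der T F) (y # ys) =
      - der (b (T y)) F ys - (der T (der (b y) F) ys - der (b y) (der T F) ys) -
      (der T (rd b ?F) ys - rd b (der T ?F) ys)"
    by simp
  also have "\<dots> = rd B F (y # ys)"
    unfolding der_commutator IH using B by simp
  finally show ?case .
qed

text \<open>The Jacobi identity says that \<open>b x\<close> is a derivation of
  \<open>b\<close>.\<close>

lemma rd_lie_derivative:
  assumes "jacobi_on b F"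
  shows "rd b (der (b x) F) xs = der (b x) (rd b F) xs"
  using assms
proof (induction xs arbitrary: F)
  case Nil
  then show ?case by simp
next
  case (Cons y ys)
  let ?F = "\<lambda>zs. F (y # zs)"
  have J: "der (\<lambda>z. b x (b y z)) F ys = der (\<lambda>z. b y (b x z)) F ys + der (b (b x y)) F ys"
    using Cons.prems
  proof (induction ys arbitrary: F)
    case Nil
    then show ?case by simp
  next
    case (Cons z zs)
    show ?case
      using Cons.IH[OF jacobi_on_Cons[OF Cons.prems]] jacobi_onD[OF Cons.prems, of x y z zs] by simp
  qed
  have A: "rd b (der (b x) F) (y # ys) =
      - der (b y) (der (b x) F) ys - rd b (\<lambda>zs. F (b x y # zs)) ys - rd b (der (b x) ?F) ys"
    by (simp add: rd_add)
  have B: "der (b x) (rd b F) (y # ys) =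
      rd b F (b x y # ys) - der (b x) (der (b y) F) ys - der (b x) (rd b ?F) ys"
    by (simp add: der_diff der_minus)
  show ?case
    unfolding A B using der_commutator[of "b x" "b y" F ys] J Cons.IH[OF jacobi_on_Cons[OF Cons.prems], of y]
    by (simp only: rd.simps) (simp add: algebra_simps)
qed

text \<open>Cartan's formula, used twice on the first entry, leaves the commutator of the
  differential with a Lie derivative, which is zero, and the same claim for the contracted form on a
  shorter list.\<close>

lemma rd_rd:
  assumes "jacobi_on b F"
  shows "rd b (rd b F) xs = 0"
  using assms
proof (induction xs arbitrary: F)
  case Nil
  then show ?case by simp
next
  case (Cons x xs)
  have "rd b (\<lambda>ys. rd b F (x # ys)) xs = - rd b (der (b x) F) xs - rd b (rd b (\<lambda>zs. F (x # zs))) xs"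
    by (simp add: rd_diff rd_minus)
  then show ?case
    using rd_lie_derivative[OF Cons.prems, of x xs] Cons.IH[OF jacobi_on_Cons[OF Cons.prems]] by simp
qed

text \<open>Recursive form of the alternating sum over the entry that is taken out of the
  list.\<close>

fun alt_sum :: "('x \<Rightarrow> 'x list \<Rightarrow> complex) \<Rightarrow> 'x list \<Rightarrow> complex" where
  "alt_sum H [] = 0"
| "alt_sum H (x # xs) = H x xs - alt_sum (\<lambda>y ys. H y (x # ys)) xs"

lemma alt_sum_add: "alt_sum (\<lambda>y ys. H y ys + K y ys) xs = alt_sum H xs + alt_sum K xs"
  by (induction xs arbitrary: H K) auto

lemma alt_sum_minus: "alt_sum (\<lambda>y ys. - H y ys) xs = - alt_sum H xs"
  by (induction xs arbitrary: H) auto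

lemma alt_sum_zero: "alt_sum (\<lambda>y ys. 0) xs = 0"
  by (induction xs) auto

lemma alt_sum_der:
  assumes "alt F"
  shows "alt_sum (\<lambda>y ys. F (T y # ys)) xs = der T F xs"
  using assms
proof (induction xs arbitrary: F)
  case Nil
  then show ?case by simp
next
  case (Cons z zs)
  have "alt_sum (\<lambda>y ys. F (T y # z # ys)) zs = - alt_sum (\<lambda>y ys. F (z # T y # ys)) zs"
    unfolding alt_sum_minus[symmetric] using altD0[OF Cons.prems, of _ z] by simp
  then show ?case
    using Cons.IH[OF alt_Cons[OF Cons.prems]] by simp
qed

text \<open>The bracket of two entries arises twice, once from either of them. It follows that a
  form with vanishing Lie derivatives is closed.\<close>

lemma twice_rd:
  assumes "alt F" "skew_on b F"
  shows "alt_sum (\<lambda>x. der (b x) F) xs = - 2 * rd b F xs"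
  using assms
proof (induction xs arbitrary: F)
  case Nil
  then show ?case by simp
next
  case (Cons x xs)
  have "alt_sum (\<lambda>y ys. der (b y) F (x # ys)) xs =
      alt_sum (\<lambda>y ys. F (b y x # ys)) xs + alt_sum (\<lambda>y. der (b y) (\<lambda>zs. F (x # zs))) xs"
    by (simp add: alt_sum_add)
  also have "alt_sum (\<lambda>y ys. F (b y x # ys)) xs = - alt_sum (\<lambda>y ys. F (b x y # ys)) xs"
    unfolding alt_sum_minus[symmetric] using skew_onD[OF Cons.prems(2), of _ x] by simp
  also have "alt_sum (\<lambda>y ys. F (b x y # ys)) xs = der (b x) F xs"
    by (rule alt_sum_der[OF Cons.prems(1)])
  finally show ?case
    using Cons.IH[OF alt_Cons[OF Cons.prems(1)] skew_on_Cons[OF Cons.prems(2)]] by simp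
qed

lemma der_map:
  assumes "\<And>x. f (T x) = U (f x)"
  shows "der T (\<lambda>ys. F (map f ys)) xs = der U F (map f xs)"
  by (induction xs arbitrary: F) (auto simp: assms)

lemma rd_map:
  assumes "\<And>x y. f (b x y) = c (f x) (f y)"
  shows "rd b (\<lambda>ys. F (map f ys)) xs = rd c F (map f xs)"
proof (induction xs arbitrary: F)
  case Nil
  then show ?case by simp
next
  case (Cons x xs)
  have "der (b x) (\<lambda>ys. F (map f ys)) xs = der (c (f x)) F (map f xs)"
    by (rule der_map) (rule assms)
  then show ?case using Cons[of "\<lambda>ys. F (f x # ys)"] by simp
qed

lemma der_cong_length:
  assumes "\<And>ys. length ys = length xs \<Longrightarrow> F ys = G ys"
  shows "der T F xs = der T G xs"
  using assms
proof (induction xs arbitrary: F G)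
  case Nil
  then show ?case by simp
next
  case (Cons x xs)
  have "der T (\<lambda>zs. F (x # zs)) xs = der T (\<lambda>zs. G (x # zs)) xs"
    by (rule Cons.IH) (simp add: Cons.prems)
  then show ?case by (simp add: Cons.prems)
qed

lemma rd_cong_length:
  assumes "\<And>ys. length ys = length xs - 1 \<Longrightarrow> F ys = G ys"
  shows "rd b F xs = rd b G xs"
  using assms
proof (induction xs arbitrary: F G)
  case Nil
  then show ?case by simp
next
  case (Cons x xs)
  have "der (b x) F xs = der (b x) G xs"
    using Cons.prems by (intro der_cong_length) simp
  moreover have "rd b (\<lambda>ys. F (x # ys)) xs = rd b (\<lambda>ys. G (x # ys)) xs"
  proof (cases xs)
    case (Cons y ys)
    then show ?thesis using Cons.prems by (intro Cons.IH) simp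
  qed simp
  ultimately show ?case by simp
qed

subsection \<open>The explicit formula for the differential\<close>

definition ce_formula :: "('x \<Rightarrow> 'x \<Rightarrow> 'x) \<Rightarrow> nat \<Rightarrow> ('x list \<Rightarrow> complex) \<Rightarrow> 'x list \<Rightarrow> complex" where
  "ce_formula b n F xs =
     (\<Sum>j<Suc n. \<Sum>i<j. (-1) ^ (i + j) * F (b (xs ! i) (xs ! j) # nths xs (- {i, j})))"

lemma alt_move:
  assumes "alt F"
  shows "F (us @ x # vs) = (-1) ^ length us * F (x # us @ vs)"
  using assms
proof (induction us arbitrary: F)
  case Nil
  then show ?case by simp
next
  case (Cons u us)
  show ?case
    using Cons.IH[OF alt_Cons[OF Cons.prems], of u] altD0[OF Cons.prems, of u x] by simp
qed

lemma nths_remove1: "i < length xs \<Longrightarrow> nths xs (- {i}) = take i xs @ drop (Suc i) xs"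
proof (induction xs arbitrary: i)
  case Nil
  then show ?case by simp
next
  case (Cons x xs)
  show ?case
  proof (cases i)
    case 0
    have "{j. Suc j \<in> - {0}} = UNIV" by auto
    then show ?thesis using 0 by (simp add: nths_Cons nths_all)
  next
    case (Suc k)
    have "{j. Suc j \<in> - {Suc k}} = - {k}" by auto
    then show ?thesis using Suc Cons by (simp add: nths_Cons)
  qed
qed

lemma der_nth:
  "der T F xs = (\<Sum>j<length xs. F (take j xs @ T (xs ! j) # drop (Suc j) xs))"
proof (induction xs arbitrary: F)
  case Nil
  then show ?case by simp
next
  case (Cons x xs)
  have "(\<Sum>j<length (x # xs). F (take j (x # xs) @ T ((x # xs) ! j) # drop (Suc j) (x # xs))) =
      F (T x # xs) + (\<Sum>j<length xs. F (x # take j xs @ T (xs ! j) # drop (Suc j) xs))"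
    by (simp only: list.size(4) add_0_right add_Suc_right sum.lessThan_Suc_shift) simp
  then show ?case using Cons by simp
qed

lemma der_update: "der T F xs = (\<Sum>j<length xs. F (xs[j := T (xs ! j)]))"
  unfolding der_nth by (intro sum.cong) (auto simp: upd_conv_take_nth_drop)

lemma der_front:
  assumes "alt F"
  shows "der T F xs = (\<Sum>j<length xs. (-1) ^ j * F (T (xs ! j) # nths xs (- {j})))"
  unfolding der_nth
  by (intro sum.cong) (auto simp: alt_move[OF assms] nths_remove1)

text \<open>The pairs with \<open>i = 0\<close> give the Lie derivative along the first entry, and
  the other pairs give the differential of the contraction, so the double sum obeys the recursion of
  \<open>rd\<close>.\<close>

lemma ce_formula_eq_rd:
  assumes "alt F" "length xs = Suc n"
  shows "ce_formula b n F xs = rd b F xs"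
  using assms
proof (induction n arbitrary: F xs)
  case 0
  then obtain x where "xs = [x]" by (metis length_0_conv length_Suc_conv)
  then show ?case by (simp add: ce_formula_def)
next
  case (Suc n)
  then obtain x ys where xs: "xs = x # ys" "length ys = Suc n"
    by (metis length_Suc_conv)
  let ?t = "\<lambda>i j. (-1) ^ (i + j) * F (b (xs ! i) (xs ! j) # nths xs (- {i, j}))"
  have s0: "nths (x # ys) (- {0, Suc j}) = nths ys (- {j})" for j
  proof -
    have "{k. Suc k \<in> - {0, Suc j}} = - {j}" by auto
    then show ?thesis by (simp only: nths_Cons) simp
  qed
  have s1: "nths (x # ys) (- {Suc i, Suc j}) = x # nths ys (- {i, j})" for i j
  proof -
    have "{k. Suc k \<in> - {Suc i, Suc j}} = - {i, j}" by auto
    then show ?thesis by (simp only: nths_Cons) simp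
  qed
  have "ce_formula b (Suc n) F xs = (\<Sum>j<Suc n. \<Sum>i<Suc j. ?t i (Suc j))"
    unfolding ce_formula_def by (subst sum.lessThan_Suc_shift) simp
  also have "\<dots> = (\<Sum>j<Suc n. ?t 0 (Suc j) + (\<Sum>i<j. ?t (Suc i) (Suc j)))"
    by (subst sum.lessThan_Suc_shift) simp
  also have "\<dots> = (\<Sum>j<Suc n. ?t 0 (Suc j)) + (\<Sum>j<Suc n. \<Sum>i<j. ?t (Suc i) (Suc j))"
    by (rule sum.distrib)
  also have "(\<Sum>j<Suc n. ?t 0 (Suc j)) = - der (b x) F ys"
    unfolding der_front[OF Suc.prems(1)] xs(2) sum_negf[symmetric]
    by (intro sum.cong) (simp_all add: xs(1) s0)
  also have "(\<Sum>j<Suc n. \<Sum>i<j. ?t (Suc i) (Suc j)) = - ce_formula b n (\<lambda>zs. F (x # zs)) ys"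
    unfolding ce_formula_def sum_negf[symmetric]
    by (intro sum.cong) (simp_all add: xs(1) s1 altD0[OF Suc.prems(1), of _ x])
  also have "ce_formula b n (\<lambda>zs. F (x # zs)) ys = rd b (\<lambda>zs. F (x # zs)) ys"
    by (rule Suc.IH[OF alt_Cons[OF Suc.prems(1)] xs(2)])
  finally show ?case by (simp add: xs(1))
qed

subsection \<open>Permutations\<close>

text \<open>Bringing the two entries next to each other costs the same sign on both sides.\<close>

lemma alt_swap:
  assumes "alt F"
  shows "F (us @ x # ws @ y # vs) = - F (us @ y # ws @ x # vs)"
proof -
  have a: "alt (\<lambda>zs. F (us @ zs))"
    using assms unfolding alt_def by (metis append_assoc)
  have "F (us @ x # ws @ y # vs) = (-1) ^ length ws * F (us @ x # y # ws @ vs)"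
    using alt_move[OF alt_Cons[OF a], of x ws y vs] by simp
  moreover have "F (us @ x # y # ws @ vs) = - F (us @ y # x # ws @ vs)"
    by (rule altD[OF assms])
  moreover have "F (us @ y # ws @ x # vs) = (-1) ^ length ws * F (us @ y # x # ws @ vs)"
    using alt_move[OF alt_Cons[OF a], of y ws x vs] by simp
  ultimately show ?thesis by simp
qed

lemma permute_transpose:
  "permute_list (transpose (length us) (Suc (length us + length ws))) (us @ x # ws @ y # vs) = us @ y # ws @ x # vs"
proof (rule nth_equalityI)
  fix i assume "i < length (permute_list (transpose (length us) (Suc (length us + length ws))) (us @ x # ws @ y # vs))"
  then have i: "i < length (us @ x # ws @ y # vs)" by simp
  have p: "permute_list f zs ! i = zs ! f i" if "i < length zs" for f and zs :: "'a list"
    using that by (simp add: permute_list_def)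
  let ?l = "length us" and ?m = "Suc (length us + length ws)"
  have 1: "(us @ x # ws @ y # vs) ! ?m = y" "(us @ y # ws @ x # vs) ! ?m = x"
    using nth_append_length[of "us @ x # ws" y vs] nth_append_length[of "us @ y # ws" x vs] by simp_all
  have 2: "(us @ x # ws @ y # vs) ! i = (us @ y # ws @ x # vs) ! i" if "i \<noteq> ?l" "i \<noteq> ?m"
  proof -
    consider "i < ?l" | "?l < i" "i < ?m" | "?m < i" using \<open>i \<noteq> ?l\<close> \<open>i \<noteq> ?m\<close> by linarith
    then show ?thesis
    proof cases
      case 1
      then show ?thesis by (simp add: nth_append)
    next
      case 2
      then obtain k where "i = Suc (?l + k)" "k < length ws"
        by (metis add_Suc_right less_imp_Suc_add nat_add_left_cancel_less not_less_eq)
      then show ?thesis by (simp add: nth_append)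
    next
      case 3
      then obtain k where "i = Suc (?m + k)" by (metis less_imp_Suc_add)
      then show ?thesis by (simp add: nth_append)
    qed
  qed
  show "permute_list (transpose ?l ?m) (us @ x # ws @ y # vs) ! i = (us @ y # ws @ x # vs) ! i"
    unfolding p[OF i] using 1 2 by (auto simp: transpose_def)
qed simp

lemma alt_if_permute:
  fixes F :: "'x list \<Rightarrow> complex"
  assumes "\<And>xs \<sigma>. \<sigma> permutes {..<length xs} \<Longrightarrow> F (permute_list \<sigma> xs) = of_int (sign \<sigma>) * F xs"
  shows "alt F"
  unfolding alt_def
proof (intro allI)
  fix us vs :: "'x list" and x y
  let ?s = "transpose (length us) (Suc (length us))"
  have "F (us @ y # x # vs) = F (permute_list ?s (us @ x # y # vs))"
    using permute_transpose[of us "[]" x y vs] by simp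
  also have "\<dots> = of_int (sign ?s) * F (us @ x # y # vs)"
    by (intro assms permutes_swap_id) auto
  also have "\<dots> = - F (us @ x # y # vs)"
    by (simp add: sign_swap_id)
  finally show "F (us @ x # y # vs) = - F (us @ y # x # vs)" by simp
qed

lemma alt_transpose:
  assumes "alt F" "i < j" "j < length xs"
  shows "F (permute_list (transpose i j) xs) = - F xs"
proof -
  define us where "us = take i xs"
  define ws where "ws = take (j - Suc i) (drop (Suc i) xs)"
  define vs where "vs = drop (Suc j) xs"
  have "xs = us @ xs ! i # drop (Suc i) xs"
    unfolding us_def using assms by (intro id_take_nth_drop) simp
  also have "drop (Suc i) xs = ws @ drop (Suc i) xs ! (j - Suc i) # drop (Suc (j - Suc i)) (drop (Suc i) xs)"
    unfolding ws_def using assms by (intro id_take_nth_drop) simp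
  also have "\<dots> = ws @ xs ! j # vs"
    using assms by (simp add: vs_def)
  finally have xs: "xs = us @ xs ! i # ws @ xs ! j # vs" .
  have l: "length us = i" "Suc (length us + length ws) = j"
    using assms by (auto simp: us_def ws_def)
  have "F (permute_list (transpose i j) xs) = F (us @ xs ! j # ws @ xs ! i # vs)"
    using permute_transpose[of us ws "xs ! i" "xs ! j" vs] xs l by simp
  also have "\<dots> = - F xs"
    using alt_swap[OF assms(1)] xs by metis
  finally show ?thesis .
qed

lemma alt_permute:
  assumes F: "alt F" and "\<sigma> permutes {..<n}" "length xs = n"
  shows "F (permute_list \<sigma> xs) = of_int (sign \<sigma>) * F xs"
proof -
  have "\<forall>xs. length xs = n \<longrightarrow> F (permute_list \<sigma> xs) = of_int (sign \<sigma>) * F xs"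
    using assms(2) finite_lessThan
  proof (induction rule: permutes_induct)
    case id
    then show ?case by (simp add: sign_id)
  next
    case (swap a b p)
    show ?case
    proof (intro allI impI)
      fix xs :: "'a list" assume n: "length xs = n"
      have "F (permute_list (transpose a b \<circ> p) xs) = F (permute_list p (permute_list (transpose a b) xs))"
        using swap n by (simp add: permute_list_compose)
      also have "\<dots> = of_int (sign p) * F (permute_list (transpose a b) xs)"
        using swap n by simp
      also have "F (permute_list (transpose a b) xs) = - F xs"
      proof (cases "a < b")
        case True
        then show ?thesis using alt_transpose[OF F True] swap n by simp
      next
        case False
        then have "b < a" using swap by simp
        then show ?thesis using alt_transpose[OF F, of b a xs] swap n by (simp add: transpose_commute)
      qed
      also have "of_int (sign p) * - F xs = of_int (sign (transpose a b \<circ> p)) * F xs"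
      proof -
        have "permutation p" using swap by (auto simp: permutation_permutes)
        then show ?thesis
          using swap by (simp add: sign_compose permutation_swap_id sign_swap_id)
      qed
      finally show "F (permute_list (transpose a b \<circ> p) xs) = of_int (sign (transpose a b \<circ> p)) * F xs" .
    qed
  qed
  then show ?thesis using assms(3) by blast
qed

section \<open>Multilinear forms\<close>

context lie_algebra
begin

sublocale VC: vector_space_pair scale "(*) :: complex \<Rightarrow> complex \<Rightarrow> complex"
  by unfold_locales (auto simp: algebra_simps)

text \<open>
  The slots of a form take values \<open>e i a\<close> with \<open>i\<close> an index: \<open>e i a = a\<close> for forms on \<open>\<gg>\<close>, and
  \<open>e i a = (i, a)\<close> for forms whose arguments carry a degree or a spectral parameter.
\<close>

definition slotlin :: "('i \<Rightarrow> 'g \<Rightarrow> 'x) \<Rightarrow> ('x list \<Rightarrow> complex) \<Rightarrow> bool" where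
  "slotlin e F \<longleftrightarrow> (\<forall>us i vs. Vector_Spaces.linear scale (*) (\<lambda>a. F (us @ e i a # vs)))"

text \<open>The target index may depend on \<open>i\<close> but not on \<open>a\<close>. Such maps
  preserve \<open>slotlin\<close> when they are applied in a slot, which covers both bracketing and
  the truncated action.\<close>

definition fiberlin :: "('i \<Rightarrow> 'g \<Rightarrow> 'x) \<Rightarrow> ('x \<Rightarrow> 'x) \<Rightarrow> bool" where
  "fiberlin e T \<longleftrightarrow> (\<forall>i. \<exists>j L. Vector_Spaces.linear scale scale L \<and> (\<forall>a. T (e i a) = e j (L a)))"

lemma slotlinD: "slotlin e F \<Longrightarrow> Vector_Spaces.linear scale (*) (\<lambda>a. F (us @ e i a # vs))"
  unfolding slotlin_def by blast

lemma slotlinD0: "slotlin e F \<Longrightarrow> Vector_Spaces.linear scale (*) (\<lambda>a. F (e i a # vs))"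
  using slotlinD[of e F "[]"] by simp

lemma slotlin_Cons:
  assumes "slotlin e F"
  shows "slotlin e (\<lambda>ys. F (x # ys))"
  unfolding slotlin_def using slotlinD[OF assms, of "x # us" for us] by simp

lemma slotlin_fiber:
  assumes "slotlin e F" "fiberlin e T"
  shows "Vector_Spaces.linear scale (*) (\<lambda>a. F (us @ T (e i a) # vs))"
proof -
  obtain j L where L: "Vector_Spaces.linear scale scale L" "\<And>a. T (e i a) = e j (L a)"
    using assms(2) unfolding fiberlin_def by blast
  show ?thesis
    unfolding L(2) using Vector_Spaces.linear_compose[OF L(1) slotlinD[OF assms(1), of us j vs]]
    by (simp add: o_def)
qed

lemma slotlin_der:
  assumes F: "slotlin e F" and T: "fiberlin e T"
  shows "slotlin e (der T F)"
  unfolding slotlin_def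
proof (intro allI)
  fix us i vs
  have 1: "Vector_Spaces.linear scale (*) (\<lambda>a. der T (\<lambda>ws. F (ws @ e i a # vs)) us)"
    unfolding der_nth by (intro VC.linear_compose_sum ballI slotlinD[OF F])
  have 2: "Vector_Spaces.linear scale (*) (\<lambda>a. der T (\<lambda>ws. F (us @ e i a # ws)) vs)"
    unfolding der_nth by (intro VC.linear_compose_sum ballI slotlinD[OF F])
  have 3: "Vector_Spaces.linear scale (*) (\<lambda>a. F (us @ T (e i a) # vs))"
    by (rule slotlin_fiber[OF F T])
  show "Vector_Spaces.linear scale (*) (\<lambda>a. der T F (us @ e i a # vs))"
    using VC.linear_compose_add[OF 1 VC.linear_compose_add[OF 3 2]] by (simp add: der_append)
qed

lemma slotlin_rd:
  assumes F: "slotlin e F" and b: "\<And>x. fiberlin e (b x)" "\<And>x. fiberlin e (\<lambda>y. b y x)"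
  shows "slotlin e (rd b F)"
  unfolding slotlin_def
proof (intro allI)
  fix us i vs
  show "Vector_Spaces.linear scale (*) (\<lambda>a. rd b F (us @ e i a # vs))"
    using F
  proof (induction us arbitrary: F)
    case Nil
    interpret F: Vector_Spaces.linear scale "(*)" "\<lambda>a. F (e i a # zs)" for zs
      by (rule slotlinD0[OF Nil])
    have 1: "Vector_Spaces.linear scale (*) (\<lambda>a. der (b (e i a)) F vs)"
      unfolding der_nth by (intro VC.linear_compose_sum ballI slotlin_fiber[OF Nil b(2)])
    have 2: "Vector_Spaces.linear scale (*) (\<lambda>a. rd b (\<lambda>ys. F (e i a # ys)) vs)"
      by unfold_locales (auto simp: F.add F.scale rd_add rd_scale)
    show ?case
      using VC.linear_compose_sub[OF VC.linear_compose_neg[OF 1] 2] by simp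
  next
    case (Cons u us)
    show ?case
      using VC.linear_compose_sub[OF VC.linear_compose_neg[OF slotlinD[OF slotlin_der[OF Cons.prems b(1), of u]]]
        Cons.IH[OF slotlin_Cons[OF Cons.prems, of u]], of us i vs]
      by simp
  qed
qed

fun basis_coeff :: "'g set \<Rightarrow> 'g list \<Rightarrow> 'g list \<Rightarrow> complex" where
  "basis_coeff B [] [] = 1"
| "basis_coeff B (b # bs) (a # as) = representation B a b * basis_coeff B bs as"
| "basis_coeff B _ _ = 0"

abbreviation id_slot :: "unit \<Rightarrow> 'g \<Rightarrow> 'g" where "id_slot \<equiv> \<lambda>_ a. a"

lemma lists_length_Suc:
  "{xs. set xs \<subseteq> B \<and> length xs = Suc n} = (\<lambda>(x, xs). x # xs) ` (B \<times> {xs. set xs \<subseteq> B \<and> length xs = n})"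
  by (auto simp: length_Suc_conv image_iff)

text \<open>This expansion yields the finite dimension of the spaces of forms and, later, a degree
  bound that is uniform in the vectors.\<close>

lemma multilinear_expand:
  assumes B: "basis_of B UNIV" and F: "slotlin id_slot F"
  shows "F as = (\<Sum>bs | set bs \<subseteq> B \<and> length bs = length as. basis_coeff B bs as * F bs)"
  using F
proof (induction as arbitrary: F)
  case Nil
  have "{bs. set bs \<subseteq> B \<and> bs = []} = {[]}" by auto
  then show ?case by simp
next
  case (Cons a as)
  interpret F: Vector_Spaces.linear scale "(*)" "\<lambda>a. F (a # zs)" for zs
    by (rule slotlinD0[where i = "()", OF Cons.prems])
  have "F (a # as) = F ((\<Sum>b\<in>B. scale (representation B a b) b) # as)"
    using repr_eq[OF B, of a] by simp
  also have "\<dots> = (\<Sum>b\<in>B. representation B a b * F (b # as))"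
    by (simp add: F.sum F.scale)
  also have "\<dots> = (\<Sum>b\<in>B. \<Sum>bs | set bs \<subseteq> B \<and> length bs = length as. basis_coeff B (b # bs) (a # as) * F (b # bs))"
  proof (intro sum.cong refl)
    fix b
    have "F (b # as) = (\<Sum>bs | set bs \<subseteq> B \<and> length bs = length as. basis_coeff B bs as * F (b # bs))"
      by (rule Cons.IH[OF slotlin_Cons[OF Cons.prems]])
    then have "representation B a b * F (b # as) = representation B a b *
        (\<Sum>bs | set bs \<subseteq> B \<and> length bs = length as. basis_coeff B bs as * F (b # bs))"
      by (rule arg_cong)
    then show "representation B a b * F (b # as) =
        (\<Sum>bs | set bs \<subseteq> B \<and> length bs = length as. basis_coeff B (b # bs) (a # as) * F (b # bs))"
      by (simp only: sum_distrib_left mult.assoc basis_coeff.simps)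
  qed
  also have "\<dots> = (\<Sum>bs\<in>(\<lambda>(x, xs). x # xs) ` (B \<times> {bs. set bs \<subseteq> B \<and> length bs = length as}). basis_coeff B bs (a # as) * F bs)"
    by (subst sum.reindex) (auto simp: inj_on_def sum.cartesian_product case_prod_unfold)
  finally show ?case by (simp add: lists_length_Suc)
qed

section \<open>The Chevalley--Eilenberg complex\<close>

lemma ce_cochains_iff:
  "\<omega> \<in> ce_cochains n \<longleftrightarrow> (\<forall>as. length as \<noteq> n \<longrightarrow> \<omega> as = 0) \<and> slotlin id_slot \<omega> \<and> alt \<omega>"
proof
  assume w: "\<omega> \<in> ce_cochains n"
  then have len: "\<forall>as. length as \<noteq> n \<longrightarrow> \<omega> as = 0"
    and lin: "length as = n \<Longrightarrow> i < n \<Longrightarrow> Vector_Spaces.linear scale (*) (\<lambda>a. \<omega> (as[i := a]))" for as i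
    by (simp_all add: ce_cochains_def)
  have "Vector_Spaces.linear scale (*) (\<lambda>a. \<omega> (us @ a # vs))" for us vs
  proof (cases "length (us @ undefined # vs) = n")
    case True
    then have "Vector_Spaces.linear scale (*) (\<lambda>a. \<omega> ((us @ undefined # vs)[length us := a]))"
      using lin[of "us @ undefined # vs" "length us"] by simp
    then show ?thesis by simp
  next
    case False
    then have "\<omega> (us @ a # vs) = 0" for a using len by simp
    then show ?thesis using VC.linear_zero by simp
  qed
  moreover have "alt \<omega>"
  proof (rule alt_if_permute)
    fix xs :: "'g list" and \<sigma> assume s: "\<sigma> permutes {..<length xs}"
    show "\<omega> (permute_list \<sigma> xs) = of_int (sign \<sigma>) * \<omega> xs"
    proof (cases "length xs = n")
      case True
      then show ?thesis using w s by (simp add: ce_cochains_def)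
    next
      case False
      then show ?thesis using len by simp
    qed
  qed
  ultimately show "(\<forall>as. length as \<noteq> n \<longrightarrow> \<omega> as = 0) \<and> slotlin id_slot \<omega> \<and> alt \<omega>"
    using len by (simp add: slotlin_def)
next
  assume w: "(\<forall>as. length as \<noteq> n \<longrightarrow> \<omega> as = 0) \<and> slotlin id_slot \<omega> \<and> alt \<omega>"
  have "Vector_Spaces.linear scale (*) (\<lambda>a. \<omega> (as[i := a]))" if "i < length as" for as i
    using slotlinD[of id_slot \<omega> "take i as" "()" "drop (Suc i) as"] w that
    by (simp add: upd_conv_take_nth_drop)
  then show "\<omega> \<in> ce_cochains n"
    using w alt_permute[of \<omega>] by (auto simp: ce_cochains_def)
qed

lemma br_fiberlin: "fiberlin id_slot (br x)" "fiberlin id_slot (\<lambda>y. br y x)"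
  unfolding fiberlin_def using br_linear_right br_linear_left by blast+

lemma slotlin_skew: "slotlin id_slot F \<Longrightarrow> skew_on br F"
  unfolding skew_on_def
proof (intro allI)
  fix us x y vs assume "slotlin id_slot F"
  then interpret F: Vector_Spaces.linear scale "(*)" "\<lambda>a. F (us @ a # vs)"
    by (rule slotlinD[where i = "()"])
  show "F (us @ br x y # vs) = - F (us @ br y x # vs)"
    using br_swap[of x y] by (simp add: F.neg)
qed

lemma slotlin_jacobi: "slotlin id_slot F \<Longrightarrow> jacobi_on br F"
  unfolding jacobi_on_def
proof (intro allI)
  fix us x y z vs assume "slotlin id_slot F"
  then interpret F: Vector_Spaces.linear scale "(*)" "\<lambda>a. F (us @ a # vs)"
    by (rule slotlinD[where i = "()"])
  show "F (us @ br x (br y z) # vs) = F (us @ br (br x y) z # vs) + F (us @ br y (br x z) # vs)"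
    by (subst br_jacobi) (rule F.add)
qed

end

lemma rd_wrong_length:
  assumes "\<And>ys. length ys \<noteq> n \<Longrightarrow> F ys = 0" "length xs \<noteq> Suc n"
  shows "rd b F xs = 0"
proof (cases xs)
  case (Cons y ys)
  have "rd b F xs = rd b (\<lambda>_. 0) xs"
    by (rule rd_cong_length) (use assms Cons in simp)
  then show ?thesis by simp
qed simp

lemma der_wrong_length:
  assumes "\<And>ys. length ys \<noteq> n \<Longrightarrow> F ys = 0" "length xs \<noteq> n"
  shows "der T F xs = 0"
proof -
  have "der T F xs = der T (\<lambda>_. 0) xs"
    by (rule der_cong_length) (use assms in simp)
  then show ?thesis by simp
qed

context lie_algebra
begin

lemma ce_d_eq_rd:
  assumes "\<omega> \<in> ce_cochains n"
  shows "ce_d n \<omega> = rd br \<omega>"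
proof
  fix as
  have w: "\<forall>as. length as \<noteq> n \<longrightarrow> \<omega> as = 0" "alt \<omega>" using assms by (simp_all add: ce_cochains_iff)
  show "ce_d n \<omega> as = rd br \<omega> as"
  proof (cases "length as = Suc n")
    case True
    then show ?thesis
      using ce_formula_eq_rd[OF w(2) True, of br] by (simp add: ce_d_def ce_formula_def)
  next
    case False
    then have "rd br \<omega> as = 0" using w(1) by (intro rd_wrong_length) auto
    then show ?thesis using False by (simp add: ce_d_def)
  qed
qed

lemma rd_ce_cochains:
  assumes "\<omega> \<in> ce_cochains n"
  shows "rd br \<omega> \<in> ce_cochains (Suc n)"
  using assms slotlin_rd[of id_slot \<omega> br, OF _ br_fiberlin] alt_rd[of \<omega> br] slotlin_skew[of \<omega>]
    rd_wrong_length[of n \<omega> _ br]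
  by (simp add: ce_cochains_iff)

lemma rd_rd_ce:
  assumes "\<omega> \<in> ce_cochains n"
  shows "rd br (rd br \<omega>) = (\<lambda>_. 0)"
  using rd_rd[OF slotlin_jacobi] assms by (auto simp: ce_cochains_iff)

section \<open>The Lie algebra acting on its forms\<close>

definition fscale :: "complex \<Rightarrow> ('x list \<Rightarrow> complex) \<Rightarrow> 'x list \<Rightarrow> complex" where
  "fscale c F xs = c * F xs"

text \<open>Precomposition reverses the order of operators, so it is the sign that makes this a
  representation.\<close>

definition lie_der :: "'g \<Rightarrow> ('g list \<Rightarrow> complex) \<Rightarrow> 'g list \<Rightarrow> complex" where
  "lie_der x \<omega> as = - der (br x) \<omega> as"

lemma forms_vs: "complex_vs (fscale :: complex \<Rightarrow> ('x list \<Rightarrow> complex) \<Rightarrow> _)"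
  by (intro complex_vs.intro vector_space.intro)
    (rule ext, simp add: fscale_def ring_distribs)+

lemma lie_der_linear: "Vector_Spaces.linear fscale fscale (lie_der x)"
proof -
  interpret FV: complex_vs "fscale :: complex \<Rightarrow> ('g list \<Rightarrow> complex) \<Rightarrow> _" by (rule forms_vs)
  have "lie_der x (\<omega> + \<eta>) = lie_der x \<omega> + lie_der x \<eta>" for \<omega> \<eta>
    by (auto simp: lie_der_def plus_fun_def der_add)
  moreover have "lie_der x (fscale c \<omega>) = fscale c (lie_der x \<omega>)" for c \<omega>
  proof
    fix as
    have "der (br x) (fscale c \<omega>) as = c * der (br x) \<omega> as"
      using der_scale[of "br x" c \<omega> as] by (simp add: fscale_def[abs_def])
    then show "lie_der x (fscale c \<omega>) as = fscale c (lie_der x \<omega>) as"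
      by (simp add: lie_der_def fscale_def)
  qed
  ultimately show ?thesis by unfold_locales
qed

sublocale forms: lie_action scale br "fscale :: complex \<Rightarrow> ('g list \<Rightarrow> complex) \<Rightarrow> _" lie_der
  by (intro lie_action.intro lie_action_axioms.intro lie_algebra_axioms forms_vs lie_der_linear)

lemma lie_der_ce_cochains: "\<omega> \<in> ce_cochains n \<Longrightarrow> lie_der x \<omega> \<in> ce_cochains n"
proof -
  assume w: "\<omega> \<in> ce_cochains n"
  then have "slotlin id_slot (der (br x) \<omega>)" "alt (der (br x) \<omega>)"
    by (auto simp: ce_cochains_iff intro: slotlin_der br_fiberlin alt_der)
  then show ?thesis
  proof -
    assume d: "slotlin id_slot (der (br x) \<omega>)" "alt (der (br x) \<omega>)"
    have "lie_der x \<omega> as = 0" if "length as \<noteq> n" for as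
      using w that der_wrong_length[of n \<omega> as "br x"] by (simp add: lie_der_def ce_cochains_iff)
    moreover have "slotlin id_slot (lie_der x \<omega>)"
      unfolding slotlin_def lie_der_def by (intro allI VC.linear_compose_neg slotlinD[OF d(1)])
    moreover have "alt (lie_der x \<omega>)"
      unfolding alt_def lie_der_def using altD[OF d(2)] by (metis minus_minus)
    ultimately show ?thesis by (simp add: ce_cochains_iff)
  qed
qed

lemma subspace_ce_cochains: "forms.V.subspace (ce_cochains n)"
proof (rule forms.V.subspaceI)
  show "0 \<in> ce_cochains n"
    using VC.linear_zero by (auto simp: ce_cochains_iff slotlin_def alt_def zero_fun_def)
next
  fix \<omega> \<eta> assume "\<omega> \<in> ce_cochains n" "\<eta> \<in> ce_cochains n"
  then have w: "\<forall>as. length as \<noteq> n \<longrightarrow> \<omega> as = 0" "slotlin id_slot \<omega>" "alt \<omega>"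
    "\<forall>as. length as \<noteq> n \<longrightarrow> \<eta> as = 0" "slotlin id_slot \<eta>" "alt \<eta>"
    by (simp_all add: ce_cochains_iff)
  have "slotlin id_slot (\<omega> + \<eta>)"
    unfolding slotlin_def plus_fun_apply
    by (intro allI VC.linear_compose_add slotlinD[OF w(2)] slotlinD[OF w(5)])
  moreover have "alt (\<omega> + \<eta>)"
    unfolding alt_def plus_fun_apply
  proof (intro allI)
    fix us x y vs
    show "\<omega> (us @ x # y # vs) + \<eta> (us @ x # y # vs) = - (\<omega> (us @ y # x # vs) + \<eta> (us @ y # x # vs))"
      using altD[OF w(3), of us x y vs] altD[OF w(6), of us x y vs] by simp
  qed
  ultimately show "\<omega> + \<eta> \<in> ce_cochains n"
    using w(1,4) by (simp add: ce_cochains_iff)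
next
  fix c \<omega> assume "\<omega> \<in> ce_cochains n"
  then have w: "\<forall>as. length as \<noteq> n \<longrightarrow> \<omega> as = 0" "slotlin id_slot \<omega>" "alt \<omega>"
    by (simp_all add: ce_cochains_iff)
  have "slotlin id_slot (fscale c \<omega>)"
    unfolding slotlin_def fscale_def
    by (intro allI VC.linear_compose_scale_right slotlinD[OF w(2)])
  moreover have "alt (fscale c \<omega>)"
    unfolding alt_def fscale_def
  proof (intro allI)
    fix us x y vs
    show "c * \<omega> (us @ x # y # vs) = - (c * \<omega> (us @ y # x # vs))"
      using altD[OF w(3), of us x y vs] by simp
  qed
  ultimately show "fscale c \<omega> \<in> ce_cochains n"
    using w(1) by (simp add: ce_cochains_iff fscale_def)
qed

end

context semisimple_lie_algebra
begin

lemma fin_dim_ce_cochains: "forms.V.fin_dim (ce_cochains n)"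
proof -
  obtain B where B: "basis_of B UNIV"
    using basis_of_exists[OF subspace_UNIV fin_dim_any] .
  let ?L = "{bs. set bs \<subseteq> B \<and> length bs = n}"
  have fin: "finite ?L" using finite_lists_length_eq[OF basis_ofD(1)[OF B]] .
  define \<delta> where "\<delta> bs as = (if length as = n then basis_coeff B bs as else 0)" for bs as
  have "ce_cochains n \<subseteq> forms.V.span (\<delta> ` ?L)"
  proof
    fix \<omega> assume w: "\<omega> \<in> ce_cochains n"
    have "\<omega> = (\<Sum>bs\<in>?L. fscale (\<omega> bs) (\<delta> bs))"
    proof
      fix as
      have "(\<Sum>bs\<in>?L. fscale (\<omega> bs) (\<delta> bs)) as = (\<Sum>bs\<in>?L. \<omega> bs * \<delta> bs as)"
        using fin by (induction rule: finite_induct) (auto simp: fscale_def)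
      then show "\<omega> as = (\<Sum>bs\<in>?L. fscale (\<omega> bs) (\<delta> bs)) as"
        using w multilinear_expand[OF B, of \<omega> as]
        by (cases "length as = n") (auto simp: ce_cochains_iff \<delta>_def mult.commute)
    qed
    also have "\<dots> \<in> forms.V.span (\<delta> ` ?L)"
      by (intro forms.V.span_sum forms.V.span_scale forms.V.span_base) auto
    finally show "\<omega> \<in> forms.V.span (\<delta> ` ?L)" .
  qed
  then show ?thesis unfolding forms.V.fin_dim_def using fin by blast
qed

lemma rep_on_ce_cochains: "forms.rep_on UNIV (ce_cochains n)"
  unfolding forms.rep_on_def
proof (intro conjI allI ballI)
  show "forms.V.subspace (ce_cochains n)" by (rule subspace_ce_cochains)
  show "forms.V.fin_dim (ce_cochains n)" by (rule fin_dim_ce_cochains)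
  fix x y c \<omega> assume w: "\<omega> \<in> ce_cochains n"
  then show "lie_der x \<omega> \<in> ce_cochains n" by (rule lie_der_ce_cochains)
  interpret F: Vector_Spaces.linear scale "(*)" "\<lambda>a. \<omega> (us @ a # vs)" for us vs
    using w slotlinD[of id_slot \<omega> _ "()"] by (simp add: ce_cochains_iff)
  show "lie_der (x + y) \<omega> = lie_der x \<omega> + lie_der y \<omega>"
    by (auto simp: lie_der_def der_nth br_left F.add sum.distrib)
  show "lie_der (scale c x) \<omega> = fscale c (lie_der x \<omega>)"
    by (auto simp: lie_der_def fscale_def der_nth br_left F.scale sum_distrib_left)
  show "lie_der (br x y) \<omega> = lie_der x (lie_der y \<omega>) - lie_der y (lie_der x \<omega>)"
  proof
    fix as
    have "lie_der x (lie_der y \<omega>) as - lie_der y (lie_der x \<omega>) as =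
        der (br x) (der (br y) \<omega>) as - der (br y) (der (br x) \<omega>) as"
      by (simp add: lie_der_def[abs_def] der_minus)
    also have "\<dots> = lie_der (br x y) \<omega> as"
      unfolding der_commutator
      by (simp add: lie_der_def der_nth br_br F.diff sum_subtractf)
    finally show "lie_der (br x y) \<omega> as = (lie_der x (lie_der y \<omega>) - lie_der y (lie_der x \<omega>)) as"
      by simp
  qed
qed

sublocale forms: semisimple_action scale br "fscale :: complex \<Rightarrow> ('a list \<Rightarrow> complex) \<Rightarrow> _" lie_der
  by (intro semisimple_action.intro semisimple_lie_algebra_axioms forms.lie_action_axioms)

definition invariant_cochains :: "nat \<Rightarrow> ('a list \<Rightarrow> complex) set" where
  "invariant_cochains n = forms.invariants (ce_cochains n)"

lemma Carr_invariant_forms: "Carr (invariant_forms n) = invariant_cochains n"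
proof -
  have "(\<forall>x as. length as = n \<longrightarrow> (\<Sum>i<n. - \<omega> (as[i := br x (as ! i)])) = 0) \<longleftrightarrow> (\<forall>x. lie_der x \<omega> = 0)"
    if w: "\<omega> \<in> ce_cochains n" for \<omega>
  proof -
    have "lie_der x \<omega> as = (if length as = n then \<Sum>i<n. - \<omega> (as[i := br x (as ! i)]) else 0)" for x as
      using w der_wrong_length[of n \<omega> as "br x"]
      by (auto simp: lie_der_def der_update sum_negf ce_cochains_iff)
    then show ?thesis by (auto simp: fun_eq_iff)
  qed
  then show ?thesis
    by (auto simp: invariant_forms_def invariant_cochains_def forms.invariants_def)
qed

lemma rd_invariant:
  assumes "\<omega> \<in> invariant_cochains n"
  shows "rd br \<omega> = (\<lambda>_. 0)"
proof
  fix as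
  have w: "\<omega> \<in> ce_cochains n" "\<And>x. lie_der x \<omega> = 0"
    using assms by (auto simp: invariant_cochains_def forms.invariants_def)
  have "der (br x) \<omega> = (\<lambda>_. 0)" for x
    using w(2)[of x] by (auto simp: lie_der_def fun_eq_iff)
  then have "- 2 * rd br \<omega> as = alt_sum (\<lambda>_ _. 0) as"
    using twice_rd[of \<omega> br as] w(1) slotlin_skew[of \<omega>] by (simp add: ce_cochains_iff)
  then show "rd br \<omega> as = 0" by (simp add: alt_sum_zero)
qed

lemma lie_der_cocycle:
  assumes "\<omega> \<in> ce_cochains (Suc m)" "rd br \<omega> = (\<lambda>_. 0)"
  shows "lie_der x \<omega> = rd br (\<lambda>as. \<omega> (x # as))" "(\<lambda>as. \<omega> (x # as)) \<in> ce_cochains m"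
proof -
  have "rd br \<omega> (x # as) = 0" for as by (simp only: assms(2))
  then show "lie_der x \<omega> = rd br (\<lambda>as. \<omega> (x # as))"
    by (auto simp: lie_der_def)
  show "(\<lambda>as. \<omega> (x # as)) \<in> ce_cochains m"
    using assms(1) slotlin_Cons[of id_slot \<omega> x] alt_Cons[of \<omega> x] by (auto simp: ce_cochains_iff)
qed

lemma rd_linear: "Vector_Spaces.linear fscale fscale (rd br)"
proof -
  have "rd br (\<omega> + \<eta>) = rd br \<omega> + rd br \<eta>" for \<omega> \<eta> :: "'a list \<Rightarrow> complex"
    by (auto simp: plus_fun_def rd_add)
  moreover have "rd br (fscale c \<omega>) = fscale c (rd br \<omega>)" for c and \<omega> :: "'a list \<Rightarrow> complex"
  proof
    fix as
    show "rd br (fscale c \<omega>) as = fscale c (rd br \<omega>) as"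
      using rd_scale[of br c \<omega> as] by (simp add: fscale_def[abs_def])
  qed
  ultimately show ?thesis by unfold_locales
qed

text \<open>The cocycles form a subrepresentation. The complement of its invariants is spanned by
  Lie derivatives of cocycles, which are exact by \<open>lie_der_cocycle\<close>.\<close>

lemma cocycle_invariant_part:
  assumes w: "\<omega> \<in> ce_cochains n" "rd br \<omega> = (\<lambda>_. 0)"
  obtains a where "a \<in> invariant_cochains n" "n = 0 \<Longrightarrow> \<omega> = a"
    "\<And>m. n = Suc m \<Longrightarrow> \<exists>\<eta>\<in>ce_cochains m. \<omega> - a = rd br \<eta>"
proof -
  interpret rd: Vector_Spaces.linear "fscale :: complex \<Rightarrow> ('a list \<Rightarrow> complex) \<Rightarrow> _" fscale "rd br"
    by (rule rd_linear)
  let ?Z = "{\<omega> \<in> ce_cochains n. rd br \<omega> = (\<lambda>_. 0)}"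
  have sZ: "forms.V.subspace ?Z"
  proof -
    have "?Z = ce_cochains n \<inter> {\<omega>. rd br \<omega> = 0}" by (auto simp: zero_fun_def)
    moreover have "forms.V.subspace {\<omega>. rd br \<omega> = 0}" by (rule rd.subspace_kernel)
    ultimately show ?thesis
      using forms.V.subspace_inter[OF subspace_ce_cochains[of n]] by metis
  qed
  have rZ: "forms.rep_on UNIV ?Z"
  proof (rule forms.rep_on_submodule[OF rep_on_ce_cochains sZ])
    fix x \<omega> assume w: "\<omega> \<in> ?Z"
    then have "rd br (der (br x) \<omega>) as = der (br x) (rd br \<omega>) as" for as
      by (intro rd_lie_derivative slotlin_jacobi) (simp add: ce_cochains_iff)
    then have "rd br (lie_der x \<omega>) as = 0" for as
      using w by (simp add: lie_der_def[abs_def] rd_minus)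
    then show "lie_der x \<omega> \<in> ?Z" using w lie_der_ce_cochains by auto
  qed auto
  obtain a where a: "a \<in> forms.invariants ?Z" "\<omega> - a \<in> forms.moved ?Z"
    using forms.invariants_complement(2)[OF rZ, of \<omega>] w by blast
  show ?thesis
  proof (rule that)
    show "a \<in> invariant_cochains n"
      using a(1) by (auto simp: invariant_cochains_def forms.invariants_def)
  next
    assume "n = 0"
    have "lie_der x z = 0" if "z \<in> ?Z" for x z
    proof
      fix as
      show "lie_der x z as = 0 as"
        using that \<open>n = 0\<close> der_wrong_length[of 0 z as "br x"]
        by (cases as) (auto simp: lie_der_def ce_cochains_iff)
    qed
    then have "{lie_der x z |x z. z \<in> ?Z} \<subseteq> {0}" by auto
    then have "forms.moved ?Z \<subseteq> {0}"
      unfolding forms.moved_def by (rule forms.V.span_minimal) simp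
    then show "\<omega> = a" using a(2) by auto
  next
    fix m assume n: "n = Suc m"
    have "{lie_der x z |x z. z \<in> ?Z} \<subseteq> rd br ` ce_cochains m"
    proof
      fix y assume "y \<in> {lie_der x z |x z. z \<in> ?Z}"
      then obtain x z where xz: "y = lie_der x z" "z \<in> ?Z" by blast
      then have "z \<in> ce_cochains (Suc m)" "rd br z = (\<lambda>_. 0)" using n by auto
      then show "y \<in> rd br ` ce_cochains m"
        using lie_der_cocycle[of z m x] xz(1) by auto
    qed
    then have "forms.moved ?Z \<subseteq> rd br ` ce_cochains m"
      unfolding forms.moved_def
      by (rule forms.V.span_minimal) (rule rd.subspace_image[OF subspace_ce_cochains])
    then show "\<exists>\<eta>\<in>ce_cochains m. \<omega> - a = rd br \<eta>" using a(2) by auto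
  qed
qed

text \<open>Subtracting an invariant form, which is closed, turns the primitive into a combination
  of Lie derivatives. Its differential is then such a combination too, and an invariant form of this
  kind is zero.\<close>

lemma invariant_coboundary:
  assumes a: "a \<in> invariant_cochains (Suc m)" "a = rd br \<eta>" "\<eta> \<in> ce_cochains m"
  shows "a = 0"
proof -
  interpret rd: Vector_Spaces.linear "fscale :: complex \<Rightarrow> ('a list \<Rightarrow> complex) \<Rightarrow> _" fscale "rd br"
    by (rule rd_linear)
  obtain b where b: "b \<in> forms.invariants (ce_cochains m)" "\<eta> - b \<in> forms.moved (ce_cochains m)"
    using forms.invariants_complement(2)[OF rep_on_ce_cochains a(3)] by blast
  have "rd br b = 0"
    using rd_invariant[of b m] b(1) by (simp add: invariant_cochains_def zero_fun_def)
  then have "a = rd br (\<eta> - b)" by (simp add: a(2) rd.diff)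
  also have "rd br (\<eta> - b) \<in> forms.moved (ce_cochains (Suc m))"
    using b(2) unfolding forms.moved_def[of "ce_cochains m"]
  proof (induction rule: forms.V.span_induct_alt)
    case base
    then show ?case using forms.V.subspace_0[OF forms.subspace_moved] by (simp only: rd.zero)
  next
    case (step c z y)
    then obtain x w where xw: "z = lie_der x w" "w \<in> ce_cochains m" by blast
    have "rd br (der (br x) w) as = der (br x) (rd br w) as" for as
      using xw(2) by (intro rd_lie_derivative slotlin_jacobi) (simp add: ce_cochains_iff)
    then have "rd br z = lie_der x (rd br w)"
      unfolding xw(1) by (auto simp: lie_der_def[abs_def] rd_minus)
    then have "rd br z \<in> forms.moved (ce_cochains (Suc m))"
      using forms.act_in_moved rd_ce_cochains[OF xw(2)] by simp
    then show ?case
      using step.IH unfolding rd.add rd.scale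
      by (intro forms.V.subspace_add forms.V.subspace_scale forms.subspace_moved)
  qed
  finally show ?thesis
    using forms.invariants_complement(1)[OF rep_on_ce_cochains, of "Suc m"] a(1)
    by (auto simp: invariant_cochains_def)
qed

end

section \<open>The degree homotopy\<close>

lemma der_weight:
  fixes T :: "'i::comm_monoid_add \<times> 'x \<Rightarrow> 'i \<times> 'x"
  assumes "\<And>y. fst (T y) = t + fst y"
  shows "der T (\<lambda>xs. \<phi> (sum_list (map fst xs)) * F xs) xs = \<phi> (t + sum_list (map fst xs)) * der T F xs"
proof (induction xs arbitrary: \<phi> F)
  case Nil
  then show ?case by simp
next
  case (Cons y ys)
  show ?case
    using Cons.IH[of "\<lambda>s. \<phi> (fst y + s)" "\<lambda>zs. F (y # zs)"]
    by (simp add: assms distrib_left add.assoc add.left_commute)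
qed

text \<open>Brackets preserve the total index. The lemma serves both for the degree in
  \<open>t\<close>, with the weight \<open>- 1 / degree\<close>, and for the sum of the spectral
  parameters, by which \<partial> multiplies.\<close>

lemma rd_weight:
  fixes b :: "'i::comm_monoid_add \<times> 'x \<Rightarrow> 'i \<times> 'x \<Rightarrow> 'i \<times> 'x"
  assumes "\<And>x y. fst (b x y) = fst x + fst y"
  shows "rd b (\<lambda>xs. \<phi> (sum_list (map fst xs)) * F xs) xs = \<phi> (sum_list (map fst xs)) * rd b F xs"
proof (induction xs arbitrary: \<phi> F)
  case Nil
  then show ?case by simp
next
  case (Cons x xs)
  have "der (b x) (\<lambda>xs. \<phi> (sum_list (map fst xs)) * F xs) xs = \<phi> (fst x + sum_list (map fst xs)) * der (b x) F xs"
    by (rule der_weight) (rule assms)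
  then show ?case
    using Cons.IH[of "\<lambda>s. \<phi> (fst x + s)" "\<lambda>zs. F (x # zs)"]
    by (simp add: right_diff_distrib)
qed

text \<open>Reduces an identity for all other slots to one for a single pair: \<open>y\<close> is
  the first slot, and \<open>z\<close> runs through the rest.\<close>

lemma sum_der_pairs_zero:
  assumes "\<And>us z vs. (\<Sum>k\<in>K. F (T k y # us @ U k z # vs) + F (U k y # us @ T k z # vs) - F (X k # us @ B k y z # vs)) = 0"
  shows "(\<Sum>k\<in>K. der (U k) (\<lambda>zs. F (T k y # zs)) ys + der (T k) (\<lambda>zs. F (U k y # zs)) ys -
    der (B k y) (\<lambda>zs. F (X k # zs)) ys) = 0"
  unfolding der_nth sum.distrib[symmetric] sum_subtractf[symmetric]
  by (subst sum.swap) (simp add: assms)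

text \<open>This shift matches the two-slot terms with the defect terms. The vanishing of
  \<open>g\<close> from \<open>N\<close> on allows both sums to have the same range.\<close>

lemma sum_shift_truncated:
  fixes g :: "nat \<Rightarrow> complex"
  assumes "\<And>p. N \<le> p \<Longrightarrow> g p = 0"
  shows "(\<Sum>p=1..<N. if p \<le> n then g (p + m) else 0) = (\<Sum>p=1..<N. if m < p \<and> p \<le> m + n then g p else 0)"
proof -
  have "(\<Sum>p=1..<N. if p \<le> n then g (p + m) else 0) = (\<Sum>p=1..n. g (p + m))"
    by (rule sum.mono_neutral_cong) (auto simp: assms)
  also have "\<dots> = (\<Sum>p=1+m..n+m. g p)"
    by (rule sum.shift_bounds_cl_nat_ivl[symmetric])
  also have "\<dots> = (\<Sum>p=1..<N. if m < p \<and> p \<le> m + n then g p else 0)"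
    by (rule sum.mono_neutral_cong) (auto simp: assms)
  finally show ?thesis .
qed

definition degree_bounded :: "nat \<Rightarrow> ((nat \<times> 'x) list \<Rightarrow> complex) \<Rightarrow> bool" where
  "degree_bounded N F \<longleftrightarrow> (\<forall>us k a vs. N \<le> k \<longrightarrow> F (us @ (k, a) # vs) = 0)"

lemma degree_boundedD: "degree_bounded N F \<Longrightarrow> N \<le> k \<Longrightarrow> F (us @ (k, a) # vs) = 0"
  unfolding degree_bounded_def by blast

lemma degree_boundedD0: "degree_bounded N F \<Longrightarrow> N \<le> k \<Longrightarrow> F ((k, a) # vs) = 0"
  using degree_boundedD[of N F k "[]"] by simp

lemma degree_bounded_Cons:
  assumes "degree_bounded N F"
  shows "degree_bounded N (\<lambda>ys. F (x # ys))"
  unfolding degree_bounded_def using degree_boundedD[OF assms, of _ "x # us" for us] by simp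

context lie_algebra
begin

text \<open>For natural indices \<open>(i, a)\<close> stands for \<open>t^i a\<close> in \<gg>[t];
  for complex indices the sum is the parameter \<lambda> + \<mu> that goes with a \<lambda>-bracket.
  One operation serves both sides of the Taylor transform.\<close>

definition pair_br :: "'i::comm_monoid_add \<times> 'g \<Rightarrow> 'i \<times> 'g \<Rightarrow> 'i \<times> 'g" where
  "pair_br x y = (fst x + fst y, br (snd x) (snd y))"

lemma pair_br_simps [simp]: "pair_br (i, a) (j, c) = (i + j, br a c)" "fst (pair_br x y) = fst x + fst y"
  "snd (pair_br x y) = br (snd x) (snd y)"
  by (simp_all add: pair_br_def)

lemma pair_br_fiberlin: "fiberlin Pair (pair_br x)" "fiberlin Pair (\<lambda>y. pair_br y x)"
  unfolding fiberlin_def pair_br_def using br_linear_right br_linear_left by (metis fst_conv snd_conv)+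

lemma slotlin_pair_skew:
  assumes "slotlin Pair F"
  shows "skew_on pair_br F"
  unfolding skew_on_def
proof (intro allI)
  fix us x y vs
  interpret F: Vector_Spaces.linear scale "(*)" "\<lambda>a. F (us @ (i, a) # vs)" for i
    using assms by (rule slotlinD)
  show "F (us @ pair_br x y # vs) = - F (us @ pair_br y x # vs)"
    using br_swap[of "snd x" "snd y"] by (simp add: pair_br_def F.neg add.commute)
qed

lemma slotlin_pair_jacobi:
  assumes "slotlin Pair F"
  shows "jacobi_on pair_br F"
  unfolding jacobi_on_def
proof (intro allI)
  fix us x y z vs
  interpret F: Vector_Spaces.linear scale "(*)" "\<lambda>a. F (us @ (i, a) # vs)" for i
    using assms by (rule slotlinD)
  show "F (us @ pair_br x (pair_br y z) # vs) = F (us @ pair_br (pair_br x y) z # vs) + F (us @ pair_br y (pair_br x z) # vs)"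
    by (simp add: pair_br_def br_br F.diff add.assoc add.left_commute)
qed

text \<open>The truncated action of \<open>t^(-p) c\<close>. When \<open>p\<close> exceeds the
  degree, the vector is zero and the index cut off at 0 by natural subtraction does no harm in a
  slot of a multilinear form.\<close>

definition lower :: "'g \<Rightarrow> nat \<Rightarrow> nat \<times> 'g \<Rightarrow> nat \<times> 'g" where
  "lower c p x = (fst x - p, if p \<le> fst x then br c (snd x) else 0)"

text \<open>The deviation of \<open>lower c p\<close> from a derivation of the bracket. Its three
  terms have the same degree whenever their vectors are nonzero, so they fit into one pair.\<close>

definition lower_defect :: "'g \<Rightarrow> nat \<Rightarrow> nat \<times> 'g \<Rightarrow> nat \<times> 'g \<Rightarrow> nat \<times> 'g" where
  "lower_defect c p x y = (fst x + fst y - p,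
     (if p \<le> fst x then br (br c (snd x)) (snd y) else 0) +
     (if p \<le> fst y then br (snd x) (br c (snd y)) else 0) -
     (if p \<le> fst x + fst y then br c (br (snd x) (snd y)) else 0))"

lemma lower_fiberlin: "fiberlin Pair (lower c p)"
  unfolding fiberlin_def
proof
  fix k
  show "\<exists>j L. Vector_Spaces.linear scale scale L \<and> (\<forall>a. lower c p (k, a) = (j, L a))"
  proof (cases "p \<le> k")
    case True
    then show ?thesis
      using br_linear_right by (intro exI[of _ "k - p"] exI[of _ "br c"]) (auto simp: lower_def)
  next
    case False
    have "Vector_Spaces.linear scale scale (\<lambda>_. 0)"
      by unfold_locales auto
    then show ?thesis
      using False by (intro exI[of _ "k - p"] exI[of _ "\<lambda>_. 0"]) (auto simp: lower_def)
  qed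
qed

lemma lower_defect:
  assumes "slotlin Pair F"
  shows "F (us @ lower_defect c p y z # vs) = F (us @ pair_br (lower c p y) z # vs) +
    F (us @ pair_br y (lower c p z) # vs) - F (us @ lower c p (pair_br y z) # vs)"
proof -
  interpret F: Vector_Spaces.linear scale "(*)" "\<lambda>a. F (us @ (i, a) # vs)" for i
    using assms by (rule slotlinD)
  have "F (us @ lower_defect c p y z # vs) =
      F (us @ (fst y + fst z - p, if p \<le> fst y then br (br c (snd y)) (snd z) else 0) # vs) +
      F (us @ (fst y + fst z - p, if p \<le> fst z then br (snd y) (br c (snd z)) else 0) # vs) -
      F (us @ (fst y + fst z - p, if p \<le> fst y + fst z then br c (br (snd y) (snd z)) else 0) # vs)"
    unfolding lower_defect_def F.add F.diff ..
  moreover have "F (us @ pair_br (lower c p y) z # vs) =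
      F (us @ (fst y + fst z - p, if p \<le> fst y then br (br c (snd y)) (snd z) else 0) # vs)"
    by (simp add: lower_def pair_br_def F.zero br_left)
  moreover have "F (us @ pair_br y (lower c p z) # vs) =
      F (us @ (fst y + fst z - p, if p \<le> fst z then br (snd y) (br c (snd z)) else 0) # vs)"
    by (simp add: lower_def pair_br_def F.zero br_right)
  moreover have "F (us @ lower c p (pair_br y z) # vs) =
      F (us @ (fst y + fst z - p, if p \<le> fst y + fst z then br c (br (snd y) (snd z)) else 0) # vs)"
    by (simp add: lower_def)
  ultimately show ?thesis by simp
qed

end

context lie_algebra
begin

context
  fixes B :: "'g set" and d :: "'g \<Rightarrow> 'g"
  assumes casimir_pair: "casimir_pair B d"
begin

private lemma inv_tensor:
  assumes "\<And>u. Vector_Spaces.linear scale (*) (\<lambda>v. \<Psi> v u)" "\<And>u. Vector_Spaces.linear scale (*) (\<Psi> u)"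
  shows "(\<Sum>b\<in>B. (\<Psi> b (br (d b) a) :: complex)) = - (\<Sum>b\<in>B. \<Psi> (br b a) (d b))"
  using casimir_pair assms by (simp add: casimir_pair_def)

private lemma casimir: "(\<Sum>b\<in>B. br b (br (d b) a)) = a"
  using casimir_pair by (simp add: casimir_pair_def)

text \<open>The affine Sugawara operator, with \<open>\<iota>\<^bsub>t\<^sup>p b\<^esub>\<close> in place of the positive modes.\<close>

definition sugawara :: "nat \<Rightarrow> ((nat \<times> 'g) list \<Rightarrow> complex) \<Rightarrow> (nat \<times> 'g) list \<Rightarrow> complex" where
  "sugawara N F xs = (\<Sum>p=1..<N. \<Sum>b\<in>B. der (lower (d b) p) (\<lambda>ys. F ((p, b) # ys)) xs)"

text \<open>For slots of degrees m and n the defect is supported on \<open>m < p \<le> m + n\<close>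
  and on \<open>n < p \<le> m + n\<close>, by the Jacobi identity. The two products have
  \<open>p \<le> n\<close> and \<open>p \<le> m\<close>; shifted by m and by n they occupy exactly
  these ranges, and invariance of the Casimir tensor identifies the summands.\<close>

lemma sugawara_pair_identity:
  assumes F: "slotlin Pair F" "alt F" "degree_bounded N F"
  shows "(\<Sum>p=1..<N. \<Sum>b\<in>B. F (lower (d b) p y # us @ pair_br (p, b) z # vs) +
    F (pair_br (p, b) y # us @ lower (d b) p z # vs) - F ((p, b) # us @ lower_defect (d b) p y z # vs)) = 0"
proof -
  define f where "f i j u v = F ((i, u) # us @ (j, v) # vs)" for i j u v
  interpret fl: Vector_Spaces.linear scale "(*)" "\<lambda>u. f i j u v" for i j v
    unfolding f_def by (rule slotlinD0[OF F(1)])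
  interpret fr: Vector_Spaces.linear scale "(*)" "\<lambda>v. f i j u v" for i j u
    unfolding f_def using slotlinD[OF F(1), of "(i, u) # us" j vs] by simp
  have f_swap: "f i j u v = - f j i v u" for i j u v
    unfolding f_def using alt_swap[OF F(2), of "[]" "(i, u)" us "(j, v)" vs] by simp
  have f0: "f i j u v = 0" if "N \<le> i \<or> N \<le> j" for i j u v
    unfolding f_def using that degree_boundedD0[OF F(3), of i] degree_boundedD[OF F(3), of j "(i, u) # us"] by auto
  obtain m a where y: "y = (m, a)" by (cases y)
  obtain n c where z: "z = (n, c)" by (cases z)
  \<comment> \<open>Normal forms of the terms: \<open>b\<close> acts on the left slot in
    \<open>g1\<close> and on the right slot in \<open>g2\<close>, and \<open>p\<close> is the
    resulting degree of that slot.\<close>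
  define g1 where "g1 p = (\<Sum>b\<in>B. f p (m + n - p) (br b a) (br (d b) c))" for p
  define g2 where "g2 p = (\<Sum>b\<in>B. f (m + n - p) p (br (d b) a) (br b c))" for p
  have g0: "g1 p = 0" "g2 p = 0" if "N \<le> p" for p
    using f0 that by (simp_all add: g1_def g2_def)
  note lin_br = Vector_Spaces.linear_compose[OF br_linear_left] Vector_Spaces.linear_compose[OF br_linear_right]
  have t1: "(\<Sum>b\<in>B. f p q b (br (br (d b) a) c)) = - (\<Sum>b\<in>B. f p q (br b a) (br (d b) c))" for p q
  proof (rule inv_tensor)
    show "Vector_Spaces.linear scale (*) (\<lambda>v. f p q v (br u c))" for u
      by (rule fl.linear_axioms)
    show "Vector_Spaces.linear scale (*) (\<lambda>v. f p q u (br v c))" for u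
      using lin_br(1)[OF fr.linear_axioms] by (simp add: o_def)
  qed
  have "(\<Sum>b\<in>B. f p q b (br a (br (d b) c))) = - (\<Sum>b\<in>B. f p q (br b c) (br a (d b)))" for p q
  proof (rule inv_tensor)
    show "Vector_Spaces.linear scale (*) (\<lambda>v. f p q v (br a u))" for u
      by (rule fl.linear_axioms)
    show "Vector_Spaces.linear scale (*) (\<lambda>v. f p q u (br a v))" for u
      using lin_br(2)[OF fr.linear_axioms] by (simp add: o_def)
  qed
  moreover have "f p q (br b c) (br a (d b)) = f q p (br (d b) a) (br b c)" for p q b
    using f_swap[of p q "br b c"] by (subst (2) br_swap) (simp add: fr.neg)
  ultimately have t2: "(\<Sum>b\<in>B. f p q b (br a (br (d b) c))) = - (\<Sum>b\<in>B. f q p (br (d b) a) (br b c))" for p q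
    by simp
  have defect: "F ((p, b) # us @ lower_defect (d b) p y z # vs) =
      (if m < p \<and> p \<le> m + n then - f p (m + n - p) b (br (br (d b) a) c) else 0) +
      (if n < p \<and> p \<le> m + n then - f p (m + n - p) b (br a (br (d b) c)) else 0)" for p b
  proof -
    have "lower_defect (d b) p y z = (m + n - p,
        (if m < p \<and> p \<le> m + n then - br (br (d b) a) c else 0) +
        (if n < p \<and> p \<le> m + n then - br a (br (d b) c) else 0))"
      using br_jacobi[of "d b" a c] by (auto simp: lower_defect_def y z)
    then have "F ((p, b) # us @ lower_defect (d b) p y z # vs) = f p (m + n - p) b
        ((if m < p \<and> p \<le> m + n then - br (br (d b) a) c else 0) +
         (if n < p \<and> p \<le> m + n then - br a (br (d b) c) else 0))"
      by (simp add: f_def)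
    then show ?thesis by (simp add: fr.add fr.neg fr.zero)
  qed
  have sum_if: "(\<Sum>b\<in>B. if C then X b else 0) = (if C then \<Sum>b\<in>B. X b else 0)" for C and X :: "'g \<Rightarrow> complex"
    by simp
  have D: "(\<Sum>p=1..<N. \<Sum>b\<in>B. F ((p, b) # us @ lower_defect (d b) p y z # vs)) =
      (\<Sum>p=1..<N. if m < p \<and> p \<le> m + n then g1 p else 0) + (\<Sum>p=1..<N. if n < p \<and> p \<le> n + m then g2 p else 0)"
    unfolding sum.distrib[symmetric]
  proof (intro sum.cong refl)
    fix p
    have "(\<Sum>b\<in>B. if m < p \<and> p \<le> m + n then - f p (m + n - p) b (br (br (d b) a) c) else 0) =
        (if m < p \<and> p \<le> m + n then g1 p else 0)"
      using t1[of p "m + n - p"] unfolding sum_if by (simp add: g1_def sum_negf)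
    moreover have "(\<Sum>b\<in>B. if n < p \<and> p \<le> m + n then - f p (m + n - p) b (br a (br (d b) c)) else 0) =
        (if n < p \<and> p \<le> n + m then g2 p else 0)"
      using t2[of p "m + n - p"] unfolding sum_if by (simp add: g2_def sum_negf add.commute[of n m])
    ultimately show "(\<Sum>b\<in>B. F ((p, b) # us @ lower_defect (d b) p y z # vs)) =
        (if m < p \<and> p \<le> m + n then g1 p else 0) + (if n < p \<and> p \<le> n + m then g2 p else 0)"
      unfolding defect sum.distrib by simp
  qed
  have U: "(\<Sum>p=1..<N. \<Sum>b\<in>B. F (pair_br (p, b) y # us @ lower (d b) p z # vs)) =
      (\<Sum>p=1..<N. if p \<le> n then g1 (p + m) else 0)"
  proof (intro sum.cong refl)
    fix p
    have "F (pair_br (p, b) y # us @ lower (d b) p z # vs) =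
        (if p \<le> n then f (p + m) (m + n - (p + m)) (br b a) (br (d b) c) else 0)" for b
      using fr.zero[of "p + m" "n - p" "br b a"] by (auto simp: f_def y z lower_def)
    then show "(\<Sum>b\<in>B. F (pair_br (p, b) y # us @ lower (d b) p z # vs)) = (if p \<le> n then g1 (p + m) else 0)"
      by (simp add: g1_def)
  qed
  have L: "(\<Sum>p=1..<N. \<Sum>b\<in>B. F (lower (d b) p y # us @ pair_br (p, b) z # vs)) =
      (\<Sum>p=1..<N. if p \<le> m then g2 (p + n) else 0)"
  proof (intro sum.cong refl)
    fix p
    have "F (lower (d b) p y # us @ pair_br (p, b) z # vs) =
        (if p \<le> m then f (m + n - (p + n)) (p + n) (br (d b) a) (br b c) else 0)" for b
      using fl.zero[of "m - p" "p + n" "br b c"] by (auto simp: f_def y z lower_def)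
    then show "(\<Sum>b\<in>B. F (lower (d b) p y # us @ pair_br (p, b) z # vs)) = (if p \<le> m then g2 (p + n) else 0)"
      by (simp add: g2_def)
  qed
  show ?thesis
    unfolding sum_subtractf sum.distrib D U L
    using sum_shift_truncated[of N g1 n m, OF g0(1)] sum_shift_truncated[of N g2 m n, OF g0(2)] by simp
qed

lemma sugawara_degree:
  assumes "slotlin Pair F" "alt F" "degree_bounded N F"
  shows "(\<Sum>p=1..<N. \<Sum>b\<in>B. der (lower (d b) p) (der (pair_br (p, b)) F) xs +
    rd (lower_defect (d b) p) (\<lambda>ys. F ((p, b) # ys)) xs) = of_nat (sum_list (map fst xs)) * F xs"
  using assms
proof (induction xs arbitrary: F)
  case Nil
  then show ?case by simp
next
  case (Cons y ys)
  let ?F = "\<lambda>zs. F (y # zs)" and ?K = "{1..<N} \<times> B"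
  note F = Cons.prems
  obtain m a where y: "y = (m, a)" by (cases y)
  interpret F: Vector_Spaces.linear scale "(*)" "\<lambda>a. F ((i, a) # zs)" for i zs
    by (rule slotlinD0[OF F(1)])
  have swap: "rd (lower_defect c p) (\<lambda>zs. F ((p, b) # y # zs)) ys = - rd (lower_defect c p) (\<lambda>zs. F (y # (p, b) # zs)) ys" for c p b
    unfolding rd_minus[symmetric] using altD0[OF F(2), of "(p, b)" y] by simp
  have split: "der (lower (d b) p) (der (pair_br (p, b)) F) (y # ys) + rd (lower_defect (d b) p) (\<lambda>zs. F ((p, b) # zs)) (y # ys) =
      F (pair_br (p, b) (lower (d b) p y) # ys) +
      (der (pair_br (p, b)) (\<lambda>zs. F (lower (d b) p y # zs)) ys + der (lower (d b) p) (\<lambda>zs. F (pair_br (p, b) y # zs)) ys -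
        der (lower_defect (d b) p y) (\<lambda>zs. F ((p, b) # zs)) ys) +
      (der (lower (d b) p) (der (pair_br (p, b)) ?F) ys + rd (lower_defect (d b) p) (\<lambda>zs. ?F ((p, b) # zs)) ys)" for p b
    by (simp add: der_add swap)
  \<comment> \<open>For each \<open>p\<close> from 1 to \<open>m\<close> the sum over
    \<open>b\<close> is the Casimir element on \<open>a\<close>, hence the identity. When
    \<open>m\<close> exceeds the range of \<open>p\<close>, the form vanishes by its degree
    bound.\<close>
  have 1: "(\<Sum>p=1..<N. \<Sum>b\<in>B. F (pair_br (p, b) (lower (d b) p y) # ys)) = of_nat m * F (y # ys)"
  proof -
    have "(\<Sum>b\<in>B. F (pair_br (p, b) (lower (d b) p y) # ys)) = (if p \<le> m then F (y # ys) else 0)" for p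
    proof (cases "p \<le> m")
      case True
      then have "(\<Sum>b\<in>B. F (pair_br (p, b) (lower (d b) p y) # ys)) = (\<Sum>b\<in>B. F ((m, br b (br (d b) a)) # ys))"
        by (simp add: y lower_def)
      also have "\<dots> = F ((m, a) # ys)"
        by (simp add: F.sum[symmetric] casimir)
      finally show ?thesis using True y by simp
    next
      case False
      then show ?thesis by (simp add: y lower_def br_right F.zero)
    qed
    then have "(\<Sum>p=1..<N. \<Sum>b\<in>B. F (pair_br (p, b) (lower (d b) p y) # ys)) = (\<Sum>p=1..<N. if p \<le> m then F (y # ys) else 0)"
      by simp
    also have "\<dots> = of_nat m * F (y # ys)"
    proof (cases "m < N")
      case True
      have "(\<Sum>p=1..<N. if p \<le> m then F (y # ys) else 0) = (\<Sum>p=1..m. F (y # ys))"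
        by (rule sum.mono_neutral_cong_right) (use True in auto)
      then show ?thesis by simp
    next
      case False
      then have "F (y # ys) = 0" using degree_boundedD0[OF F(3), of m] by (simp add: y)
      then show ?thesis by (simp only: if_cancel sum.neutral_const mult_zero_right)
    qed
    finally show ?thesis .
  qed
  have 2: "(\<Sum>p=1..<N. \<Sum>b\<in>B. der (pair_br (p, b)) (\<lambda>zs. F (lower (d b) p y # zs)) ys + der (lower (d b) p) (\<lambda>zs. F (pair_br (p, b) y # zs)) ys -
        der (lower_defect (d b) p y) (\<lambda>zs. F ((p, b) # zs)) ys) = 0"
  proof -
    have "(\<Sum>k\<in>?K. der (pair_br k) (\<lambda>zs. F (lower (d (snd k)) (fst k) y # zs)) ys +
        der (lower (d (snd k)) (fst k)) (\<lambda>zs. F (pair_br k y # zs)) ys -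
        der (lower_defect (d (snd k)) (fst k) y) (\<lambda>zs. F (k # zs)) ys) = 0"
    proof (rule sum_der_pairs_zero[where B = "\<lambda>k. lower_defect (d (snd k)) (fst k)"])
      fix us z vs
      show "(\<Sum>k\<in>?K. F (lower (d (snd k)) (fst k) y # us @ pair_br k z # vs) + F (pair_br k y # us @ lower (d (snd k)) (fst k) z # vs) -
          F (k # us @ lower_defect (d (snd k)) (fst k) y z # vs)) = 0"
        using sugawara_pair_identity[OF F, of y us z vs] by (simp add: sum.cartesian_product case_prod_unfold)
    qed
    then show ?thesis by (simp add: sum.cartesian_product case_prod_unfold)
  qed
  have 3: "(\<Sum>p=1..<N. \<Sum>b\<in>B. der (lower (d b) p) (der (pair_br (p, b)) ?F) ys + rd (lower_defect (d b) p) (\<lambda>zs. ?F ((p, b) # zs)) ys) =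
      of_nat (sum_list (map fst ys)) * F (y # ys)"
    by (rule Cons.IH[OF slotlin_Cons[OF F(1)] alt_Cons[OF F(2)] degree_bounded_Cons[OF F(3)]])
  have distrib3: "(\<Sum>p=1..<N. \<Sum>b\<in>B. f p b + g p b + h p b) =
      (\<Sum>p=1..<N. \<Sum>b\<in>B. f p b) + (\<Sum>p=1..<N. \<Sum>b\<in>B. g p b) + (\<Sum>p=1..<N. \<Sum>b\<in>B. h p b)"
    for f g h :: "nat \<Rightarrow> 'g \<Rightarrow> complex"
    by (simp only: sum.distrib)
  show ?case
    unfolding split distrib3 1 2 3 by (simp add: y distrib_right)
qed

text \<open>Commuting the differential past the truncated action produces
  \<open>lower_defect\<close>, and Cartan's formula for the contraction produces the action of
  \<open>t^p b\<close>; \<open>sugawara_degree\<close> sums up both.\<close>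

lemma sugawara_homotopy:
  assumes F: "slotlin Pair F" "alt F" "degree_bounded N F"
  shows "rd pair_br (sugawara N F) xs + sugawara N (rd pair_br F) xs = - of_nat (sum_list (map fst xs)) * F xs"
proof -
  have "rd pair_br (der (lower (d b) p) (\<lambda>ys. F ((p, b) # ys))) xs + der (lower (d b) p) (\<lambda>ys. rd pair_br F ((p, b) # ys)) xs =
      - (der (lower (d b) p) (der (pair_br (p, b)) F) xs + rd (lower_defect (d b) p) (\<lambda>ys. F ((p, b) # ys)) xs)" for p b
  proof -
    have "der (lower (d b) p) (rd pair_br (\<lambda>ys. F ((p, b) # ys))) xs - rd pair_br (der (lower (d b) p) (\<lambda>ys. F ((p, b) # ys))) xs =
        rd (lower_defect (d b) p) (\<lambda>ys. F ((p, b) # ys)) xs"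
      by (rule der_rd_commutator) (rule lower_defect[OF slotlin_Cons[OF F(1)]])
    moreover have "der (lower (d b) p) (\<lambda>ys. rd pair_br F ((p, b) # ys)) xs =
        - der (lower (d b) p) (der (pair_br (p, b)) F) xs - der (lower (d b) p) (rd pair_br (\<lambda>ys. F ((p, b) # ys))) xs"
      by (simp add: der_diff der_minus)
    ultimately show ?thesis by (simp add: algebra_simps)
  qed
  then have "rd pair_br (sugawara N F) xs + sugawara N (rd pair_br F) xs =
      (\<Sum>p=1..<N. \<Sum>b\<in>B. - (der (lower (d b) p) (der (pair_br (p, b)) F) xs + rd (lower_defect (d b) p) (\<lambda>ys. F ((p, b) # ys)) xs))"
    unfolding sugawara_def[abs_def] rd_sum sum.distrib[symmetric] by simp
  also have "\<dots> = - of_nat (sum_list (map fst xs)) * F xs"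
    unfolding sum_negf sugawara_degree[OF F] by simp
  finally show ?thesis .
qed

lemma slotlin_sugawara: "slotlin Pair F \<Longrightarrow> slotlin Pair (sugawara N F)"
  unfolding slotlin_def[of _ "sugawara N F"] sugawara_def
  by (intro allI VC.linear_compose_sum ballI slotlinD slotlin_der lower_fiberlin slotlin_Cons)

lemma alt_sugawara:
  assumes "alt F"
  shows "alt (sugawara N F)"
  unfolding alt_def sugawara_def sum_negf[symmetric]
  by (intro allI sum.cong refl altD alt_der alt_Cons assms)

text \<open>The truncated action takes away \<open>p < N\<close> from a degree, so a degree of at
  least \<open>2 * N\<close> stays at least \<open>N\<close>.\<close>

lemma degree_bounded_sugawara:
  assumes F: "slotlin Pair F" "degree_bounded N F"
  shows "degree_bounded (2 * N) (sugawara N F)"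
  unfolding degree_bounded_def
proof (intro allI impI)
  fix us k a vs assume k: "2 * N \<le> k"
  have "der (lower (d b) p) (\<lambda>ys. F ((p, b) # ys)) (us @ (k, a) # vs) = 0" if "p < N" for p b
  proof -
    have z: "F ((p, b) # ys @ (k, a) # zs) = 0" for ys zs
      using degree_boundedD[OF F(2), of k "(p, b) # ys"] k by simp
    have "F ((p, b) # us @ lower (d b) p (k, a) # vs) = 0"
      using degree_boundedD[OF F(2), of "k - p" "(p, b) # us"] k that by (simp add: lower_def)
    then show ?thesis by (simp add: der_append z)
  qed
  then show "sugawara N F (us @ (k, a) # vs) = 0"
    by (simp add: sugawara_def)
qed

end

end

text \<open>Dividing by the degree inverts the right-hand side of the homotopy formula in positive degrees.\<close>

lemma (in semisimple_lie_algebra) pair_cocycle_exact: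
  fixes F :: "(nat \<times> 'a) list \<Rightarrow> complex"
  assumes F: "slotlin Pair F" "alt F" "degree_bounded N F" and cocycle: "\<And>xs. rd pair_br F xs = 0"
    and len: "\<And>xs. length xs \<noteq> n \<Longrightarrow> F xs = 0"
  obtains H where "slotlin Pair H" "alt H" "degree_bounded (2 * N) H"
    "\<And>xs. Suc (length xs) \<noteq> n \<Longrightarrow> H xs = 0"
    "\<And>xs. rd pair_br H xs = (if sum_list (map fst xs) = 0 then 0 else F xs)"
proof -
  obtain B d where Bd: "casimir_pair B d"
    by (rule killing_casimir)
  \<comment> \<open>As \<open>inverse 0 = 0\<close>, the component of degree zero is dropped rather
    than divided.\<close>
  define G where "G xs = - inverse (of_nat (sum_list (map fst xs))) * F xs" for xs
  have G: "slotlin Pair G"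
    unfolding slotlin_def
  proof (intro allI)
    fix us i vs
    have "(\<lambda>a. G (us @ (i, a) # vs)) =
        (\<lambda>a. - inverse (of_nat (sum_list (map fst us) + (i + sum_list (map fst vs)))) * F (us @ (i, a) # vs))"
      by (simp add: G_def)
    then show "Vector_Spaces.linear scale (*) (\<lambda>a. G (us @ (i, a) # vs))"
      by (simp only: VC.linear_compose_scale_right[OF slotlinD[OF F(1)]])
  qed
  have altG: "alt G"
    unfolding alt_def G_def
  proof (intro allI)
    fix us x y vs
    show "- inverse (of_nat (sum_list (map fst (us @ x # y # vs)))) * F (us @ x # y # vs) =
        - (- inverse (of_nat (sum_list (map fst (us @ y # x # vs)))) * F (us @ y # x # vs))"
      using altD[OF F(2), of us x y vs] by (simp add: add.left_commute)
  qed
  have bG: "degree_bounded N G"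
    using F(3) by (auto simp: degree_bounded_def G_def)
  have "rd pair_br G xs = - inverse (of_nat (sum_list (map fst xs))) * rd pair_br F xs" for xs
    unfolding G_def[abs_def] by (rule rd_weight[of pair_br "\<lambda>s. - inverse (of_nat s)"]) simp
  then have "rd pair_br G = (\<lambda>_. 0)" using cocycle by (simp add: fun_eq_iff)
  then have "sugawara B d N (rd pair_br G) xs = 0" for xs
    by (simp add: sugawara_def[OF Bd])
  then have "rd pair_br (sugawara B d N G) xs = (if sum_list (map fst xs) = 0 then 0 else F xs)" for xs
    using sugawara_homotopy[OF Bd G altG bG, of xs] by (simp add: G_def)
  moreover have "sugawara B d N G xs = 0" if "Suc (length xs) \<noteq> n" for xs
  proof -
    have "der (lower (d b) p) (\<lambda>ys. G ((p, b) # ys)) xs = 0" for p b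
    proof -
      have "der (lower (d b) p) (\<lambda>ys. G ((p, b) # ys)) xs = der (lower (d b) p) (\<lambda>_. 0) xs"
        by (rule der_cong_length) (use that len in \<open>simp add: G_def\<close>)
      then show ?thesis by simp
    qed
    then show ?thesis by (simp add: sugawara_def[OF Bd])
  qed
  ultimately show ?thesis
    using that[of "sugawara B d N G"] slotlin_sugawara[OF Bd G] alt_sugawara[OF Bd altG]
      degree_bounded_sugawara[OF Bd G bG] by blast
qed

section \<open>Polynomial forms and their Taylor coefficients\<close>

text \<open>A linear change of the index variable, made in all slots at once. With divided powers as
  coefficients it sums a Taylor series; with interpolation weights it recovers Taylor coefficients
  from values.\<close>

fun Tr :: "('j \<Rightarrow> nat \<Rightarrow> complex) \<Rightarrow> (nat \<Rightarrow> 'i) \<Rightarrow> nat \<Rightarrow> (('i \<times> 'g) list \<Rightarrow> complex) \<Rightarrow> ('j \<times> 'g) list \<Rightarrow> complex" where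
  "Tr c pt N F [] = F []"
| "Tr c pt N F (x # xs) = (\<Sum>k<N. c (fst x) k * Tr c pt N (\<lambda>ys. F ((pt k, snd x) # ys)) xs)"

lemma Tr_zero [simp]: "Tr c pt N (\<lambda>_. 0) xs = 0"
  by (induction xs) auto

lemma Tr_add: "Tr c pt N (\<lambda>ys. F ys + G ys) xs = Tr c pt N F xs + Tr c pt N G xs"
  by (induction xs arbitrary: F G) (auto simp: sum.distrib distrib_left)

lemma Tr_scale: "Tr c pt N (\<lambda>ys. r * F ys) xs = r * Tr c pt N F xs"
  by (induction xs arbitrary: F) (auto simp: sum_distrib_left mult.left_commute)

lemma Tr_minus: "Tr c pt N (\<lambda>ys. - F ys) xs = - Tr c pt N F xs"
  using Tr_scale[of c pt N "- 1" F xs] by simp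

lemma Tr_diff: "Tr c pt N (\<lambda>ys. F ys - G ys) xs = Tr c pt N F xs - Tr c pt N G xs"
  using Tr_add[of c pt N F "\<lambda>ys. - G ys" xs] by (simp add: Tr_minus)

lemma Tr_sum: "Tr c pt N (\<lambda>ys. \<Sum>i\<in>I. F i ys) xs = (\<Sum>i\<in>I. Tr c pt N (F i) xs)"
  by (induction I rule: infinite_finite_induct) (auto simp: Tr_add)

lemma Tr_wrong_length:
  assumes "\<And>ys. length ys \<noteq> n \<Longrightarrow> F ys = 0" "length xs \<noteq> n"
  shows "Tr c pt N F xs = 0"
  using assms
proof (induction xs arbitrary: F n)
  case Nil
  then show ?case by simp
next
  case (Cons x xs)
  have "Tr c pt N (\<lambda>ys. F (z # ys)) xs = 0" for z
  proof (cases n)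
    case 0
    then have "(\<lambda>ys. F (z # ys)) = (\<lambda>_. 0)" using Cons.prems(1) by auto
    then show ?thesis by simp
  next
    case (Suc m)
    then show ?thesis using Cons.prems by (intro Cons.IH[of m]) auto
  qed
  then show ?case by simp
qed

lemma alt_Tr:
  assumes "alt F"
  shows "alt (Tr c pt N F)"
  unfolding alt_def
proof (intro allI)
  fix us x y vs
  show "Tr c pt N F (us @ x # y # vs) = - Tr c pt N F (us @ y # x # vs)"
    using assms
  proof (induction us arbitrary: F)
    case Nil
    have "Tr c pt N (\<lambda>ys. F ((pt k, snd x) # (pt l, snd y) # ys)) vs =
        - Tr c pt N (\<lambda>ys. F ((pt l, snd y) # (pt k, snd x) # ys)) vs" for k l
      unfolding Tr_minus[symmetric] using altD0[OF Nil, of "(pt k, snd x)"] by simp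
    then show ?case
      by (simp add: sum_distrib_left sum_negf mult.left_commute) (rule sum.swap)
  next
    case (Cons u us)
    show ?case
      using Cons.IH[OF alt_Cons[OF Cons.prems]] by (simp add: sum_negf)
  qed
qed

text \<open>Divided powers of \<lambda> + \<mu> are convolutions free of binomial coefficients. This
  is dual to the multiplication of powers of \<open>t\<close>, so the differential of \<gg>[t]
  appears with no extra constants.\<close>

definition dpow :: "complex \<Rightarrow> nat \<Rightarrow> complex" where
  "dpow l m = l ^ m / fact m"

lemma dpow_0 [simp]: "dpow l 0 = 1"
  by (simp add: dpow_def)

abbreviation taylor :: "nat \<Rightarrow> ((nat \<times> 'g) list \<Rightarrow> complex) \<Rightarrow> (complex \<times> 'g) list \<Rightarrow> complex" where
  "taylor \<equiv> Tr dpow (\<lambda>k. k)"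

lemma taylor_mono:
  assumes "degree_bounded N F" "N \<le> M"
  shows "taylor M F xs = taylor N F xs"
  using assms(1)
proof (induction xs arbitrary: F)
  case Nil
  then show ?case by simp
next
  case (Cons x xs)
  have "(\<lambda>ys. F ((k, snd x) # ys)) = (\<lambda>_. 0)" if "N \<le> k" for k
    using degree_boundedD0[OF Cons.prems that] by simp
  then have "taylor M F (x # xs) = (\<Sum>k<N. dpow (fst x) k * taylor M (\<lambda>ys. F ((k, snd x) # ys)) xs)"
    unfolding Tr.simps using assms(2) by (intro sum.mono_neutral_right ballI) auto
  then show ?case
    using Cons.IH[OF degree_bounded_Cons[OF Cons.prems]] by simp
qed

text \<open>The product rule of the exponential series, paired with \<open>g\<close>. The vanishing
  of \<open>g\<close> from \<open>N\<close> on turns the triangle \<open>m + n < N\<close> into a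
  square.\<close>

lemma sum_exp_convolution:
  fixes g :: "nat \<Rightarrow> complex"
  assumes "\<And>k. N \<le> k \<Longrightarrow> g k = 0"
  shows "(\<Sum>k<N. dpow (x + y) k * g k) = (\<Sum>m<N. \<Sum>n<N. dpow x m * (dpow y n * g (m + n)))"
proof -
  have binom: "dpow (x + y) k = (\<Sum>m\<le>k. dpow x m * dpow y (k - m))" for k
    unfolding dpow_def binomial_ring sum_divide_distrib
    by (intro sum.cong) (auto simp: binomial_fact field_simps)
  have "(\<Sum>k<N. dpow (x + y) k * g k) =
      (\<Sum>k<N. \<Sum>m\<le>k. dpow x m * (dpow y (k - m) * g (m + (k - m))))"
    unfolding binom sum_distrib_right by (intro sum.cong) (auto simp: mult.assoc)
  also have "\<dots> = (\<Sum>(m, n)\<in>{(m, n). m + n < N}. dpow x m * (dpow y n * g (m + n)))"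
    by (rule sum.triangle_reindex[symmetric])
  also have "\<dots> = (\<Sum>(m, n)\<in>{..<N} \<times> {..<N}. dpow x m * (dpow y n * g (m + n)))"
  proof (rule sum.mono_neutral_left)
    show "\<forall>z\<in>{..<N} \<times> {..<N} - {(m, n). m + n < N}. (case z of (m, n) \<Rightarrow> dpow x m * (dpow y n * g (m + n))) = 0"
    proof
      fix z assume z: "z \<in> {..<N} \<times> {..<N} - {(m, n). m + n < N}"
      obtain m n where mn: "z = (m, n)" by (cases z)
      then have "g (m + n) = 0" using z by (intro assms) auto
      then show "(case z of (m, n) \<Rightarrow> dpow x m * (dpow y n * g (m + n))) = 0" by (simp add: mn)
    qed
  qed auto
  also have "\<dots> = (\<Sum>m<N. \<Sum>n<N. dpow x m * (dpow y n * g (m + n)))"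
    by (rule sum.cartesian_product[symmetric])
  finally show ?thesis .
qed

lemma powers_independent:
  fixes c :: "nat \<Rightarrow> complex"
  assumes "\<And>l. (\<Sum>m<N. dpow l m * c m) = 0" "m < N"
  shows "c m = 0"
proof -
  define p where "p = (\<Sum>m<N. monom (c m / fact m) m)"
  have "poly p l = 0" for l
    using assms(1)[of l] by (simp add: p_def poly_sum poly_monom dpow_def mult.commute)
  then have "p = 0" using poly_all_0_iff_0 by blast
  then have "coeff p m = 0" by simp
  then show ?thesis using assms(2) by (simp add: p_def coeff_sum)
qed

text \<open>One slot at a time, by linear independence of the powers of a parameter. It carries the
  cocycle condition from a Taylor sum to its coefficients.\<close>

lemma taylor_injective:
  assumes "degree_bounded N F" "\<And>ys. taylor N F ys = 0"
  shows "F xs = 0"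
  using assms
proof (induction xs arbitrary: F)
  case Nil
  then show ?case using Nil(2)[of "[]"] by simp
next
  case (Cons x xs)
  obtain m a where x: "x = (m, a)" by (cases x)
  show ?case
  proof (cases "m < N")
    case True
    have "taylor N (\<lambda>ys. F ((m, a) # ys)) ys = 0" for ys
    proof (rule powers_independent[where c = "\<lambda>m. taylor N (\<lambda>ys. F ((m, a) # ys)) ys", OF _ True])
      fix l
      show "(\<Sum>m<N. dpow l m * taylor N (\<lambda>ys. F ((m, a) # ys)) ys) = 0"
        using Cons.prems(2)[of "(l, a) # ys"] by simp
    qed
    then show ?thesis
      using Cons.IH[OF degree_bounded_Cons[OF Cons.prems(1)], of "(m, a)"] x by simp
  next
    case False
    then show ?thesis using degree_boundedD0[OF Cons.prems(1), of m] x by simp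
  qed
qed

lemma taylor_degree_zero:
  assumes "0 < N"
  shows "taylor N (\<lambda>xs. if sum_list (map fst xs) = 0 then F xs else 0) xs = F (map (\<lambda>x. (0, snd x)) xs)"
proof (induction xs arbitrary: F)
  case Nil
  then show ?case by simp
next
  case (Cons x xs)
  have "taylor N (\<lambda>xs. if sum_list (map fst xs) = 0 then F xs else 0) (x # xs) =
      (\<Sum>k<N. if k = 0 then F (map (\<lambda>x. (0, snd x)) (x # xs)) else 0)"
    unfolding Tr.simps
  proof (intro sum.cong refl)
    fix k
    show "dpow (fst x) k * taylor N (\<lambda>ys. if sum_list (map fst ((k, snd x) # ys)) = 0 then F ((k, snd x) # ys) else 0) xs =
        (if k = 0 then F (map (\<lambda>x. (0, snd x)) (x # xs)) else 0)"
    proof (cases "k = 0")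
      case True
      show ?thesis
        unfolding True using Cons.IH[of "\<lambda>ys. F ((0, snd x) # ys)"] by simp
    qed simp
  qed
  then show ?case using assms by simp
qed

subsection \<open>Interpolation\<close>

definition poly_deg :: "nat \<Rightarrow> (complex \<Rightarrow> complex) \<Rightarrow> bool" where
  "poly_deg N f \<longleftrightarrow> (\<exists>p. (p = 0 \<or> degree p < N) \<and> (\<forall>l. f l = poly p l))"

text \<open>Interpolation at the nodes 0, ..., \<open>N - 1\<close>: the weight \<open>w m k\<close>
  is \<open>fact m\<close> times the coefficient of degree \<open>m\<close> of the Lagrange
  polynomial of the node \<open>k\<close>. Taylor coefficients become fixed finite combinations of
  values and so inherit linearity and alternation from the form.\<close>

lemma lagrange_weights:
  obtains w :: "nat \<Rightarrow> nat \<Rightarrow> complex" where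
    "\<And>m k. N \<le> m \<Longrightarrow> w m k = 0"
    "\<And>f l. poly_deg N f \<Longrightarrow> f l = (\<Sum>m<N. dpow l m * (\<Sum>k<N. w m k * f (of_nat k)))"
proof -
  define L where "L k = (\<Prod>j\<in>{..<N} - {k}. smult (1 / (of_nat k - of_nat j)) [:- of_nat j, 1::complex:])" for k :: nat
  have degL: "degree (L k) < N" if "k < N" for k
  proof -
    have "degree (L k) \<le> (\<Sum>j\<in>{..<N} - {k}. degree (smult (1 / (of_nat k - of_nat j)) [:- of_nat j, 1::complex:]))"
      unfolding L_def by (rule order.trans[OF degree_prod_sum_le]) (simp_all only: o_def finite_Diff finite_lessThan order.refl)
    also have "\<dots> \<le> (\<Sum>j\<in>{..<N} - {k}. 1)"
      by (intro sum_mono order.trans[OF degree_smult_le]) simp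
    also have "\<dots> < N" using that by simp
    finally show ?thesis .
  qed
  have evalL: "poly (L k) (of_nat j) = (if j = k then 1 else 0)" if "k < N" "j < N" for k j
  proof (cases "j = k")
    case True
    have "poly (L k) (of_nat j) = (\<Prod>i\<in>{..<N} - {k}. 1)"
      unfolding L_def poly_prod True by (intro prod.cong) (auto simp: diff_divide_distrib[symmetric])
    then show ?thesis using True by simp
  next
    case False
    then show ?thesis
      using that unfolding L_def poly_prod by (auto intro!: prod_zero bexI[of _ j])
  qed
  define w where "w m k = (if m < N then fact m * coeff (L k) m else 0)" for m k
  show ?thesis
  proof (rule that[of w])
    show "w m k = 0" if "N \<le> m" for m k using that by (simp add: w_def)
  next
    fix f l assume "poly_deg N f"
    then obtain p where p: "p = 0 \<or> degree p < N" "\<And>l. f l = poly p l"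
      unfolding poly_deg_def by blast
    define q where "q = (\<Sum>k<N. smult (f (of_nat k)) (L k))"
    have "p = q"
    proof (cases "N = 0")
      case True
      then show ?thesis using p(1) by (simp add: q_def)
    next
      case False
      have cardA: "card (of_nat ` {..<N} :: complex set) = N"
        by (subst card_image) (auto simp: inj_on_def)
      show ?thesis
      proof (rule poly_eqI_degree[where A = "of_nat ` {..<N}"])
        show "poly p x = poly q x" if x: "x \<in> of_nat ` {..<N}" for x
        proof -
          obtain j where j: "j < N" "x = of_nat j" using x by auto
          have "poly q x = (\<Sum>k<N. if j = k then f (of_nat k) else 0)"
            unfolding q_def poly_sum j(2) by (intro sum.cong) (auto simp: evalL j(1))
          then show ?thesis using j p(2) by simp
        qed
        show "degree p < card (of_nat ` {..<N} :: complex set)" unfolding cardA using p(1) False by auto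
        have "degree q \<le> N - 1"
          unfolding q_def
          by (intro degree_sum_le order.trans[OF degree_smult_le]) (use degL in \<open>auto simp: less_eq_Suc_le intro: le_diff_conv2[THEN iffD2]\<close>)
        then show "degree q < card (of_nat ` {..<N} :: complex set)" unfolding cardA using False by simp
      qed
    qed
    have "f l = (\<Sum>k<N. f (of_nat k) * poly (L k) l)"
      using p(2)[of l] \<open>p = q\<close> by (simp add: q_def poly_sum)
    also have "\<dots> = (\<Sum>k<N. f (of_nat k) * (\<Sum>m<N. coeff (L k) m * l ^ m))"
    proof (intro sum.cong refl)
      fix k assume "k \<in> {..<N}"
      then have d: "degree (L k) < N" using degL by simp
      have "poly (L k) l = (\<Sum>m<N. coeff (L k) m * l ^ m)"
        unfolding poly_altdef by (rule sum.mono_neutral_left) (use d in \<open>auto simp: coeff_eq_0\<close>)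
      then show "f (of_nat k) * poly (L k) l = f (of_nat k) * (\<Sum>m<N. coeff (L k) m * l ^ m)" by simp
    qed
    also have "\<dots> = (\<Sum>m<N. \<Sum>k<N. f (of_nat k) * (coeff (L k) m * l ^ m))"
      unfolding sum_distrib_left by (rule sum.swap)
    also have "\<dots> = (\<Sum>m<N. dpow l m * (\<Sum>k<N. w m k * f (of_nat k)))"
      unfolding sum_distrib_left by (intro sum.cong) (auto simp: w_def dpow_def)
    finally show "f l = (\<Sum>m<N. dpow l m * (\<Sum>k<N. w m k * f (of_nat k)))" .
  qed
qed

lemma taylor_interpolate:
  assumes w: "\<And>f l. poly_deg N f \<Longrightarrow> f l = (\<Sum>m<N. dpow l m * (\<Sum>k<N. w m k * f (of_nat k)))"
    and G: "\<And>us a vs. poly_deg N (\<lambda>l. G (us @ (l, a) # vs))"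
  shows "taylor N (Tr w of_nat N G) xs = G xs"
  using G
proof (induction xs arbitrary: G)
  case Nil
  then show ?case by simp
next
  case (Cons x xs)
  obtain l a where x: "x = (l, a)" by (cases x)
  have IH: "taylor N (Tr w of_nat N (\<lambda>ys. G (z # ys))) xs = G (z # xs)" for z
    by (rule Cons.IH) (use Cons.prems[of "z # us" for us] in simp)
  have "taylor N (Tr w of_nat N G) (x # xs) =
      (\<Sum>m<N. dpow l m * (\<Sum>k<N. w m k * G ((of_nat k, a) # xs)))"
    by (simp add: x Tr_sum Tr_scale IH)
  also have "\<dots> = G ((l, a) # xs)"
    using w[OF Cons.prems[of "[]" a xs], of l] by simp
  finally show ?case by (simp add: x)
qed

lemma degree_bounded_Tr:
  assumes "\<And>m k. N \<le> m \<Longrightarrow> w m k = 0"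
  shows "degree_bounded N (Tr w pt M G)"
  unfolding degree_bounded_def
proof (intro allI impI)
  fix us k a vs assume "N \<le> k"
  then show "Tr w pt M G (us @ (k, a) # vs) = 0"
    by (induction us arbitrary: G) (auto simp: assms)
qed

context lie_algebra
begin

lemma slotlin_Tr:
  assumes "slotlin Pair F"
  shows "slotlin Pair (Tr c pt N F)"
  unfolding slotlin_def
proof (intro allI)
  fix us i vs
  show "Vector_Spaces.linear scale (*) (\<lambda>a. Tr c pt N F (us @ (i, a) # vs))"
    using assms
  proof (induction us arbitrary: F)
    case Nil
    interpret F: Vector_Spaces.linear scale "(*)" "\<lambda>a. F ((j, a) # zs)" for j zs
      by (rule slotlinD0[OF Nil])
    show ?case
    proof (unfold_locales, goal_cases)
      case (1 a a')
      show ?case by (simp add: F.add Tr_add distrib_left sum.distrib)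
    next
      case (2 r a)
      show ?case
        unfolding append_Nil Tr.simps fst_conv snd_conv F.scale Tr_scale sum_distrib_left
        by (intro sum.cong refl mult.left_commute)
    qed
  next
    case (Cons u us)
    have "\<forall>k\<in>{..<N}. Vector_Spaces.linear scale (*)
        (\<lambda>a. c (fst u) k * Tr c pt N (\<lambda>ys. F ((pt k, snd u) # ys)) (us @ (i, a) # vs))"
      by (intro ballI VC.linear_compose_scale_right[OF Cons.IH[OF slotlin_Cons[OF Cons.prems]]])
    from VC.linear_compose_sum[OF this] show ?case by simp
  qed
qed

text \<open>In the slot that is hit the parameter becomes \<open>l + l'\<close>, and the convolution
  formula separates it into Taylor sums in \<open>l\<close> and \<open>l'\<close>. The other slots
  go through by induction.\<close>

lemma der_taylor:
  assumes "degree_bounded N F"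
  shows "der (pair_br (l, a)) (taylor N F) xs = (\<Sum>m<N. dpow l m * taylor N (der (pair_br (m, a)) F) xs)"
  using assms
proof (induction xs arbitrary: F)
  case Nil
  then show ?case by simp
next
  case (Cons y ys)
  obtain l' c where y: "y = (l', c)" by (cases y)
  define g where "g k = taylor N (\<lambda>zs. F ((k, br a c) # zs)) ys" for k
  have g0: "g k = 0" if "N \<le> k" for k
  proof -
    have "(\<lambda>zs. F ((k, br a c) # zs)) = (\<lambda>_. 0)"
      using degree_boundedD0[OF Cons.prems that] by simp
    then show ?thesis by (simp add: g_def)
  qed
  have "der (pair_br (l, a)) (taylor N F) (y # ys) =
      (\<Sum>k<N. dpow (l + l') k * g k) +
      (\<Sum>n<N. dpow l' n * (\<Sum>m<N. dpow l m * taylor N (der (pair_br (m, a)) (\<lambda>zs. F ((n, c) # zs))) ys))"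
    using Cons.IH[OF degree_bounded_Cons[OF Cons.prems]]
    by (simp add: y g_def der_sum der_scale)
  also have "(\<Sum>k<N. dpow (l + l') k * g k) = (\<Sum>m<N. \<Sum>n<N. dpow l m * (dpow l' n * g (m + n)))"
    by (rule sum_exp_convolution[OF g0])
  also have "(\<Sum>n<N. dpow l' n * (\<Sum>m<N. dpow l m * taylor N (der (pair_br (m, a)) (\<lambda>zs. F ((n, c) # zs))) ys)) =
      (\<Sum>m<N. \<Sum>n<N. dpow l m * (dpow l' n * taylor N (der (pair_br (m, a)) (\<lambda>zs. F ((n, c) # zs))) ys))"
    unfolding sum_distrib_left by (subst sum.swap, intro sum.cong refl mult.left_commute)
  also have "(\<Sum>m<N. \<Sum>n<N. dpow l m * (dpow l' n * g (m + n))) + \<dots> =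
      (\<Sum>m<N. dpow l m * taylor N (der (pair_br (m, a)) F) (y # ys))"
    unfolding sum.distrib[symmetric]
  proof (intro sum.cong refl)
    fix m
    have "taylor N (der (pair_br (m, a)) F) (y # ys) =
        (\<Sum>n<N. dpow l' n * (g (m + n) + taylor N (der (pair_br (m, a)) (\<lambda>zs. F ((n, c) # zs))) ys))"
      by (simp add: y g_def Tr_add)
    then show "(\<Sum>n<N. dpow l m * (dpow l' n * g (m + n)) + dpow l m * (dpow l' n * taylor N (der (pair_br (m, a)) (\<lambda>zs. F ((n, c) # zs))) ys)) =
        dpow l m * taylor N (der (pair_br (m, a)) F) (y # ys)"
      by (simp only: sum_distrib_left distrib_left)
  qed
  finally show ?case .
qed

lemma rd_taylor:
  assumes "degree_bounded N F"
  shows "rd pair_br (taylor N F) xs = taylor N (rd pair_br F) xs"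
  using assms
proof (induction xs arbitrary: F)
  case Nil
  then show ?case by simp
next
  case (Cons x xs)
  obtain l a where x: "x = (l, a)" by (cases x)
  have "rd pair_br (taylor N F) (x # xs) =
      - (\<Sum>m<N. dpow l m * taylor N (der (pair_br (m, a)) F) xs) -
      (\<Sum>m<N. dpow l m * taylor N (rd pair_br (\<lambda>ys. F ((m, a) # ys))) xs)"
    using Cons.IH[OF degree_bounded_Cons[OF Cons.prems]]
    by (simp add: x der_taylor[OF Cons.prems] rd_sum rd_scale)
  also have "\<dots> = taylor N (rd pair_br F) (x # xs)"
    by (simp add: x Tr_diff Tr_minus sum_subtractf sum_negf right_diff_distrib)
  finally show ?case .
qed

lemma degree_bounded_rd:
  fixes F :: "(nat \<times> 'g) list \<Rightarrow> complex"
  assumes "degree_bounded N F"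
  shows "degree_bounded N (rd pair_br F)"
  unfolding degree_bounded_def
proof (intro allI impI)
  fix us k a vs assume k: "N \<le> k"
  show "rd pair_br F (us @ (k, a) # vs) = 0"
    using assms
  proof (induction us arbitrary: F)
    case Nil
    have "(\<lambda>ys. F ((k, a) # ys)) = (\<lambda>_. 0)"
      using degree_boundedD0[OF Nil k] by simp
    moreover have "der (pair_br (k, a)) F vs = 0"
      unfolding der_nth pair_br_def
      by (intro sum.neutral ballI degree_boundedD[OF Nil]) (use k in simp)
    ultimately show ?case by simp
  next
    case (Cons u us)
    have z: "F (ys @ (k, a) # zs) = 0" for ys zs
      by (rule degree_boundedD[OF Cons.prems k])
    have "F (us @ pair_br u (k, a) # vs) = 0"
      unfolding pair_br_def by (rule degree_boundedD[OF Cons.prems]) (use k in simp)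
    then have "der (pair_br u) F (us @ (k, a) # vs) = 0"
      using z[of "us @ _"] by (simp add: der_append z)
    then show ?case
      using Cons.IH[OF degree_bounded_Cons[OF Cons.prems]] by simp
  qed
qed

end

section \<open>Cochains of the current conformal algebra\<close>

abbreviation mpf :: "nat \<Rightarrow> (complex list \<Rightarrow> complex) \<Rightarrow> bool" where
  "mpf \<equiv> multi_poly_fun (*)"

section \<open>Polynomial functions of several parameters\<close>

lemma mpfI:
  assumes "finite E" "\<And>ls. length ls = n \<Longrightarrow> f ls = (\<Sum>e\<in>E. (\<Prod>i<n. ls ! i ^ e i) * c e)"
  shows "mpf n f"
  unfolding multi_poly_fun_def using assms by (intro exI[of _ E] exI[of _ c]) simp

lemma mpf_cong:
  assumes "\<And>ls. length ls = n \<Longrightarrow> f ls = g ls"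
  shows "mpf n f \<longleftrightarrow> mpf n g"
proof -
  have *: "mpf n g" if "mpf n f" and eq: "\<And>ls. length ls = n \<Longrightarrow> f ls = g ls" for f g
  proof -
    obtain E c where E: "finite E" "\<And>ls. length ls = n \<Longrightarrow> f ls = (\<Sum>e\<in>E. (\<Prod>i<n. ls ! i ^ e i) * c e)"
      using \<open>mpf n f\<close> unfolding multi_poly_fun_def by blast
    show ?thesis by (rule mpfI[OF E(1)]) (simp add: eq[symmetric] E(2))
  qed
  show ?thesis using *[of f g] *[of g f] assms by auto
qed

lemma mpf_const: "mpf 0 (\<lambda>_. c)"
  unfolding multi_poly_fun_def by (intro exI[of _ "{\<lambda>_. 0}"] exI[of _ "\<lambda>_. c"]) simp

lemma mpf_zero: "mpf n (\<lambda>_. 0)"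
  unfolding multi_poly_fun_def by (intro exI[of _ "{}"]) simp

lemma mpf_scale:
  assumes "mpf n f"
  shows "mpf n (\<lambda>ls. r * f ls)"
proof -
  obtain E c where E: "finite E" "\<And>ls. length ls = n \<Longrightarrow> f ls = (\<Sum>e\<in>E. (\<Prod>i<n. ls ! i ^ e i) * c e)"
    using assms unfolding multi_poly_fun_def by blast
  show ?thesis
    unfolding multi_poly_fun_def
    by (intro exI[of _ E] exI[of _ "\<lambda>e. r * c e"] conjI allI impI E(1))
      (simp add: E(2) sum_distrib_left mult.left_commute)
qed

lemma mpf_add:
  assumes "mpf n f" "mpf n g"
  shows "mpf n (\<lambda>ls. f ls + g ls)"
proof -
  obtain E c where E: "finite E" "\<And>ls. length ls = n \<Longrightarrow> f ls = (\<Sum>e\<in>E. (\<Prod>i<n. ls ! i ^ e i) * c e)"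
    using assms(1) unfolding multi_poly_fun_def by blast
  obtain E' c' where E': "finite E'" "\<And>ls. length ls = n \<Longrightarrow> g ls = (\<Sum>e\<in>E'. (\<Prod>i<n. ls ! i ^ e i) * c' e)"
    using assms(2) unfolding multi_poly_fun_def by blast
  have "f ls + g ls = (\<Sum>e\<in>E \<union> E'. (\<Prod>i<n. ls ! i ^ e i) * ((if e \<in> E then c e else 0) + (if e \<in> E' then c' e else 0)))"
    if "length ls = n" for ls
  proof -
    have "f ls = (\<Sum>e\<in>E \<union> E'. (\<Prod>i<n. ls ! i ^ e i) * (if e \<in> E then c e else 0))"
      unfolding E(2)[OF that] by (rule sum.mono_neutral_cong_left) (use E E' in auto)
    moreover have "g ls = (\<Sum>e\<in>E \<union> E'. (\<Prod>i<n. ls ! i ^ e i) * (if e \<in> E' then c' e else 0))"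
      unfolding E'(2)[OF that] by (rule sum.mono_neutral_cong_left) (use E E' in auto)
    ultimately show ?thesis by (simp only: distrib_left sum.distrib)
  qed
  with E(1) E'(1) show ?thesis by (intro mpfI) auto
qed

lemma mpf_sum: "(\<And>i. i \<in> I \<Longrightarrow> mpf n (f i)) \<Longrightarrow> mpf n (\<lambda>ls. \<Sum>i\<in>I. f i ls)"
  by (induction I rule: infinite_finite_induct) (auto intro: mpf_add mpf_zero)

lemma mpf_Cons:
  assumes "mpf n g"
  shows "mpf (Suc n) (\<lambda>ls. hd ls ^ k * g (tl ls))"
proof -
  obtain E c where E: "finite E" "\<And>ls. length ls = n \<Longrightarrow> g ls = (\<Sum>e\<in>E. (\<Prod>i<n. ls ! i ^ e i) * c e)"
    using assms unfolding multi_poly_fun_def by blast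
  define J where "J e i = (case i of 0 \<Rightarrow> k | Suc i \<Rightarrow> e i)" for e :: "nat \<Rightarrow> nat" and i
  have inj: "inj_on J E"
    by (intro inj_onI ext) (metis J_def nat.case(2))
  have "hd ls ^ k * g (tl ls) = (\<Sum>e\<in>J ` E. (\<Prod>i<Suc n. ls ! i ^ e i) * c (\<lambda>i. e (Suc i)))"
    if len: "length ls = Suc n" for ls
  proof -
    obtain l ls' where ls: "ls = l # ls'" "length ls' = n" using len by (metis length_Suc_conv)
    have "(\<Sum>e\<in>J ` E. (\<Prod>i<Suc n. ls ! i ^ e i) * c (\<lambda>i. e (Suc i))) =
        (\<Sum>e\<in>E. l ^ k * ((\<Prod>i<n. ls' ! i ^ e i) * c e))"
      by (simp only: sum.reindex[OF inj] o_def prod.lessThan_Suc_shift) (simp add: J_def ls(1) mult.assoc)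
    then show ?thesis by (simp add: ls E(2) sum_distrib_left)
  qed
  with E(1) show ?thesis by (intro mpfI) auto
qed

lemma mpf_times_nth:
  assumes "mpf n f" "j < n"
  shows "mpf n (\<lambda>ls. ls ! j * f ls)"
proof -
  obtain E c where E: "finite E" "\<And>ls. length ls = n \<Longrightarrow> f ls = (\<Sum>e\<in>E. (\<Prod>i<n. ls ! i ^ e i) * c e)"
    using assms(1) unfolding multi_poly_fun_def by blast
  define J where "J e = e(j := Suc (e j))" for e :: "nat \<Rightarrow> nat"
  \<comment> \<open>\<open>J'\<close> undoes the raised exponent, so that the old coefficient can be
    found after reindexing.\<close>
  define J' where "J' e = e(j := e j - 1)" for e :: "nat \<Rightarrow> nat"
  have J'J: "J' (J e) = e" for e by (simp add: J_def J'_def fun_eq_iff)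
  then have inj: "inj_on J E" by (metis inj_onI)
  have "ls ! j * f ls = (\<Sum>e\<in>J ` E. (\<Prod>i<n. ls ! i ^ e i) * c (J' e))" if len: "length ls = n" for ls
  proof -
    have "(\<Prod>i<n. ls ! i ^ J e i) = ls ! j * (\<Prod>i<n. ls ! i ^ e i)" for e
    proof -
      have "(\<Prod>i<n. ls ! i ^ J e i) = ls ! j ^ Suc (e j) * (\<Prod>i\<in>{..<n} - {j}. ls ! i ^ e i)"
        using assms(2) by (subst prod.remove[of _ j]) (auto simp: J_def intro!: prod.cong)
      also have "\<dots> = ls ! j * (\<Prod>i<n. ls ! i ^ e i)"
        using assms(2) by (subst (2) prod.remove[of _ j]) auto
      finally show ?thesis .
    qed
    then show ?thesis
      by (simp add: sum.reindex[OF inj] J'J E(2)[OF len] sum_distrib_left mult.assoc)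
  qed
  with E(1) show ?thesis by (intro mpfI) auto
qed

lemma poly_deg_add:
  assumes "poly_deg N f" "poly_deg N g"
  shows "poly_deg N (\<lambda>l. f l + g l)"
proof -
  obtain p q where "p = 0 \<or> degree p < N" "\<forall>l. f l = poly p l" "q = 0 \<or> degree q < N" "\<forall>l. g l = poly q l"
    using assms unfolding poly_deg_def by blast
  then show ?thesis
    unfolding poly_deg_def
    by (intro exI[of _ "p + q"]) (auto intro: degree_add_less)
qed

lemma poly_deg_scale:
  assumes "poly_deg N f"
  shows "poly_deg N (\<lambda>l. c * f l)"
proof -
  obtain p where "p = 0 \<or> degree p < N" "\<forall>l. f l = poly p l"
    using assms unfolding poly_deg_def by blast
  then show ?thesis
    unfolding poly_deg_def
    by (intro exI[of _ "smult c p"]) (auto intro: le_less_trans[OF degree_smult_le])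
qed

lemma poly_deg_zero: "poly_deg N (\<lambda>_. 0)"
  unfolding poly_deg_def by (intro exI[of _ 0]) simp

lemma poly_deg_sum: "(\<And>i. i \<in> I \<Longrightarrow> poly_deg N (f i)) \<Longrightarrow> poly_deg N (\<lambda>l. \<Sum>i\<in>I. f i l)"
  by (induction I rule: infinite_finite_induct) (auto intro: poly_deg_add poly_deg_zero)

lemma poly_deg_monom:
  assumes "k < N"
  shows "poly_deg N (\<lambda>l. l ^ k * c)"
  unfolding poly_deg_def
  using assms by (intro exI[of _ "monom c k"]) (auto simp: poly_monom degree_monom_eq intro: le_less_trans[OF degree_monom_le])

lemma mpf_poly_deg:
  assumes "mpf n f"
  obtains N where "\<And>ls j. length ls = n \<Longrightarrow> j < n \<Longrightarrow> poly_deg N (\<lambda>l. f (ls[j := l]))"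
proof -
  obtain E c where E: "finite E" "\<And>ls. length ls = n \<Longrightarrow> f ls = (\<Sum>e\<in>E. (\<Prod>i<n. ls ! i ^ e i) * c e)"
    using assms unfolding multi_poly_fun_def by blast
  \<comment> \<open>A crude bound: every single exponent is at most the sum of all exponents that
    occur.\<close>
  define N where "N = Suc (\<Sum>e\<in>E. \<Sum>i<n. e i)"
  show ?thesis
  proof (rule that[of N])
    fix ls :: "complex list" and j assume len: "length ls = n" and j: "j < n"
    have "f (ls[j := l]) = (\<Sum>e\<in>E. l ^ e j * ((\<Prod>i\<in>{..<n} - {j}. ls ! i ^ e i) * c e))" for l
    proof -
      have "(\<Prod>i<n. ls[j := l] ! i ^ e i) = l ^ e j * (\<Prod>i\<in>{..<n} - {j}. ls ! i ^ e i)" for e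
        using j len by (subst prod.remove[of _ j]) (auto intro!: prod.cong)
      then show ?thesis using len by (simp add: E(2) mult.assoc)
    qed
    moreover have "e j < N" if "e \<in> E" for e
    proof -
      have "e j \<le> (\<Sum>i<n. e i)" using j by (intro member_le_sum) auto
      also have "\<dots> \<le> (\<Sum>e\<in>E. \<Sum>i<n. e i)"
        using that E(1) by (intro member_le_sum) auto
      finally show ?thesis by (simp add: N_def)
    qed
    ultimately show "poly_deg N (\<lambda>l. f (ls[j := l]))"
      by (simp only:) (intro poly_deg_sum poly_deg_monom)
  qed
qed

lemma poly_deg_mono:
  assumes "poly_deg N f" "N \<le> M"
  shows "poly_deg M f"
proof -
  obtain p where "p = 0 \<or> degree p < N" "\<forall>l. f l = poly p l"
    using assms(1) unfolding poly_deg_def by blast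
  then show ?thesis
    unfolding poly_deg_def using assms(2) by (intro exI[of _ p]) auto
qed

context lie_algebra
begin

section \<open>Forms with spectral parameters and cochains of the current algebra\<close>

definition eval_pair :: "complex \<times> 'g poly \<Rightarrow> complex \<times> 'g" where
  "eval_pair x = (fst x, eval_at (- fst x) (snd x))"

text \<open>
  The cochain of \<open>Cur \<gg>\<close> whose restriction to \<open>\<gg>\<close> is \<open>G\<close>: arguments are paired with their spectral
  parameters, and sesquilinearity forces the evaluation \<open>\<partial> = -\<lambda>\<^sub>i\<close>.
\<close>

definition lift_form :: "nat \<Rightarrow> ((complex \<times> 'g) list \<Rightarrow> complex) \<Rightarrow> complex list \<Rightarrow> 'g poly list \<Rightarrow> complex" where
  "lift_form n G ls ps = (if length ls = n \<and> length ps = n then G (map eval_pair (zip ls ps)) else 0)"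

definition restrict_form :: "(complex list \<Rightarrow> 'g poly list \<Rightarrow> complex) \<Rightarrow> (complex \<times> 'g) list \<Rightarrow> complex" where
  "restrict_form \<gamma> xs = \<gamma> (map fst xs) (map (\<lambda>x. [:snd x:]) xs)"

lemma eval_pair_const [simp]: "eval_pair (l, [:a:]) = (l, a)"
  by (simp add: eval_pair_def)

text \<open>Evaluating the bracket at \<open>- (l + m)\<close> evaluates its arguments at
  \<open>- l\<close> and \<open>- m\<close>. Hence the sesquilinear bracket becomes the bracket of
  \<gg>, with the parameters added.\<close>

lemma eval_pair_lbr:
  "eval_pair (l + m, cur_lbr p l q) = pair_br (eval_pair (l, p)) (eval_pair (m, q))"
proof -
  have "- (l + m) + l = - m" by simp
  then show ?thesis by (simp add: eval_pair_def eval_at_cur_lbr)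
qed

lemma eval_at_linear: "Vector_Spaces.linear cur_scale scale (eval_at x)"
proof -
  interpret C: vector_space cur_scale by (rule vector_space_cur)
  show ?thesis by unfold_locales (simp_all add: eval_at_add eval_at_cur_scale)
qed

lemma map_eval_const: "map eval_pair (zip (map fst xs) (map (\<lambda>x. [:snd x:]) xs)) = xs"
  by (induction xs) auto

lemma restrict_lift:
  assumes "\<And>xs. length xs \<noteq> n \<Longrightarrow> G xs = 0"
  shows "restrict_form (lift_form n G) = G"
  using assms by (auto simp: restrict_form_def lift_form_def map_eval_const)

lemma zip_map_update:
  assumes "length ls = length ps" "i < length ps"
  shows "map eval_pair (zip ls (ps[i := p])) =
    take i (map eval_pair (zip ls ps)) @ eval_pair (ls ! i, p) # drop (Suc i) (map eval_pair (zip ls ps))"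
proof -
  have "zip ls (ps[i := p]) = (zip ls ps)[i := (ls ! i, p)]"
    using zip_update[of ls i "ls ! i" ps p] by simp
  then show ?thesis
    using assms by (simp add: map_update upd_conv_take_nth_drop take_map drop_map)
qed

text \<open>A parameter enters polynomially in two ways: through its divided powers in the Taylor
  sum and through the evaluation of the polynomial argument at its negative.\<close>

lemma mpf_lift_taylor:
  assumes "slotlin Pair F"
  shows "mpf (length ps) (\<lambda>ls. taylor N F (map eval_pair (zip ls ps)))"
  using assms
proof (induction ps arbitrary: F)
  case Nil
  then show ?case using mpf_const[of "F []"] by simp
next
  case (Cons p ps)
  interpret F: Vector_Spaces.linear scale "(*)" "\<lambda>a. F ((j, a) # zs)" for j zs
    by (rule slotlinD0[OF Cons.prems])
  let ?g = "\<lambda>m k ls. taylor N (\<lambda>ys. F ((m, coeff p k) # ys)) (map eval_pair (zip ls ps))"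
  have "taylor N F (map eval_pair (zip ls (p # ps))) =
      (\<Sum>m<N. \<Sum>k\<le>degree p. (inverse (fact m) * (-1) ^ k) * (hd ls ^ (m + k) * ?g m k (tl ls)))"
    if len: "length ls = Suc (length ps)" for ls
  proof -
    obtain l ls' where ls: "ls = l # ls'" using len by (cases ls) auto
    have ev: "eval_at (- l) p = (\<Sum>k\<le>degree p. scale ((-1) ^ k * l ^ k) (coeff p k))"
      unfolding eval_at_def by (subst power_minus) simp
    have "taylor N (\<lambda>ys. F ((m, eval_at (- l) p) # ys)) zs =
        (\<Sum>k\<le>degree p. ((-1) ^ k * l ^ k) * taylor N (\<lambda>ys. F ((m, coeff p k) # ys)) zs)" for m zs
      unfolding ev F.sum F.scale Tr_sum Tr_scale ..
    then have "taylor N F (map eval_pair (zip ls (p # ps))) =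
        (\<Sum>m<N. dpow l m * (\<Sum>k\<le>degree p. ((-1) ^ k * l ^ k) * ?g m k ls'))"
      unfolding ls zip_Cons_Cons list.map Tr.simps eval_pair_def fst_conv snd_conv by simp
    also have "\<dots> = (\<Sum>m<N. \<Sum>k\<le>degree p. (inverse (fact m) * (-1) ^ k) * (hd ls ^ (m + k) * ?g m k (tl ls)))"
      unfolding sum_distrib_left
    proof (intro sum.cong refl)
      fix m k
      show "dpow l m * ((- 1) ^ k * l ^ k * ?g m k ls') =
          inverse (fact m) * (- 1) ^ k * (hd ls ^ (m + k) * ?g m k (tl ls))"
        unfolding ls list.sel dpow_def power_add divide_inverse by (simp only: mult_ac)
    qed
    finally show ?thesis .
  qed
  moreover have "mpf (Suc (length ps)) (\<lambda>ls. \<Sum>m<N. \<Sum>k\<le>degree p. (inverse (fact m) * (-1) ^ k) * (hd ls ^ (m + k) * ?g m k (tl ls)))"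
    by (intro mpf_sum mpf_scale mpf_Cons Cons.IH slotlin_Cons Cons.prems)
  ultimately show ?case
    using mpf_cong[of "length (p # ps)" "\<lambda>ls. taylor N F (map eval_pair (zip ls (p # ps)))"] by simp
qed

lemma lift_taylor_basic:
  assumes F: "slotlin Pair F" "alt F" "\<And>xs. length xs \<noteq> n \<Longrightarrow> F xs = 0"
  shows "lift_form n (taylor N F) \<in> cur.basic_cochains n"
proof -
  let ?G = "taylor N F"
  have G: "slotlin Pair ?G" "alt ?G"
    using slotlin_Tr[OF F(1)] alt_Tr[OF F(2)] by auto
  show ?thesis
    unfolding cur.basic_cochains_def mem_Collect_eq
  proof (intro conjI allI impI)
    fix ls :: "complex list" and ps :: "'g poly list"
    assume "\<not> (length ls = n \<and> length ps = n)"
    then show "lift_form n ?G ls ps = 0" by (auto simp: lift_form_def)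
  next
    fix ps :: "'g poly list" assume len: "length ps = n"
    have "mpf n (\<lambda>ls. lift_form n ?G ls ps) \<longleftrightarrow> mpf n (\<lambda>ls. ?G (map eval_pair (zip ls ps)))"
      by (rule mpf_cong) (simp add: lift_form_def len)
    then show "mpf n (\<lambda>ls. lift_form n ?G ls ps)"
      using mpf_lift_taylor[OF F(1), of ps N] len by simp
  next
    fix ls :: "complex list" and ps :: "'g poly list" and i
    assume l: "length ls = n \<and> length ps = n \<and> i < n"
    let ?L = "map eval_pair (zip ls ps)"
    have upd: "lift_form n ?G ls (ps[i := p]) = ?G (take i ?L @ (ls ! i, eval_at (- (ls ! i)) p) # drop (Suc i) ?L)" for p
      using l zip_map_update[of ls ps i p] by (simp add: lift_form_def eval_pair_def)
    show "Vector_Spaces.linear cur_scale (*) (\<lambda>p. lift_form n ?G ls (ps[i := p]))"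
      unfolding upd
      using Vector_Spaces.linear_compose[OF eval_at_linear slotlinD[OF G(1)]] by (simp add: o_def)
    interpret G: Vector_Spaces.linear scale "(*)" "\<lambda>a. ?G (us @ (j, a) # vs)" for us j vs
      by (rule slotlinD[OF G(1)])
    have "lift_form n ?G ls (ps[i := pCons 0 (ps ! i)]) = - (ls ! i) * lift_form n ?G ls (ps[i := ps ! i])"
      unfolding upd eval_at_pCons0 G.scale ..
    then show "lift_form n ?G ls (ps[i := pCons 0 (ps ! i)]) = - (ls ! i) * lift_form n ?G ls ps"
      by simp
  next
    fix ls :: "complex list" and ps :: "'g poly list" and \<sigma>
    assume l: "length ls = n \<and> length ps = n \<and> \<sigma> permutes {..<n}"
    let ?L = "map eval_pair (zip ls ps)"
    have "zip (permute_list \<sigma> ls) (permute_list \<sigma> ps) = permute_list \<sigma> (zip ls ps)"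
      using l by (subst permute_list_zip[of \<sigma> "{..<n}"]) auto
    then have "map eval_pair (zip (permute_list \<sigma> ls) (permute_list \<sigma> ps)) = permute_list \<sigma> ?L"
      using l by (simp add: permute_list_map)
    then show "lift_form n ?G (permute_list \<sigma> ls) (permute_list \<sigma> ps) = of_int (sign \<sigma>) * lift_form n ?G ls ps"
      using l alt_permute[OF G(2), of \<sigma> n ?L] by (simp add: lift_form_def)
  qed
qed

lemma length_nths_remove2:
  assumes "i < j" "j < length xs"
  shows "Suc (Suc (length (nths xs (- {i, j})))) = length xs"
proof -
  have "{k. k < length xs \<and> k \<in> - {i, j}} = {..<length xs} - {i, j}" by auto
  then have "length (nths xs (- {i, j})) = card ({..<length xs} - {i, j})"
    by (simp add: length_nths)
  also have "\<dots> = length xs - 2"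
    using assms by (subst card_Diff_subset) auto
  finally show ?thesis using assms by simp
qed

text \<open>The module is trivial, so only the bracket terms remain, and \<open>eval_pair\<close>
  turns them into brackets of pairs.\<close>

lemma basic_d_lift:
  assumes "alt G" "\<And>xs. length xs \<noteq> n \<Longrightarrow> G xs = 0"
  shows "cur.basic_d n (lift_form n G) = lift_form (Suc n) (rd pair_br G)"
proof (intro ext)
  fix ls :: "complex list" and ps :: "'g poly list"
  show "cur.basic_d n (lift_form n G) ls ps = lift_form (Suc n) (rd pair_br G) ls ps"
  proof (cases "length ls = Suc n \<and> length ps = Suc n")
    case False
    then show ?thesis by (auto simp: cur.basic_d_def lift_form_def)
  next
    case True
    define L where "L = zip ls ps"
    have ls: "ls = map fst L" and ps: "ps = map snd L" and lenL: "length L = Suc n"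
      using True by (simp_all add: L_def)
    have "cur.basic_d n (lift_form n G) ls ps = ce_formula pair_br n G (map eval_pair L)"
      unfolding ce_formula_def
    proof -
      have t: "lift_form n G ((ls ! i + ls ! j) # nths ls (- {i, j})) (cur_lbr (ps ! i) (ls ! i) (ps ! j) # nths ps (- {i, j})) =
          G (pair_br (map eval_pair L ! i) (map eval_pair L ! j) # nths (map eval_pair L) (- {i, j}))"
        if ij: "i < j" "j < Suc n" for i j
      proof -
        have "Suc (length (nths L (- {i, j}))) = n"
          using length_nths_remove2[OF ij(1), of L] ij(2) lenL by simp
        then have "lift_form n G ((ls ! i + ls ! j) # nths ls (- {i, j})) (cur_lbr (ps ! i) (ls ! i) (ps ! j) # nths ps (- {i, j})) =
            G (eval_pair (ls ! i + ls ! j, cur_lbr (ps ! i) (ls ! i) (ps ! j)) # map eval_pair (nths L (- {i, j})))"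
          by (simp add: lift_form_def ls ps nths_map zip_map_fst_snd)
        also have "\<dots> = G (pair_br (map eval_pair L ! i) (map eval_pair L ! j) # nths (map eval_pair L) (- {i, j}))"
          using ij lenL by (simp add: eval_pair_lbr nths_map ls ps)
        finally show ?thesis .
      qed
      show "cur.basic_d n (lift_form n G) ls ps =
          (\<Sum>j<Suc n. \<Sum>i<j. (-1) ^ (i + j) * G (pair_br (map eval_pair L ! i) (map eval_pair L ! j) # nths (map eval_pair L) (- {i, j})))"
        unfolding cur.basic_d_def using True by (auto simp: t simp del: sum.lessThan_Suc intro!: sum.cong)
    qed
    also have "\<dots> = rd pair_br G (map eval_pair L)"
      by (rule ce_formula_eq_rd[OF assms(1)]) (simp add: lenL)
    finally show ?thesis using True by (simp add: lift_form_def L_def)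
  qed
qed

text \<open>Sesquilinearity lets \<partial> act in the slot \<open>i\<close> as multiplication by
  the negative parameter; Horner's scheme then replaces the polynomial by its value.\<close>

lemma basic_cochain_const:
  assumes \<gamma>: "\<gamma> \<in> cur.basic_cochains n" and len: "length ls = n" "length ps = n" and i: "i < n"
  shows "\<gamma> ls (ps[i := p]) = \<gamma> ls (ps[i := [:eval_at (- (ls ! i)) p:]])"
proof -
  interpret \<gamma>: Vector_Spaces.linear cur_scale "(*)" "\<lambda>a. \<gamma> ls (ps[i := a])"
    using \<gamma> len i by (simp add: cur.basic_cochains_def)
  have shift: "\<gamma> ls (ps[i := pCons 0 q]) = - (ls ! i) * \<gamma> ls (ps[i := q])" for q
  proof -
    have "\<forall>ls as i. length ls = n \<and> length as = n \<and> i < n \<longrightarrow> \<gamma> ls (as[i := pCons 0 (as ! i)]) = - (ls ! i) * \<gamma> ls as"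
      using \<gamma> by (simp add: cur.basic_cochains_def)
    from this[rule_format, of ls "ps[i := q]" i] show ?thesis
      using len i by simp
  qed
  have const: "\<gamma> ls (ps[i := [:scale c a + b:]]) = c * \<gamma> ls (ps[i := [:a:]]) + \<gamma> ls (ps[i := [:b:]])" for a b c
  proof -
    have "[:scale c a + b:] = cur_scale c [:a:] + [:b:]"
      by (simp add: poly_eq_iff coeff_pCons split: nat.splits)
    then show ?thesis by (simp only: \<gamma>.add \<gamma>.scale)
  qed
  show ?thesis
  proof (induction p)
    case 0
    then show ?case by simp
  next
    case (pCons a p)
    have split: "pCons a p = [:a:] + pCons 0 p" by simp
    have "eval_at (- (ls ! i)) (pCons a p) = scale (- (ls ! i)) (eval_at (- (ls ! i)) p) + a"
      unfolding split eval_at_add eval_at_pCons0 by simp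
    then have "\<gamma> ls (ps[i := [:eval_at (- (ls ! i)) (pCons a p):]]) =
        - (ls ! i) * \<gamma> ls (ps[i := p]) + \<gamma> ls (ps[i := [:a:]])"
      by (simp only: const pCons.IH)
    also have "\<dots> = \<gamma> ls (ps[i := pCons a p])"
      unfolding split \<gamma>.add shift by simp
    finally show ?case by simp
  qed
qed

lemma lift_restrict:
  assumes \<gamma>: "\<gamma> \<in> cur.basic_cochains n"
  shows "lift_form n (restrict_form \<gamma>) = \<gamma>"
proof (intro ext)
  fix ls :: "complex list" and ps :: "'g poly list"
  show "lift_form n (restrict_form \<gamma>) ls ps = \<gamma> ls ps"
  proof (cases "length ls = n \<and> length ps = n")
    case False
    then show ?thesis using \<gamma> by (auto simp: lift_form_def cur.basic_cochains_def)
  next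
    case True
    let ?c = "\<lambda>i. [:eval_at (- (ls ! i)) (ps ! i):]"
    \<comment> \<open>The arguments are replaced by constants one after the other, from the
      left.\<close>
    have "\<gamma> ls (map ?c [0..<k] @ drop k ps) = \<gamma> ls ps" if "k \<le> n" for k
      using that
    proof (induction k)
      case 0
      then show ?case by simp
    next
      case (Suc k)
      let ?ps = "map ?c [0..<k] @ drop k ps"
      have k: "k < n" using Suc by simp
      have d: "drop k ps = ps ! k # drop (Suc k) ps"
        using True k by (simp add: Cons_nth_drop_Suc)
      have "map ?c [0..<Suc k] @ drop (Suc k) ps = ?ps[k := ?c k]"
        by (simp add: list_update_append d)
      moreover have "?ps = ?ps[k := ps ! k]"
        by (simp add: list_update_append d)
      ultimately show ?case
        using basic_cochain_const[OF \<gamma>, of ls ?ps k "ps ! k"] True k Suc by simp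
    qed
    from this[of n] have "\<gamma> ls (map ?c [0..<n]) = \<gamma> ls ps" using True by simp
    moreover have "map (\<lambda>x. [:snd x:]) (map eval_pair (zip ls ps)) = map ?c [0..<n]"
      using True by (intro nth_equalityI) (auto simp: eval_pair_def)
    moreover have "map fst (map eval_pair (zip ls ps)) = ls"
      using True by (intro nth_equalityI) (auto simp: eval_pair_def)
    ultimately show ?thesis
      using True by (simp only: lift_form_def restrict_form_def) simp
  qed
qed

lemma restrict_basic:
  assumes \<gamma>: "\<gamma> \<in> cur.basic_cochains n"
  shows "slotlin Pair (restrict_form \<gamma>)" "alt (restrict_form \<gamma>)" "length xs \<noteq> n \<Longrightarrow> restrict_form \<gamma> xs = 0"
proof -
  show len: "restrict_form \<gamma> xs = 0" if "length xs \<noteq> n" for xs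
    using \<gamma> that by (simp add: cur.basic_cochains_def restrict_form_def)
  have const: "Vector_Spaces.linear scale cur_scale (\<lambda>a. [:a:])"
  proof -
    interpret C: vector_space cur_scale by (rule vector_space_cur)
    show ?thesis
      by unfold_locales (auto simp: poly_eq_iff coeff_pCons split: nat.splits)
  qed
  show "slotlin Pair (restrict_form \<gamma>)"
    unfolding slotlin_def
  proof (intro allI)
    fix us l vs
    show "Vector_Spaces.linear scale (*) (\<lambda>a. restrict_form \<gamma> (us @ (l, a) # vs))"
    proof (cases "Suc (length us + length vs) = n")
      case True
      let ?ls = "map fst us @ l # map fst vs" and ?ps = "map (\<lambda>x. [:snd x:]) us @ 0 # map (\<lambda>x. [:snd x:]) vs"
      have "Vector_Spaces.linear cur_scale (*) (\<lambda>p. \<gamma> ?ls (?ps[length us := p]))"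
        using \<gamma> True by (auto simp: cur.basic_cochains_def)
      from Vector_Spaces.linear_compose[OF const this] show ?thesis
        by (simp add: o_def restrict_form_def list_update_append)
    next
      case False
      then have "restrict_form \<gamma> (us @ (l, a) # vs) = 0" for a by (intro len) simp
      then show ?thesis using VC.linear_zero by simp
    qed
  qed
  show "alt (restrict_form \<gamma>)"
  proof (rule alt_if_permute)
    fix xs :: "(complex \<times> 'g) list" and \<sigma> assume s: "\<sigma> permutes {..<length xs}"
    show "restrict_form \<gamma> (permute_list \<sigma> xs) = of_int (sign \<sigma>) * restrict_form \<gamma> xs"
    proof (cases "length xs = n")
      case True
      then have "\<gamma> (permute_list \<sigma> (map fst xs)) (permute_list \<sigma> (map (\<lambda>x. [:snd x:]) xs)) =
          of_int (sign \<sigma>) * \<gamma> (map fst xs) (map (\<lambda>x. [:snd x:]) xs)"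
        using \<gamma> s unfolding cur.basic_cochains_def by simp
      then show ?thesis
        by (simp add: restrict_form_def permute_list_map[OF s])
    next
      case False
      then show ?thesis using len by simp
    qed
  qed
qed

end

context semisimple_lie_algebra
begin

text \<open>Finite-dimensionality of \<open>\<gg>\<close> bounds the \<open>\<lambda>\<close>-degree of a cochain.\<close>

lemma restrict_poly_deg:
  assumes \<gamma>: "\<gamma> \<in> cur.basic_cochains n"
  obtains N where "0 < N" "\<And>us a vs. poly_deg N (\<lambda>l. restrict_form \<gamma> (us @ (l, a) # vs))"
proof -
  obtain B where B: "basis_of B UNIV"
    using basis_of_exists[OF subspace_UNIV fin_dim_any] .
  let ?L = "{bs. set bs \<subseteq> B \<and> length bs = n}"
  have fin: "finite ?L" using finite_lists_length_eq[OF basis_ofD(1)[OF B]] .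
  let ?f = "\<lambda>bs ls. \<gamma> ls (map (\<lambda>a. [:a:]) bs)"
  have "\<exists>N. \<forall>ls j. length ls = n \<longrightarrow> j < n \<longrightarrow> poly_deg N (\<lambda>l. ?f bs (ls[j := l]))" if "bs \<in> ?L" for bs
  proof -
    have "mpf n (?f bs)" using \<gamma> that by (simp add: cur.basic_cochains_def)
    then show ?thesis by (rule mpf_poly_deg) blast
  qed
  then have "\<forall>bs\<in>?L. \<exists>N. \<forall>ls j. length ls = n \<longrightarrow> j < n \<longrightarrow> poly_deg N (\<lambda>l. ?f bs (ls[j := l]))"
    by blast
  from bchoice[OF this] obtain N' where
    "\<forall>bs\<in>?L. \<forall>ls j. length ls = n \<longrightarrow> j < n \<longrightarrow> poly_deg (N' bs) (\<lambda>l. ?f bs (ls[j := l]))"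
    by (rule exE)
  then have N': "poly_deg (N' bs) (\<lambda>l. ?f bs (ls[j := l]))" if "bs \<in> ?L" "length ls = n" "j < n" for bs ls j
    using that by blast
  \<comment> \<open>One bound for the finitely many tuples of basis vectors; the successor makes it
    positive.\<close>
  define N where "N = Suc (\<Sum>bs\<in>?L. N' bs)"
  have N: "poly_deg N (\<lambda>l. ?f bs (ls[j := l]))" if "bs \<in> ?L" "length ls = n" "j < n" for bs ls j
  proof (rule poly_deg_mono[OF N'[OF that]])
    show "N' bs \<le> N" unfolding N_def using member_le_sum[OF that(1) _ fin, of N'] by simp
  qed
  note G = restrict_basic[OF \<gamma>]
  show ?thesis
  proof (rule that[of N])
    show "0 < N" by (simp add: N_def)
  next
    fix us :: "(complex \<times> 'a) list" and a vs
    show "poly_deg N (\<lambda>l. restrict_form \<gamma> (us @ (l, a) # vs))"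
    proof (cases "Suc (length us + length vs) = n")
      case False
      then show ?thesis using G(3) poly_deg_zero by simp
    next
      case True
      define as where "as = map snd us @ a # map snd vs"
      \<comment> \<open>For fixed parameters the form is multilinear in the vectors, so it is a
        combination of its values on basis tuples, with coefficients that do not involve
        \<open>l\<close>.\<close>
      have expand: "restrict_form \<gamma> (us @ (l, a) # vs) = (\<Sum>bs\<in>?L. basis_coeff B bs as * ?f bs ((map fst us @ 0 # map fst vs)[length us := l]))" for l
      proof -
        define ls where "ls = map fst us @ l # map fst vs"
        have len: "length ls = n" "length as = n" using True by (simp_all add: ls_def as_def)
        define H where "H cs = (if length cs = n then restrict_form \<gamma> (zip ls cs) else 0)" for cs
        have "slotlin id_slot H"
          unfolding slotlin_def
        proof (intro allI)
          fix cs ds :: "'a list"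
          show "Vector_Spaces.linear scale (*) (\<lambda>c. H (cs @ c # ds))"
          proof (cases "length (cs @ undefined # ds) = n")
            case False
            then have "H (cs @ c # ds) = 0" for c by (simp add: H_def)
            then show ?thesis using VC.linear_zero by simp
          next
            case True
            then have "drop (length cs) ls = ls ! length cs # drop (Suc (length cs)) ls"
              using len by (intro Cons_nth_drop_Suc[symmetric]) simp
            then have "H (cs @ c # ds) =
                restrict_form \<gamma> (zip (take (length cs) ls) cs @ (ls ! length cs, c) # zip (drop (Suc (length cs)) ls) ds)" for c
              using True by (simp add: H_def zip_append2)
            then show ?thesis using slotlinD[OF G(1)] by simp
          qed
        qed
        then have "H as = (\<Sum>bs | set bs \<subseteq> B \<and> length bs = length as. basis_coeff B bs as * H bs)"
          by (rule multilinear_expand[OF B])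
        moreover have "H bs = ?f bs ls" if "length bs = n" for bs
        proof -
          have "map (\<lambda>x. [:snd x:]) (zip ls bs) = map (\<lambda>a. [:a:]) bs"
            using that len by (intro nth_equalityI) auto
          then show ?thesis using that len by (simp add: H_def restrict_form_def)
        qed
        moreover have "zip ls as = us @ (l, a) # vs"
          by (simp add: ls_def as_def zip_map_fst_snd)
        ultimately show ?thesis
          using len by (simp add: H_def ls_def list_update_append)
      qed
      show ?thesis
        unfolding expand using True
        by (intro poly_deg_sum poly_deg_scale N) auto
    qed
  qed
qed

text \<open>Interpolation in all slots at once yields the coefficients, thanks to a degree bound
  \<open>N\<close> that is common to all slots and all vectors.\<close>

lemma basic_cochain_taylor:
  assumes \<gamma>: "\<gamma> \<in> cur.basic_cochains n"
  obtains N F where "0 < N" "slotlin Pair F" "alt F" "degree_bounded N F"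
    "\<And>xs. length xs \<noteq> n \<Longrightarrow> F xs = 0" "restrict_form \<gamma> = taylor N F"
proof -
  note G = restrict_basic[OF \<gamma>]
  obtain N where N: "0 < N" "\<And>us a vs. poly_deg N (\<lambda>l. restrict_form \<gamma> (us @ (l, a) # vs))"
    using restrict_poly_deg[OF \<gamma>] by blast
  obtain w :: "nat \<Rightarrow> nat \<Rightarrow> complex" where w: "\<And>m k. N \<le> m \<Longrightarrow> w m k = 0"
    "\<And>f l. poly_deg N f \<Longrightarrow> f l = (\<Sum>m<N. dpow l m * (\<Sum>k<N. w m k * f (of_nat k)))"
    using lagrange_weights[of N] by blast
  let ?F = "Tr w of_nat N (restrict_form \<gamma>)"
  show ?thesis
  proof (rule that[of N ?F, OF N(1)])
    show "slotlin Pair ?F" by (rule slotlin_Tr[OF G(1)])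
    show "alt ?F" by (rule alt_Tr[OF G(2)])
    show "degree_bounded N ?F" by (rule degree_bounded_Tr) (rule w(1))
    show "?F xs = 0" if "length xs \<noteq> n" for xs by (rule Tr_wrong_length[OF G(3) that])
    show "restrict_form \<gamma> = taylor N ?F"
      using taylor_interpolate[OF w(2) N(2)] by (intro ext) simp
  qed
qed

end

section \<open>Cohomology of the basic complex\<close>

context lie_algebra
begin

definition bscale :: "complex \<Rightarrow> (complex list \<Rightarrow> 'g poly list \<Rightarrow> complex) \<Rightarrow> complex list \<Rightarrow> 'g poly list \<Rightarrow> complex" where
  "bscale c \<gamma> ls ps = c * \<gamma> ls ps"

lemma complex_vector_space: "vector_space ((*) :: complex \<Rightarrow> complex \<Rightarrow> complex)"
  by (intro vector_space.intro) (simp_all add: ring_distribs)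

lemma bscale_vs: "vector_space bscale"
  by (intro vector_space.intro; intro ext; simp add: bscale_def ring_distribs)

lemma lift_form_zero: "lift_form n (\<lambda>_. 0) = 0"
  by (intro ext) (simp add: lift_form_def)

lemma lift_form_add: "lift_form n (\<lambda>xs. F xs + G xs) = lift_form n F + lift_form n G"
  by (intro ext) (simp add: lift_form_def)

lemma lift_form_scale: "lift_form n (\<lambda>xs. c * F xs) = bscale c (lift_form n F)"
  by (intro ext) (simp add: lift_form_def bscale_def)

lemma lift_form_length_cong:
  assumes "\<And>xs. length xs = n \<Longrightarrow> F xs = G xs"
  shows "lift_form n F = lift_form n G"
  using assms by (intro ext) (simp add: lift_form_def)

lemma restrict_form_add: "restrict_form (\<gamma> + \<gamma>') = (\<lambda>xs. restrict_form \<gamma> xs + restrict_form \<gamma>' xs)"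
  by (intro ext) (simp add: restrict_form_def)

lemma restrict_form_scale: "restrict_form (bscale c \<gamma>) = (\<lambda>xs. c * restrict_form \<gamma> xs)"
  by (intro ext) (simp add: restrict_form_def bscale_def)

lemma basic_d_restrict:
  assumes "\<gamma> \<in> cur.basic_cochains n"
  shows "cur.basic_d n \<gamma> = lift_form (Suc n) (rd pair_br (restrict_form \<gamma>))"
  using basic_d_lift[of "restrict_form \<gamma>" n] restrict_basic[OF assms] lift_restrict[OF assms] by simp

lemma restrict_basic_d:
  assumes "\<gamma> \<in> cur.basic_cochains n"
  shows "restrict_form (cur.basic_d n \<gamma>) = rd pair_br (restrict_form \<gamma>)"
  unfolding basic_d_restrict[OF assms]
  by (rule restrict_lift) (rule rd_wrong_length[OF restrict_basic(3)[OF assms]])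

lemma basic_cochains_subspace:
  "0 \<in> cur.basic_cochains n"
  "\<gamma> \<in> cur.basic_cochains n \<Longrightarrow> \<gamma>' \<in> cur.basic_cochains n \<Longrightarrow> \<gamma> + \<gamma>' \<in> cur.basic_cochains n"
  "\<gamma> \<in> cur.basic_cochains n \<Longrightarrow> bscale c \<gamma> \<in> cur.basic_cochains n"
proof -
  interpret VP: vector_space_pair cur_scale "(*) :: complex \<Rightarrow> complex \<Rightarrow> complex"
    by (intro vector_space_pair.intro vector_space_cur complex_vector_space)
  show "0 \<in> cur.basic_cochains n"
    using VP.linear_zero by (auto simp: cur.basic_cochains_def mpf_zero)
  assume g: "\<gamma> \<in> cur.basic_cochains n"
  then show "bscale c \<gamma> \<in> cur.basic_cochains n"
    unfolding cur.basic_cochains_def mem_Collect_eq bscale_def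
    by (auto intro: mpf_scale VP.linear_compose_scale_right)
  assume "\<gamma>' \<in> cur.basic_cochains n"
  with g show "\<gamma> + \<gamma>' \<in> cur.basic_cochains n"
    unfolding cur.basic_cochains_def mem_Collect_eq plus_fun_apply
    by (auto intro: mpf_add VP.linear_compose_add simp: distrib_left)
qed

lemma basic_cochains_diff:
  assumes "\<gamma> \<in> cur.basic_cochains n" "\<gamma>' \<in> cur.basic_cochains n"
  shows "\<gamma> - \<gamma>' \<in> cur.basic_cochains n"
proof -
  have "\<gamma> - \<gamma>' = \<gamma> + bscale (- 1) \<gamma>'" by (intro ext) (simp add: bscale_def)
  then show ?thesis by (simp only:) (intro basic_cochains_subspace assms)
qed

lemma basic_d_add:
  assumes "\<gamma> \<in> cur.basic_cochains n" "\<gamma>' \<in> cur.basic_cochains n"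
  shows "cur.basic_d n (\<gamma> + \<gamma>') = cur.basic_d n \<gamma> + cur.basic_d n \<gamma>'"
  unfolding basic_d_restrict[OF assms(1)] basic_d_restrict[OF assms(2)]
    basic_d_restrict[OF basic_cochains_subspace(2)[OF assms]]
  unfolding restrict_form_add lift_form_add[symmetric]
  by (intro arg_cong[where f = "lift_form (Suc n)"] ext) (rule rd_add)

lemma basic_d_scale:
  assumes "\<gamma> \<in> cur.basic_cochains n"
  shows "cur.basic_d n (bscale c \<gamma>) = bscale c (cur.basic_d n \<gamma>)"
  unfolding basic_d_restrict[OF assms(1)] basic_d_restrict[OF basic_cochains_subspace(3)[OF assms]]
  unfolding restrict_form_scale lift_form_scale[symmetric]
  by (intro arg_cong[where f = "lift_form (Suc n)"] ext) (rule rd_scale)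

lemma basic_d_zero: "cur.basic_d n 0 = 0"
proof -
  have "bscale 0 \<gamma> = 0" for \<gamma> by (intro ext) (simp add: bscale_def)
  then show ?thesis
    using basic_d_scale[OF basic_cochains_subspace(1), of n 0] by simp
qed

lemma basic_d_diff:
  assumes "\<gamma> \<in> cur.basic_cochains n" "\<gamma>' \<in> cur.basic_cochains n"
  shows "cur.basic_d n (\<gamma> - \<gamma>') = cur.basic_d n \<gamma> - cur.basic_d n \<gamma>'"
  using basic_d_add[OF basic_cochains_diff[OF assms] assms(2)] by (simp add: algebra_simps)

lemma ce_embedding_lift: "ce_embedding n \<omega> = lift_form n (\<lambda>xs. \<omega> (map snd xs))"
proof (intro ext)
  fix ls ps
  have "map2 (\<lambda>l p. eval_at (- l) p) ls ps = map snd (map eval_pair (zip ls ps))"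
    by (simp add: eval_pair_def o_def case_prod_unfold)
  then show "ce_embedding n \<omega> ls ps = lift_form n (\<lambda>xs. \<omega> (map snd xs)) ls ps"
    by (simp only: ce_embedding_def lift_form_def)
qed

text \<open>The form is viewed as a form on \<gg>[t] concentrated in degree zero, so that the claim
  is a case of \<open>lift_taylor_basic\<close> with \<open>N = 1\<close>.\<close>

lemma ce_embedding_basic:
  assumes "\<omega> \<in> ce_cochains n"
  shows "ce_embedding n \<omega> \<in> cur.basic_cochains n"
proof -
  have w: "\<forall>as. length as \<noteq> n \<longrightarrow> \<omega> as = 0" "slotlin id_slot \<omega>" "alt \<omega>"
    using assms by (simp_all add: ce_cochains_iff)
  define F :: "(nat \<times> 'g) list \<Rightarrow> complex" where
    "F xs = (if sum_list (map fst xs) = 0 then \<omega> (map snd xs) else 0)" for xs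
  have "slotlin Pair F"
    unfolding slotlin_def F_def
  proof (intro allI)
    fix us i vs
    show "Vector_Spaces.linear scale (*) (\<lambda>a. if sum_list (map fst (us @ (i, a) # vs)) = 0 then \<omega> (map snd (us @ (i, a) # vs)) else 0)"
      using slotlinD[OF w(2), of "map snd us" "map snd vs"] VC.linear_zero
      by (cases "sum_list (map fst us) + (i + sum_list (map fst vs)) = 0") simp_all
  qed
  moreover have "alt F"
    unfolding alt_def F_def
  proof (intro allI)
    fix us vs :: "(nat \<times> 'g) list" and x y
    show "(if sum_list (map fst (us @ x # y # vs)) = 0 then \<omega> (map snd (us @ x # y # vs)) else 0) =
        - (if sum_list (map fst (us @ y # x # vs)) = 0 then \<omega> (map snd (us @ y # x # vs)) else 0)"
    proof -
      have "sum_list (map fst (us @ x # y # vs)) = sum_list (map fst (us @ y # x # vs))" by (simp add: add.left_commute)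
      then show ?thesis
        using altD[OF w(3), of "map snd us" "snd x" "snd y" "map snd vs"] by (simp only: map_append list.map) simp
    qed
  qed
  moreover have "F xs = 0" if "length xs \<noteq> n" for xs using w(1) that by (simp add: F_def)
  ultimately have l: "lift_form n (taylor 1 F) \<in> cur.basic_cochains n" by (rule lift_taylor_basic)
  have "taylor 1 F xs = \<omega> (map snd xs)" for xs
    unfolding F_def[abs_def] by (subst taylor_degree_zero) (simp_all add: o_def)
  then have eq: "taylor 1 F = (\<lambda>xs. \<omega> (map snd xs))" by (intro ext)
  show ?thesis using l unfolding eq ce_embedding_lift .
qed

lemma ce_embedding_add: "ce_embedding n (\<omega> + \<eta>) = ce_embedding n \<omega> + ce_embedding n \<eta>"
  by (intro ext) (simp add: ce_embedding_def)

lemma ce_embedding_scale: "ce_embedding n (fscale c \<omega>) = bscale c (ce_embedding n \<omega>)"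
  by (intro ext) (simp add: ce_embedding_def fscale_def bscale_def)

lemma ce_embedding_zero: "ce_embedding n 0 = 0"
  by (intro ext) (simp add: ce_embedding_def)

lemma basic_d_embedding:
  assumes "\<omega> \<in> ce_cochains n"
  shows "cur.basic_d n (ce_embedding n \<omega>) = ce_embedding (Suc n) (rd br \<omega>)"
proof -
  have w: "\<forall>as. length as \<noteq> n \<longrightarrow> \<omega> as = 0" "alt \<omega>"
    using assms by (simp_all add: ce_cochains_iff)
  have "alt (\<lambda>xs :: (complex \<times> 'g) list. \<omega> (map snd xs))"
    unfolding alt_def
  proof (intro allI)
    fix us x y and vs :: "(complex \<times> 'g) list"
    show "\<omega> (map snd (us @ x # y # vs)) = - \<omega> (map snd (us @ y # x # vs))"
      using altD[OF w(2), of "map snd us" "snd x" "snd y" "map snd vs"] by simp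
  qed
  then have "cur.basic_d n (ce_embedding n \<omega>) = lift_form (Suc n) (rd pair_br (\<lambda>xs. \<omega> (map snd xs)))"
    unfolding ce_embedding_lift by (rule basic_d_lift) (simp add: w(1))
  also have "rd pair_br (\<lambda>xs. \<omega> (map snd xs)) = (\<lambda>xs :: (complex \<times> 'g) list. rd br \<omega> (map snd xs))"
    by (intro ext rd_map) simp
  finally show ?thesis by (simp add: ce_embedding_lift)
qed

text \<open>The projection to \<lambda>-degree zero: a map of complexes that is left inverse to
  \<open>ce_embedding\<close>. It pulls exactness in the basic complex back to exactness on
  \<gg>.\<close>

definition at_zero :: "(complex list \<Rightarrow> 'g poly list \<Rightarrow> complex) \<Rightarrow> 'g list \<Rightarrow> complex" where
  "at_zero \<gamma> as = restrict_form \<gamma> (map (Pair 0) as)"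

lemma at_zero_ce_cochains:
  assumes "\<gamma> \<in> cur.basic_cochains n"
  shows "at_zero \<gamma> \<in> ce_cochains n"
proof -
  note G = restrict_basic[OF assms]
  have "slotlin id_slot (at_zero \<gamma>)"
    unfolding slotlin_def at_zero_def using slotlinD[OF G(1)] by simp
  moreover have "alt (at_zero \<gamma>)"
    unfolding alt_def at_zero_def
  proof (intro allI)
    fix us x y vs
    show "restrict_form \<gamma> (map (Pair 0) (us @ x # y # vs)) = - restrict_form \<gamma> (map (Pair 0) (us @ y # x # vs))"
      using altD[OF G(2), of "map (Pair 0) us" "(0, x)" "(0, y)" "map (Pair 0) vs"] by simp
  qed
  ultimately show ?thesis
    using G(3) by (simp add: ce_cochains_iff at_zero_def)
qed

lemma at_zero_basic_d:
  assumes "\<gamma> \<in> cur.basic_cochains n"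
  shows "at_zero (cur.basic_d n \<gamma>) = rd br (at_zero \<gamma>)"
proof
  fix as
  have "rd br (at_zero \<gamma>) as = rd pair_br (restrict_form \<gamma>) (map (Pair 0) as)"
    unfolding at_zero_def[abs_def] by (rule rd_map) simp
  then show "at_zero (cur.basic_d n \<gamma>) as = rd br (at_zero \<gamma>) as"
    unfolding at_zero_def[of "cur.basic_d n \<gamma>"] restrict_basic_d[OF assms] by simp
qed

lemma at_zero_embedding:
  assumes "\<omega> \<in> ce_cochains n"
  shows "at_zero (ce_embedding n \<omega>) = \<omega>"
proof
  fix as
  have "restrict_form (ce_embedding n \<omega>) = (\<lambda>xs. \<omega> (map snd xs))"
    unfolding ce_embedding_lift by (rule restrict_lift) (use assms in \<open>simp add: ce_cochains_iff\<close>)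
  then show "at_zero (ce_embedding n \<omega>) as = \<omega> as"
    by (simp add: at_zero_def o_def)
qed

lemma at_zero_add: "at_zero (\<gamma> + \<gamma>') = at_zero \<gamma> + at_zero \<gamma>'"
  by (intro ext) (simp add: at_zero_def restrict_form_def)

theorem ce_embedding_bij:
  "bij_betw (ce_embedding n) (ce_cochains n) (degree_zero_cochains n)"
  unfolding bij_betw_def
proof
  show "inj_on (ce_embedding n) (ce_cochains n)"
    by (rule inj_onI) (metis at_zero_embedding)
  show "ce_embedding n ` ce_cochains n = degree_zero_cochains n"
  proof (intro equalityI subsetI)
    fix \<gamma> assume "\<gamma> \<in> ce_embedding n ` ce_cochains n"
    then obtain \<omega> where w: "\<omega> \<in> ce_cochains n" "\<gamma> = ce_embedding n \<omega>" by blast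
    then show "\<gamma> \<in> degree_zero_cochains n"
      using ce_embedding_basic[OF w(1)] by (simp add: degree_zero_cochains_def ce_embedding_const)
  next
    fix \<gamma> assume g: "\<gamma> \<in> degree_zero_cochains n"
    then have b: "\<gamma> \<in> cur.basic_cochains n" by (simp add: degree_zero_cochains_def)
    have "\<gamma> = lift_form n (restrict_form \<gamma>)" using lift_restrict[OF b] by simp
    also have "\<dots> = lift_form n (\<lambda>xs. at_zero \<gamma> (map snd xs))"
    proof (rule lift_form_length_cong)
      fix xs :: "(complex \<times> 'g) list" assume l: "length xs = n"
      have "\<gamma> (map fst xs) (map (\<lambda>a. [:a:]) (map snd xs)) = \<gamma> (map (\<lambda>_. 0) xs) (map (\<lambda>a. [:a:]) (map snd xs))"
      proof -
        have h: "\<forall>as ls ls'. length as = n \<and> length ls = n \<and> length ls' = n \<longrightarrow>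
            \<gamma> ls (map (\<lambda>a. [:a:]) as) = \<gamma> ls' (map (\<lambda>a. [:a:]) as)"
          using g by (simp add: degree_zero_cochains_def)
        show ?thesis
          using h[rule_format, of "map snd xs" "map fst xs" "map (\<lambda>_. 0) xs"] l by simp
      qed
      then show "restrict_form \<gamma> xs = at_zero \<gamma> (map snd xs)"
        by (simp add: restrict_form_def at_zero_def o_def)
    qed
    finally show "\<gamma> \<in> ce_embedding n ` ce_cochains n"
      using at_zero_ce_cochains[OF b] by (simp add: ce_embedding_lift[symmetric])
  qed
qed

section \<open>The action of \<partial> on cochains\<close>

lemma partial_eq: "cur.basic_partial \<gamma> ls ps = sum_list ls * \<gamma> ls ps"
  by (simp add: cur.basic_partial_def)

lemma partial_add: "cur.basic_partial (\<gamma> + \<gamma>') = cur.basic_partial \<gamma> + cur.basic_partial \<gamma>'"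
  by (intro ext) (simp add: partial_eq distrib_left)

lemma partial_scale: "cur.basic_partial (bscale c \<gamma>) = bscale c (cur.basic_partial \<gamma>)"
  by (intro ext) (simp add: partial_eq bscale_def)

lemma partial_zero: "cur.basic_partial 0 = 0"
  by (intro ext) (simp add: partial_eq)

lemma sum_list_permute:
  assumes "\<sigma> permutes {..<length ls}"
  shows "sum_list (permute_list \<sigma> ls) = sum_list (ls :: complex list)"
  using assms by (metis mset_permute_list sum_mset_sum_list)

lemma partial_basic:
  assumes "\<gamma> \<in> cur.basic_cochains n"
  shows "cur.basic_partial \<gamma> \<in> cur.basic_cochains n"
proof -
  interpret VP: vector_space_pair cur_scale "(*) :: complex \<Rightarrow> complex \<Rightarrow> complex"
    by (intro vector_space_pair.intro vector_space_cur complex_vector_space)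
  have "mpf n (\<lambda>ls. sum_list ls * \<gamma> ls as)" if "length as = n" for as
  proof -
    have "mpf n (\<lambda>ls. \<Sum>j<n. ls ! j * \<gamma> ls as)"
      using assms that by (intro mpf_sum mpf_times_nth) (auto simp: cur.basic_cochains_def)
    then show ?thesis
      by (subst mpf_cong) (auto simp: sum_list_sum_nth sum_distrib_right atLeast0LessThan)
  qed
  then show ?thesis
    using assms unfolding cur.basic_cochains_def mem_Collect_eq partial_eq
    by (auto simp: sum_list_permute intro: VP.linear_compose_scale_right)
qed

lemma basic_d_partial:
  assumes "\<gamma> \<in> cur.basic_cochains n"
  shows "cur.basic_d n (cur.basic_partial \<gamma>) = cur.basic_partial (cur.basic_d n \<gamma>)"
proof -
  have r: "restrict_form (cur.basic_partial \<gamma>) = (\<lambda>xs. sum_list (map fst xs) * restrict_form \<gamma> xs)"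
    by (intro ext) (simp add: restrict_form_def partial_eq)
  have rd: "rd pair_br (restrict_form (cur.basic_partial \<gamma>)) xs = sum_list (map fst xs) * rd pair_br (restrict_form \<gamma>) xs" for xs
    unfolding r by (rule rd_weight[of pair_br "\<lambda>s. s"]) simp
  have "map fst (map eval_pair (zip ls ps)) = ls" if "length ls = length ps" for ls ps
    using that by (simp add: eval_pair_def o_def)
  then show ?thesis
    unfolding basic_d_restrict[OF partial_basic[OF assms]] basic_d_restrict[OF assms]
    by (intro ext) (simp add: lift_form_def rd partial_eq del: map_map)
qed

text \<open>As a function of the first parameter a value of the cochain is a polynomial, and
  multiplication by the nonzero linear polynomial \<open>[:sum_list ls', 1:]\<close> is injective.
  This uses that there is at least one argument.\<close>

lemma partial_injective:
  assumes \<gamma>: "\<gamma> \<in> cur.basic_cochains (Suc n)" and z: "cur.basic_partial \<gamma> = 0"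
  shows "\<gamma> = 0"
proof (intro ext)
  fix ls :: "complex list" and ps :: "'g poly list"
  show "\<gamma> ls ps = 0 ls ps"
  proof (cases "length ls = Suc n \<and> length ps = Suc n")
    case False
    then show ?thesis using \<gamma> by (auto simp: cur.basic_cochains_def)
  next
    case True
    then obtain l ls' where ls: "ls = l # ls'" by (cases ls) auto
    have "mpf (Suc n) (\<lambda>ls. \<gamma> ls ps)" using \<gamma> True by (simp add: cur.basic_cochains_def)
    then obtain N where "poly_deg N (\<lambda>x. \<gamma> (ls[0 := x]) ps)"
      by (rule mpf_poly_deg) (use True in blast)
    then obtain p where p: "\<And>x. \<gamma> (x # ls') ps = poly p x"
      unfolding poly_deg_def ls by auto
    have "poly ([:sum_list ls', 1:] * p) x = 0" for x
    proof -
      have "cur.basic_partial \<gamma> (x # ls') ps = 0" by (simp add: z)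
      then show ?thesis by (simp add: partial_eq p algebra_simps)
    qed
    then have "[:sum_list ls', 1:] * p = 0" using poly_all_0_iff_0 by blast
    then have "p = 0" by (simp only: mult_eq_0_iff pCons_eq_0_iff one_neq_zero simp_thms)
    then show ?thesis by (simp add: ls p)
  qed
qed

end

context semisimple_lie_algebra
begin

text \<open>The differential is the lift of the Taylor sum of \<open>rd pair_br F\<close>, so all
  cochain conditions, polynomiality included, come from \<open>lift_taylor_basic\<close>.\<close>

lemma basic_d_basic:
  assumes "\<gamma> \<in> cur.basic_cochains n"
  shows "cur.basic_d n \<gamma> \<in> cur.basic_cochains (Suc n)"
proof -
  obtain N F where F: "0 < N" "slotlin Pair F" "alt F" "degree_bounded N F"
    "\<And>xs. length xs \<noteq> n \<Longrightarrow> F xs = 0" "restrict_form \<gamma> = taylor N F"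
    using basic_cochain_taylor[OF assms] by blast
  have "cur.basic_d n \<gamma> = lift_form (Suc n) (taylor N (rd pair_br F))"
    unfolding basic_d_restrict[OF assms] F(6)
    by (intro arg_cong[where f = "lift_form (Suc n)"] ext) (rule rd_taylor[OF F(4)])
  also have "\<dots> \<in> cur.basic_cochains (Suc n)"
    using rd_wrong_length[of n F _ pair_br] F(5)
    by (intro lift_taylor_basic slotlin_rd F(2) pair_br_fiberlin alt_rd F(3) slotlin_pair_skew) auto
  finally show ?thesis .
qed

lemma basic_d_d:
  assumes "\<gamma> \<in> cur.basic_cochains n"
  shows "cur.basic_d (Suc n) (cur.basic_d n \<gamma>) = 0"
proof -
  have "rd pair_br (rd pair_br (restrict_form \<gamma>)) = (\<lambda>_. 0)"
    using rd_rd[OF slotlin_pair_jacobi[OF restrict_basic(1)[OF assms]]] by auto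
  then show ?thesis
    unfolding basic_d_restrict[OF basic_d_basic[OF assms]] restrict_basic_d[OF assms]
    by (simp add: lift_form_zero)
qed

text \<open>On the side of Taylor coefficients the homotopy makes everything of positive degree
  exact; what remains is the constant term \<omega>. Summing with the bound \<open>2 * N\<close>,
  which suits both \<open>F\<close> and the primitive \<open>H\<close>, carries this back to
  cochains.\<close>

lemma basic_cocycle_decomposition:
  assumes \<gamma>: "\<gamma> \<in> cur.basic_cochains n" and d: "cur.basic_d n \<gamma> = 0"
  obtains \<omega> where "\<omega> \<in> ce_cochains n" "rd br \<omega> = (\<lambda>_. 0)" "n = 0 \<Longrightarrow> \<gamma> = ce_embedding n \<omega>"
    "\<And>m. n = Suc m \<Longrightarrow> \<exists>\<xi>\<in>cur.basic_cochains m. \<gamma> = ce_embedding n \<omega> + cur.basic_d m \<xi>"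
proof -
  obtain N F where F: "0 < N" "slotlin Pair F" "alt F" "degree_bounded N F"
    "\<And>xs. length xs \<noteq> n \<Longrightarrow> F xs = 0" "restrict_form \<gamma> = taylor N F"
    using basic_cochain_taylor[OF \<gamma>] by blast
  have "rd pair_br (taylor N F) xs = 0" for xs
    using restrict_basic_d[OF \<gamma>] d by (simp add: F(6) restrict_form_def fun_eq_iff)
  then have "taylor N (rd pair_br F) xs = 0" for xs
    using rd_taylor[OF F(4), of xs] by simp
  then have cocycle: "rd pair_br F xs = 0" for xs
    by (rule taylor_injective[OF degree_bounded_rd[OF F(4)]])
  obtain H where H: "slotlin Pair H" "alt H" "degree_bounded (2 * N) H"
    "\<And>xs. Suc (length xs) \<noteq> n \<Longrightarrow> H xs = 0"
    "\<And>xs. rd pair_br H xs = (if sum_list (map fst xs) = 0 then 0 else F xs)"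
    using pair_cocycle_exact[OF F(2,3,4) cocycle F(5)] by blast
  define \<omega> where "\<omega> as = F (map (Pair 0) as)" for as
  have sl: "slotlin id_slot \<omega>"
    unfolding slotlin_def \<omega>_def using slotlinD[OF F(2)] by simp
  have al: "alt \<omega>"
    unfolding alt_def \<omega>_def
  proof (intro allI)
    fix us x y vs
    show "F (map (Pair 0) (us @ x # y # vs)) = - F (map (Pair 0) (us @ y # x # vs))"
      using altD[OF F(3), of "map (Pair 0) us" "(0, x)" "(0, y)" "map (Pair 0) vs"] by simp
  qed
  have w: "\<omega> \<in> ce_cochains n"
    using sl al F(5) by (simp add: ce_cochains_iff \<omega>_def)
  have "rd br \<omega> as = rd pair_br F (map (Pair 0) as)" for as
    unfolding \<omega>_def[abs_def] by (rule rd_map) simp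
  then have rdw: "rd br \<omega> = (\<lambda>_. 0)" using cocycle by auto
  have split: "restrict_form \<gamma> xs = \<omega> (map snd xs) + rd pair_br (taylor (2 * N) H) xs" for xs
  proof -
    have "restrict_form \<gamma> xs = taylor (2 * N) F xs"
      unfolding F(6) by (rule taylor_mono[OF F(4), symmetric]) simp
    also have "F = (\<lambda>xs. (if sum_list (map fst xs) = 0 then F xs else 0) + rd pair_br H xs)"
      by (intro ext) (simp add: H(5))
    also have "taylor (2 * N) \<dots> xs = F (map (\<lambda>x. (0, snd x)) xs) + taylor (2 * N) (rd pair_br H) xs"
      unfolding Tr_add using taylor_degree_zero[of "2 * N" F xs] F(1) by simp
    also have "taylor (2 * N) (rd pair_br H) xs = rd pair_br (taylor (2 * N) H) xs"
      by (rule rd_taylor[OF H(3), symmetric])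
    finally show ?thesis by (simp add: \<omega>_def o_def)
  qed
  have \<gamma>_eq: "\<gamma> = ce_embedding n \<omega> + lift_form n (rd pair_br (taylor (2 * N) H))"
    using lift_restrict[OF \<gamma>] by (simp add: split[abs_def] ce_embedding_lift lift_form_add[symmetric])
  show ?thesis
  proof (rule that[OF w rdw])
    assume "n = 0"
    \<comment> \<open>A primitive of a 0-cochain would live on lists of length -1:
      \<open>Suc (length xs) = 0\<close> is impossible, so \<open>H\<close> vanishes
      everywhere.\<close>
    then have "H = (\<lambda>_. 0)" using H(4) by auto
    then have "taylor (2 * N) H = (\<lambda>_. 0)" by (intro ext) simp
    then have "rd pair_br (taylor (2 * N) H) = (\<lambda>_. 0)" by (intro ext) simp
    then show "\<gamma> = ce_embedding n \<omega>" using \<gamma>_eq by (simp add: lift_form_zero)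
  next
    fix m assume n: "n = Suc m"
    then have lenH: "H xs = 0" if "length xs \<noteq> m" for xs using H(4) that by simp
    have "lift_form m (taylor (2 * N) H) \<in> cur.basic_cochains m"
      by (rule lift_taylor_basic[OF H(1,2) lenH])
    moreover have "cur.basic_d m (lift_form m (taylor (2 * N) H)) = lift_form n (rd pair_br (taylor (2 * N) H))"
      unfolding n by (rule basic_d_lift[OF alt_Tr[OF H(2)]]) (rule Tr_wrong_length[OF lenH])
    ultimately show "\<exists>\<xi>\<in>cur.basic_cochains m. \<gamma> = ce_embedding n \<omega> + cur.basic_d m \<xi>"
      using \<gamma>_eq by (metis (no_types))
  qed
qed

lemma invariant_ce: "\<omega> \<in> invariant_cochains n \<Longrightarrow> \<omega> \<in> ce_cochains n"
  by (simp add: invariant_cochains_def forms.invariants_def)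

lemma basic_cocycle_invariant:
  assumes \<gamma>: "\<gamma> \<in> cur.basic_cochains n" and d: "cur.basic_d n \<gamma> = 0"
  obtains \<omega> where "\<omega> \<in> invariant_cochains n" "n = 0 \<Longrightarrow> \<gamma> = ce_embedding n \<omega>"
    "\<And>m. n = Suc m \<Longrightarrow> \<exists>\<xi>\<in>cur.basic_cochains m. \<gamma> = ce_embedding n \<omega> + cur.basic_d m \<xi>"
proof -
  obtain \<omega> where w: "\<omega> \<in> ce_cochains n" "rd br \<omega> = (\<lambda>_. 0)" "n = 0 \<Longrightarrow> \<gamma> = ce_embedding n \<omega>"
    "\<And>m. n = Suc m \<Longrightarrow> \<exists>\<xi>\<in>cur.basic_cochains m. \<gamma> = ce_embedding n \<omega> + cur.basic_d m \<xi>"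
    using basic_cocycle_decomposition[OF \<gamma> d] by blast
  obtain a where a: "a \<in> invariant_cochains n" "n = 0 \<Longrightarrow> \<omega> = a"
    "\<And>m. n = Suc m \<Longrightarrow> \<exists>\<eta>\<in>ce_cochains m. \<omega> - a = rd br \<eta>"
    using cocycle_invariant_part[OF w(1,2)] by blast
  show ?thesis
  proof (rule that[OF a(1)])
    show "\<gamma> = ce_embedding n a" if "n = 0" using w(3)[OF that] a(2)[OF that] by simp
  next
    fix m assume n: "n = Suc m"
    obtain \<xi> where \<xi>: "\<xi> \<in> cur.basic_cochains m" "\<gamma> = ce_embedding n \<omega> + cur.basic_d m \<xi>"
      using w(4)[OF n] by blast
    obtain \<eta> where \<eta>: "\<eta> \<in> ce_cochains m" "\<omega> - a = rd br \<eta>" using a(3)[OF n] by blast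
    have "ce_embedding n \<omega> = ce_embedding n (a + rd br \<eta>)" by (simp add: \<eta>(2)[symmetric])
    also have "\<dots> = ce_embedding n a + cur.basic_d m (ce_embedding m \<eta>)"
      unfolding ce_embedding_add basic_d_embedding[OF \<eta>(1)] n ..
    finally have "\<gamma> = ce_embedding n a + cur.basic_d m (ce_embedding m \<eta> + \<xi>)"
      using \<xi> ce_embedding_basic[OF \<eta>(1)] by (simp add: basic_d_add add.assoc)
    then show "\<exists>\<xi>\<in>cur.basic_cochains m. \<gamma> = ce_embedding n a + cur.basic_d m \<xi>"
      using basic_cochains_subspace(2)[OF ce_embedding_basic[OF \<eta>(1)] \<xi>(1)] by blast
  qed
qed

lemma embedding_invariant_exact:
  assumes "\<omega> \<in> invariant_cochains (Suc m)" "ce_embedding (Suc m) \<omega> = cur.basic_d m \<xi>" "\<xi> \<in> cur.basic_cochains m"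
  shows "\<omega> = 0"
proof -
  have "\<omega> = at_zero (cur.basic_d m \<xi>)"
    using at_zero_embedding[OF invariant_ce[OF assms(1)]] assms(2) by simp
  also have "\<dots> = rd br (at_zero \<xi>)" by (rule at_zero_basic_d[OF assms(3)])
  finally show ?thesis
    using invariant_coboundary[OF assms(1) _ at_zero_ce_cochains[OF assms(3)]] by blast
qed

lemma basic_d_embedding_invariant:
  assumes "\<omega> \<in> invariant_cochains n"
  shows "cur.basic_d n (ce_embedding n \<omega>) = 0"
  using basic_d_embedding[OF invariant_ce[OF assms]] rd_invariant[OF assms] ce_embedding_zero
  by (simp add: zero_fun_def)

text \<open>\<partial> of an embedded invariant form is a cocycle that vanishes where all parameters
  are zero. The invariant part of its class is therefore exact on \<gg>, hence zero.\<close>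

lemma partial_embedding_exact:
  assumes "\<eta> \<in> invariant_cochains (Suc q)"
  shows "\<exists>\<xi>\<in>cur.basic_cochains q. cur.basic_d q \<xi> = cur.basic_partial (ce_embedding (Suc q) \<eta>)"
proof -
  let ?e = "ce_embedding (Suc q) \<eta>"
  have e: "?e \<in> cur.basic_cochains (Suc q)" by (rule ce_embedding_basic[OF invariant_ce[OF assms]])
  have "cur.basic_d (Suc q) (cur.basic_partial ?e) = 0"
    unfolding basic_d_partial[OF e] basic_d_embedding_invariant[OF assms] by (rule partial_zero)
  then obtain \<omega> \<xi> where w: "\<omega> \<in> invariant_cochains (Suc q)" "\<xi> \<in> cur.basic_cochains q"
    "cur.basic_partial ?e = ce_embedding (Suc q) \<omega> + cur.basic_d q \<xi>"
    using basic_cocycle_invariant[OF partial_basic[OF e]] by metis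
  have "at_zero (cur.basic_partial ?e) = 0"
    by (intro ext) (simp add: at_zero_def restrict_form_def partial_eq o_def)
  then have "\<omega> + rd br (at_zero \<xi>) = 0"
    unfolding w(3) at_zero_add at_zero_embedding[OF invariant_ce[OF w(1)]] at_zero_basic_d[OF w(2)] .
  then have "\<omega> = - rd br (at_zero \<xi>)" by (simp add: eq_neg_iff_add_eq_0)
  also have "\<dots> = rd br (- at_zero \<xi>)"
    by (intro ext) (simp add: rd_minus[symmetric] fun_Compl_def)
  finally have "\<omega> = 0"
  proof (rule invariant_coboundary[OF w(1)])
    show "- at_zero \<xi> \<in> ce_cochains q"
      using forms.V.subspace_neg[OF subspace_ce_cochains at_zero_ce_cochains[OF w(2)]] .
  qed
  then show ?thesis using w ce_embedding_zero by auto
qed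

lemma subspace_invariant_cochains: "forms.V.subspace (invariant_cochains n)"
  using subspace_ce_cochains[of n]
  by (auto simp: invariant_cochains_def forms.invariants_def forms.V.subspace_def forms.act_simps)

text \<open>Primitives are chosen on a basis of the invariant forms and extended linearly, because
  the map from pairs of invariant forms to reduced classes has to be linear.\<close>

lemma partial_primitive:
  obtains k where "Vector_Spaces.linear fscale bscale k"
    "\<And>\<eta>. \<eta> \<in> invariant_cochains (Suc q) \<Longrightarrow> k \<eta> \<in> cur.basic_cochains q"
    "\<And>\<eta>. \<eta> \<in> invariant_cochains (Suc q) \<Longrightarrow> cur.basic_d q (k \<eta>) = cur.basic_partial (ce_embedding (Suc q) \<eta>)"
proof -
  interpret VP: vector_space_pair "fscale :: complex \<Rightarrow> ('a list \<Rightarrow> complex) \<Rightarrow> _" bscale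
    by (intro vector_space_pair.intro forms.V.vector_space_axioms bscale_vs)
  let ?I = "invariant_cochains (Suc q)"
  obtain B where B: "B \<subseteq> ?I" "forms.V.independent B" "?I \<subseteq> forms.V.span B"
    using forms.V.maximal_independent_subset[of ?I] by blast
  have "\<forall>\<eta>\<in>B. \<exists>\<xi>. \<xi> \<in> cur.basic_cochains q \<and> cur.basic_d q \<xi> = cur.basic_partial (ce_embedding (Suc q) \<eta>)"
    using partial_embedding_exact B(1) by blast
  from bchoice[OF this] obtain f where
    f: "\<forall>\<eta>\<in>B. f \<eta> \<in> cur.basic_cochains q \<and> cur.basic_d q (f \<eta>) = cur.basic_partial (ce_embedding (Suc q) \<eta>)"
    by (rule exE)
  obtain k where k: "Vector_Spaces.linear fscale bscale k" "\<forall>\<eta>\<in>B. k \<eta> = f \<eta>"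
    using VP.linear_independent_extend[OF B(2), of f] by blast
  interpret k: Vector_Spaces.linear fscale bscale k by (rule k(1))
  let ?S = "{\<eta>. k \<eta> \<in> cur.basic_cochains q \<and> cur.basic_d q (k \<eta>) = cur.basic_partial (ce_embedding (Suc q) \<eta>)}"
  have "forms.V.subspace ?S"
  proof (rule forms.V.subspaceI)
    show "0 \<in> ?S"
      by (simp only: k.zero mem_Collect_eq basic_d_zero ce_embedding_zero partial_zero basic_cochains_subspace(1) simp_thms)
  next
    fix x y assume "x \<in> ?S" "y \<in> ?S"
    then show "x + y \<in> ?S"
      by (simp only: k.add mem_Collect_eq basic_d_add ce_embedding_add partial_add basic_cochains_subspace(2) simp_thms)
  next
    fix c x assume "x \<in> ?S"
    then show "fscale c x \<in> ?S"
      by (simp only: k.scale mem_Collect_eq basic_d_scale ce_embedding_scale partial_scale basic_cochains_subspace(3) simp_thms)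
  qed
  moreover have "B \<subseteq> ?S" using f k(2) by auto
  ultimately have "forms.V.span B \<subseteq> ?S" by (intro forms.V.span_minimal)
  then have "\<eta> \<in> ?S" if "\<eta> \<in> ?I" for \<eta> using B(3) that by blast
  then show ?thesis using that[OF k(1)] by blast
qed

text \<open>From \<open>d \<gamma> = \<partial> \<eta>'\<close> follows
  \<open>\<partial> d \<eta>' = 0\<close>, so \<eta>' is a cocycle by injectivity of \<partial>. Its
  invariant part \<eta> is accounted for by \<open>k \<eta>\<close> and its exact part
  \<open>d \<zeta>\<close> by \<open>\<partial> \<zeta>\<close>; what is left of \<gamma> is a basic
  cocycle.\<close>

lemma reduced_cocycle_decomposition:
  assumes k: "\<And>\<eta>. \<eta> \<in> invariant_cochains (Suc q) \<Longrightarrow> k \<eta> \<in> cur.basic_cochains q"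
    "\<And>\<eta>. \<eta> \<in> invariant_cochains (Suc q) \<Longrightarrow> cur.basic_d q (k \<eta>) = cur.basic_partial (ce_embedding (Suc q) \<eta>)"
    and \<gamma>: "\<gamma> \<in> cur.basic_cochains q" "\<eta>' \<in> cur.basic_cochains (Suc q)" "cur.basic_d q \<gamma> = cur.basic_partial \<eta>'"
  obtains \<omega> \<eta> \<zeta> where "\<omega> \<in> invariant_cochains q" "\<eta> \<in> invariant_cochains (Suc q)" "\<zeta> \<in> cur.basic_cochains q"
    "q = 0 \<Longrightarrow> \<gamma> = ce_embedding q \<omega> + k \<eta> + cur.basic_partial \<zeta>"
    "\<And>m. q = Suc m \<Longrightarrow> \<exists>\<xi>\<in>cur.basic_cochains m. \<gamma> = ce_embedding q \<omega> + k \<eta> + cur.basic_d m \<xi> + cur.basic_partial \<zeta>"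
proof -
  have "cur.basic_partial (cur.basic_d (Suc q) \<eta>') = cur.basic_d (Suc q) (cur.basic_d q \<gamma>)"
    unfolding \<gamma>(3) by (rule basic_d_partial[OF \<gamma>(2), symmetric])
  also have "\<dots> = 0" by (rule basic_d_d[OF \<gamma>(1)])
  finally have "cur.basic_d (Suc q) \<eta>' = 0"
    by (rule partial_injective[OF basic_d_basic[OF \<gamma>(2)]])
  then obtain \<eta> \<zeta> where \<eta>: "\<eta> \<in> invariant_cochains (Suc q)" "\<zeta> \<in> cur.basic_cochains q"
    "\<eta>' = ce_embedding (Suc q) \<eta> + cur.basic_d q \<zeta>"
    using basic_cocycle_invariant[OF \<gamma>(2)] by metis
  let ?\<gamma> = "\<gamma> - k \<eta> - cur.basic_partial \<zeta>"
  have b: "?\<gamma> \<in> cur.basic_cochains q"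
    by (intro basic_cochains_diff \<gamma>(1) k(1) \<eta> partial_basic)
  have "cur.basic_d q ?\<gamma> = cur.basic_d q \<gamma> - cur.basic_d q (k \<eta>) - cur.basic_d q (cur.basic_partial \<zeta>)"
    by (simp only: basic_d_diff basic_cochains_diff \<gamma>(1) k(1)[OF \<eta>(1)] partial_basic[OF \<eta>(2)])
  also have "\<dots> = 0"
    unfolding \<gamma>(3) k(2)[OF \<eta>(1)] basic_d_partial[OF \<eta>(2)] \<eta>(3) partial_add by simp
  finally have d: "cur.basic_d q ?\<gamma> = 0" .
  obtain \<omega> where w: "\<omega> \<in> invariant_cochains q" "q = 0 \<Longrightarrow> ?\<gamma> = ce_embedding q \<omega>"
    "\<And>m. q = Suc m \<Longrightarrow> \<exists>\<xi>\<in>cur.basic_cochains m. ?\<gamma> = ce_embedding q \<omega> + cur.basic_d m \<xi>"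
    using basic_cocycle_invariant[OF b d] by blast
  have add: "\<gamma> = ?\<gamma> + k \<eta> + cur.basic_partial \<zeta>" by simp
  show ?thesis
  proof (rule that[OF w(1) \<eta>(1,2)])
    show "\<gamma> = ce_embedding q \<omega> + k \<eta> + cur.basic_partial \<zeta>" if "q = 0"
      using add unfolding w(2)[OF that] .
  next
    fix m assume "q = Suc m"
    then obtain \<xi> where \<xi>: "\<xi> \<in> cur.basic_cochains m" "?\<gamma> = ce_embedding q \<omega> + cur.basic_d m \<xi>"
      using w(3) by blast
    have "\<gamma> = ce_embedding q \<omega> + k \<eta> + cur.basic_d m \<xi> + cur.basic_partial \<zeta>"
      using add unfolding \<xi>(2) by (simp add: algebra_simps)
    then show "\<exists>\<xi>\<in>cur.basic_cochains m. \<gamma> = ce_embedding q \<omega> + k \<eta> + cur.basic_d m \<xi> + cur.basic_partial \<zeta>"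
      using \<xi>(1) by blast
  qed
qed

text \<open>For exact cochains this is clear, as \<partial> commutes with the differential; for
  invariant forms it is \<open>partial_embedding_exact\<close>.\<close>

lemma partial_exact_embedding:
  assumes "\<zeta> \<in> cur.basic_cochains (Suc m)" "cur.basic_d (Suc m) \<zeta> = 0"
  shows "\<exists>\<xi>\<in>cur.basic_cochains m. cur.basic_partial \<zeta> = cur.basic_d m \<xi>"
proof -
  obtain \<omega> \<xi> where w: "\<omega> \<in> invariant_cochains (Suc m)" "\<xi> \<in> cur.basic_cochains m"
    "\<zeta> = ce_embedding (Suc m) \<omega> + cur.basic_d m \<xi>"
    using basic_cocycle_invariant[OF assms] by metis
  obtain \<xi>' where \<xi>': "\<xi>' \<in> cur.basic_cochains m" "cur.basic_d m \<xi>' = cur.basic_partial (ce_embedding (Suc m) \<omega>)"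
    using partial_embedding_exact[OF w(1)] by blast
  have "cur.basic_partial \<zeta> = cur.basic_d m (\<xi>' + cur.basic_partial \<xi>)"
    unfolding w(3) partial_add basic_d_add[OF \<xi>'(1) partial_basic[OF w(2)]] \<xi>'(2) basic_d_partial[OF w(2)] ..
  then show ?thesis
    using basic_cochains_subspace(2)[OF \<xi>'(1) partial_basic[OF w(2)]] by blast
qed

text \<open>Applying the differential gives \<open>\<partial> \<eta> = \<partial> d \<zeta>\<close>;
  cancelling \<partial> makes \<eta> exact, hence zero. Then \<zeta> is a cocycle, so for positive
  \<open>q\<close> its multiple \<open>\<partial> \<zeta>\<close> is exact, and \<omega> is an exact
  invariant form.\<close>

lemma reduced_coboundary_zero:
  assumes k: "k \<eta> \<in> cur.basic_cochains q" "cur.basic_d q (k \<eta>) = cur.basic_partial (ce_embedding (Suc q) \<eta>)" "k 0 = 0"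
    and w: "\<omega> \<in> invariant_cochains q" "\<eta> \<in> invariant_cochains (Suc q)" "\<zeta> \<in> cur.basic_cochains q"
    and eq: "q = 0 \<Longrightarrow> ce_embedding q \<omega> + k \<eta> = cur.basic_partial \<zeta>"
    "\<And>m. q = Suc m \<Longrightarrow> \<exists>\<xi>\<in>cur.basic_cochains m. ce_embedding q \<omega> + k \<eta> = cur.basic_d m \<xi> + cur.basic_partial \<zeta>"
  shows "\<omega> = 0" "\<eta> = 0"
proof -
  have e: "ce_embedding q \<omega> \<in> cur.basic_cochains q" by (rule ce_embedding_basic[OF invariant_ce[OF w(1)]])
  have "cur.basic_d q (ce_embedding q \<omega> + k \<eta>) = cur.basic_partial (cur.basic_d q \<zeta>)"
  proof (cases q)
    case 0
    then show ?thesis using eq(1) basic_d_partial[OF w(3)] by simp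
  next
    case (Suc m)
    obtain \<xi> where \<xi>: "\<xi> \<in> cur.basic_cochains m" "ce_embedding q \<omega> + k \<eta> = cur.basic_d m \<xi> + cur.basic_partial \<zeta>"
      using eq(2)[OF Suc] by blast
    have "cur.basic_d m \<xi> \<in> cur.basic_cochains q" "cur.basic_d q (cur.basic_d m \<xi>) = 0"
      using basic_d_basic[OF \<xi>(1)] basic_d_d[OF \<xi>(1)] Suc by simp_all
    then show ?thesis
      unfolding \<xi>(2) by (simp add: basic_d_add partial_basic[OF w(3)] basic_d_partial[OF w(3)])
  qed
  then have p: "cur.basic_partial (ce_embedding (Suc q) \<eta>) = cur.basic_partial (cur.basic_d q \<zeta>)"
    by (simp add: basic_d_add[OF e k(1)] basic_d_embedding_invariant[OF w(1)] k(2))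
  have e': "ce_embedding (Suc q) \<eta> \<in> cur.basic_cochains (Suc q)" by (rule ce_embedding_basic[OF invariant_ce[OF w(2)]])
  have "cur.basic_partial (ce_embedding (Suc q) \<eta> - cur.basic_d q \<zeta>) = 0"
  proof (intro ext)
    fix ls ps
    have "cur.basic_partial (ce_embedding (Suc q) \<eta>) ls ps = cur.basic_partial (cur.basic_d q \<zeta>) ls ps"
      using p by simp
    then show "cur.basic_partial (ce_embedding (Suc q) \<eta> - cur.basic_d q \<zeta>) ls ps = 0 ls ps"
      by (simp only: partial_eq right_diff_distrib minus_apply diff_self zero_fun_apply)
  qed
  then have "ce_embedding (Suc q) \<eta> = cur.basic_d q \<zeta>"
    using partial_injective[OF basic_cochains_diff[OF e' basic_d_basic[OF w(3)]]] by simp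
  then show eta: "\<eta> = 0" using embedding_invariant_exact[OF w(2) _ w(3)] by blast
  then have dz: "cur.basic_d q \<zeta> = 0"
    using \<open>ce_embedding (Suc q) \<eta> = cur.basic_d q \<zeta>\<close> ce_embedding_zero by simp
  show "\<omega> = 0"
  proof (cases q)
    case 0
    \<comment> \<open>On 0-cochains the sum of the parameters is empty.\<close>
    have "cur.basic_partial \<zeta> = 0"
    proof (intro ext)
      fix ls ps
      show "cur.basic_partial \<zeta> ls ps = 0 ls ps"
        using w(3) 0 by (cases ls) (auto simp: partial_eq cur.basic_cochains_def)
    qed
    then have "ce_embedding q \<omega> = 0" using eq(1)[OF 0] eta k(3) by simp
    then show ?thesis
      using at_zero_embedding[OF invariant_ce[OF w(1)]] at_zero_embedding[of 0 q] ce_embedding_zero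
        forms.V.subspace_0[OF subspace_ce_cochains] by metis
  next
    case (Suc m)
    obtain \<xi> where \<xi>: "\<xi> \<in> cur.basic_cochains m" "ce_embedding q \<omega> = cur.basic_d m \<xi> + cur.basic_partial \<zeta>"
      using eq(2)[OF Suc] eta k(3) by auto
    obtain \<xi>' where \<xi>': "\<xi>' \<in> cur.basic_cochains m" "cur.basic_partial \<zeta> = cur.basic_d m \<xi>'"
      using partial_exact_embedding[of \<zeta> m] w(3) dz Suc by blast
    have "ce_embedding (Suc m) \<omega> = cur.basic_d m (\<xi> + \<xi>')"
      using \<xi> \<xi>' Suc by (simp add: basic_d_add)
    then show ?thesis
      using embedding_invariant_exact[of \<omega> m "\<xi> + \<xi>'"] w(1) Suc basic_cochains_subspace(2)[OF \<xi>(1) \<xi>'(1)] by simp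
  qed
qed

end

section \<open>Cohomology spaces\<close>

text \<open>Laws relative to a carrier that pass to subspaces and quotients. The elements of reduced
  cohomology are cosets of cosets, so the quotient construction is applied to its own
  result.\<close>

definition cvec :: "'v cspace \<Rightarrow> bool" where
  "cvec V \<longleftrightarrow> Zero V \<in> Carr V \<and>
     (\<forall>x\<in>Carr V. \<forall>y\<in>Carr V. Add V x y \<in> Carr V \<and> Add V x y = Add V y x) \<and>
     (\<forall>x\<in>Carr V. \<forall>y\<in>Carr V. \<forall>z\<in>Carr V. Add V (Add V x y) z = Add V x (Add V y z)) \<and>
     (\<forall>x\<in>Carr V. Add V (Zero V) x = x \<and> Add V x (Scale V (- 1) x) = Zero V) \<and>
     (\<forall>c. \<forall>x\<in>Carr V. Scale V c x \<in> Carr V) \<and>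
     (\<forall>c. \<forall>x\<in>Carr V. \<forall>y\<in>Carr V. Scale V c (Add V x y) = Add V (Scale V c x) (Scale V c y)) \<and>
     (\<forall>c. Scale V c (Zero V) = Zero V)"

definition csub :: "'v cspace \<Rightarrow> 'v set \<Rightarrow> bool" where
  "csub V B \<longleftrightarrow> B \<subseteq> Carr V \<and> Zero V \<in> B \<and> (\<forall>x\<in>B. \<forall>y\<in>B. Add V x y \<in> B) \<and> (\<forall>c. \<forall>x\<in>B. Scale V c x \<in> B)"

lemma cvecD:
  assumes "cvec V"
  shows "Zero V \<in> Carr V" "x \<in> Carr V \<Longrightarrow> y \<in> Carr V \<Longrightarrow> Add V x y \<in> Carr V"
    "x \<in> Carr V \<Longrightarrow> y \<in> Carr V \<Longrightarrow> Add V x y = Add V y x"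
    "x \<in> Carr V \<Longrightarrow> y \<in> Carr V \<Longrightarrow> z \<in> Carr V \<Longrightarrow> Add V (Add V x y) z = Add V x (Add V y z)"
    "x \<in> Carr V \<Longrightarrow> Add V (Zero V) x = x" "x \<in> Carr V \<Longrightarrow> Add V x (Scale V (- 1) x) = Zero V"
    "x \<in> Carr V \<Longrightarrow> Scale V c x \<in> Carr V"
    "x \<in> Carr V \<Longrightarrow> y \<in> Carr V \<Longrightarrow> Scale V c (Add V x y) = Add V (Scale V c x) (Scale V c y)"
    "Scale V c (Zero V) = Zero V"
  using assms unfolding cvec_def by blast+

lemma csubD:
  assumes "csub V B"
  shows "x \<in> B \<Longrightarrow> x \<in> Carr V" "Zero V \<in> B" "x \<in> B \<Longrightarrow> y \<in> B \<Longrightarrow> Add V x y \<in> B" "x \<in> B \<Longrightarrow> Scale V c x \<in> B"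
  using assms unfolding csub_def by blast+

lemma carr_update_simps:
  "Carr (V\<lparr>Carr := Z\<rparr>) = Z" "Zero (V\<lparr>Carr := Z\<rparr>) = Zero V" "Add (V\<lparr>Carr := Z\<rparr>) = Add V"
  "Scale (V\<lparr>Carr := Z\<rparr>) = Scale V"
  by simp_all

lemma cvec_csub:
  assumes "cvec V" "csub V Z"
  shows "cvec (V\<lparr>Carr := Z\<rparr>)"
proof -
  note v = cvecD[OF assms(1)] and z = csubD[OF assms(2)]
  show ?thesis
    unfolding cvec_def carr_update_simps
    by (intro conjI ballI allI)
      ((rule z(2) v(9) | erule z(3), assumption | erule z(4) | rule v(3-6,8); erule z(1))+)
qed

lemma cvec_pointwise:
  assumes "vector_space s" "module.subspace s (Carr V)" "Zero V = 0" "Add V = (+)" "Scale V = s"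
  shows "cvec V"
proof -
  interpret S: vector_space s by (rule assms(1))
  show ?thesis
    unfolding cvec_def assms(3-5)
    using assms(2) by (auto simp: S.subspace_0 S.subspace_add S.subspace_scale S.scale_right_distrib add.assoc add.commute)
qed

lemma linear_mapD:
  assumes "linear_map V W f"
  shows "x \<in> Carr V \<Longrightarrow> f x \<in> Carr W" "x \<in> Carr V \<Longrightarrow> y \<in> Carr V \<Longrightarrow> f (Add V x y) = Add W (f x) (f y)"
    "x \<in> Carr V \<Longrightarrow> f (Scale V c x) = Scale W c (f x)"
  using assms unfolding linear_map_def by blast+

lemma linear_map_zero:
  assumes "linear_map V W f" "cvec V" "cvec W"
  shows "f (Zero V) = Zero W"
proof -
  note V = cvecD[OF assms(2)] and W = cvecD[OF assms(3)] and f = linear_mapD[OF assms(1)]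
  have "f (Zero V) = f (Add V (Zero V) (Scale V (- 1) (Zero V)))" using V by simp
  also have "\<dots> = Add W (f (Zero V)) (Scale W (- 1) (f (Zero V)))" using V f by (metis (no_types))
  also have "\<dots> = Zero W" using W(6) f(1) V(1) by blast
  finally show ?thesis .
qed

lemma linear_iso_sym:
  assumes "linear_iso V W f" "cvec V"
  shows "W \<simeq> V"
proof -
  note f = linear_mapD[OF assms(1)[unfolded linear_iso_def, THEN conjunct1]] and V = cvecD[OF assms(2)]
  have bij: "bij_betw f (Carr V) (Carr W)" using assms(1) by (simp add: linear_iso_def)
  let ?g = "inv_into (Carr V) f"
  have g: "?g y \<in> Carr V" "f (?g y) = y" if "y \<in> Carr W" for y
    using that bij by (auto simp: bij_betw_def inv_into_into f_inv_into_f)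
  have gf: "?g (f x) = x" if "x \<in> Carr V" for x
    using that bij by (simp add: bij_betw_def)
  have "linear_map W V ?g"
    unfolding linear_map_def
  proof (intro conjI allI ballI)
    fix x y assume x: "x \<in> Carr W"
    then show "?g x \<in> Carr V" by (rule g)
    show "?g (Scale W c x) = Scale V c (?g x)" for c
    proof -
      have "Scale W c x = f (Scale V c (?g x))" using f(3) g x by simp
      then show ?thesis using gf V(7) g(1)[OF x] by simp
    qed
    assume y: "y \<in> Carr W"
    have "Add W x y = f (Add V (?g x) (?g y))" using f(2) g x y by simp
    then show "?g (Add W x y) = Add V (?g x) (?g y)" using gf V(2) g(1)[OF x] g(1)[OF y] by simp
  qed
  then show ?thesis
    unfolding isomorphic_def linear_iso_def using bij_betw_inv_into[OF bij] by blast
qed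

lemma linear_iso_comp:
  assumes "linear_iso U V f" "linear_iso V W g"
  shows "linear_iso U W (\<lambda>x. g (f x))"
  using assms bij_betw_trans[of f "Carr U" "Carr V" g "Carr W"]
  unfolding linear_iso_def linear_map_def by (auto simp: o_def)

lemma isomorphic_trans: "U \<simeq> V \<Longrightarrow> V \<simeq> W \<Longrightarrow> U \<simeq> W"
  unfolding isomorphic_def using linear_iso_comp by blast

text \<open>Two out of three. It identifies the map induced on cohomology, since the classes on both
  sides are represented by the invariant forms.\<close>

lemma linear_iso_factor:
  assumes f: "linear_iso U V f" and g: "linear_iso U W g" and h: "\<And>u. u \<in> Carr U \<Longrightarrow> h (f u) = g u" and U: "cvec U"
  shows "linear_iso V W h"
proof -
  have fb: "bij_betw f (Carr U) (Carr V)" and gb: "bij_betw g (Carr U) (Carr W)"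
    and fl: "linear_map U V f" and gl: "linear_map U W g"
    using f g by (simp_all add: linear_iso_def)
  have surj: "\<exists>u\<in>Carr U. v = f u" if "v \<in> Carr V" for v
    using fb that by (auto simp: bij_betw_def)
  have "bij_betw (\<lambda>u. h (f u)) (Carr U) (Carr W)"
    using gb h by (subst bij_betw_cong[where g = g]) auto
  then have "bij_betw h (Carr V) (Carr W)"
    using bij_betw_comp_iff[OF fb, of h "Carr W"] by (simp add: o_def)
  moreover have "linear_map V W h"
    unfolding linear_map_def
  proof (intro conjI allI ballI)
    fix x y assume "x \<in> Carr V"
    then obtain u where u: "u \<in> Carr U" "x = f u" using surj by blast
    then show "h x \<in> Carr W" using h linear_mapD(1)[OF gl] by simp
    show "h (Scale V c x) = Scale W c (h x)" for c
      using u h linear_mapD(3)[OF fl u(1), symmetric] linear_mapD(3)[OF gl u(1)] cvecD(7)[OF U u(1)] by simp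
    assume "y \<in> Carr V"
    then obtain v where v: "v \<in> Carr U" "y = f v" using surj by blast
    show "h (Add V x y) = Add W (h x) (h y)"
      using u v h linear_mapD(2)[OF fl u(1) v(1), symmetric] linear_mapD(2)[OF gl u(1) v(1)] cvecD(2)[OF U u(1) v(1)] by simp
  qed
  ultimately show ?thesis by (simp add: linear_iso_def)
qed

lemma direct_sum_simps [simp]:
  "Carr (direct_sum V W) = Carr V \<times> Carr W" "Zero (direct_sum V W) = (Zero V, Zero W)"
  "Add (direct_sum V W) (x, y) (x', y') = (Add V x x', Add W y y')"
  "Scale (direct_sum V W) c (x, y) = (Scale V c x, Scale W c y)"
  by (simp_all add: direct_sum_def)

lemma cvec_direct_sum: "cvec V \<Longrightarrow> cvec W \<Longrightarrow> cvec (direct_sum V W)"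
  unfolding cvec_def by (auto simp: mem_Times_iff)

lemma direct_sum_cong:
  assumes "linear_iso V V' f" "linear_iso W W' g"
  shows "linear_iso (direct_sum V W) (direct_sum V' W') (map_prod f g)"
  using assms bij_betw_map_prod[of f "Carr V" "Carr V'" g "Carr W" "Carr W'"]
  unfolding linear_iso_def linear_map_def by (auto simp: map_prod_def case_prod_unfold)

section \<open>Quotients by a subspace\<close>

lemma quotient_space_simps [simp]:
  "Carr (quotient_space V B) = coset V B ` Carr V" "Zero (quotient_space V B) = B"
  by (simp_all add: quotient_space_def)

context
  fixes V :: "'v cspace" and B assumes V: "cvec V" and B: "csub V B"
begin

lemma coset_eq_iff:
  assumes "x \<in> Carr V" "y \<in> Carr V"
  shows "coset V B x = coset V B y \<longleftrightarrow> (\<exists>b\<in>B. x = Add V y b)"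
proof
  note v = cvecD[OF V] and b = csubD[OF B]
  assume eq: "coset V B x = coset V B y"
  have "x = Add V x (Zero V)" using v(1,3,5) assms by simp
  then have "x \<in> coset V B x" using b(2) by (auto simp: coset_def)
  then show "\<exists>b\<in>B. x = Add V y b" using eq by (auto simp: coset_def)
next
  note v = cvecD[OF V] and b = csubD[OF B]
  assume "\<exists>b\<in>B. x = Add V y b"
  then obtain c where c: "c \<in> B" "x = Add V y c" by blast
  have cV: "c \<in> Carr V" using b(1) c(1) .
  let ?n = "Scale V (- 1) c"
  have nB: "?n \<in> B" using b(4) c(1) .
  then have nV: "?n \<in> Carr V" by (rule b(1))
  have "Add V x ?n = Add V y (Add V c ?n)" unfolding c(2) by (rule v(4)[OF assms(2) cV nV])
  also have "\<dots> = y" using v(1,3,5,6) cV assms(2) by simp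
  finally have y: "y = Add V x ?n" by simp
  have sub: "coset V B x \<subseteq> coset V B y" if "x \<in> Carr V" "y \<in> Carr V" "c \<in> B" "x = Add V y c" for x y c
  proof
    fix z assume "z \<in> coset V B x"
    then obtain d where d: "d \<in> B" "z = Add V x d" by (auto simp: coset_def)
    have "z = Add V y (Add V c d)"
      unfolding d(2) that(4) using v(4) that(2) b(1) that(3) d(1) by simp
    then show "z \<in> coset V B y" using b(3)[OF that(3) d(1)] by (auto simp: coset_def)
  qed
  show "coset V B x = coset V B y"
    using sub[OF assms c] sub[OF assms(2,1) nB y] by blast
qed

lemma coset_zero: "coset V B (Zero V) = B"
  using cvecD(5)[OF V] csubD(1)[OF B] by (force simp: coset_def)

lemma coset_eq_zero_iff:
  assumes "x \<in> Carr V"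
  shows "coset V B x = B \<longleftrightarrow> x \<in> B"
proof -
  have "coset V B x = B \<longleftrightarrow> (\<exists>b\<in>B. x = Add V (Zero V) b)"
    using coset_eq_iff[OF assms cvecD(1)[OF V]] coset_zero by simp
  also have "\<dots> \<longleftrightarrow> x \<in> B" using cvecD(5)[OF V] csubD(1)[OF B] by auto
  finally show ?thesis .
qed

lemma coset_nonempty: "coset V B x \<noteq> {}"
  using csubD(2)[OF B] by (auto simp: coset_def)

lemma quotient_Add:
  assumes "x \<in> Carr V" "y \<in> Carr V"
  shows "Add (quotient_space V B) (coset V B x) (coset V B y) = coset V B (Add V x y)"
proof -
  note v = cvecD[OF V] and b = csubD[OF B]
  have "coset V B (Add V x' y') = coset V B (Add V x y)" if h: "x' \<in> coset V B x" "y' \<in> coset V B y" for x' y'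
  proof -
    obtain c d where cd: "c \<in> B" "x' = Add V x c" "d \<in> B" "y' = Add V y d"
      using h by (auto simp: coset_def)
    note C = assms b(1)[OF cd(1)] b(1)[OF cd(3)]
    have "Add V x' y' = Add V x (Add V c (Add V y d))"
      unfolding cd using v(2,4) C by simp
    also have "Add V c (Add V y d) = Add V y (Add V c d)"
      using v(2,3,4) C by metis
    also have "Add V x (Add V y (Add V c d)) = Add V (Add V x y) (Add V c d)"
      using v(2,4) C by simp
    finally have "Add V x' y' = Add V (Add V x y) (Add V c d)" .
    moreover have "Add V x' y' \<in> Carr V" "Add V x y \<in> Carr V"
      using cd(2,4) v(2) C by auto
    ultimately show ?thesis
      using coset_eq_iff b(3)[OF cd(1,3)] by blast
  qed
  then show ?thesis
    using coset_nonempty by (auto simp: quotient_space_def)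
qed

lemma quotient_Scale:
  assumes "x \<in> Carr V"
  shows "Scale (quotient_space V B) c (coset V B x) = coset V B (Scale V c x)"
proof -
  note v = cvecD[OF V] and b = csubD[OF B]
  have "coset V B (Scale V c x') = coset V B (Scale V c x)" if h: "x' \<in> coset V B x" for x'
  proof -
    obtain d where d: "d \<in> B" "x' = Add V x d"
      using h by (auto simp: coset_def)
    have "Scale V c x' = Add V (Scale V c x) (Scale V c d)"
      unfolding d(2) by (rule v(8)[OF assms b(1)[OF d(1)]])
    moreover have "Scale V c x' \<in> Carr V" "Scale V c x \<in> Carr V"
      using d v(2,7) assms b(1) by auto
    ultimately show ?thesis
      using coset_eq_iff b(4)[OF d(1)] by blast
  qed
  then show ?thesis
    using coset_nonempty by (auto simp: quotient_space_def)
qed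

lemma cvec_quotient: "cvec (quotient_space V B)"
proof -
  note v = cvecD[OF V] and b = csubD[OF B]
  have z: "B = coset V B (Zero V)" by (rule coset_zero[symmetric])
  show ?thesis
    unfolding cvec_def quotient_space_simps
  proof (intro conjI ballI allI)
    show "B \<in> coset V B ` Carr V" using z v(1) by blast
    show "Scale (quotient_space V B) c B = B" for c
      using quotient_Scale[OF v(1), of c] by (simp add: v(9) coset_zero)
  next
    fix X assume "X \<in> coset V B ` Carr V"
    then obtain x where x: "x \<in> Carr V" "X = coset V B x" by blast
    show "Add (quotient_space V B) B X = X"
      using quotient_Add[OF v(1) x(1)] x v(5) z by simp
    show "Add (quotient_space V B) X (Scale (quotient_space V B) (- 1) X) = B"
      using x v(6,7) z by (simp add: quotient_Add quotient_Scale)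
    show "Scale (quotient_space V B) c X \<in> coset V B ` Carr V" for c
      using x v(7) by (simp add: quotient_Scale)
    fix Y assume "Y \<in> coset V B ` Carr V"
    then obtain y where y: "y \<in> Carr V" "Y = coset V B y" by blast
    show "Add (quotient_space V B) X Y \<in> coset V B ` Carr V"
      using x y v(2) by (simp add: quotient_Add)
    show "Add (quotient_space V B) X Y = Add (quotient_space V B) Y X"
      using x y v(3) by (simp add: quotient_Add)
    show "Scale (quotient_space V B) c (Add (quotient_space V B) X Y) =
        Add (quotient_space V B) (Scale (quotient_space V B) c X) (Scale (quotient_space V B) c Y)" for c
      using x y v(2,7,8) by (simp add: quotient_Add quotient_Scale)
    fix Z assume "Z \<in> coset V B ` Carr V"
    then obtain w where w: "w \<in> Carr V" "Z = coset V B w" by blast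
    show "Add (quotient_space V B) (Add (quotient_space V B) X Y) Z =
        Add (quotient_space V B) X (Add (quotient_space V B) Y Z)"
      using x y w v(2,4) by (simp add: quotient_Add)
  qed
qed

end

lemma induced_map_coset:
  assumes V: "cvec V" "csub V B" and f: "linear_map V W f" "f ` B \<subseteq> B'" and W: "cvec W" "csub W B'" and x: "x \<in> Carr V"
  shows "induced_map W B' f (coset V B x) = coset W B' (f x)"
proof -
  note f' = linear_mapD[OF f(1)] and b = csubD[OF V(2)]
  have "coset W B' (f x') = coset W B' (f x)" if h: "x' \<in> coset V B x" for x'
  proof -
    obtain c where c: "c \<in> B" "x' = Add V x c"
      using h by (auto simp: coset_def)
    have "f x' = Add W (f x) (f c)" unfolding c(2) by (rule f'(2)[OF x b(1)[OF c(1)]])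
    moreover have "f c \<in> B'" "f x \<in> Carr W" "f x' \<in> Carr W"
      using c(1) f(2) f'(1) x cvecD(2)[OF V(1) x b(1)[OF c(1)]] c(2) by auto
    ultimately show ?thesis
      using coset_eq_iff[OF W] by blast
  qed
  then show ?thesis
    unfolding induced_map_def using coset_nonempty[OF V, of x] by blast
qed

text \<open>The hypotheses make \<open>r\<close> an isomorphism of \<open>U\<close> onto a
  complement of \<open>B\<close> in \<open>V\<close>.\<close>

lemma quotient_linear_iso:
  assumes V: "cvec V" "csub V B" and U: "cvec U" and r: "linear_map U V r"
    and surj: "\<And>x. x \<in> Carr V \<Longrightarrow> \<exists>u\<in>Carr U. \<exists>b\<in>B. x = Add V (r u) b"
    and inj: "\<And>u. u \<in> Carr U \<Longrightarrow> r u \<in> B \<Longrightarrow> u = Zero U"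
  shows "linear_iso U (quotient_space V B) (\<lambda>u. coset V B (r u))"
proof -
  note v = cvecD[OF V(1)] and b = csubD[OF V(2)] and u = cvecD[OF U] and r' = linear_mapD[OF r]
  have "linear_map U (quotient_space V B) (\<lambda>u. coset V B (r u))"
    unfolding linear_map_def by (auto simp: r' quotient_Add[OF V] quotient_Scale[OF V])
  moreover have "inj_on (\<lambda>u. coset V B (r u)) (Carr U)"
  proof (rule inj_onI)
    fix x y assume xy: "x \<in> Carr U" "y \<in> Carr U" "coset V B (r x) = coset V B (r y)"
    then obtain c where c: "c \<in> B" "r x = Add V (r y) c"
      using coset_eq_iff[OF V r'(1) r'(1)] by blast
    let ?n = "Scale U (- 1) y"
    have nU: "?n \<in> Carr U" using u(7) xy(2) .
    have "r (Add U x ?n) = Add V (Add V (r y) c) (Scale V (- 1) (r y))"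
      using r'(2)[OF xy(1) nU] r'(3)[OF xy(2)] c(2) by simp
    also have "\<dots> = Add V c (Add V (r y) (Scale V (- 1) (r y)))"
      using v(2,3,4,7) r'(1)[OF xy(2)] b(1)[OF c(1)] by metis
    also have "\<dots> = c" using v(1,3,5,6) r'(1)[OF xy(2)] b(1)[OF c(1)] by simp
    finally have "Add U x ?n = Zero U" using inj u(2)[OF xy(1) nU] c(1) by simp
    then have "Add U (Add U x ?n) y = y" using u(5) xy(2) by simp
    moreover have "Add U (Add U x ?n) y = x"
      using u(1,3,4,5,6) xy nU by simp
    ultimately show "x = y" by simp
  qed
  moreover have "(\<lambda>u. coset V B (r u)) ` Carr U = coset V B ` Carr V"
  proof (intro equalityI subsetI)
    fix X assume "X \<in> coset V B ` Carr V"
    then obtain x where x: "x \<in> Carr V" "X = coset V B x" by blast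
    obtain u c where "u \<in> Carr U" "c \<in> B" "x = Add V (r u) c" using surj[OF x(1)] by blast
    then show "X \<in> (\<lambda>u. coset V B (r u)) ` Carr U"
      using coset_eq_iff[OF V x(1) r'(1)] x(2) by blast
  qed (use r' in auto)
  ultimately show ?thesis
    unfolding linear_iso_def bij_betw_def by simp
qed

section \<open>Cochain complexes and representatives of their cohomology\<close>

definition cochain_complex :: "(nat \<Rightarrow> 'v cspace) \<Rightarrow> (nat \<Rightarrow> 'v \<Rightarrow> 'v) \<Rightarrow> bool" where
  "cochain_complex C d \<longleftrightarrow> (\<forall>n. cvec (C n) \<and> linear_map (C n) (C (Suc n)) (d n) \<and>
     (\<forall>x\<in>Carr (C n). d (Suc n) (d n x) = Zero (C (Suc (Suc n)))))"

lemma cochain_complexD: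
  assumes "cochain_complex C d"
  shows "cvec (C n)" "linear_map (C n) (C (Suc n)) (d n)" "x \<in> Carr (C n) \<Longrightarrow> d (Suc n) (d n x) = Zero (C (Suc (Suc n)))"
  using assms unfolding cochain_complex_def by blast+

lemma cocycles_csub:
  assumes "cochain_complex C d"
  shows "csub (C n) (cocycles C d n)"
proof -
  note c = cochain_complexD[OF assms]
  note d = linear_mapD[OF c(2)] and z = linear_map_zero[OF c(2) c(1) c(1)]
  show ?thesis
    unfolding csub_def cocycles_def
    using cvecD(1,2,7)[OF c(1)[of n]] cvecD(1,5,9)[OF c(1)[of "Suc n"]] by (auto simp: d z)
qed

lemma coboundaries_csub:
  assumes "cochain_complex C d"
  shows "csub ((C n)\<lparr>Carr := cocycles C d n\<rparr>) (coboundaries C d n)"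
proof (cases n)
  case 0
  note c = cochain_complexD[OF assms]
  show ?thesis
    unfolding csub_def 0 coboundaries_def
    using csubD(2)[OF cocycles_csub[OF assms, of 0]] cvecD(1,5,9)[OF c(1)[of 0]] by auto
next
  case (Suc m)
  note c = cochain_complexD[OF assms]
  note d = linear_mapD[OF c(2)[of m]] and z = linear_map_zero[OF c(2) c(1) c(1), of m]
  have "d m (Zero (C m)) \<in> d m ` Carr (C m)" using cvecD(1)[OF c(1)] by blast
  moreover have "Add (C (Suc m)) (d m x) (d m y) \<in> d m ` Carr (C m)" if "x \<in> Carr (C m)" "y \<in> Carr (C m)" for x y
    using d(2)[OF that] cvecD(2)[OF c(1) that] by (metis imageI)
  moreover have "Scale (C (Suc m)) k (d m x) \<in> d m ` Carr (C m)" if "x \<in> Carr (C m)" for x k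
    using d(3)[OF that] cvecD(7)[OF c(1) that] by (metis imageI)
  ultimately show ?thesis
    unfolding csub_def Suc coboundaries_def cocycles_def using z d(1) c(3) by auto
qed

text \<open>The cohomology computations below all have this shape, with \<open>U\<close> built from
  invariant forms and \<open>r\<close> the choice of a representing cocycle.\<close>

lemma cohomology_iso:
  assumes C: "cochain_complex C d" and U: "cvec U" and r: "linear_map U (C n) r"
    and cocycle: "\<And>u. u \<in> Carr U \<Longrightarrow> d n (r u) = Zero (C (Suc n))"
    and surj: "\<And>x. x \<in> Carr (C n) \<Longrightarrow> d n x = Zero (C (Suc n)) \<Longrightarrow>
      \<exists>u\<in>Carr U. \<exists>b\<in>coboundaries C d n. x = Add (C n) (r u) b"
    and inj: "\<And>u. u \<in> Carr U \<Longrightarrow> r u \<in> coboundaries C d n \<Longrightarrow> u = Zero U"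
  shows "linear_iso U (cohomology C d n) (\<lambda>u. coset ((C n)\<lparr>Carr := cocycles C d n\<rparr>) (coboundaries C d n) (r u))"
  unfolding cohomology_def
proof (rule quotient_linear_iso[OF cvec_csub[OF cochain_complexD(1)[OF C] cocycles_csub[OF C]] coboundaries_csub[OF C] U])
  show "linear_map U ((C n)\<lparr>Carr := cocycles C d n\<rparr>) r"
    using r cocycle by (auto simp: linear_map_def cocycles_def)
  show "\<exists>u\<in>Carr U. \<exists>b\<in>coboundaries C d n. x = Add ((C n)\<lparr>Carr := cocycles C d n\<rparr>) (r u) b"
    if "x \<in> Carr ((C n)\<lparr>Carr := cocycles C d n\<rparr>)" for x
    using surj[of x] that by (simp add: cocycles_def)
qed (rule inj)

section \<open>The cohomology of the current algebra\<close>

context semisimple_lie_algebra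
begin

lemma complex_simps:
  "Carr (ce_complex n) = ce_cochains n" "Zero (ce_complex n) = 0" "Add (ce_complex n) = (+)" "Scale (ce_complex n) = fscale"
  "Carr (invariant_forms n) = invariant_cochains n" "Zero (invariant_forms n) = 0" "Add (invariant_forms n) = (+)"
  "Scale (invariant_forms n) = fscale"
  "Carr (cur.basic_complex n) = cur.basic_cochains n" "Zero (cur.basic_complex n) = 0" "Add (cur.basic_complex n) = (+)"
  "Scale (cur.basic_complex n) = bscale"
  using Carr_invariant_forms[of n]
  by (auto simp: ce_complex_def invariant_forms_def cur.basic_complex_def fscale_def bscale_def fun_eq_iff)

lemma cvec_ce: "cvec (ce_complex n)"
  by (rule cvec_pointwise[where s = fscale]) (simp_all add: complex_simps forms.V.vector_space_axioms subspace_ce_cochains)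

lemma cvec_invariant: "cvec (invariant_forms n)"
  by (rule cvec_pointwise[where s = fscale]) (simp_all add: complex_simps forms.V.vector_space_axioms subspace_invariant_cochains)

lemma basic_subspace: "module.subspace bscale (cur.basic_cochains n)"
proof -
  interpret B: vector_space bscale by (rule bscale_vs)
  show ?thesis using basic_cochains_subspace by (auto simp: B.subspace_def)
qed

lemma cvec_basic: "cvec (cur.basic_complex n)"
  by (rule cvec_pointwise[where s = bscale]) (simp_all add: complex_simps bscale_vs basic_subspace)

lemma ce_complex_cochain_complex: "cochain_complex ce_complex ce_d"
proof -
  interpret R: Vector_Spaces.linear "fscale :: complex \<Rightarrow> ('a list \<Rightarrow> complex) \<Rightarrow> _" fscale "rd br" by (rule rd_linear)
  show ?thesis
    unfolding cochain_complex_def linear_map_def complex_simps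
    using cvec_ce forms.V.subspace_add[OF subspace_ce_cochains] forms.V.subspace_scale[OF subspace_ce_cochains] rd_ce_cochains
    by (auto simp: ce_d_eq_rd R.add R.scale rd_rd_ce zero_fun_def)
qed

lemma basic_cochain_complex: "cochain_complex cur.basic_complex cur.basic_d"
  unfolding cochain_complex_def linear_map_def complex_simps
  using cvec_basic basic_d_basic basic_d_add basic_d_scale basic_d_d by auto

lemma ce_coboundaries:
  "coboundaries ce_complex ce_d 0 = {0}" "coboundaries ce_complex ce_d (Suc m) = rd br ` ce_cochains m"
  by (auto simp: coboundaries_def complex_simps ce_d_eq_rd)

lemma basic_coboundaries:
  "coboundaries cur.basic_complex cur.basic_d 0 = {0}"
  "coboundaries cur.basic_complex cur.basic_d (Suc m) = cur.basic_d m ` cur.basic_cochains m"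
  by (auto simp: coboundaries_def complex_simps)

lemma invariant_forms_ce_cohomology:
  "linear_iso (invariant_forms n) (ce_cohomology n)
    (\<lambda>\<omega>. coset ((ce_complex n)\<lparr>Carr := cocycles ce_complex ce_d n\<rparr>) (coboundaries ce_complex ce_d n) \<omega>)"
  unfolding ce_cohomology_def
proof (rule cohomology_iso[OF ce_complex_cochain_complex cvec_invariant, where r = "\<lambda>\<omega>. \<omega>"])
  show "linear_map (invariant_forms n) (ce_complex n) (\<lambda>\<omega>. \<omega>)"
    unfolding linear_map_def complex_simps by (auto intro: invariant_ce)
  show "ce_d n u = Zero (ce_complex (Suc n))" if "u \<in> Carr (invariant_forms n)" for u
    using that rd_invariant[of u n] ce_d_eq_rd[OF invariant_ce] by (simp add: complex_simps zero_fun_def)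
next
  fix x assume "x \<in> Carr (ce_complex n)" "ce_d n x = Zero (ce_complex (Suc n))"
  then have x: "x \<in> ce_cochains n" "rd br x = (\<lambda>_. 0)"
    using ce_d_eq_rd[of x n] by (simp_all add: complex_simps zero_fun_def)
  obtain a where a: "a \<in> invariant_cochains n" "n = 0 \<Longrightarrow> x = a"
    "\<And>m. n = Suc m \<Longrightarrow> \<exists>\<eta>\<in>ce_cochains m. x - a = rd br \<eta>"
    by (rule cocycle_invariant_part[OF x]) (rule that)
  have "\<exists>b\<in>coboundaries ce_complex ce_d n. x = a + b"
  proof (cases n)
    case 0
    with a(2) show ?thesis by (simp add: ce_coboundaries)
  next
    case (Suc m)
    obtain \<eta> where "\<eta> \<in> ce_cochains m" "x - a = rd br \<eta>" using a(3)[OF Suc] by blast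
    then show ?thesis
      unfolding Suc ce_coboundaries by (intro bexI[of _ "rd br \<eta>"]) (auto simp: algebra_simps)
  qed
  then show "\<exists>u\<in>Carr (invariant_forms n). \<exists>b\<in>coboundaries ce_complex ce_d n. x = Add (ce_complex n) u b"
    using a(1) unfolding complex_simps by blast
next
  fix u assume u: "u \<in> Carr (invariant_forms n)" "u \<in> coboundaries ce_complex ce_d n"
  show "u = Zero (invariant_forms n)"
  proof (cases n)
    case 0
    with u show ?thesis by (simp add: ce_coboundaries complex_simps)
  next
    case (Suc m)
    obtain \<eta> where "\<eta> \<in> ce_cochains m" "u = rd br \<eta>" using u(2) unfolding Suc ce_coboundaries by blast
    then show ?thesis
      using invariant_coboundary[of u m \<eta>] u(1) Suc by (simp add: complex_simps)
  qed
qed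

lemma invariant_forms_basic_cohomology:
  "linear_iso (invariant_forms n) (cohomology cur.basic_complex cur.basic_d n)
    (\<lambda>\<omega>. coset ((cur.basic_complex n)\<lparr>Carr := cocycles cur.basic_complex cur.basic_d n\<rparr>)
      (coboundaries cur.basic_complex cur.basic_d n) (ce_embedding n \<omega>))"
proof (rule cohomology_iso[OF basic_cochain_complex cvec_invariant])
  show "linear_map (invariant_forms n) (cur.basic_complex n) (ce_embedding n)"
    unfolding linear_map_def complex_simps
    by (auto intro: invariant_ce ce_embedding_basic simp: ce_embedding_add ce_embedding_scale)
  show "cur.basic_d n (ce_embedding n u) = Zero (cur.basic_complex (Suc n))" if "u \<in> Carr (invariant_forms n)" for u
    using that basic_d_embedding_invariant[of u n] by (simp add: complex_simps)
next
  fix x assume "x \<in> Carr (cur.basic_complex n)" "cur.basic_d n x = Zero (cur.basic_complex (Suc n))"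
  then have x: "x \<in> cur.basic_cochains n" "cur.basic_d n x = 0" by (simp_all add: complex_simps)
  obtain a where a: "a \<in> invariant_cochains n" "n = 0 \<Longrightarrow> x = ce_embedding n a"
    "\<And>m. n = Suc m \<Longrightarrow> \<exists>\<xi>\<in>cur.basic_cochains m. x = ce_embedding n a + cur.basic_d m \<xi>"
    by (rule basic_cocycle_invariant[OF x]) (rule that)
  have "\<exists>b\<in>coboundaries cur.basic_complex cur.basic_d n. x = ce_embedding n a + b"
  proof (cases n)
    case 0
    with a(2) show ?thesis by (simp add: basic_coboundaries)
  next
    case (Suc m)
    with a(3)[OF Suc] show ?thesis by (auto simp: basic_coboundaries)
  qed
  then show "\<exists>u\<in>Carr (invariant_forms n). \<exists>b\<in>coboundaries cur.basic_complex cur.basic_d n.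
      x = Add (cur.basic_complex n) (ce_embedding n u) b"
    using a(1) unfolding complex_simps by blast
next
  fix u assume u: "u \<in> Carr (invariant_forms n)" "ce_embedding n u \<in> coboundaries cur.basic_complex cur.basic_d n"
  show "u = Zero (invariant_forms n)"
  proof (cases n)
    case 0
    have "ce_embedding 0 u = ce_embedding 0 0" using u(2) by (simp add: 0 basic_coboundaries ce_embedding_zero)
    moreover have "u \<in> ce_cochains 0" "0 \<in> ce_cochains 0"
      using u(1) 0 invariant_ce forms.V.subspace_0[OF subspace_ce_cochains] by (auto simp: complex_simps)
    ultimately show ?thesis
      using ce_embedding_bij[of 0] by (auto simp: bij_betw_def inj_on_def complex_simps)
  next
    case (Suc m)
    obtain \<xi> where "\<xi> \<in> cur.basic_cochains m" "ce_embedding n u = cur.basic_d m \<xi>"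
      using u(2) unfolding Suc basic_coboundaries by blast
    then show ?thesis
      using embedding_invariant_exact[of u m \<xi>] u(1) Suc by (simp add: complex_simps)
  qed
qed

lemma embedding_cochain_map:
  "cochain_map ce_complex ce_d cur.basic_complex cur.basic_d ce_embedding"
  unfolding cochain_map_def linear_map_def complex_simps
  by (auto simp: ce_embedding_basic ce_embedding_add ce_embedding_scale ce_d_eq_rd basic_d_embedding)

text \<open>The induced map sends the class of an invariant form to the class of its embedding, and
  on both sides these classes are the whole cohomology, each taken once.\<close>

lemma embedding_quasi_isomorphism:
  "quasi_isomorphism ce_complex ce_d cur.basic_complex cur.basic_d ce_embedding"
  unfolding quasi_isomorphism_def
proof (intro conjI allI)
  show cm: "cochain_map ce_complex ce_d cur.basic_complex cur.basic_d ce_embedding"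
    by (rule embedding_cochain_map)
  fix n
  let ?V = "(ce_complex n)\<lparr>Carr := cocycles ce_complex ce_d n\<rparr>" and ?B = "coboundaries ce_complex ce_d n"
  let ?W = "(cur.basic_complex n)\<lparr>Carr := cocycles cur.basic_complex cur.basic_d n\<rparr>"
  let ?B' = "coboundaries cur.basic_complex cur.basic_d n"
  \<comment> \<open>Cosets depend on the addition only, so restricting the carrier to the cocycles
    does not change them.\<close>
  have coset: "coset ?W = coset (cur.basic_complex n)" by (intro ext) (simp add: coset_def)
  have d0: "cur.basic_d n (ce_embedding n x) = 0" if "x \<in> ce_cochains n" "ce_d n x = 0" for x
    using basic_d_embedding[OF that(1)] ce_d_eq_rd[OF that(1)] that(2) by (simp add: ce_embedding_zero)
  have lin: "linear_map ?V ?W (ce_embedding n)"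
    using cm d0 unfolding cochain_map_def linear_map_def by (auto simp: cocycles_def complex_simps)
  have img: "ce_embedding n ` ?B \<subseteq> ?B'"
  proof (cases n)
    case 0
    then show ?thesis by (simp add: ce_coboundaries basic_coboundaries ce_embedding_zero)
  next
    case (Suc m)
    then show ?thesis
      unfolding Suc ce_coboundaries basic_coboundaries
      using basic_d_embedding[symmetric] ce_embedding_basic by auto
  qed
  have V: "cvec ?V" "csub ?V ?B" and W: "cvec ?W" "csub ?W ?B'"
    using cvec_csub cochain_complexD(1) cocycles_csub coboundaries_csub ce_complex_cochain_complex basic_cochain_complex by blast+
  have im: "induced_map (cur.basic_complex n) ?B' (ce_embedding n) = induced_map ?W ?B' (ce_embedding n)"
    by (intro ext) (simp add: induced_map_def coset)
  show "linear_iso (cohomology ce_complex ce_d n) (cohomology cur.basic_complex cur.basic_d n)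
      (induced_map (cur.basic_complex n) ?B' (ce_embedding n))"
    unfolding im
  proof (rule linear_iso_factor[OF invariant_forms_ce_cohomology[unfolded ce_cohomology_def]
        invariant_forms_basic_cohomology _ cvec_invariant])
    fix u assume "u \<in> Carr (invariant_forms n)"
    then have "u \<in> Carr ?V"
      using rd_invariant[of u n] ce_d_eq_rd[OF invariant_ce] invariant_ce
      by (simp add: cocycles_def complex_simps zero_fun_def)
    then show "induced_map ?W ?B' (ce_embedding n) (coset ?V ?B u) = coset ?W ?B' (ce_embedding n u)"
      by (rule induced_map_coset[OF V lin img W])
  qed
qed

section \<open>The reduced complex and its cohomology\<close>

lemma partial_csub: "csub (cur.basic_complex n) (cur.basic_partial ` cur.basic_cochains n)"
  unfolding csub_def complex_simps
proof (intro conjI ballI allI)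
  show "0 \<in> cur.basic_partial ` cur.basic_cochains n"
    using basic_cochains_subspace(1) partial_zero by (metis imageI)
qed (use partial_basic basic_cochains_subspace in \<open>auto simp: partial_add[symmetric] partial_scale[symmetric]\<close>)

abbreviation reduced_class ::
  "nat \<Rightarrow> (complex list \<Rightarrow> 'a poly list \<Rightarrow> complex) \<Rightarrow> (complex list \<Rightarrow> 'a poly list \<Rightarrow> complex) set" where
  "reduced_class n \<equiv> coset (cur.basic_complex n) (cur.basic_partial ` cur.basic_cochains n)"

lemma reduced_d_coset:
  assumes "\<gamma> \<in> cur.basic_cochains n"
  shows "cur.reduced_d n (reduced_class n \<gamma>) =
    reduced_class (Suc n) (cur.basic_d n \<gamma>)"
  unfolding cur.reduced_d_def
proof (rule induced_map_coset[OF cvec_basic partial_csub cochain_complexD(2)[OF basic_cochain_complex] _ cvec_basic partial_csub])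
  show "cur.basic_d n ` cur.basic_partial ` cur.basic_cochains n \<subseteq> cur.basic_partial ` cur.basic_cochains (Suc n)"
    using basic_d_partial basic_d_basic by auto
qed (use assms in \<open>simp add: complex_simps\<close>)

lemma reduced_Carr:
  "Carr (cur.reduced_complex n) =
    reduced_class n ` cur.basic_cochains n"
  "Zero (cur.reduced_complex n) = cur.basic_partial ` cur.basic_cochains n"
  by (simp_all add: cur.reduced_complex_def complex_simps)

lemma reduced_Add:
  assumes "x \<in> cur.basic_cochains n" "y \<in> cur.basic_cochains n"
  shows "Add (cur.reduced_complex n) (reduced_class n x)
      (reduced_class n y) =
    reduced_class n (x + y)"
  using quotient_Add[OF cvec_basic partial_csub, of x n y] assms by (simp add: cur.reduced_complex_def complex_simps)

lemma reduced_Scale: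
  assumes "x \<in> cur.basic_cochains n"
  shows "Scale (cur.reduced_complex n) c (reduced_class n x) =
    reduced_class n (bscale c x)"
  using quotient_Scale[OF cvec_basic partial_csub, of x n c] assms by (simp add: cur.reduced_complex_def complex_simps)

lemma reduced_cochain_complex: "cochain_complex cur.reduced_complex cur.reduced_d"
proof -
  have "cvec (cur.reduced_complex n)" for n
    unfolding cur.reduced_complex_def by (rule cvec_quotient[OF cvec_basic partial_csub])
  moreover have "linear_map (cur.reduced_complex n) (cur.reduced_complex (Suc n)) (cur.reduced_d n)" for n
    unfolding linear_map_def reduced_Carr
    using basic_cochains_subspace
    by (auto simp: reduced_d_coset reduced_Add reduced_Scale basic_d_basic basic_d_add basic_d_scale)
  moreover have "cur.reduced_d (Suc n) (cur.reduced_d n X) = Zero (cur.reduced_complex (Suc (Suc n)))"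
    if X: "X \<in> Carr (cur.reduced_complex n)" for n X
  proof -
    obtain x where x: "x \<in> cur.basic_cochains n" "X = reduced_class n x"
      using X by (auto simp: reduced_Carr)
    show ?thesis
      using coset_zero[OF cvec_basic[of "Suc (Suc n)"] partial_csub] basic_d_d[OF x(1)]
      by (simp add: x reduced_d_coset basic_d_basic reduced_Carr complex_simps)
  qed
  ultimately show ?thesis unfolding cochain_complex_def by blast
qed

lemma reduced_class_eq_iff:
  assumes "x \<in> cur.basic_cochains n" "y \<in> cur.basic_cochains n"
  shows "reduced_class n x = reduced_class n y \<longleftrightarrow> (\<exists>\<zeta>\<in>cur.basic_cochains n. x = y + cur.basic_partial \<zeta>)"
  using coset_eq_iff[OF cvec_basic partial_csub, of x n y] assms by (auto simp: complex_simps)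

lemma reduced_class_eq_zero_iff:
  assumes "x \<in> cur.basic_cochains n"
  shows "reduced_class n x = Zero (cur.reduced_complex n) \<longleftrightarrow> (\<exists>\<zeta>\<in>cur.basic_cochains n. x = cur.basic_partial \<zeta>)"
  using coset_eq_zero_iff[OF cvec_basic partial_csub, of x n] assms by (auto simp: complex_simps reduced_Carr)

lemma reduced_coboundaries:
  "coboundaries cur.reduced_complex cur.reduced_d 0 = {Zero (cur.reduced_complex 0)}"
  "coboundaries cur.reduced_complex cur.reduced_d (Suc m) =
    (\<lambda>\<xi>. reduced_class (Suc m) (cur.basic_d m \<xi>)) ` cur.basic_cochains m"
  by (simp_all add: coboundaries_def reduced_Carr image_image reduced_d_coset)

lemma reduced_cohomology_iso:
  "\<exists>f. linear_iso (direct_sum (invariant_forms q) (invariant_forms (Suc q)))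
    (cohomology cur.reduced_complex cur.reduced_d q) f"
proof -
  obtain k where klin: "Vector_Spaces.linear fscale bscale k"
    and k: "\<And>\<eta>. \<eta> \<in> invariant_cochains (Suc q) \<Longrightarrow> k \<eta> \<in> cur.basic_cochains q"
      "\<And>\<eta>. \<eta> \<in> invariant_cochains (Suc q) \<Longrightarrow> cur.basic_d q (k \<eta>) = cur.basic_partial (ce_embedding (Suc q) \<eta>)"
    by (rule partial_primitive[of q]) (rule that)
  interpret k: Vector_Spaces.linear "fscale :: complex \<Rightarrow> ('a list \<Rightarrow> complex) \<Rightarrow> _" bscale k by (rule klin)
  \<comment> \<open>The first summand is a basic cocycle. The second is closed only modulo
    \<partial>: its differential is \<partial> of the embedded form of degree
    \<open>Suc q\<close>.\<close>
  define g where "g u = ce_embedding q (fst u) + k (snd u)" for u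
  let ?U = "direct_sum (invariant_forms q) (invariant_forms (Suc q))"
  have gC: "g u \<in> cur.basic_cochains q" if "u \<in> invariant_cochains q \<times> invariant_cochains (Suc q)" for u
    unfolding g_def using that k(1) ce_embedding_basic[OF invariant_ce] by (intro basic_cochains_subspace) auto
  have gd: "cur.basic_d q (g u) = cur.basic_partial (ce_embedding (Suc q) (snd u))"
    if "u \<in> invariant_cochains q \<times> invariant_cochains (Suc q)" for u
    using that k ce_embedding_basic[OF invariant_ce] basic_d_embedding_invariant
    by (auto simp: g_def basic_d_add)
  have "linear_iso ?U (cohomology cur.reduced_complex cur.reduced_d q)
    (\<lambda>u. coset ((cur.reduced_complex q)\<lparr>Carr := cocycles cur.reduced_complex cur.reduced_d q\<rparr>)
      (coboundaries cur.reduced_complex cur.reduced_d q) (reduced_class q (g u)))"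
  proof (rule cohomology_iso[OF reduced_cochain_complex cvec_direct_sum[OF cvec_invariant cvec_invariant]])
    have "g (\<omega> + \<omega>', \<eta> + \<eta>') = g (\<omega>, \<eta>) + g (\<omega>', \<eta>')" for \<omega> \<omega>' \<eta> \<eta>'
      by (simp add: g_def k.add ce_embedding_add)
    moreover have "g (fscale c \<omega>, fscale c \<eta>) = bscale c (g (\<omega>, \<eta>))" for c \<omega> \<eta>
      by (simp add: g_def k.scale ce_embedding_scale k.vs2.scale_right_distrib)
    ultimately show "linear_map ?U (cur.reduced_complex q) (\<lambda>u. reduced_class q (g u))"
      unfolding linear_map_def using gC by (auto simp: complex_simps reduced_Carr reduced_Add reduced_Scale)
    fix u assume "u \<in> Carr ?U"
    then have u: "u \<in> invariant_cochains q \<times> invariant_cochains (Suc q)" by (simp add: complex_simps)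
    have e: "ce_embedding (Suc q) (snd u) \<in> cur.basic_cochains (Suc q)"
      using u by (intro ce_embedding_basic invariant_ce) (simp add: mem_Times_iff)
    show "cur.reduced_d q (reduced_class q (g u)) = Zero (cur.reduced_complex (Suc q))"
      unfolding reduced_d_coset[OF gC[OF u]] reduced_class_eq_zero_iff[OF basic_d_basic[OF gC[OF u]]]
      using gd[OF u] e by blast
  next
    fix X assume X: "X \<in> Carr (cur.reduced_complex q)" "cur.reduced_d q X = Zero (cur.reduced_complex (Suc q))"
    obtain \<gamma> where \<gamma>: "\<gamma> \<in> cur.basic_cochains q" "X = reduced_class q \<gamma>" using X(1) by (auto simp: reduced_Carr)
    obtain \<eta>' where \<eta>': "\<eta>' \<in> cur.basic_cochains (Suc q)" "cur.basic_d q \<gamma> = cur.basic_partial \<eta>'"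
      using X(2) unfolding \<gamma>(2) reduced_d_coset[OF \<gamma>(1)] reduced_class_eq_zero_iff[OF basic_d_basic[OF \<gamma>(1)]] by blast
    obtain \<omega> \<eta> \<zeta> where *: "\<omega> \<in> invariant_cochains q" "\<eta> \<in> invariant_cochains (Suc q)" "\<zeta> \<in> cur.basic_cochains q"
      "q = 0 \<Longrightarrow> \<gamma> = ce_embedding q \<omega> + k \<eta> + cur.basic_partial \<zeta>"
      "\<And>m. q = Suc m \<Longrightarrow> \<exists>\<xi>\<in>cur.basic_cochains m. \<gamma> = ce_embedding q \<omega> + k \<eta> + cur.basic_d m \<xi> + cur.basic_partial \<zeta>"
      by (rule reduced_cocycle_decomposition[of q k, OF k \<gamma>(1) \<eta>']) (assumption | rule that)+
    have u: "(\<omega>, \<eta>) \<in> invariant_cochains q \<times> invariant_cochains (Suc q)" using * by simp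
    have "\<exists>b\<in>coboundaries cur.reduced_complex cur.reduced_d q. X = Add (cur.reduced_complex q) (reduced_class q (g (\<omega>, \<eta>))) b"
    proof (cases q)
      case 0
      have z: "Zero (cur.reduced_complex q) = reduced_class q 0"
        using reduced_class_eq_zero_iff[of 0 q] partial_zero basic_cochains_subspace(1)[of q] by metis
      have "X = reduced_class q (g (\<omega>, \<eta>))"
        unfolding \<gamma>(2) reduced_class_eq_iff[OF \<gamma>(1) gC[OF u]] using *(3) *(4)[OF 0] by (auto simp: g_def)
      also have "\<dots> = Add (cur.reduced_complex q) (reduced_class q (g (\<omega>, \<eta>))) (Zero (cur.reduced_complex q))"
        unfolding z using reduced_Add[OF gC[OF u] basic_cochains_subspace(1)] by simp
      finally show ?thesis using reduced_coboundaries(1) 0 by simp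
    next
      case (Suc m)
      obtain \<xi> where x: "\<xi> \<in> cur.basic_cochains m" "\<gamma> = g (\<omega>, \<eta>) + cur.basic_d m \<xi> + cur.basic_partial \<zeta>"
        using *(5)[OF Suc] by (auto simp: g_def)
      have d: "cur.basic_d m \<xi> \<in> cur.basic_cochains q" using basic_d_basic[OF x(1)] Suc by simp
      have "X = reduced_class q (g (\<omega>, \<eta>) + cur.basic_d m \<xi>)"
        unfolding \<gamma>(2) reduced_class_eq_iff[OF \<gamma>(1) basic_cochains_subspace(2)[OF gC[OF u] d]] using x *(3) by blast
      also have "\<dots> = Add (cur.reduced_complex q) (reduced_class q (g (\<omega>, \<eta>))) (reduced_class q (cur.basic_d m \<xi>))"
        using reduced_Add[OF gC[OF u] d] by simp
      finally show ?thesis using x(1) by (auto simp: Suc reduced_coboundaries)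
    qed
    then show "\<exists>u\<in>Carr ?U. \<exists>b\<in>coboundaries cur.reduced_complex cur.reduced_d q.
        X = Add (cur.reduced_complex q) (reduced_class q (g u)) b"
      using u by (intro bexI[of _ "(\<omega>, \<eta>)"]) (auto simp: complex_simps)
  next
    fix u assume u: "u \<in> Carr ?U" "reduced_class q (g u) \<in> coboundaries cur.reduced_complex cur.reduced_d q"
    obtain \<omega> \<eta> where w: "u = (\<omega>, \<eta>)" "\<omega> \<in> invariant_cochains q" "\<eta> \<in> invariant_cochains (Suc q)"
      using u(1) by (auto simp: complex_simps)
    have gu: "g u \<in> cur.basic_cochains q" using gC u(1) by (simp add: complex_simps)
    have "\<exists>\<zeta>\<in>cur.basic_cochains q. (q = 0 \<longrightarrow> g u = cur.basic_partial \<zeta>) \<and>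
      (\<forall>m. q = Suc m \<longrightarrow> (\<exists>\<xi>\<in>cur.basic_cochains m. g u = cur.basic_d m \<xi> + cur.basic_partial \<zeta>))"
    proof (cases q)
      case 0
      then show ?thesis using u(2) reduced_class_eq_zero_iff[OF gu] by (auto simp: reduced_coboundaries)
    next
      case (Suc m)
      obtain \<xi> where x: "\<xi> \<in> cur.basic_cochains m" "reduced_class q (g u) = reduced_class q (cur.basic_d m \<xi>)"
        using u(2) by (auto simp: Suc reduced_coboundaries)
      have d: "cur.basic_d m \<xi> \<in> cur.basic_cochains q" using basic_d_basic[OF x(1)] Suc by simp
      show ?thesis using x reduced_class_eq_iff[OF gu d] Suc by auto
    qed
    then obtain \<zeta> where z: "\<zeta> \<in> cur.basic_cochains q" "q = 0 \<Longrightarrow> ce_embedding q \<omega> + k \<eta> = cur.basic_partial \<zeta>"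
      "\<And>m. q = Suc m \<Longrightarrow> \<exists>\<xi>\<in>cur.basic_cochains m. ce_embedding q \<omega> + k \<eta> = cur.basic_d m \<xi> + cur.basic_partial \<zeta>"
      by (auto simp: g_def w(1))
    show "u = Zero ?U"
      using reduced_coboundary_zero[OF k(1)[OF w(3)] k(2)[OF w(3)] k.zero w(2,3) z] by (simp add: w(1) complex_simps)
  qed
  then show ?thesis by blast
qed

end

theorem theorem8p1:
  fixes scale :: "complex \<Rightarrow> 'g::ab_group_add \<Rightarrow> 'g" and br :: "'g \<Rightarrow> 'g \<Rightarrow> 'g"
  assumes "semisimple_lie_algebra scale br"
  shows
    "(\<forall>n. bij_betw (lie_algebra.ce_embedding scale n)
            (Carr (lie_algebra.ce_complex scale n))
            (lie_algebra.degree_zero_cochains scale n)) \<and>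
     quasi_isomorphism
       (lie_algebra.ce_complex scale) (lie_algebra.ce_d br)
       (lie_algebra.cur_basic_complex scale) (lie_algebra.cur_basic_d scale br)
       (lie_algebra.ce_embedding scale) \<and>
     (\<forall>n. lie_algebra.cur_basic_cohomology scale br n \<simeq> lie_algebra.ce_cohomology scale br n) \<and>
     (\<forall>n. lie_algebra.ce_cohomology scale br n \<simeq> lie_algebra.invariant_forms scale br n) \<and>
     (\<forall>q. lie_algebra.cur_reduced_cohomology scale br q \<simeq>
            direct_sum (lie_algebra.ce_cohomology scale br q)
                       (lie_algebra.ce_cohomology scale br (Suc q)))"
proof -
  interpret semisimple_lie_algebra scale br by (rule assms)
  have ce: "ce_cohomology n \<simeq> invariant_forms n" for n
    by (rule linear_iso_sym[OF invariant_forms_ce_cohomology cvec_invariant])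
  have "cur_basic_cohomology n \<simeq> invariant_forms n" for n
    unfolding cur_basic_cohomology_def cur.basic_cohomology_def
    by (rule linear_iso_sym[OF invariant_forms_basic_cohomology cvec_invariant])
  moreover have "invariant_forms n \<simeq> ce_cohomology n" for n
    using invariant_forms_ce_cohomology unfolding isomorphic_def by blast
  ultimately have "cur_basic_cohomology n \<simeq> ce_cohomology n" for n
    by (rule isomorphic_trans)
  moreover have "cur_reduced_cohomology q \<simeq> direct_sum (ce_cohomology q) (ce_cohomology (Suc q))" for q
  proof -
    obtain f where f: "linear_iso (direct_sum (invariant_forms q) (invariant_forms (Suc q)))
        (cohomology cur.reduced_complex cur.reduced_d q) f"
      using reduced_cohomology_iso by blast
    have "cur_reduced_cohomology q \<simeq> direct_sum (invariant_forms q) (invariant_forms (Suc q))"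
      unfolding cur_reduced_cohomology_def cur.reduced_cohomology_def
      by (rule linear_iso_sym[OF f cvec_direct_sum[OF cvec_invariant cvec_invariant]])
    moreover have "direct_sum (invariant_forms q) (invariant_forms (Suc q)) \<simeq>
        direct_sum (ce_cohomology q) (ce_cohomology (Suc q))"
      unfolding isomorphic_def
      using direct_sum_cong[OF invariant_forms_ce_cohomology invariant_forms_ce_cohomology] by blast
    ultimately show ?thesis by (rule isomorphic_trans)
  qed
  ultimately show ?thesis
    using ce ce_embedding_bij embedding_quasi_isomorphism
    unfolding cur_basic_complex_def cur_basic_d_def by (simp add: complex_simps)
qed

end
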